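(* Let $\Lambda_1$ and $\Lambda_2$ be two lattices in $\mathbb R^n$ and let $w$ be a polynomially bounded weight function on $\mathbb R^n$. Then, topologically (equality of sets with equivalent norms), (i) $(L^p_w\widehat\otimes_\pi L^2)^{B_0}_d(\Lambda_1\times\Lambda_2)=\ell^1_w(\Lambda_1;\ell^2(\Lambda_2))$ if $1\le p\le2$, (ii) $(L^p_w\widehat\otimes_\epsilon L^2)^{B_0}_d(\Lambda_1\times\Lambda_2)=c_{0,w}(\Lambda_1;\ell^2(\Lambda_2))$ if $2\le p<\infty$.
   Context: A polynomially bounded weight function on $\mathbb R^n$ is a measurable $w:\mathbb R^n\to(0,\infty)$ with $w(x+y)\le Cw(x)(1+|y|)^\tau$ for all $x,y$ and some $C,\tau>0$. $L^p_w=L^p_w(\mathbb R^n)$ has norm $\|fw\|_{L^p}$, and $L^2=L^2(\mathbb R^n)$. $\widehat\otimes_\pi$ and $\widehat\otimes_\epsilon$ denote the completed projective and injective tensor products of Banach spaces; $L^p_w\widehat\otimes_\tau L^2$ ($\tau=\pi$ or $\epsilon$) is regarded as a Banach space of distributions on $\mathbb R^{2n}=\mathbb R^n_x\times\mathbb R^n_\xi$, continuously included in $\mathcal S'(\mathbb R^{2n})$, with $f\otimes g$ identified with $(x,\xi)\mapsto f(x)g(\xi)$. For a Banach space $F\subset\mathcal S'(\mathbb R^{2n})$ of this kind and the lattice $\Lambda=\Lambda_1\times\Lambda_2$ in $\mathbb R^{2n}$, choose a bounded open neighbourhood $U$ of $0$ in $\mathbb R^{2n}$ with the sets $\lambda+U$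 ($\lambda\in\Lambda$) pairwise disjoint, and $\chi\in\mathcal D(U)\setminus\{0\}$. Then $F^{B_0}_d(\Lambda)=\{c\in\mathbb C^\Lambda:\sum_{\lambda\in\Lambda}c_\lambda T^{B_0}_\lambda\chi\in F\}$ with norm $\|\sum_\lambda c_\lambda T^{B_0}_\lambda\chi\|_F$, where $T^{B_0}_{(x,\xi)}f(t,\eta)=f(t-x,\eta-\xi)e^{-2\pi i x\cdot(\eta-\xi)}$; it is independent of $U,\chi$ up to equivalent norms. A lattice is a discrete subgroup spanning the ambient space. For a Banach space $X\subset\mathbb C^{\Lambda_2}$, $\ell^1_w(\Lambda_1;X)$ is the space of $c=(c_{\lambda_1,\lambda_2})$ with $c_{\lambda_1}:=(c_{\lambda_1,\lambda_2})_{\lambda_2}\in X$ for each $\lambda_1$ and $\sum_{\lambda_1}\|c_{\lambda_1}\|_Xw(\lambda_1)<\infty$; $c_{0,w}(\Lambda_1;X)$ is the space of those $c$ for which $(\|c_{\lambda_1}\|_Xw(\lambda_1))_{\lambda_1\in\Lambda_1}$ tends to $0$ at infinity, with the supremum norm. *)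

theory Defs
  imports "HOL-Analysis.Analysis"
begin

text \<open>Spaces of functions are modelled by honest functions with a seminorm (functions
  that agree almost everywhere are not identified), so the norm may vanish off 0.\<close>

record 'v nspace =
  elems :: "'v set"
  nrm :: "'v \<Rightarrow> real"

definition eq_top :: "'v nspace \<Rightarrow> 'v nspace \<Rightarrow> bool"  (infix "\<approx>\<^sub>t\<^sub>o\<^sub>p" 50) where
  "X \<approx>\<^sub>t\<^sub>o\<^sub>p Y \<longleftrightarrow> elems X = elems Y \<and>
     (\<exists>A>0. \<exists>B>0. \<forall>c\<in>elems X. A * nrm X c \<le> nrm Y c \<and> nrm Y c \<le> B * nrm X c)"

definition poly_bounded_weight :: "('a::euclidean_space \<Rightarrow> real) \<Rightarrow> bool" where
  "poly_bounded_weight w \<longleftrightarrow> w \<in> borel_measurable lebesgue \<and> (\<forall>x. w x > 0) \<and>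
     (\<exists>C>0. \<exists>\<tau>>0. \<forall>x y. w (x + y) \<le> C * w x * (1 + norm y) powr \<tau>)"

definition is_lattice :: "'a::euclidean_space set \<Rightarrow> bool" where
  "is_lattice \<Lambda> \<longleftrightarrow> 0 \<in> \<Lambda> \<and> (\<forall>x\<in>\<Lambda>. \<forall>y\<in>\<Lambda>. x - y \<in> \<Lambda>) \<and> discrete \<Lambda> \<and> span \<Lambda> = UNIV"

text \<open>Only used for finite exponents.\<close>

definition Lp :: "real \<Rightarrow> ('a::euclidean_space \<Rightarrow> real) \<Rightarrow> ('a \<Rightarrow> complex) nspace" where
  "Lp p w = \<lparr>
     elems = {f \<in> borel_measurable lebesgue.
                integrable lebesgue (\<lambda>x. (norm (f x) * w x) powr p)},
     nrm = (\<lambda>f. (integral\<^sup>L lebesgue (\<lambda>x. (norm (f x) * w x) powr p)) powr (1 / p)) \<rparr>"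

abbreviation L2 :: "('a::euclidean_space \<Rightarrow> complex) nspace" where
  "L2 \<equiv> Lp 2 (\<lambda>_. 1)"

text \<open>\<open>partials [v\<^sub>1, \<dots>, v\<^sub>k] f\<close> is \<open>\<partial>\<^bsub>v\<^sub>1\<^esub> \<dots> \<partial>\<^bsub>v\<^sub>k\<^esub> f\<close>; with
  \<open>v\<^sub>i\<close> ranging over \<open>Basis\<close> these are all partial derivatives of order \<open>k\<close>.\<close>

fun partials :: "'a::euclidean_space list \<Rightarrow> ('a \<Rightarrow> complex) \<Rightarrow> 'a \<Rightarrow> complex" where
  "partials [] f = f"
| "partials (v # vs) f = (\<lambda>x. frechet_derivative (partials vs f) (at x) v)"

definition smooth :: "('a::euclidean_space \<Rightarrow> complex) \<Rightarrow> bool" where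
  "smooth f \<longleftrightarrow> (\<forall>vs\<in>lists Basis. \<forall>x. partials vs f differentiable (at x))"

definition test_functions :: "'a::euclidean_space set \<Rightarrow> ('a \<Rightarrow> complex) set" where
  "test_functions U = {\<phi>. smooth \<phi> \<and> compact (closure {x. \<phi> x \<noteq> 0}) \<and> closure {x. \<phi> x \<noteq> 0} \<subseteq> U}"

definition schwartz :: "('a::euclidean_space \<Rightarrow> complex) set" where
  "schwartz = {\<phi>. smooth \<phi> \<and>
     (\<forall>k. \<forall>vs\<in>lists Basis. bounded (range (\<lambda>x. of_real ((1 + norm x) ^ k) * partials vs \<phi> x)))}"

definition schwartz_seminorm :: "nat \<Rightarrow> ('a::euclidean_space \<Rightarrow> complex) \<Rightarrow> real" where
  "schwartz_seminorm N \<phi> =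
     (SUP (vs, x) \<in> {vs \<in> lists Basis. length vs \<le> N} \<times> UNIV.
        (1 + norm x) ^ N * norm (partials vs \<phi> x))"

text \<open>Distributions are functionals on Schwartz functions, with an irrelevant fixed value
  elsewhere so that equality of distributions is equality in HOL.\<close>

definition tempered :: "(('a::euclidean_space \<Rightarrow> complex) \<Rightarrow> complex) set" where
  "tempered = {u \<in> extensional schwartz.
     (\<forall>\<phi>\<in>schwartz. \<forall>\<psi>\<in>schwartz. u (\<lambda>x. \<phi> x + \<psi> x) = u \<phi> + u \<psi>) \<and>
     (\<forall>a. \<forall>\<phi>\<in>schwartz. u (\<lambda>x. a * \<phi> x) = a * u \<phi>) \<and>
     (\<exists>C N. \<forall>\<phi>\<in>schwartz. norm (u \<phi>) \<le> C * schwartz_seminorm N \<phi>)}"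

definition pairing :: "('a::euclidean_space \<Rightarrow> complex) \<Rightarrow> ('a \<Rightarrow> complex) \<Rightarrow> complex" where
  "pairing h \<phi> = integral\<^sup>L lebesgue (\<lambda>x. h x * \<phi> x)"

text \<open>A list of pairs \<open>(f\<^sub>i, g\<^sub>i)\<close> represents the tensor \<open>\<Sum>\<^sub>i f\<^sub>i \<otimes> g\<^sub>i\<close>, which is identified with
  the function \<open>(x, \<xi>) \<mapsto> \<Sum>\<^sub>i f\<^sub>i(x) g\<^sub>i(\<xi>)\<close> up to equality almost everywhere. For spaces whose
  null vectors are the almost everywhere vanishing functions, this identifies the
  algebraic tensor product with a space of (classes of) functions.\<close>

definition represents_tensor ::
  "('a::euclidean_space \<Rightarrow> complex) nspace \<Rightarrow> ('b::euclidean_space \<Rightarrow> complex) nspace \<Rightarrow>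
   (('a \<Rightarrow> complex) \<times> ('b \<Rightarrow> complex)) list \<Rightarrow> ('a \<times> 'b \<Rightarrow> complex) \<Rightarrow> bool" where
  "represents_tensor E F r h \<longleftrightarrow> set r \<subseteq> elems E \<times> elems F \<and>
     (AE z in lebesgue. h z = (\<Sum>(f, g)\<leftarrow>r. f (fst z) * g (snd z)))"

definition alg_tensor ::
  "('a::euclidean_space \<Rightarrow> complex) nspace \<Rightarrow> ('b::euclidean_space \<Rightarrow> complex) nspace \<Rightarrow>
   ('a \<times> 'b \<Rightarrow> complex) set" where
  "alg_tensor E F = {h. \<exists>r. represents_tensor E F r h}"

definition proj_tensor_norm ::
  "('a::euclidean_space \<Rightarrow> complex) nspace \<Rightarrow> ('b::euclidean_space \<Rightarrow> complex) nspace \<Rightarrow>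
   ('a \<times> 'b \<Rightarrow> complex) \<Rightarrow> real" where
  "proj_tensor_norm E F h =
     Inf {(\<Sum>(f, g)\<leftarrow>r. nrm E f * nrm F g) | r. represents_tensor E F r h}"

definition dual_ball :: "('a \<Rightarrow> complex) nspace \<Rightarrow> (('a \<Rightarrow> complex) \<Rightarrow> complex) set" where
  "dual_ball E = {l.
     (\<forall>f\<in>elems E. \<forall>g\<in>elems E. l (\<lambda>x. f x + g x) = l f + l g) \<and>
     (\<forall>a. \<forall>f\<in>elems E. l (\<lambda>x. a * f x) = a * l f) \<and>
     (\<forall>f\<in>elems E. norm (l f) \<le> nrm E f)}"

text \<open>The value \<open>\<Sum>\<^sub>i l(f\<^sub>i) m(g\<^sub>i)\<close> does not depend on the representation of the tensor, so letting
  \<open>r\<close> vary in the supremum is harmless.\<close>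

definition inj_tensor_norm ::
  "('a::euclidean_space \<Rightarrow> complex) nspace \<Rightarrow> ('b::euclidean_space \<Rightarrow> complex) nspace \<Rightarrow>
   ('a \<times> 'b \<Rightarrow> complex) \<Rightarrow> real" where
  "inj_tensor_norm E F h =
     Sup {norm (\<Sum>(f, g)\<leftarrow>r. l f * m g) | r l m.
            represents_tensor E F r h \<and> l \<in> dual_ball E \<and> m \<in> dual_ball F}"

text \<open>The completion of a space \<open>H\<close> of functions with respect to the norm \<open>N\<close>, realised as a
  space of tempered distributions: its elements are the limits in \<open>\<S>'\<close> of the \<open>N\<close>-Cauchy
  sequences in \<open>H\<close>. When the completion embeds into \<open>\<S>'\<close>, as it does for the tensor products
  considered here, all sequences approximating \<open>u\<close> yield the same limit of norms; the
  infimum is the quotient norm in general.\<close>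

definition approximates ::
  "('a::euclidean_space \<Rightarrow> complex) set \<Rightarrow> (('a \<Rightarrow> complex) \<Rightarrow> real) \<Rightarrow>
   (nat \<Rightarrow> 'a \<Rightarrow> complex) \<Rightarrow> (('a \<Rightarrow> complex) \<Rightarrow> complex) \<Rightarrow> bool" where
  "approximates H N h u \<longleftrightarrow> (\<forall>k. h k \<in> H) \<and>
     (\<forall>e>0. \<exists>M. \<forall>j\<ge>M. \<forall>k\<ge>M. N (\<lambda>z. h j z - h k z) < e) \<and>
     (\<forall>\<phi>\<in>schwartz. (\<lambda>k. pairing (h k) \<phi>) \<longlonglongrightarrow> u \<phi>)"

definition completion ::
  "('a::euclidean_space \<Rightarrow> complex) set \<Rightarrow> (('a \<Rightarrow> complex) \<Rightarrow> real) \<Rightarrow>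
   (('a \<Rightarrow> complex) \<Rightarrow> complex) nspace" where
  "completion H N = \<lparr>
     elems = {u \<in> tempered. \<exists>h. approximates H N h u},
     nrm = (\<lambda>u. Inf {L. \<exists>h. approximates H N h u \<and> (\<lambda>k. N (h k)) \<longlonglongrightarrow> L}) \<rparr>"

definition proj_tensor  (infixr "\<otimes>\<^sub>\<pi>" 70) where
  "E \<otimes>\<^sub>\<pi> F = completion (alg_tensor E F) (proj_tensor_norm E F)"

definition inj_tensor  (infixr "\<otimes>\<^sub>\<epsilon>" 70) where
  "E \<otimes>\<^sub>\<epsilon> F = completion (alg_tensor E F) (inj_tensor_norm E F)"

definition T_B0 :: "'a \<times> 'a \<Rightarrow> ('a \<times> 'a \<Rightarrow> complex) \<Rightarrow> 'a::euclidean_space \<times> 'a \<Rightarrow> complex" where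
  "T_B0 = (\<lambda>(x, \<xi>) f (t, \<eta>). f (t - x, \<eta> - \<xi>) * cis (- 2 * pi * (x \<bullet> (\<eta> - \<xi>))))"

text \<open>For \<open>chi\<close> supported in a set with disjoint translates, at each point at most one term is
  nonzero.\<close>

definition synth ::
  "('a::euclidean_space \<times> 'a) set \<Rightarrow> ('a \<times> 'a \<Rightarrow> complex) \<Rightarrow> ('a \<times> 'a \<Rightarrow> complex) \<Rightarrow>
   'a \<times> 'a \<Rightarrow> complex" where
  "synth \<Lambda> chi c = (\<lambda>z. \<Sum>\<^sub>\<infinity>\<mu>\<in>\<Lambda>. c \<mu> * T_B0 \<mu> chi z)"

text \<open>\<open>synth \<Lambda> chi c\<close> need not be of polynomial growth for arbitrary \<open>c\<close>, so it is compared with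
  a tempered distribution as an element of \<open>\<D>'\<close>.\<close>

definition represents_dist ::
  "('a::euclidean_space \<Rightarrow> complex) \<Rightarrow> (('a \<Rightarrow> complex) \<Rightarrow> complex) \<Rightarrow> bool" where
  "represents_dist h u \<longleftrightarrow> (\<forall>\<phi>\<in>test_functions UNIV. u \<phi> = pairing h \<phi>)"

text \<open>\<open>\<complex>\<^bsup>I\<^esup>\<close> is rendered as \<open>extensional I\<close>. The distribution \<open>u\<close> is unique since test functions
  are dense in \<open>schwartz\<close>.\<close>

definition discrete_space ::
  "(('a::euclidean_space \<times> 'a \<Rightarrow> complex) \<Rightarrow> complex) nspace \<Rightarrow> ('a \<times> 'a \<Rightarrow> complex) \<Rightarrow>
   ('a \<times> 'a) set \<Rightarrow> ('a \<times> 'a \<Rightarrow> complex) nspace" where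
  "discrete_space F chi \<Lambda> = \<lparr>
     elems = {c \<in> extensional \<Lambda>. \<exists>u\<in>elems F. represents_dist (synth \<Lambda> chi c) u},
     nrm = (\<lambda>c. nrm F (THE u. u \<in> elems F \<and> represents_dist (synth \<Lambda> chi c) u)) \<rparr>"

definition l2 :: "'b set \<Rightarrow> ('b \<Rightarrow> complex) nspace" where
  "l2 I = \<lparr>
     elems = {d \<in> extensional I. (\<lambda>j. (norm (d j))\<^sup>2) summable_on I},
     nrm = (\<lambda>d. sqrt (\<Sum>\<^sub>\<infinity>j\<in>I. (norm (d j))\<^sup>2)) \<rparr>"

definition l1w ::
  "('a \<Rightarrow> real) \<Rightarrow> 'a set \<Rightarrow> 'b set \<Rightarrow> ('b \<Rightarrow> complex) nspace \<Rightarrow> ('a \<times> 'b \<Rightarrow> complex) nspace" where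
  "l1w w I J X = \<lparr>
     elems = {c \<in> extensional (I \<times> J). (\<forall>i\<in>I. curry c i \<in> elems X) \<and>
                (\<lambda>i. nrm X (curry c i) * w i) summable_on I},
     nrm = (\<lambda>c. \<Sum>\<^sub>\<infinity>i\<in>I. nrm X (curry c i) * w i) \<rparr>"

definition c0w ::
  "('a::real_normed_vector \<Rightarrow> real) \<Rightarrow> 'a set \<Rightarrow> 'b set \<Rightarrow> ('b \<Rightarrow> complex) nspace \<Rightarrow>
   ('a \<times> 'b \<Rightarrow> complex) nspace" where
  "c0w w I J X = \<lparr>
     elems = {c \<in> extensional (I \<times> J). (\<forall>i\<in>I. curry c i \<in> elems X) \<and>
                ((\<lambda>i. nrm X (curry c i) * w i) \<longlongrightarrow> 0) (inf at_infinity (principal I))},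
     nrm = (\<lambda>c. SUP i\<in>I. nrm X (curry c i) * w i) \<rparr>"

end

theory Submission
  imports Defs "HOL-Probability.Characteristic_Functions" "HOL-Probability.Sinc_Integral"
begin

text \<open>On a product window \<open>\<phi> \<otimes> \<psi>\<close> the synthesis operator turns \<open>c\<close> into a sum over \<open>x\<close> of the rank-one tensors
  \<open>\<phi>(\<cdot> - x) \<otimes> g\<^sub>x\<close>, where \<open>g\<^sub>x\<close> is the Gabor sum of the row \<open>c\<^sub>x\<close> and \<open>\<parallel>g\<^sub>x\<parallel>\<close> is at most a multiple of
  \<open>\<parallel>c\<^sub>x\<parallel>\<close>, by Bessel's inequality for modulations. This gives the projective bound at once; the injective
  one follows by testing against functionals, because \<open>\<Sum>\<^sub>x |m(g\<^sub>x)|\<^sup>2\<close> is bounded over the unit ball of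
  the dual and \<open>\<ell>\<^sup>2 \<subseteq> \<ell>\<^sup>p\<close> for \<open>p \<ge> 2\<close>. A general \<open>chi\<close> is an absolutely convergent series of
  products: differences of consecutive dyadic step approximations in the first variable are sums of mixed
  differences against indicators.

  Conversely, pairing with the shifts of a product window supported in \<open>U\<close> recovers \<open>c\<close> up to a constant.
  On \<open>f \<otimes> g\<close> the pairing factors into a sequence bounded in \<open>\<ell>\<^sup>p\<^sub>w\<close> and an array bounded in \<open>\<ell>\<^sup>2\<close>,
  and \<open>\<ell>\<^sup>p \<subseteq> \<ell>\<^sup>2\<close> for \<open>p \<le> 2\<close> with the Cauchy-Schwarz inequality yields the sum over \<open>x\<close>.\<close>

subsection \<open>Smooth functions and tempered distributions\<close>

text \<open>Two obstacles shape the proof. First, \<open>chi\<close> is arbitrary and its step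
  approximations leave \<open>U\<close>, so disjointness of the translates helps only when
  coefficients are recovered. Synthesis relies on bounded overlap of lattice translates, at the
  price of a constant depending on the support radius; all dyadic levels share one radius, hence one
  constant. Second, the norm of the completion is an infimum over approximating sequences. Lower
  bounds must hold along every such sequence, and they do, since coefficients are limits of pairings
  with fixed test functions. Upper bounds need one sequence: c is cut off to lattice balls while
  \<open>chi\<close> is replaced by its step approximation, both with the same index. It is Cauchy
  only if c has small tails in the sequence norm, which is why c_0 appears and not
  \<ell>^\<infinity>. Conversely, the rows of a finite tensor die out at infinity, and the row
  estimate is uniform in x, so norm limits inherit this. Bessel's inequality is used row by row for
  the projective norm, jointly in x for the injective one.\<close>

lemma partials_coinduct:
  assumes "f \<in> S" and "\<And>g b. g \<in> S \<Longrightarrow> b \<in> Basis \<Longrightarrow> (\<lambda>x. frechet_derivative g (at x) b) \<in> S"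
    and "vs \<in> lists Basis"
  shows "partials vs f \<in> S"
  using assms(3) by (induction vs) (auto simp: assms)

text \<open>Iterated partials rarely have a manageable closed form. A set S that is stable under one
  coordinate derivative and consists of differentiable functions replaces it; each smoothness proof
  then amounts to guessing S.\<close>

lemma smoothI:
  assumes "f \<in> S" and "\<And>g b. g \<in> S \<Longrightarrow> b \<in> Basis \<Longrightarrow> (\<lambda>x. frechet_derivative g (at x) b) \<in> S"
    and "\<And>g x. g \<in> S \<Longrightarrow> g differentiable (at x)"
  shows "smooth f"
  unfolding smooth_def using partials_coinduct[OF assms(1,2)] assms(3) by blast

lemma partials_append: "partials (vs @ us) f = partials vs (partials us f)"
  by (induction vs) auto

lemma smooth_partials:
  fixes f :: "'a::euclidean_space \<Rightarrow> complex"
  assumes "smooth f" "vs \<in> lists Basis"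
  shows "smooth (partials vs f)"
  unfolding smooth_def
proof (intro ballI allI)
  fix us and x :: 'a assume "us \<in> lists (Basis::'a set)"
  then have "us @ vs \<in> lists Basis" using assms(2) by auto
  then have "partials (us @ vs) f differentiable at x"
    using assms(1) unfolding smooth_def by blast
  then show "partials us (partials vs f) differentiable at x" by (simp add: partials_append)
qed

lemma smooth_differentiable: "smooth f \<Longrightarrow> f differentiable (at x)"
  unfolding smooth_def by (metis lists.Nil partials.simps(1))

lemma smooth_has_derivative: "smooth f \<Longrightarrow> (f has_derivative frechet_derivative f (at x)) (at x)"
  using smooth_differentiable frechet_derivative_works by blast

lemma smooth_partial: "smooth f \<Longrightarrow> b \<in> Basis \<Longrightarrow> smooth (\<lambda>x. frechet_derivative f (at x) b)"
  using smooth_partials[of f "[b]"] by simp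

lemma smooth_continuous: "smooth f \<Longrightarrow> continuous_on S f"
  by (meson continuous_at_imp_continuous_on differentiable_imp_continuous_within smooth_differentiable)

lemma smooth_borel: "smooth f \<Longrightarrow> f \<in> borel_measurable borel"
  by (intro borel_measurable_continuous_onI smooth_continuous)

lemma frechet_derivative_eq: "(f has_derivative f') (at x) \<Longrightarrow> frechet_derivative f (at x) = f'"
  using frechet_derivative_at by metis

lemma smooth_const: "smooth (\<lambda>_. c)"
  by (rule smoothI[where S="range (\<lambda>c _. c)"]) (auto simp: frechet_derivative_const)

text \<open>\<open>smooth\<close> speaks only of derivatives along \<open>Basis\<close>. If A sends
  basis vectors to multiples of basis vectors, the chain rule turns one partial into a multiple of a
  single partial. The multiple may be 0, so that coordinate projections of a product are covered
  besides scalings and inclusions of a factor.\<close>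

lemma smooth_affine:
  fixes A :: "'b::euclidean_space \<Rightarrow> 'a::euclidean_space"
  assumes A: "linear A" "\<And>b. b \<in> Basis \<Longrightarrow> \<exists>r. \<exists>b'\<in>Basis. A b = r *\<^sub>R b'" and "smooth f"
  shows "smooth (\<lambda>x. f (A x + a))"
\<comment> \<open>The scalar c absorbs the factors r that the chain rule produces.\<close>
proof (rule smoothI[where S="{\<lambda>x. c * g (A x + a) | c g. smooth g}"])
  show "(\<lambda>x. f (A x + a)) \<in> {\<lambda>x. c * g (A x + a) | c g. smooth g}"
    using assms(3) by (intro CollectI exI[of _ 1] exI[of _ f]) auto
next
  have D: "((\<lambda>x. c * g (A x + a)) has_derivative (\<lambda>v. c * frechet_derivative g (at (A x + a)) (A v))) (at x)"
    if "smooth g" for c g x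
  proof -
    have "((\<lambda>x. A x + a) has_derivative A) (at x)"
      using linear_conv_bounded_linear[THEN iffD1, OF A(1)]
      by (auto intro!: derivative_eq_intros bounded_linear_imp_has_derivative)
    from has_derivative_compose[OF this smooth_has_derivative[OF that]]
    show ?thesis by (auto intro!: derivative_eq_intros)
  qed
  { fix h b assume "h \<in> {\<lambda>x. c * g (A x + a) | c g. smooth g}" and b: "b \<in> (Basis::'b set)"
    then obtain c g where h: "h = (\<lambda>x. c * g (A x + a))" and g: "smooth g" by auto
    obtain r b' where r: "b' \<in> Basis" "A b = r *\<^sub>R b'" using A(2)[OF b] by auto
    have "(\<lambda>x. frechet_derivative h (at x) b)
        = (\<lambda>x. (c * of_real r) * (\<lambda>x. frechet_derivative g (at x) b') (A x + a))"
    proof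
      fix x
      have lin: "linear (frechet_derivative g (at (A x + a)))"
        by (rule linear_frechet_derivative[OF smooth_differentiable[OF g]])
      show "frechet_derivative h (at x) b = (c * of_real r) * (\<lambda>x. frechet_derivative g (at x) b') (A x + a)"
        unfolding h frechet_derivative_eq[OF D[OF g]] r(2) linear_scale[OF lin]
        by (simp add: scaleR_conv_of_real)
    qed
    then show "(\<lambda>x. frechet_derivative h (at x) b) \<in> {\<lambda>x. c * g (A x + a) | c g. smooth g}"
      using smooth_partial[OF g r(1)] by (intro CollectI exI conjI) }
  { fix h x assume "h \<in> {\<lambda>x. c * g (A x + a) | c g. smooth g}"
    then show "h differentiable at x" using D by (auto simp: differentiable_def) }
qed

text \<open>Closed under partial derivatives by the product rule, hence consisting of smooth functions.\<close>

inductive_set prod_span :: "('a::euclidean_space \<Rightarrow> complex) set" where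
  prod: "smooth f \<Longrightarrow> smooth g \<Longrightarrow> (\<lambda>x. f x * g x) \<in> prod_span"
| add: "f \<in> prod_span \<Longrightarrow> g \<in> prod_span \<Longrightarrow> (\<lambda>x. f x + g x) \<in> prod_span"

text \<open>Differentiability and stability go through one induction, because the sum rule in the
  case \<open>add\<close> needs the summands to be differentiable.\<close>

lemma prod_span_deriv:
  assumes "h \<in> prod_span" "b \<in> Basis"
  shows "(\<forall>x. h differentiable (at x)) \<and> (\<lambda>x. frechet_derivative h (at x) b) \<in> prod_span"
  using assms(1)
proof induction
  case (prod f g)
  have D: "((\<lambda>x. f x * g x) has_derivative
      (\<lambda>v. f x * frechet_derivative g (at x) v + frechet_derivative f (at x) v * g x)) (at x)" for x
    by (rule has_derivative_mult[OF smooth_has_derivative smooth_has_derivative]) fact+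
  have "(\<lambda>x. frechet_derivative (\<lambda>x. f x * g x) (at x) b)
      = (\<lambda>x. f x * frechet_derivative g (at x) b + frechet_derivative f (at x) b * g x)"
    using frechet_derivative_eq[OF D] by auto
  also have "\<dots> \<in> prod_span"
    by (intro prod_span.add prod_span.prod smooth_partial prod assms(2))
  finally show ?case using D unfolding differentiable_def by blast
next
  case (add f g)
  have D: "((\<lambda>x. f x + g x) has_derivative
      (\<lambda>v. frechet_derivative f (at x) v + frechet_derivative g (at x) v)) (at x)" for x
    using add.IH frechet_derivative_works by (intro has_derivative_add) blast+
  have "(\<lambda>x. frechet_derivative (\<lambda>x. f x + g x) (at x) b)
      = (\<lambda>x. frechet_derivative f (at x) b + frechet_derivative g (at x) b)"
    using frechet_derivative_eq[OF D] by auto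
  also have "\<dots> \<in> prod_span"
    using add.IH by (intro prod_span.add) auto
  finally show ?case using D unfolding differentiable_def by blast
qed

lemma prod_span_smooth: "h \<in> prod_span \<Longrightarrow> smooth h"
  \<comment> \<open>\<open>prod_span_deriv\<close> yields differentiability only together with a
    basis vector, so one has to exist.\<close>
  using prod_span_deriv nonempty_Basis by (intro smoothI[where S=prod_span]) blast+

lemma smooth_mult: "smooth f \<Longrightarrow> smooth g \<Longrightarrow> smooth (\<lambda>x. f x * g x)"
  by (rule prod_span_smooth[OF prod_span.prod])

text \<open>Each summand is a product with the constant 1, so the set built for the product rule
  serves sums as well.\<close>

lemma smooth_add: "smooth f \<Longrightarrow> smooth g \<Longrightarrow> smooth (\<lambda>x. f x + g x)"
  using prod_span_smooth[OF prod_span.add[OF prod_span.prod[OF _ smooth_const[of 1]]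
    prod_span.prod[OF _ smooth_const[of 1]]]] by simp

lemma smooth_cnj:
  fixes f :: "'a::euclidean_space \<Rightarrow> complex"
  assumes "smooth f" shows "smooth (\<lambda>x. cnj (f x))"
proof (rule smoothI[where S="{\<lambda>x. cnj (g x) | g. smooth g}"])
  have D: "((\<lambda>x. cnj (g x)) has_derivative (\<lambda>v. cnj (frechet_derivative g (at x) v))) (at x)"
    if "smooth g" for g :: "'a \<Rightarrow> complex" and x
    using bounded_linear.has_derivative[OF bounded_linear_cnj smooth_has_derivative[OF that]] .
  { fix h :: "'a \<Rightarrow> complex" and b assume "h \<in> {\<lambda>x. cnj (g x) | g. smooth g}" and b: "b \<in> (Basis::'a set)"
    then obtain g where h: "h = (\<lambda>x. cnj (g x))" and g: "smooth g" by auto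
    show "(\<lambda>x. frechet_derivative h (at x) b) \<in> {\<lambda>x. cnj (g x) | g. smooth g}"
      unfolding h frechet_derivative_eq[OF D[OF g]] using smooth_partial[OF g b] by (intro CollectI exI conjI) (rule refl) }
  { fix h :: "'a \<Rightarrow> complex" and x assume "h \<in> {\<lambda>x. cnj (g x) | g. smooth g}"
    then show "h differentiable at x" using D by (auto simp: differentiable_def) }
qed (use assms in blast)

lemma smooth_cis: "smooth (\<lambda>x::'a::euclidean_space. cis (v \<bullet> x + r))"
proof (rule smoothI[where S="range (\<lambda>c x. c * cis (v \<bullet> x + r))"])
  show "(\<lambda>x::'a. cis (v \<bullet> x + r)) \<in> range (\<lambda>c x. c * cis (v \<bullet> x + r))"
    by (rule range_eqI[of _ _ 1]) auto
  have D: "((\<lambda>x. c * cis (v \<bullet> x + r)) has_derivative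
     (\<lambda>u. c * (of_real (v \<bullet> u) * (\<i> * cis (v \<bullet> x + r))))) (at x)" for c and x :: 'a
  proof -
    have "((\<lambda>x. v \<bullet> x + r) has_derivative (\<lambda>u. v \<bullet> u)) (at x)"
      by (auto intro!: derivative_eq_intros)
    moreover have "(cis has_derivative (\<lambda>s. s *\<^sub>R (\<i> * cis y))) (at y)" for y
    proof -
      have "((\<lambda>s. exp (\<i> * of_real s)) has_vector_derivative \<i> * exp (\<i> * of_real y)) (at y)"
        by (rule has_vector_derivative_real_field) (auto intro!: derivative_eq_intros)
      then show ?thesis by (simp add: has_vector_derivative_def cis_conv_exp[abs_def])
    qed
    ultimately have "((\<lambda>x. cis (v \<bullet> x + r)) has_derivative (\<lambda>u. (v \<bullet> u) *\<^sub>R (\<i> * cis (v \<bullet> x + r)))) (at x)"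
      by (rule has_derivative_compose)
    then show ?thesis by (auto intro!: derivative_eq_intros simp: scaleR_conv_of_real)
  qed
  { fix g and b :: 'a assume "g \<in> range (\<lambda>c x. c * cis (v \<bullet> x + r))"
    then obtain c where g: "g = (\<lambda>x. c * cis (v \<bullet> x + r))" by auto
    show "(\<lambda>x. frechet_derivative g (at x) b) \<in> range (\<lambda>c x. c * cis (v \<bullet> x + r))"
      unfolding g frechet_derivative_eq[OF D] by (rule range_eqI[of _ _ "c * of_real (v \<bullet> b) * \<i>"]) auto }
  { fix g and x :: 'a assume "g \<in> range (\<lambda>c x. c * cis (v \<bullet> x + r))"
    then show "g differentiable at x" using D by (auto simp: differentiable_def) }
qed

lemma partials_affine:
  fixes f :: "'a::euclidean_space \<Rightarrow> complex"
  assumes "smooth f" "vs \<in> lists Basis"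
  shows "partials vs (\<lambda>x. f (r *\<^sub>R x + a)) = (\<lambda>x. of_real r ^ length vs * partials vs f (r *\<^sub>R x + a))"
  using assms(2)
proof (induction vs)
  case (Cons v vs)
  have g: "smooth (partials vs f)" using Cons assms(1) by (auto intro: smooth_partials)
  have D: "((\<lambda>x. of_real r ^ length vs * partials vs f (r *\<^sub>R x + a)) has_derivative
    (\<lambda>u. of_real r ^ length vs * frechet_derivative (partials vs f) (at (r *\<^sub>R x + a)) (r *\<^sub>R u))) (at x)" for x
  proof -
    have "((\<lambda>x. r *\<^sub>R x + a) has_derivative (\<lambda>u. r *\<^sub>R u)) (at x)"
      by (auto intro!: derivative_eq_intros)
    from has_derivative_compose[OF this smooth_has_derivative[OF g]]
    show ?thesis by (auto intro!: derivative_eq_intros)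
  qed
  have "frechet_derivative (partials vs f) (at y) (r *\<^sub>R v) = of_real r * frechet_derivative (partials vs f) (at y) v" for y
    by (simp add: linear_scale[OF linear_frechet_derivative[OF smooth_differentiable[OF g]]] scaleR_conv_of_real)
  then show ?case
    using Cons by (auto simp: frechet_derivative_eq[OF D] mult_ac)
qed auto

lemma partials_add:
  fixes f g :: "'a::euclidean_space \<Rightarrow> complex"
  assumes "smooth f" "smooth g" "vs \<in> lists Basis"
  shows "partials vs (\<lambda>x. f x + g x) = (\<lambda>x. partials vs f x + partials vs g x)"
  using assms(3)
proof (induction vs)
  case (Cons v vs)
  have "smooth (partials vs f)" "smooth (partials vs g)"
    using Cons assms by (auto intro: smooth_partials)
  then have "frechet_derivative (\<lambda>x. partials vs f x + partials vs g x) (at x) =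
    (\<lambda>v. frechet_derivative (partials vs f) (at x) v + frechet_derivative (partials vs g) (at x) v)" for x
    by (intro frechet_derivative_eq has_derivative_add smooth_has_derivative)
  then show ?case using Cons by auto
qed auto

lemma partials_cmult:
  fixes f :: "'a::euclidean_space \<Rightarrow> complex"
  assumes "smooth f" "vs \<in> lists Basis"
  shows "partials vs (\<lambda>x. c * f x) = (\<lambda>x. c * partials vs f x)"
  using assms(2)
proof (induction vs)
  case (Cons v vs)
  have "smooth (partials vs f)" using Cons assms by (auto intro: smooth_partials)
  then have "frechet_derivative (\<lambda>x. c * partials vs f x) (at x) =
    (\<lambda>v. c * frechet_derivative (partials vs f) (at x) v)" for x
    by (intro frechet_derivative_eq derivative_eq_intros) (auto intro: smooth_has_derivative)
  then show ?case using Cons by auto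
qed auto

lemma partials_lincomb:
  fixes f g :: "'a::euclidean_space \<Rightarrow> complex"
  assumes "smooth f" "smooth g" "vs \<in> lists Basis"
  shows "partials vs (\<lambda>x. c * f x + g x) = (\<lambda>x. c * partials vs f x + partials vs g x)"
  using partials_add[OF smooth_mult[OF smooth_const[of c] assms(1)] assms(2,3)] partials_cmult[OF assms(1,3), of c]
  by simp

lemma partial_mult:
  fixes f g :: "'a::euclidean_space \<Rightarrow> complex"
  assumes "smooth f" "smooth g"
  shows "frechet_derivative (\<lambda>x. f x * g x) (at x) v =
     frechet_derivative f (at x) v * g x + f x * frechet_derivative g (at x) v"
  using frechet_derivative_eq[OF has_derivative_mult[OF assms[THEN smooth_has_derivative]]] by simp

lemma smooth_scale:
  fixes f :: "'a::euclidean_space \<Rightarrow> complex"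
  assumes "smooth f" shows "smooth (\<lambda>x. f (r *\<^sub>R x + a))"
proof (rule smooth_affine)
  show "linear ((*\<^sub>R) r :: 'a \<Rightarrow> 'a)" by simp
qed (use assms in auto)

text \<open>The mean value inequality on the line through z in direction v. Only the derivative in
  that direction is bounded, which is all that a mixed difference offers.\<close>

lemma partial_bound_imp_diff_bound:
  fixes f :: "'a::euclidean_space \<Rightarrow> complex"
  assumes "smooth f" "\<And>z. norm (frechet_derivative f (at z) v) \<le> B"
  shows "norm (f (z + r *\<^sub>R v) - f z) \<le> B * \<bar>r\<bar>"
proof -
  have "((\<lambda>s. f (z + s *\<^sub>R v)) has_derivative (\<lambda>u. frechet_derivative f (at (z + s *\<^sub>R v)) (u *\<^sub>R v))) (at s within UNIV)" for s
  proof -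
    have "((\<lambda>s. z + s *\<^sub>R v) has_derivative (\<lambda>u. u *\<^sub>R v)) (at s)"
      by (auto intro!: derivative_eq_intros)
    from has_derivative_compose[OF this smooth_has_derivative[OF assms(1)]] show ?thesis by simp
  qed
  moreover have "onorm (\<lambda>u::real. frechet_derivative f (at (z + s *\<^sub>R v)) (u *\<^sub>R v)) \<le> B" for s
  proof (rule onorm_le)
    fix u :: real
    show "norm (frechet_derivative f (at (z + s *\<^sub>R v)) (u *\<^sub>R v)) \<le> B * norm u"
      using mult_left_mono[OF assms(2)[of "z + s *\<^sub>R v"], of "\<bar>u\<bar>"]
      by (simp add: linear_scale[OF linear_frechet_derivative[OF smooth_differentiable[OF assms(1)]]]
          mult.commute)
  qed
  ultimately have "norm (f (z + r *\<^sub>R v) - f (z + 0 *\<^sub>R v)) \<le> B * norm (r - 0)"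
    by (intro differentiable_bound[where S=UNIV]) auto
  then show ?thesis by simp
qed

lemma bounded_partials_imp_lipschitz:
  fixes f :: "'a::euclidean_space \<Rightarrow> complex"
  assumes f: "smooth f" and B: "\<And>b z. b \<in> Basis \<Longrightarrow> norm (frechet_derivative f (at z) b) \<le> B b"
  shows "norm (f x - f y) \<le> (\<Sum>b\<in>Basis. B b) * norm (x - y)"
proof (rule differentiable_bound[where S=UNIV and f'="\<lambda>x. frechet_derivative f (at x)"])
  fix z
  have lin: "linear (frechet_derivative f (at z))"
    by (rule linear_frechet_derivative[OF smooth_differentiable[OF f]])
  show "onorm (frechet_derivative f (at z)) \<le> (\<Sum>b\<in>Basis. B b)"
  proof (rule onorm_le)
    fix u :: 'a
    have "frechet_derivative f (at z) u = frechet_derivative f (at z) (\<Sum>b\<in>Basis. (u \<bullet> b) *\<^sub>R b)"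
      by (simp add: euclidean_representation)
    also have "\<dots> = (\<Sum>b\<in>Basis. (u \<bullet> b) *\<^sub>R frechet_derivative f (at z) b)"
      by (simp add: linear_sum[OF lin] linear_scale[OF lin])
    also have "norm \<dots> \<le> (\<Sum>b\<in>Basis. B b * norm u)"
    proof (rule sum_norm_le)
      fix b :: 'a assume b: "b \<in> Basis"
      show "norm ((u \<bullet> b) *\<^sub>R frechet_derivative f (at z) b) \<le> B b * norm u"
        using mult_mono[OF Basis_le_norm[OF b, of u] B[OF b, of z]] by (simp add: mult.commute)
    qed
    finally show "norm (frechet_derivative f (at z) u) \<le> (\<Sum>b\<in>Basis. B b) * norm u"
      by (simp add: sum_distrib_right)
  qed
qed (use smooth_has_derivative[OF f] in auto)

section \<open>Schwartz functions and smooth cutoffs\<close>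

lemma schwartzD: "\<phi> \<in> schwartz \<Longrightarrow> smooth \<phi>" by (simp add: schwartz_def)

lemma norm_weight_mult:
  fixes x :: "'a::real_normed_vector" and z :: complex
  shows "norm (of_real ((1 + norm x) ^ N) * z) = (1 + norm x) ^ N * norm z"
  by (simp only: norm_mult norm_of_real) simp

lemma schwartz_bound:
  assumes "\<phi> \<in> schwartz" "vs \<in> lists Basis"
  obtains C where "C \<ge> 0" "\<And>x. (1 + norm x) ^ N * norm (partials vs \<phi> x) \<le> C"
proof -
  have "bounded (range (\<lambda>x. of_real ((1 + norm x) ^ N) * partials vs \<phi> x))"
    using assms unfolding schwartz_def by auto
  then obtain C where C: "\<And>x. norm (of_real ((1 + norm x) ^ N) * partials vs \<phi> x) \<le> C"
    unfolding bounded_iff by auto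
  have "(1 + norm x) ^ N * norm (partials vs \<phi> x) \<le> max 0 C" for x
    using C[of x] unfolding norm_weight_mult by simp
  then show thesis using that[of "max 0 C"] by auto
qed

lemma schwartzI:
  assumes "smooth \<phi>" "\<And>N vs. vs \<in> lists Basis \<Longrightarrow> \<exists>C. \<forall>x. (1 + norm x) ^ N * norm (partials vs \<phi> x) \<le> C"
  shows "\<phi> \<in> schwartz"
  unfolding schwartz_def
proof (intro CollectI conjI allI ballI)
  fix k and vs :: "'a list" assume "vs \<in> lists Basis"
  from assms(2)[OF this, of k] obtain C where "\<forall>x. (1 + norm x) ^ k * norm (partials vs \<phi> x) \<le> C" by auto
  then show "bounded (range (\<lambda>x. complex_of_real ((1 + norm x) ^ k) * partials vs \<phi> x))"
    unfolding bounded_iff by (intro exI[of _ C]) (auto simp only: norm_weight_mult)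
qed fact

lemma schwartz_partial: "\<phi> \<in> schwartz \<Longrightarrow> b \<in> Basis \<Longrightarrow> (\<lambda>x. frechet_derivative \<phi> (at x) b) \<in> schwartz"
proof (rule schwartzI)
  fix N and vs :: "'a list" assume a: "\<phi> \<in> schwartz" "b \<in> Basis" "vs \<in> lists Basis"
  then have "vs @ [b] \<in> lists Basis" by auto
  from schwartz_bound[OF a(1) this, of N] show "\<exists>C. \<forall>x. (1 + norm x) ^ N * norm (partials vs (\<lambda>x. frechet_derivative \<phi> (at x) b) x) \<le> C"
    by (auto simp: partials_append)
qed (auto intro: smooth_partial schwartzD)

lemma partials_eq_0_outside_support:
  fixes f :: "'a::euclidean_space \<Rightarrow> complex"
  assumes "x \<notin> closure {x. f x \<noteq> 0}"
  shows "partials vs f x = 0"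
  using assms
proof (induction vs arbitrary: x)
  case Nil then show ?case using closure_subset[of "{x. f x \<noteq> 0}"] by auto
next
  case (Cons v vs)
  have o: "open (- closure {x. f x \<noteq> 0})" by auto
  have "((\<lambda>_. 0) has_derivative (\<lambda>_. 0)) (at x)" by auto
  then have "(partials vs f has_derivative (\<lambda>_. 0)) (at x)"
    by (rule has_derivative_transform_within_open[OF _ o]) (use Cons in auto)
  then show ?case by (simp add: frechet_derivative_eq)
qed

lemma test_functions_smooth: "\<phi> \<in> test_functions U \<Longrightarrow> smooth \<phi>" by (simp add: test_functions_def)

lemma test_functions_partials_bounded:
  fixes \<phi> :: "'a::euclidean_space \<Rightarrow> complex"
  assumes "\<phi> \<in> test_functions U" "vs \<in> lists Basis"
  shows "\<exists>C. \<forall>x. (1 + norm x) ^ N * norm (partials vs \<phi> x) \<le> C"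
proof -
  let ?K = "closure {x. \<phi> x \<noteq> 0}" and ?g = "\<lambda>x. (1 + norm x) ^ N * norm (partials vs \<phi> x)"
  have K: "compact ?K" using assms by (auto simp: test_functions_def)
  have "smooth (partials vs \<phi>)" using assms by (auto simp: test_functions_def intro: smooth_partials)
  then have "continuous_on ?K ?g" by (intro continuous_intros smooth_continuous)
  from compact_imp_bounded[OF compact_continuous_image[OF this K]]
  obtain C where C: "\<And>x. x \<in> ?K \<Longrightarrow> norm (?g x) \<le> C" unfolding bounded_iff by auto
  have "?g x \<le> max 0 C" for x
    using C[of x] partials_eq_0_outside_support[of x \<phi> vs] by (cases "x \<in> ?K") auto
  then show ?thesis by blast
qed

lemma test_functions_schwartz: "\<phi> \<in> test_functions U \<Longrightarrow> \<phi> \<in> schwartz"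
  by (rule schwartzI) (auto intro: test_functions_partials_bounded test_functions_smooth)

lemma test_functionsI:
  fixes \<phi> :: "'a::euclidean_space \<Rightarrow> complex"
  assumes "smooth \<phi>" "\<And>x. \<phi> x \<noteq> 0 \<Longrightarrow> norm x \<le> R"
  shows "\<phi> \<in> test_functions UNIV"
proof -
  have "bounded {x. \<phi> x \<noteq> 0}" using assms(2) unfolding bounded_iff by auto
  then show ?thesis using assms(1) by (auto simp: test_functions_def compact_closure)
qed

text \<open>The product rule puts each derivative on \<phi>, which keeps its decay, or on the
  dilated factor, where it gives a bounded function times 1/R. Since R is at least 1, all bounds are
  uniform in R.\<close>

lemma scaled_mult_bound:
  fixes k \<phi> :: "'a::euclidean_space \<Rightarrow> complex"
  assumes "vs \<in> lists Basis" and "smooth k" "\<And>us. us \<in> lists Basis \<Longrightarrow> \<exists>C. \<forall>x. norm (partials us k x) \<le> C"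
    and "\<phi> \<in> schwartz"
  shows "\<exists>C. \<forall>R\<ge>1. \<forall>x. (1 + norm x) ^ N * norm (partials vs (\<lambda>x. k ((1/R) *\<^sub>R x) * \<phi> x) x) \<le> C"
  using assms
\<comment> \<open>\<open>partials\<close> applies the last entry of the list first. Peeling from the
  right therefore leaves products of the same form, with k or \<phi> replaced by a
  derivative.\<close>
proof (induction vs arbitrary: k \<phi> rule: rev_induct)
  case Nil
  obtain C where C: "\<And>x. norm (k x) \<le> C" using Nil(3)[of "[]"] by auto
  obtain D where D: "D \<ge> 0" "\<And>x. (1 + norm x) ^ N * norm (\<phi> x) \<le> D"
    using schwartz_bound[OF Nil(4), of "[]" N] by auto
  have "(1 + norm x) ^ N * norm (k ((1/R) *\<^sub>R x) * \<phi> x) \<le> C * D" for R x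
    using mult_mono[OF C[of "(1/R) *\<^sub>R x"] D(2)[of x]] norm_ge_zero[of "k ((1/R) *\<^sub>R x)"] C[of "(1/R) *\<^sub>R x"]
    by (auto simp: norm_mult mult_ac)
  then show ?case by auto
next
  case (snoc v vs)
  let ?k = "\<lambda>x. frechet_derivative k (at x) v" and ?p = "\<lambda>x. frechet_derivative \<phi> (at x) v"
  have v: "v \<in> Basis" "vs \<in> lists Basis" using snoc.prems by auto
  have sm: "smooth ?k" "smooth ?p" "smooth \<phi>" "smooth k"
    using snoc.prems v by (auto intro: smooth_partial schwartzD)
  have *: "\<exists>C. \<forall>x. norm (partials us ?k x) \<le> C" if "us \<in> lists Basis" for us
    using snoc.prems(3)[of "us @ [v]"] that v by (auto simp: partials_append)
  obtain C where C: "\<And>R x. R \<ge> 1 \<Longrightarrow> (1 + norm x) ^ N * norm (partials vs (\<lambda>x. ?k ((1/R) *\<^sub>R x) * \<phi> x) x) \<le> C"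
    using snoc.IH[OF v(2) sm(1) * snoc.prems(4)] by blast
  obtain D where D: "\<And>R x. R \<ge> 1 \<Longrightarrow> (1 + norm x) ^ N * norm (partials vs (\<lambda>x. k ((1/R) *\<^sub>R x) * ?p x) x) \<le> D"
    using snoc.IH[OF v(2) sm(4) snoc.prems(3) schwartz_partial[OF snoc.prems(4) v(1)]] by blast
  have "(1 + norm x) ^ N * norm (partials (vs @ [v]) (\<lambda>x. k ((1/R) *\<^sub>R x) * \<phi> x) x) \<le> C + D" if "R \<ge> 1" for R x
  proof -
    have s: "smooth (\<lambda>x. h ((1/R) *\<^sub>R x))" if "smooth h" for h :: "'a \<Rightarrow> complex"
      using smooth_scale[OF that, of "1/R" 0] by simp
    have "frechet_derivative (\<lambda>x. k ((1/R) *\<^sub>R x)) (at x) v = of_real (1/R) * ?k ((1/R) *\<^sub>R x)" for x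
      using fun_cong[OF partials_affine[OF sm(4), of "[v]" "1/R" 0], of x] v by simp
    then have "partials [v] (\<lambda>x. k ((1/R) *\<^sub>R x) * \<phi> x)
      = (\<lambda>x. of_real (1/R) * (?k ((1/R) *\<^sub>R x) * \<phi> x) + k ((1/R) *\<^sub>R x) * ?p x)"
      by (intro ext) (simp add: partial_mult[OF s[OF sm(4)] sm(3)] del: of_real_divide)
    then have "partials (vs @ [v]) (\<lambda>x. k ((1/R) *\<^sub>R x) * \<phi> x) x
      = of_real (1/R) * partials vs (\<lambda>x. ?k ((1/R) *\<^sub>R x) * \<phi> x) x + partials vs (\<lambda>x. k ((1/R) *\<^sub>R x) * ?p x) x"
      by (simp only: partials_append
          partials_lincomb[OF smooth_mult[OF s[OF sm(1)] sm(3)] smooth_mult[OF s[OF sm(4)] sm(2)] v(2)])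
    then have "norm (partials (vs @ [v]) (\<lambda>x. k ((1/R) *\<^sub>R x) * \<phi> x) x)
      \<le> (1/R) * norm (partials vs (\<lambda>x. ?k ((1/R) *\<^sub>R x) * \<phi> x) x) + norm (partials vs (\<lambda>x. k ((1/R) *\<^sub>R x) * ?p x) x)"
      using \<open>R \<ge> 1\<close> by (simp only:) (rule order_trans[OF norm_triangle_ineq], simp add: norm_mult norm_divide)
    also have "\<dots> \<le> norm (partials vs (\<lambda>x. ?k ((1/R) *\<^sub>R x) * \<phi> x) x) + norm (partials vs (\<lambda>x. k ((1/R) *\<^sub>R x) * ?p x) x)"
      using \<open>R \<ge> 1\<close> by (intro add_right_mono mult_left_le_one_le) auto
    finally have "(1 + norm x) ^ N * norm (partials (vs @ [v]) (\<lambda>x. k ((1/R) *\<^sub>R x) * \<phi> x) x) \<le>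
      (1 + norm x) ^ N * (norm (partials vs (\<lambda>x. ?k ((1/R) *\<^sub>R x) * \<phi> x) x) + norm (partials vs (\<lambda>x. k ((1/R) *\<^sub>R x) * ?p x) x))"
      by (intro mult_left_mono) auto
    then show ?thesis using C[OF that, of x] D[OF that, of x] by (simp add: distrib_left)
  qed
  then show ?case by blast
qed

text \<open>The gain 1/R has two sources. A derivative that hits the cutoff produces it directly. If
  none does, \<open>k 0 = 1\<close> and the Lipschitz bound give |k(x/R) - 1| at most L |x| / R, and
  the factor |x| is paid for by one more power of decay of \<phi>.\<close>

lemma cutoff_bound:
  fixes k \<phi> :: "'a::euclidean_space \<Rightarrow> complex"
  assumes "vs \<in> lists Basis" and k: "k \<in> test_functions UNIV" "k 0 = 1" and "\<phi> \<in> schwartz"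
  shows "\<exists>C. \<forall>R\<ge>1. \<forall>x. (1 + norm x) ^ N * norm (partials vs (\<lambda>x. (k ((1/R) *\<^sub>R x) + (-1)) * \<phi> x) x) \<le> C / R"
  using assms(1,4)
proof (induction vs arbitrary: \<phi> rule: rev_induct)
  case Nil
  have sk: "smooth k" using k(1) by (rule test_functions_smooth)
  have "\<forall>b\<in>Basis. \<exists>C. \<forall>x. norm (frechet_derivative k (at x) b) \<le> C"
  proof
    fix b :: 'a assume "b \<in> Basis"
    then show "\<exists>C. \<forall>x. norm (frechet_derivative k (at x) b) \<le> C"
      using test_functions_partials_bounded[OF k(1), of "[b]" 0] by simp
  qed
  from bchoice[OF this] obtain B where B: "\<And>b x. b \<in> Basis \<Longrightarrow> norm (frechet_derivative k (at x) b) \<le> B b"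
    by blast
  define L where "L = (\<Sum>b\<in>Basis. B b)"
  have L: "norm (k x - k y) \<le> L * norm (x - y)" for x y
    unfolding L_def by (rule bounded_partials_imp_lipschitz[OF sk B])
  have L0: "L \<ge> 0" unfolding L_def by (intro sum_nonneg order_trans[OF norm_ge_zero B])
  obtain D where D: "D \<ge> 0" "\<And>x. (1 + norm x) ^ Suc N * norm (\<phi> x) \<le> D"
    using schwartz_bound[OF Nil(2), of "[]" "Suc N"] by auto
  have "(1 + norm x) ^ N * norm ((k ((1/R) *\<^sub>R x) + (-1)) * \<phi> x) \<le> (L * D) / R" if "R \<ge> 1" for R x
  proof -
    have "norm (k ((1/R) *\<^sub>R x) + (-1)) \<le> (L / R) * norm x"
      using L[of "(1/R) *\<^sub>R x" 0] k(2) that by simp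
    also have "\<dots> \<le> (L / R) * (1 + norm x)" using L0 that by (intro mult_left_mono) auto
    finally have "(1 + norm x) ^ N * norm ((k ((1/R) *\<^sub>R x) + (-1)) * \<phi> x)
      \<le> (1 + norm x) ^ N * (((L / R) * (1 + norm x)) * norm (\<phi> x))"
      unfolding norm_mult by (intro mult_left_mono mult_right_mono) auto
    also have "\<dots> = (L / R) * ((1 + norm x) ^ Suc N * norm (\<phi> x))" by simp
    also have "\<dots> \<le> (L / R) * D" using D(2)[of x] L0 that by (intro mult_left_mono) auto
    finally show ?thesis by simp
  qed
  then show ?case by auto
next
  case (snoc v vs)
  let ?k = "\<lambda>x. frechet_derivative k (at x) v" and ?p = "\<lambda>x. frechet_derivative \<phi> (at x) v"
  have v: "v \<in> Basis" "vs \<in> lists Basis" using snoc.prems by auto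
  have sm: "smooth ?k" "smooth ?p" "smooth \<phi>" "smooth k"
    using snoc.prems v k by (auto intro: smooth_partial schwartzD test_functions_smooth)
  have *: "\<exists>C. \<forall>x. norm (partials us ?k x) \<le> C" if "us \<in> lists Basis" for us
    using test_functions_partials_bounded[OF k(1), of "us @ [v]" 0] that v by (auto simp: partials_append)
  obtain C where C: "\<And>R x. R \<ge> 1 \<Longrightarrow> (1 + norm x) ^ N * norm (partials vs (\<lambda>x. ?k ((1/R) *\<^sub>R x) * \<phi> x) x) \<le> C"
    using scaled_mult_bound[OF v(2) sm(1) * snoc.prems(2)] by blast
  obtain D where D: "\<And>R x. R \<ge> 1 \<Longrightarrow> (1 + norm x) ^ N * norm (partials vs (\<lambda>x. (k ((1/R) *\<^sub>R x) + (-1)) * ?p x) x) \<le> D / R"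
    using snoc.IH[OF v(2) schwartz_partial[OF snoc.prems(2) v(1)]] by blast
  have "(1 + norm x) ^ N * norm (partials (vs @ [v]) (\<lambda>x. (k ((1/R) *\<^sub>R x) + (-1)) * \<phi> x) x) \<le> (C + D) / R" if "R \<ge> 1" for R x
  proof -
    have s: "smooth (\<lambda>x. h ((1/R) *\<^sub>R x))" if "smooth h" for h :: "'a \<Rightarrow> complex"
      using smooth_scale[OF that, of "1/R" 0] by simp
    have s': "smooth (\<lambda>x. k ((1/R) *\<^sub>R x) + (-1))" by (rule smooth_add[OF s[OF sm(4)] smooth_const])
    have "frechet_derivative (\<lambda>x. k ((1/R) *\<^sub>R x)) (at x) v = of_real (1/R) * ?k ((1/R) *\<^sub>R x)" for x
      using fun_cong[OF partials_affine[OF sm(4), of "[v]" "1/R" 0], of x] v by simp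
    moreover have "frechet_derivative (\<lambda>x. k ((1/R) *\<^sub>R x) + (-1)) (at x) v = frechet_derivative (\<lambda>x. k ((1/R) *\<^sub>R x)) (at x) v" for x
      using fun_cong[OF partials_add[OF s[OF sm(4)] smooth_const[of "-1"], where vs="[v]"], of x] v by simp
    ultimately have "partials [v] (\<lambda>x. (k ((1/R) *\<^sub>R x) + (-1)) * \<phi> x)
      = (\<lambda>x. of_real (1/R) * (?k ((1/R) *\<^sub>R x) * \<phi> x) + (k ((1/R) *\<^sub>R x) + (-1)) * ?p x)"
      by (intro ext) (simp only: partials.simps partial_mult[OF s' sm(3)] mult.assoc)
    then have "partials (vs @ [v]) (\<lambda>x. (k ((1/R) *\<^sub>R x) + (-1)) * \<phi> x) x
      = of_real (1/R) * partials vs (\<lambda>x. ?k ((1/R) *\<^sub>R x) * \<phi> x) x + partials vs (\<lambda>x. (k ((1/R) *\<^sub>R x) + (-1)) * ?p x) x"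
      by (simp only: partials_append
          partials_lincomb[OF smooth_mult[OF s[OF sm(1)] sm(3)] smooth_mult[OF s' sm(2)] v(2)])
    then have "norm (partials (vs @ [v]) (\<lambda>x. (k ((1/R) *\<^sub>R x) + (-1)) * \<phi> x) x)
      \<le> (1/R) * norm (partials vs (\<lambda>x. ?k ((1/R) *\<^sub>R x) * \<phi> x) x) + norm (partials vs (\<lambda>x. (k ((1/R) *\<^sub>R x) + (-1)) * ?p x) x)"
      using \<open>R \<ge> 1\<close> by (simp only:) (rule order_trans[OF norm_triangle_ineq], simp add: norm_mult norm_divide)
    then have "(1 + norm x) ^ N * norm (partials (vs @ [v]) (\<lambda>x. (k ((1/R) *\<^sub>R x) + (-1)) * \<phi> x) x) \<le>
      (1 + norm x) ^ N * ((1/R) * norm (partials vs (\<lambda>x. ?k ((1/R) *\<^sub>R x) * \<phi> x) x) + norm (partials vs (\<lambda>x. (k ((1/R) *\<^sub>R x) + (-1)) * ?p x) x))"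
      by (intro mult_left_mono) auto
    also have "\<dots> \<le> C / R + D / R"
      using mult_left_mono[OF C[OF that, of x], of "1/R"] D[OF that, of x] that by (simp add: distrib_left mult_ac)
    finally show ?thesis by (simp add: add_divide_distrib)
  qed
  then show ?case by blast
qed

section \<open>Test functions determine tempered distributions\<close>

lemma finite_multi_indices: "finite {vs \<in> lists (Basis::'a::euclidean_space set). length vs \<le> N}"
  using finite_lists_length_le[OF finite_Basis, of N] by (simp add: lists_eq_set)

lemma schwartz_seminorm_le:
  fixes \<phi> :: "'a::euclidean_space \<Rightarrow> complex"
  assumes "\<And>vs x. vs \<in> lists Basis \<Longrightarrow> length vs \<le> N \<Longrightarrow> (1 + norm x) ^ N * norm (partials vs \<phi> x) \<le> C"
  shows "schwartz_seminorm N \<phi> \<le> C"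
  unfolding schwartz_seminorm_def
proof (rule cSUP_least)
  have "([], 0) \<in> {vs \<in> lists (Basis::'a set). length vs \<le> N} \<times> (UNIV::'a set)" by auto
  then show "{vs \<in> lists (Basis::'a set). length vs \<le> N} \<times> (UNIV::'a set) \<noteq> {}" by blast
qed (use assms in auto)

lemma schwartz_seminorm_ge:
  fixes \<phi> :: "'a::euclidean_space \<Rightarrow> complex"
  assumes "\<phi> \<in> schwartz"
  shows "(1 + norm x) ^ N * norm (\<phi> x) \<le> schwartz_seminorm N \<phi>"
proof -
  let ?I = "{vs \<in> lists (Basis::'a set). length vs \<le> N}"
  have "\<forall>vs\<in>?I. \<exists>C. C \<ge> 0 \<and> (\<forall>x. (1 + norm x) ^ N * norm (partials vs \<phi> x) \<le> C)"
  proof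
    fix vs assume "vs \<in> ?I"
    then show "\<exists>C. C \<ge> 0 \<and> (\<forall>x. (1 + norm x) ^ N * norm (partials vs \<phi> x) \<le> C)"
      by (metis (mono_tags) mem_Collect_eq schwartz_bound[OF assms, of vs N])
  qed
  from bchoice[OF this] obtain C where C: "\<And>vs. vs \<in> ?I \<Longrightarrow> C vs \<ge> 0 \<and> (\<forall>x. (1 + norm x) ^ N * norm (partials vs \<phi> x) \<le> C vs)"
    by blast
  have "bdd_above ((\<lambda>(vs, x). (1 + norm x) ^ N * norm (partials vs \<phi> x)) ` (?I \<times> UNIV))"
  proof (rule bdd_aboveI2[where M="\<Sum>vs\<in>?I. C vs"])
    fix q assume "q \<in> ?I \<times> (UNIV :: 'a set)"
    then obtain vs x where q: "q = (vs, x)" and "vs \<in> ?I" by auto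
    then have "(1 + norm x) ^ N * norm (partials vs \<phi> x) \<le> C vs" using C by auto
    also have "\<dots> \<le> (\<Sum>vs\<in>?I. C vs)"
      using C \<open>vs \<in> ?I\<close> by (intro member_le_sum finite_multi_indices) auto
    finally show "(case q of (vs, x) \<Rightarrow> (1 + norm x) ^ N * norm (partials vs \<phi> x)) \<le> (\<Sum>vs\<in>?I. C vs)"
      by (simp add: q)
  qed
  from cSUP_upper[OF _ this, of "([], x)"] show ?thesis unfolding schwartz_seminorm_def by auto
qed

text \<open>Density of the test functions: \<phi> and its cutoff k(x/R) \<phi>(x) differ by a
  function whose Schwartz seminorms are O(1/R), so a continuous functional cannot tell them apart in
  the limit.\<close>

lemma tempered_eqI:
  fixes k :: "'a::euclidean_space \<Rightarrow> complex" and u v :: "('a \<Rightarrow> complex) \<Rightarrow> complex"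
  assumes k: "k \<in> test_functions UNIV" "k 0 = 1" and u: "u \<in> tempered" and v: "v \<in> tempered"
    and eq: "\<And>\<phi>. \<phi> \<in> test_functions UNIV \<Longrightarrow> u \<phi> = v \<phi>"
  shows "u = v"
proof (rule extensionalityI[of _ schwartz])
  show "u \<in> extensional schwartz" "v \<in> extensional schwartz" using u v by (auto simp: tempered_def)
next
  fix \<phi> :: "'a \<Rightarrow> complex" assume \<phi>: "\<phi> \<in> schwartz"
  let ?g = "\<lambda>R x. (k ((1/R) *\<^sub>R x) + (-1)) * \<phi> x"
  have sk: "smooth k" using k(1) by (rule test_functions_smooth)
  have sm: "smooth (\<lambda>x. k ((1/R) *\<^sub>R x))" for R using smooth_scale[OF sk, of "1/R" 0] by simp
  have g: "?g R \<in> schwartz" if "R \<ge> 1" for R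
  proof (rule schwartzI)
    show "smooth (?g R)" by (rule smooth_mult[OF smooth_add[OF sm smooth_const] schwartzD[OF \<phi>]])
  qed (use cutoff_bound[OF _ k \<phi>] that in blast)
  have lim: "((\<lambda>R. l (?g R)) \<longlongrightarrow> 0) at_top" if l: "l \<in> tempered" for l
  proof -
    obtain C N where CN: "\<And>\<phi>. \<phi> \<in> schwartz \<Longrightarrow> norm (l \<phi>) \<le> C * schwartz_seminorm N \<phi>"
      using l unfolding tempered_def by blast
    let ?I = "{vs \<in> lists (Basis::'a set). length vs \<le> N}"
    have "\<forall>vs\<in>?I. \<exists>D. \<forall>R\<ge>1. \<forall>x. (1 + norm x) ^ N * norm (partials vs (?g R) x) \<le> D / R"
      using cutoff_bound[OF _ k \<phi>] by auto
    from bchoice[OF this] obtain D where D: "\<And>vs R x. vs \<in> ?I \<Longrightarrow> R \<ge> 1 \<Longrightarrow> (1 + norm x) ^ N * norm (partials vs (?g R) x) \<le> D vs / R"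
      by blast
    have D0: "D vs \<ge> 0" if "vs \<in> ?I" for vs
      using order_trans[OF _ D[OF that, of 1 0]] by simp
    have sn: "schwartz_seminorm N (?g R) \<le> (\<Sum>vs\<in>?I. D vs) / R" if "R \<ge> 1" for R
    proof (rule schwartz_seminorm_le)
      fix vs and x :: 'a assume "vs \<in> lists (Basis::'a set)" "length vs \<le> N"
      then have vs: "vs \<in> ?I" by auto
      have "(1 + norm x) ^ N * norm (partials vs (?g R) x) \<le> D vs / R" by (rule D[OF vs that])
      also have "\<dots> \<le> (\<Sum>vs\<in>?I. D vs) / R"
        using that vs D0 by (intro divide_right_mono member_le_sum finite_multi_indices) auto
      finally show "(1 + norm x) ^ N * norm (partials vs (?g R) x) \<le> (\<Sum>vs\<in>?I. D vs) / R" .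
    qed
    have bnd: "norm (l (?g R)) \<le> \<bar>C\<bar> * (\<Sum>vs\<in>?I. D vs) / R" if "R \<ge> 1" for R
    proof -
      have "0 \<le> schwartz_seminorm N (?g R)"
        using order_trans[OF _ schwartz_seminorm_ge[OF g[OF that], of 0 N]] by simp
      then have "norm (l (?g R)) \<le> \<bar>C\<bar> * schwartz_seminorm N (?g R)"
        using CN[OF g[OF that]] by (meson abs_ge_self mult_right_mono order_trans)
      also have "\<dots> \<le> \<bar>C\<bar> * ((\<Sum>vs\<in>?I. D vs) / R)"
        by (intro mult_left_mono sn that) auto
      finally show ?thesis by simp
    qed
    have "((\<lambda>R. \<bar>C\<bar> * (\<Sum>vs\<in>?I. D vs) / R) \<longlongrightarrow> 0) at_top"
      by (intro tendsto_divide_0[OF tendsto_const] filterlim_at_top_imp_at_infinity filterlim_ident)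
    from _ this show ?thesis
    proof (rule Lim_null_comparison)
      show "\<forall>\<^sub>F R in at_top. norm (l (?g R)) \<le> \<bar>C\<bar> * (\<Sum>vs\<in>?I. D vs) / R"
        using eventually_ge_at_top[of "1::real"] by (rule eventually_mono) (rule bnd)
    qed
  qed
  have *: "l (\<lambda>x. k ((1/R) *\<^sub>R x) * \<phi> x) = l \<phi> + l (?g R)" if "l \<in> tempered" "R \<ge> 1" for l R
  proof -
    have "l (\<lambda>x. \<phi> x + ?g R x) = l \<phi> + l (?g R)"
      using that \<phi> g[OF that(2)] by (auto simp: tempered_def)
    then show ?thesis by (simp add: algebra_simps)
  qed
  have "(\<lambda>x. k ((1/R) *\<^sub>R x) * \<phi> x) \<in> test_functions UNIV" if "R \<ge> 1" for R
  proof -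
    have "bounded {x. k x \<noteq> 0}"
      using k(1) compact_imp_bounded bounded_subset[OF _ closure_subset] by (auto simp: test_functions_def)
    then obtain S where S: "\<And>x. k x \<noteq> 0 \<Longrightarrow> norm x \<le> S" by (auto simp: bounded_iff)
    show ?thesis
    proof (rule test_functionsI)
      show "smooth (\<lambda>x. k ((1/R) *\<^sub>R x) * \<phi> x)" by (rule smooth_mult[OF sm schwartzD[OF \<phi>]])
      show "norm x \<le> R * S" if "k ((1/R) *\<^sub>R x) * \<phi> x \<noteq> 0" for x
        using S[of "(1/R) *\<^sub>R x"] that \<open>R \<ge> 1\<close> by (auto simp: field_simps)
    qed
  qed
  \<comment> \<open>The left side does not depend on R while the right side tends to 0.\<close>
  then have "u \<phi> - v \<phi> = v (?g R) - u (?g R)" if "R \<ge> 1" for R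
    using eq[of "\<lambda>x. k ((1/R) *\<^sub>R x) * \<phi> x"] *[OF u that] *[OF v that] that by (simp add: algebra_simps)
  then have "((\<lambda>R. v (?g R) - u (?g R)) \<longlongrightarrow> u \<phi> - v \<phi>) at_top"
    by (intro tendsto_eventually eventually_mono[OF eventually_ge_at_top[of "1::real"]]) simp
  moreover have "((\<lambda>R. v (?g R) - u (?g R)) \<longlongrightarrow> 0 - 0) at_top"
    by (intro tendsto_diff lim u v)
  ultimately show "u \<phi> = v \<phi>"
    using tendsto_unique[OF trivial_limit_at_top_linorder] by fastforce
qed

subsection \<open>Lattices and Gabor sums\<close>

lemma lattice_diff: "is_lattice \<Lambda> \<Longrightarrow> x \<in> \<Lambda> \<Longrightarrow> y \<in> \<Lambda> \<Longrightarrow> x - y \<in> \<Lambda>"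
  by (simp add: is_lattice_def)

text \<open>A gap around 0 is translated to every lattice point by taking differences, so one
  \<delta> serves the whole lattice.\<close>

lemma lattice_separated:
  assumes "is_lattice \<Lambda>"
  obtains \<delta> where "\<delta> > 0" "\<And>x y. x \<in> \<Lambda> \<Longrightarrow> y \<in> \<Lambda> \<Longrightarrow> dist x y < \<delta> \<Longrightarrow> x = y"
proof -
  have "0 isolated_in \<Lambda>" using assms by (auto simp: is_lattice_def discrete_def)
  then obtain d where d: "d > 0" "\<And>y. y \<in> \<Lambda> \<Longrightarrow> dist 0 y < d \<Longrightarrow> y = 0"
    by (auto elim: isolated_inE_dist)
  show thesis
  proof (rule that[OF d(1)])
    fix x y assume "x \<in> \<Lambda>" "y \<in> \<Lambda>" "dist x y < d"
    then show "x = y" using d(2)[of "x - y"] lattice_diff[OF assms, of x y] by (simp add: dist_norm norm_minus_commute)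
  qed
qed

lemma lattice_finite_cball:
  assumes "is_lattice \<Lambda>"
  shows "finite (\<Lambda> \<inter> cball a r)"
proof -
  obtain \<delta> where \<delta>: "\<delta> > 0" "\<And>x y. x \<in> \<Lambda> \<Longrightarrow> y \<in> \<Lambda> \<Longrightarrow> dist x y < \<delta> \<Longrightarrow> x = y"
    using lattice_separated[OF assms] by blast
  then have ud: "uniform_discrete \<Lambda>" unfolding uniform_discrete_def by metis
  have "finite (cball a r \<inter> \<Lambda>)"
  proof (rule finite_not_islimpt_in_compact)
    fix z show "\<not> z islimpt \<Lambda>"
      using uniform_discrete_imp_closed[OF ud] uniform_discrete_imp_discrete[OF ud]
      by (meson closed_limpt discrete_def isolated_in_islimpt_iff)
  qed auto
  then show ?thesis by (simp add: Int_commute)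
qed

text \<open>Bounds the number of lattice points in any ball of radius R, wherever its centre lies:
  subtracting one of these points from the others gives lattice vectors of norm at most 2 R.\<close>

definition overlap :: "'a::euclidean_space set \<Rightarrow> real \<Rightarrow> nat" where
  "overlap \<Lambda> R = card (\<Lambda> \<inter> cball 0 (2 * R))"

lemma overlap_bound:
  assumes \<Lambda>: "is_lattice \<Lambda>" and "X \<subseteq> \<Lambda>"
  shows "finite {x\<in>X. norm (t - x) \<le> R}" "card {x\<in>X. norm (t - x) \<le> R} \<le> overlap \<Lambda> R"
proof -
  let ?S = "{x\<in>X. norm (t - x) \<le> R}"
  have "?S \<subseteq> \<Lambda> \<inter> cball t R" using assms(2) by (auto simp: dist_norm)
  then show fin: "finite ?S" using lattice_finite_cball[OF \<Lambda>] finite_subset by blast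
  show "card ?S \<le> overlap \<Lambda> R"
  proof (cases "?S = {}")
    case False
    then obtain y where y: "y \<in> ?S" by auto
    have "(\<lambda>x. x - y) ` ?S \<subseteq> \<Lambda> \<inter> cball 0 (2 * R)"
    proof clarify
      fix x assume x: "x \<in> X" "norm (t - x) \<le> R"
      have "norm (x - y) \<le> norm (t - y) + norm (t - x)"
        using norm_triangle_ineq4[of "t - y" "t - x"] by simp
      then show "x - y \<in> \<Lambda> \<inter> cball 0 (2 * R)"
        using x y assms lattice_diff[OF \<Lambda>, of x y] by auto
    qed
    then have "card ((\<lambda>x. x - y) ` ?S) \<le> overlap \<Lambda> R"
      unfolding overlap_def by (intro card_mono lattice_finite_cball \<Lambda>)
    then show ?thesis by (subst (asm) card_image) (auto simp: inj_on_def)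
  qed (simp only: card.empty)
qed

lemma overlap_ge_1: "is_lattice \<Lambda> \<Longrightarrow> R \<ge> 0 \<Longrightarrow> overlap \<Lambda> R \<ge> 1"
  using card_mono[of "\<Lambda> \<inter> cball 0 (2 * R)" "{0}"] lattice_finite_cball[of \<Lambda>]
  by (auto simp: overlap_def is_lattice_def)

text \<open>The at most K nonzero terms are each bounded by the largest one. This loses a factor
  against the sharp power of K, but only independence of the size of X matters.\<close>

lemma norm_sum_power_le:
  fixes f :: "'i \<Rightarrow> complex" and p :: real
  assumes "finite X" "card {x\<in>X. f x \<noteq> 0} \<le> K" "p \<ge> 1"
  shows "norm (\<Sum>x\<in>X. f x) powr p \<le> real K powr p * (\<Sum>x\<in>X. norm (f x) powr p)"
proof -
  let ?S = "{x\<in>X. f x \<noteq> 0}"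
  have fin: "finite ?S" using assms by auto
  have eq: "(\<Sum>x\<in>X. f x) = (\<Sum>x\<in>?S. f x)" using assms(1) by (intro sum.mono_neutral_right) auto
  show ?thesis
  proof (cases "?S = {}")
    case True then show ?thesis unfolding eq True by (auto intro!: mult_nonneg_nonneg sum_nonneg)
  next
    case False
    define m where "m = Max ((\<lambda>x. norm (f x)) ` ?S)"
    have "m \<in> (\<lambda>x. norm (f x)) ` ?S" unfolding m_def using fin False by (intro Max_in) auto
    then obtain y where y: "y \<in> ?S" "m = norm (f y)" by auto
    have "norm (\<Sum>x\<in>?S. f x) \<le> real (card ?S) * m"
    proof (rule order_trans[OF norm_sum])
      show "(\<Sum>x\<in>?S. norm (f x)) \<le> real (card ?S) * m"
        by (rule sum_bounded_above) (use fin in \<open>auto simp: m_def intro!: Max_ge\<close>)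
    qed
    also have "\<dots> \<le> real K * m" using assms(2) y by (intro mult_right_mono) auto
    finally have "norm (\<Sum>x\<in>X. f x) powr p \<le> (real K * m) powr p"
      unfolding eq using assms(3) by (intro powr_mono2) auto
    also have "\<dots> = real K powr p * norm (f y) powr p" using y by (simp add: powr_mult)
    also have "\<dots> \<le> real K powr p * (\<Sum>x\<in>X. norm (f x) powr p)"
      using y assms(1) by (intro mult_left_mono member_le_sum) auto
    finally show ?thesis .
  qed
qed

text \<open>Induction works for the stronger bound 5 - 4 / (1 + 2 L), which is exact at L = 0. Its
  increment 8 / ((1 + 2 L)(3 + 2 L)) exceeds the contribution 2 / (1 + (L + 1)^2) of the two new
  terms.\<close>

lemma sum_inverse_squares_bound: "(\<Sum>m\<in>{-int L..int L}. 1 / (1 + (real_of_int m)\<^sup>2)) \<le> 5"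
proof -
  have "(\<Sum>m\<in>{-int L..int L}. 1 / (1 + (real_of_int m)\<^sup>2)) \<le> 5 - 4 / (1 + 2 * real L)"
  proof (induction L)
    case (Suc L)
    let ?l = "real L"
    have "{-int (Suc L)..int (Suc L)} = insert (int (Suc L)) (insert (- int (Suc L)) {-int L..int L})" by auto
    then have "(\<Sum>m\<in>{-int (Suc L)..int (Suc L)}. 1 / (1 + (real_of_int m)\<^sup>2))
      = 2 / (1 + (1 + ?l)\<^sup>2) + (\<Sum>m\<in>{-int L..int L}. 1 / (1 + (real_of_int m)\<^sup>2))"
      by (simp add: power2_eq_square algebra_simps)
    also have "\<dots> \<le> 2 / (1 + (1 + ?l)\<^sup>2) + (5 - 4 / (1 + 2 * ?l))" using Suc by simp
    also have "\<dots> \<le> 5 - 4 / (3 + 2 * ?l)"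
    proof -
      have "4 / (1 + 2 * ?l) - 4 / (3 + 2 * ?l) = 8 / ((1 + 2 * ?l) * (3 + 2 * ?l))" by (simp add: field_simps)
      moreover have "8 / (4 * (1 + (1 + ?l)\<^sup>2)) \<le> 8 / ((1 + 2 * ?l) * (3 + 2 * ?l))"
        by (intro divide_left_mono) (auto simp: power2_eq_square algebra_simps intro!: mult_pos_pos add_pos_nonneg)
      moreover have "2 / (1 + (1 + ?l)\<^sup>2) = 8 / (4 * (1 + (1 + ?l)\<^sup>2))"
        using mult_divide_mult_cancel_left[of 4 2 "1 + (1 + ?l)\<^sup>2"] by simp
      moreover have "e + (5 - a) \<le> 5 - b" if "a - b = c" "d \<le> c" "e = d" for a b c d e :: real
        using that by linarith
      ultimately show ?thesis by blast
    qed
    finally show ?case by (simp add: algebra_simps)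
  qed auto
  also have "\<dots> \<le> 5" by simp
  finally show ?thesis .
qed

text \<open>After scaling by M, coordinatewise rounding down is injective on the lattice: points
  with equal floors are closer than the separation \<delta>. The sum is thereby dominated by one
  over integer vectors, which factors into one-dimensional sums.\<close>

lemma lattice_sum_bounded:
  fixes \<Lambda> :: "'a::euclidean_space set"
  assumes \<Lambda>: "is_lattice \<Lambda>"
  obtains A where "A \<ge> 0" "\<And>X. finite X \<Longrightarrow> X \<subseteq> \<Lambda> \<Longrightarrow> (\<Sum>x\<in>X. \<Prod>b\<in>Basis. 1 / (1 + (x \<bullet> b)\<^sup>2)) \<le> A"
proof -
  obtain \<delta> where \<delta>: "\<delta> > 0" "\<And>x y. x \<in> \<Lambda> \<Longrightarrow> y \<in> \<Lambda> \<Longrightarrow> dist x y < \<delta> \<Longrightarrow> x = y"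
    using lattice_separated[OF \<Lambda>] by blast
  obtain M :: nat where M: "real DIM('a) / \<delta> < real M" using reals_Archimedean2 by blast
  have M0: "M > 0" using M \<delta>(1) by (cases M) (auto simp: divide_less_0_iff)
  \<comment> \<open>Price of rounding: the square of floor(u) is at most 2 u^2 + 2, so with u = M (x
    . b) one has 1 + floor(u)^2 at most 3 + 2 M^2 (x . b)^2.\<close>
  define C where "C = 3 + 2 * (real M)\<^sup>2"
  define fl where "fl x = restrict (\<lambda>b. \<lfloor>real M * (x \<bullet> b)\<rfloor>) Basis" for x :: 'a
  have inj: "inj_on fl \<Lambda>"
  proof
    fix x y assume xy: "x \<in> \<Lambda>" "y \<in> \<Lambda>" "fl x = fl y"
    have "\<bar>(x - y) \<bullet> b\<bar> \<le> 1 / real M" if "b \<in> Basis" for b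
    proof -
      have "\<lfloor>real M * (x \<bullet> b)\<rfloor> = \<lfloor>real M * (y \<bullet> b)\<rfloor>"
        using fun_cong[OF xy(3), of b] that by (simp add: fl_def)
      then have "\<bar>real M * (x \<bullet> b) - real M * (y \<bullet> b)\<bar> \<le> 1" by linarith
      then have "real M * \<bar>(x - y) \<bullet> b\<bar> \<le> 1"
        by (metis abs_mult abs_of_nat inner_diff_left right_diff_distrib)
      then show ?thesis using M0 by (simp add: field_simps)
    qed
    then have "(\<Sum>b\<in>Basis. \<bar>(x - y) \<bullet> b\<bar>) \<le> (\<Sum>b\<in>(Basis::'a set). 1 / real M)" by (intro sum_mono)
    then have "norm (x - y) \<le> real DIM('a) / real M"
      using norm_le_l1[of "x - y"] by simp
    also have "\<dots> < \<delta>" using M M0 \<delta>(1) by (simp add: field_simps)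
    finally show "x = y" using \<delta>(2)[OF xy(1,2)] by (simp add: dist_norm)
  qed
  have le: "1 / (1 + (x \<bullet> b)\<^sup>2) \<le> C * (1 / (1 + (real_of_int (fl x b))\<^sup>2))" if "b \<in> Basis" for x :: 'a and b
  proof -
    let ?u = "real M * (x \<bullet> b)"
    have "(real_of_int \<lfloor>?u\<rfloor>)\<^sup>2 \<le> (\<bar>?u\<bar> + 1)\<^sup>2" by (rule abs_le_square_iff[THEN iffD1]) linarith
    also have "\<dots> \<le> 2 * ?u\<^sup>2 + 2"
      using zero_le_power2[of "\<bar>?u\<bar> - 1"] by (simp add: power2_sum power2_diff)
    finally have "1 + (real_of_int (fl x b))\<^sup>2 \<le> 3 + 2 * (real M)\<^sup>2 * (x \<bullet> b)\<^sup>2"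
      using that by (simp add: fl_def power_mult_distrib)
    also have "\<dots> \<le> C * (1 + (x \<bullet> b)\<^sup>2)" by (simp add: C_def algebra_simps)
    finally show ?thesis by (simp add: field_simps add_pos_nonneg)
  qed
  have C0: "C \<ge> 0" by (simp add: C_def)
  show thesis
  proof (rule that[of "(C * 5) ^ DIM('a)"])
    fix X :: "'a set" assume X: "finite X" "X \<subseteq> \<Lambda>"
    \<comment> \<open>A crude bound on all integer coordinates that occur, enough to place them in a
      finite cube.\<close>
    define L where "L = nat (\<Sum>x\<in>X. \<Sum>b\<in>Basis. \<bar>fl x b\<bar>)"
    have L: "\<bar>fl x b\<bar> \<le> int L" if "x \<in> X" "b \<in> Basis" for x b
    proof -
      have "\<bar>fl x b\<bar> \<le> (\<Sum>b\<in>Basis. \<bar>fl x b\<bar>)" using that by (intro member_le_sum) auto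
      also have "\<dots> \<le> (\<Sum>x\<in>X. \<Sum>b\<in>Basis. \<bar>fl x b\<bar>)" using that X by (intro member_le_sum) (auto intro: sum_nonneg)
      finally show ?thesis unfolding L_def by linarith
    qed
    let ?P = "PiE (Basis::'a set) (\<lambda>_. {-int L..int L})"
    have sub: "fl ` X \<subseteq> ?P"
    proof clarify
      fix x assume x: "x \<in> X"
      have "fl x b \<in> {-int L..int L}" if "b \<in> Basis" for b using L[OF x that] by auto
      then show "fl x \<in> ?P" by (auto simp: PiE_iff fl_def)
    qed
    have "(\<Sum>x\<in>X. \<Prod>b\<in>Basis. 1 / (1 + (x \<bullet> b)\<^sup>2)) \<le> (\<Sum>x\<in>X. \<Prod>b\<in>Basis. C * (1 / (1 + (real_of_int (fl x b))\<^sup>2)))"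
      by (intro sum_mono prod_mono) (auto simp: le intro: le[simplified])
    also have "\<dots> = (\<Sum>g\<in>fl ` X. \<Prod>b\<in>Basis. C * (1 / (1 + (real_of_int (g b))\<^sup>2)))"
      using inj_on_subset[OF inj X(2)] by (simp add: sum.reindex)
    also have "\<dots> \<le> (\<Sum>g\<in>?P. \<Prod>b\<in>Basis. C * (1 / (1 + (real_of_int (g b))\<^sup>2)))"
      using C0 by (intro sum_mono2 sub finite_PiE prod_nonneg) auto
    also have "\<dots> = (\<Prod>b\<in>(Basis::'a set). \<Sum>m\<in>{-int L..int L}. C * (1 / (1 + (real_of_int m)\<^sup>2)))"
      by (rule prod_sum_PiE[symmetric]) auto
    also have "\<dots> \<le> (\<Prod>b\<in>(Basis::'a set). C * 5)"
    proof (rule prod_mono, safe)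
      show "0 \<le> (\<Sum>m\<in>{-int L..int L}. C * (1 / (1 + (real_of_int m)\<^sup>2)))" using C0 by (intro sum_nonneg) auto
      show "(\<Sum>m\<in>{-int L..int L}. C * (1 / (1 + (real_of_int m)\<^sup>2))) \<le> C * 5"
        unfolding sum_distrib_left[symmetric] by (intro mult_left_mono sum_inverse_squares_bound C0)
    qed
    finally show "(\<Sum>x\<in>X. \<Prod>b\<in>Basis. 1 / (1 + (x \<bullet> b)\<^sup>2)) \<le> (C * 5) ^ DIM('a)" by simp
  qed (use C0 in simp)
qed

section \<open>Product integrals, the Gaussian and Bessel's inequality for characters\<close>

lemma lborel_prod_integral:
  fixes f :: "'a::euclidean_space \<Rightarrow> real \<Rightarrow> 'b::{real_normed_field,banach,second_countable_topology}"
  assumes "\<And>b. b \<in> Basis \<Longrightarrow> integrable lborel (f b)"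
  shows "integrable lborel (\<lambda>x. \<Prod>b\<in>Basis. f b (x \<bullet> b))"
    and "(\<integral>x. (\<Prod>b\<in>Basis. f b (x \<bullet> b)) \<partial>lborel) = (\<Prod>b\<in>Basis. integral\<^sup>L lborel (f b))"
proof -
  interpret product_sigma_finite "\<lambda>_::'a. lborel :: real measure" by standard
  have m: "(\<lambda>g. \<Sum>b\<in>Basis. g b *\<^sub>R b) \<in> measurable (\<Pi>\<^sub>M b\<in>(Basis::'a set). lborel) borel" by measurable
  have [measurable]: "f b \<in> borel_measurable borel" if "b \<in> Basis" for b
    using borel_measurable_integrable[OF assms[OF that]] by simp
  have f: "(\<lambda>x::'a. \<Prod>b\<in>Basis. f b (x \<bullet> b)) \<in> borel_measurable borel" by measurable
  have eq: "(\<Prod>b\<in>Basis. f b ((\<Sum>b\<in>Basis. g b *\<^sub>R b) \<bullet> b)) = (\<Prod>b\<in>Basis. f b (g b))" for g :: "'a \<Rightarrow> real"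
    by (intro prod.cong refl) simp
  show "integrable lborel (\<lambda>x. \<Prod>b\<in>Basis. f b (x \<bullet> b))"
    by (subst lborel_eq, subst integrable_distr_eq[OF m f], unfold eq)
      (intro product_integrable_prod assms finite_Basis)
  show "(\<integral>x. (\<Prod>b\<in>Basis. f b (x \<bullet> b)) \<partial>lborel) = (\<Prod>b\<in>Basis. integral\<^sup>L lborel (f b))"
    by (subst lborel_eq, subst integral_distr[OF m f], unfold eq)
      (intro product_integral_prod assms finite_Basis)
qed

text \<open>Each factor 1 + (x . b)^2 is at most (1 + |x|)^2, so twice the dimension as exponent
  lets a product of integrable one-dimensional functions dominate.\<close>

lemma integrable_polynomial_decay: "integrable lborel (\<lambda>x::'a::euclidean_space. 1 / (1 + norm x) ^ (2 * DIM('a)))"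
proof (rule Bochner_Integration.integrable_bound)
  have "integrable lborel (\<lambda>x::real. inverse (1 + x\<^sup>2))"
    using integrable_inverse_1_plus_square by (simp add: set_integrable_def)
  from lborel_prod_integral(1)[OF this]
  show "integrable lborel (\<lambda>x::'a. \<Prod>b\<in>Basis. inverse (1 + (x \<bullet> b)\<^sup>2))" .
  have "1 / (1 + norm x) ^ (2 * DIM('a)) \<le> (\<Prod>b\<in>Basis. inverse (1 + (x \<bullet> b)\<^sup>2))" for x :: 'a
  proof -
    have "1 + (x \<bullet> b)\<^sup>2 \<le> (1 + norm x)\<^sup>2" if "b \<in> Basis" for b
      using abs_le_square_iff[THEN iffD1, of "x \<bullet> b" "norm x"] Basis_le_norm[OF that, of x]
      by (simp add: power2_sum)
    then have "inverse ((1 + norm x)\<^sup>2) \<le> inverse (1 + (x \<bullet> b)\<^sup>2)" if "b \<in> Basis" for b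
      using that by (intro le_imp_inverse_le) (auto simp: add_pos_nonneg)
    then have "(\<Prod>b\<in>(Basis::'a set). inverse ((1 + norm x)\<^sup>2)) \<le> (\<Prod>b\<in>Basis. inverse (1 + (x \<bullet> b)\<^sup>2))"
      by (intro prod_mono) auto
    then show ?thesis by (simp add: power_mult inverse_eq_divide power_one_over)
  qed
  then show "AE x in lborel. norm (1 / (1 + norm (x::'a)) ^ (2 * DIM('a))) \<le> norm (\<Prod>b\<in>Basis. inverse (1 + (x \<bullet> b)\<^sup>2))"
    by (intro AE_I2) (simp add: abs_prod)
qed measurable

text \<open>A weight with an explicit positive Fourier transform and a positive lower bound on every
  ball. The product form splits integrals against characters into one-dimensional ones.\<close>

definition gauss :: "'a::euclidean_space \<Rightarrow> real" where
  "gauss \<eta> = (\<Prod>b\<in>Basis. std_normal_density (\<eta> \<bullet> b))"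

lemma gauss_pos: "gauss \<eta> > 0"
  unfolding gauss_def by (intro prod_pos) (auto intro: normal_density_pos)

lemma gauss_lower_bound:
  fixes \<eta> :: "'a::euclidean_space"
  assumes "norm \<eta> \<le> R"
  shows "gauss \<eta> \<ge> std_normal_density R ^ DIM('a)"
proof -
  have "std_normal_density R \<le> std_normal_density (\<eta> \<bullet> b)" if "b \<in> Basis" for b
  proof -
    have "(\<eta> \<bullet> b)\<^sup>2 \<le> R\<^sup>2"
      using Basis_le_norm[OF that, of \<eta>] assms by (intro abs_le_square_iff[THEN iffD1]) auto
    then show ?thesis by (auto simp: std_normal_density_def intro!: divide_right_mono)
  qed
  then have "(\<Prod>b\<in>(Basis::'a set). std_normal_density R) \<le> gauss \<eta>"
    unfolding gauss_def by (intro prod_mono) (auto intro: normal_density_nonneg)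
  then show ?thesis by simp
qed

lemma gauss_fourier:
  fixes z :: "'a::euclidean_space"
  shows "integrable lborel (\<lambda>\<eta>. cis (- 2 * pi * (z \<bullet> \<eta>)) * of_real (gauss \<eta>))"
    and "(\<integral>\<eta>. cis (- 2 * pi * (z \<bullet> \<eta>)) * of_real (gauss \<eta>) \<partial>lborel)
       = of_real (\<Prod>b\<in>Basis. exp (- (2 * pi * (z \<bullet> b))\<^sup>2 / 2))"
proof -
  define f where "f b s = iexp ((- 2 * pi * (z \<bullet> b)) * s) * of_real (std_normal_density s)" for b s
  have int: "integrable lborel (f b)" for b
  proof (rule Bochner_Integration.integrable_bound[OF integrable_normal_density[where \<mu>=0 and \<sigma>=1]])
    show "0 < (1::real)" by simp
    show "f b \<in> borel_measurable lborel" unfolding f_def by measurable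
    show "AE s in lborel. norm (f b s) \<le> norm (std_normal_density s)"
      by (intro AE_I2) (simp add: f_def norm_mult)
  qed
  have val: "integral\<^sup>L lborel (f b) = of_real (exp (- (2 * pi * (z \<bullet> b))\<^sup>2 / 2))" for b
  proof -
    have "integral\<^sup>L lborel (f b) = char std_normal_distribution (- 2 * pi * (z \<bullet> b))"
      unfolding char_def f_def
      by (subst integral_density) (auto simp: scaleR_conv_of_real mult.commute)
    then show ?thesis by (simp add: char_std_normal_distribution power_mult_distrib)
  qed
  have eq: "(\<Prod>b\<in>Basis. f b (\<eta> \<bullet> b)) = cis (- 2 * pi * (z \<bullet> \<eta>)) * of_real (gauss \<eta>)" for \<eta>
  proof -
    have "(\<Prod>b\<in>Basis. iexp ((- 2 * pi * (z \<bullet> b)) * (\<eta> \<bullet> b))) = iexp (\<Sum>b\<in>Basis. (- 2 * pi * (z \<bullet> b)) * (\<eta> \<bullet> b))"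
      by (simp add: exp_sum sum_distrib_left)
    also have "(\<Sum>b\<in>Basis. (- 2 * pi * (z \<bullet> b)) * (\<eta> \<bullet> b)) = - 2 * pi * (z \<bullet> \<eta>)"
      by (simp add: euclidean_inner[of z \<eta>] sum_distrib_left mult_ac sum_negf)
    finally show ?thesis by (simp only: f_def prod.distrib gauss_def of_real_prod cis_conv_exp)
  qed
  show "integrable lborel (\<lambda>\<eta>. cis (- 2 * pi * (z \<bullet> \<eta>)) * of_real (gauss \<eta>))"
    using lborel_prod_integral(1)[of f, OF int] by (simp only: eq)
  show "(\<integral>\<eta>. cis (- 2 * pi * (z \<bullet> \<eta>)) * of_real (gauss \<eta>) \<partial>lborel)
       = of_real (\<Prod>b\<in>Basis. exp (- (2 * pi * (z \<bullet> b))\<^sup>2 / 2))"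
    using lborel_prod_integral(2)[of f, OF int] by (simp only: eq val of_real_prod)
qed

lemma integrable_nonneg_bound:
  fixes f g :: "'b \<Rightarrow> real"
  assumes "integrable M g" "f \<in> borel_measurable M" "\<And>x. 0 \<le> f x" "\<And>x. f x \<le> g x"
  shows "integrable M f"
proof (rule Bochner_Integration.integrable_bound[OF assms(1,2)], rule AE_I2)
  show "norm (f x) \<le> norm (g x)" for x using assms(3,4)[of x] by simp
qed

lemma norm_sum_sq:
  fixes f :: "'i \<Rightarrow> complex"
  shows "of_real ((norm (\<Sum>x\<in>X. f x))\<^sup>2) = (\<Sum>x\<in>X. \<Sum>y\<in>X. f x * cnj (f y))"
  by (simp only: complex_norm_square cnj_sum sum_product)

text \<open>The Gaussian weight makes the Gram matrix of the characters explicit and rapidly decaying off the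
  diagonal, so Schur's test applies.\<close>

lemma bessel:
  fixes \<Lambda> :: "'a::euclidean_space set"
  assumes \<Lambda>: "is_lattice \<Lambda>"
  obtains A where "A \<ge> 0"
    "\<And>X b. finite X \<Longrightarrow> X \<subseteq> \<Lambda> \<Longrightarrow>
      integrable lborel (\<lambda>\<eta>. (norm (\<Sum>x\<in>X. b x * cis (- 2 * pi * (x \<bullet> \<eta>))))\<^sup>2 * gauss \<eta>) \<and>
      (\<integral>\<eta>. (norm (\<Sum>x\<in>X. b x * cis (- 2 * pi * (x \<bullet> \<eta>))))\<^sup>2 * gauss \<eta> \<partial>lborel) \<le> A * (\<Sum>x\<in>X. (norm (b x))\<^sup>2)"
proof -
  obtain A where A: "A \<ge> 0" "\<And>X. finite X \<Longrightarrow> X \<subseteq> \<Lambda> \<Longrightarrow> (\<Sum>x\<in>X. \<Prod>b\<in>Basis. 1 / (1 + (x \<bullet> b)\<^sup>2)) \<le> A"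
    using lattice_sum_bounded[OF \<Lambda>] by blast
  \<comment> \<open>The Fourier transform of \<open>gauss\<close>; the numbers
    \<open>k (x - y)\<close> are the entries of the Gram matrix.\<close>
  define k where "k z = (\<Prod>b\<in>Basis. exp (- (2 * pi * (z \<bullet> b))\<^sup>2 / 2))" for z :: 'a
  have k0: "k z \<ge> 0" for z unfolding k_def by (intro prod_nonneg) auto
  have ksym: "k (x - y) = k (y - x)" for x y
    unfolding k_def by (intro prod.cong refl) (simp add: inner_diff_left power2_commute power_mult_distrib)
  have kle: "k z \<le> (\<Prod>b\<in>Basis. 1 / (1 + (z \<bullet> b)\<^sup>2))" for z
    unfolding k_def
  proof (intro prod_mono conjI)
    fix b :: 'a
    let ?u = "(2 * pi * (z \<bullet> b))\<^sup>2 / 2"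
    \<comment> \<open>With u = 2 pi^2 (z . b)^2 this gives e^u \<ge> 1 + u \<ge> 1 + (z . b)^2,
      which replaces Gaussian decay by the decay summed in
      \<open>lattice_sum_bounded\<close>.\<close>
    have "1 \<le> 2 * pi\<^sup>2" using pi_gt3 one_le_power[of pi 2] by linarith
    then have "(z \<bullet> b)\<^sup>2 \<le> ?u"
      using mult_right_mono[of 1 "2 * pi\<^sup>2" "(z \<bullet> b)\<^sup>2"] by (simp add: power_mult_distrib)
    then have "1 + (z \<bullet> b)\<^sup>2 \<le> exp ?u" using exp_ge_add_one_self[of ?u] by linarith
    then have "inverse (exp ?u) \<le> inverse (1 + (z \<bullet> b)\<^sup>2)" by (intro le_imp_inverse_le) (auto intro: add_pos_nonneg)
    then show "exp (- (2 * pi * (z \<bullet> b))\<^sup>2 / 2) \<le> 1 / (1 + (z \<bullet> b)\<^sup>2)"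
      by (simp add: exp_minus[symmetric] inverse_eq_divide[of "1 + _"])
  qed auto
  show thesis
  proof (rule that[OF A(1)])
    fix X :: "'a set" and b :: "'a \<Rightarrow> complex" assume X: "finite X" "X \<subseteq> \<Lambda>"
    let ?e = "\<lambda>z \<eta>. cis (- 2 * pi * (z \<bullet> \<eta>))"
    let ?F = "\<lambda>\<eta>. (norm (\<Sum>x\<in>X. b x * ?e x \<eta>))\<^sup>2 * gauss \<eta>"
    have ksum: "(\<Sum>y\<in>X. k (x - y)) \<le> A" if "x \<in> X" for x
    proof -
      have "(\<Sum>y\<in>X. k (x - y)) = (\<Sum>z\<in>(\<lambda>y. x - y) ` X. k z)"
        by (subst sum.reindex) (auto simp: inj_on_def)
      also have "\<dots> \<le> (\<Sum>z\<in>(\<lambda>y. x - y) ` X. \<Prod>b\<in>Basis. 1 / (1 + (z \<bullet> b)\<^sup>2))" by (intro sum_mono kle)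
      also have "\<dots> \<le> A" using X that lattice_diff[OF \<Lambda>] by (intro A(2)) auto
      finally show ?thesis .
    qed
    have expand: "of_real (?F \<eta>) = (\<Sum>x\<in>X. \<Sum>y\<in>X. (b x * cnj (b y)) * (?e (x - y) \<eta> * of_real (gauss \<eta>)))" for \<eta>
    proof -
      have "?e x \<eta> * cnj (?e y \<eta>) = ?e (x - y) \<eta>" for x y
        by (simp add: cis_cnj cis_mult inner_diff_left algebra_simps)
      then have "(b x * ?e x \<eta>) * cnj (b y * ?e y \<eta>) = b x * cnj (b y) * ?e (x - y) \<eta>" for x y
        by (metis (no_types, lifting) complex_cnj_mult mult.assoc mult.left_commute)
      then show ?thesis
        unfolding of_real_mult norm_sum_sq sum_distrib_right by (simp only: mult.assoc)
    qed
    have "integrable lborel (\<lambda>\<eta>. \<Sum>x\<in>X. \<Sum>y\<in>X. (b x * cnj (b y)) * (?e (x - y) \<eta> * of_real (gauss \<eta>)))"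
      by (intro Bochner_Integration.integrable_sum integrable_mult_right gauss_fourier(1))
    then have int: "integrable lborel (\<lambda>\<eta>. complex_of_real (?F \<eta>))" by (simp only: expand)
    then have intF: "integrable lborel ?F" by (simp only: complex_of_real_integrable_eq)
    have "of_real (integral\<^sup>L lborel ?F) = (\<integral>\<eta>. complex_of_real (?F \<eta>) \<partial>lborel)"
      by (rule integral_complex_of_real[symmetric])
    also have "\<dots> = (\<Sum>x\<in>X. \<Sum>y\<in>X. (b x * cnj (b y)) * of_real (k (x - y)))"
    proof -
      have "(\<integral>\<eta>. complex_of_real (?F \<eta>) \<partial>lborel)
        = (\<Sum>x\<in>X. \<integral>\<eta>. (\<Sum>y\<in>X. (b x * cnj (b y)) * (?e (x - y) \<eta> * of_real (gauss \<eta>))) \<partial>lborel)"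
        unfolding expand
        by (intro Bochner_Integration.integral_sum Bochner_Integration.integrable_sum integrable_mult_right gauss_fourier(1))
      also have "\<dots> = (\<Sum>x\<in>X. \<Sum>y\<in>X. \<integral>\<eta>. (b x * cnj (b y)) * (?e (x - y) \<eta> * of_real (gauss \<eta>)) \<partial>lborel)"
        by (intro sum.cong refl Bochner_Integration.integral_sum integrable_mult_right gauss_fourier(1))
      also have "\<dots> = (\<Sum>x\<in>X. \<Sum>y\<in>X. (b x * cnj (b y)) * of_real (k (x - y)))"
      proof (intro sum.cong refl)
        fix x y
        show "(\<integral>\<eta>. (b x * cnj (b y)) * (?e (x - y) \<eta> * of_real (gauss \<eta>)) \<partial>lborel) = (b x * cnj (b y)) * of_real (k (x - y))"
          unfolding k_def gauss_fourier(2)[symmetric] by (rule integral_mult_right_zero)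
      qed
      finally show ?thesis .
    qed
    finally have eq: "of_real (integral\<^sup>L lborel ?F) = (\<Sum>x\<in>X. \<Sum>y\<in>X. (b x * cnj (b y)) * complex_of_real (k (x - y)))" .
    have "\<bar>integral\<^sup>L lborel ?F\<bar> = norm (\<Sum>x\<in>X. \<Sum>y\<in>X. (b x * cnj (b y)) * complex_of_real (k (x - y)))"
      unfolding eq[symmetric] by (rule norm_of_real[symmetric])
    \<comment> \<open>The two halves of this splitting agree because k is even, and each is
      controlled by the row sums of k.\<close>
    also have "\<dots> \<le> (\<Sum>x\<in>X. \<Sum>y\<in>X. ((norm (b x))\<^sup>2 / 2 + (norm (b y))\<^sup>2 / 2) * k (x - y))"
    proof (intro sum_norm_le)
      fix x y
      have "norm (b x) * norm (b y) \<le> (norm (b x))\<^sup>2 / 2 + (norm (b y))\<^sup>2 / 2"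
        using zero_le_power2[of "norm (b x) - norm (b y)"] by (simp add: power2_diff field_simps)
      then show "norm (b x * cnj (b y) * of_real (k (x - y))) \<le> ((norm (b x))\<^sup>2 / 2 + (norm (b y))\<^sup>2 / 2) * k (x - y)"
        using k0[of "x - y"] by (simp add: norm_mult mult_right_mono)
    qed
    also have "\<dots> = (\<Sum>x\<in>X. \<Sum>y\<in>X. (norm (b x))\<^sup>2 / 2 * k (x - y)) + (\<Sum>x\<in>X. \<Sum>y\<in>X. (norm (b y))\<^sup>2 / 2 * k (x - y))"
      by (simp add: distrib_right sum.distrib)
    also have "(\<Sum>x\<in>X. \<Sum>y\<in>X. (norm (b y))\<^sup>2 / 2 * k (x - y)) = (\<Sum>x\<in>X. \<Sum>y\<in>X. (norm (b x))\<^sup>2 / 2 * k (x - y))"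
      by (subst sum.swap) (simp add: ksym)
    also have "(\<Sum>x\<in>X. \<Sum>y\<in>X. (norm (b x))\<^sup>2 / 2 * k (x - y)) + (\<Sum>x\<in>X. \<Sum>y\<in>X. (norm (b x))\<^sup>2 / 2 * k (x - y))
      = (\<Sum>x\<in>X. (norm (b x))\<^sup>2 * (\<Sum>y\<in>X. k (x - y)))"
      by (simp add: sum_distrib_left sum.distrib[symmetric]) (simp add: mult.commute)
    also have "\<dots> \<le> (\<Sum>x\<in>X. (norm (b x))\<^sup>2 * A)" by (intro sum_mono mult_left_mono ksum) auto
    finally have "\<bar>integral\<^sup>L lborel ?F\<bar> \<le> A * (\<Sum>x\<in>X. (norm (b x))\<^sup>2)"
      by (simp only: sum_distrib_right[symmetric] mult.commute[of A])
    then have "integral\<^sup>L lborel ?F \<le> A * (\<Sum>x\<in>X. (norm (b x))\<^sup>2)" by (rule abs_le_D1)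
    with intF show "integrable lborel ?F \<and> integral\<^sup>L lborel ?F \<le> A * (\<Sum>x\<in>X. (norm (b x))\<^sup>2)" by blast
  qed
qed

lemma cis_measurable [measurable]:
  assumes "f \<in> borel_measurable M" shows "(\<lambda>x. cis (f x)) \<in> borel_measurable M"
  using assms unfolding cis_conv_exp by measurable

lemma lborel_translate:
  fixes f :: "'a::euclidean_space \<Rightarrow> 'b::{banach,second_countable_topology}"
  assumes [measurable]: "f \<in> borel_measurable borel"
  shows "integral\<^sup>L lborel (\<lambda>x. f (x - a)) = integral\<^sup>L lborel f"
    and "integrable lborel (\<lambda>x. f (x - a)) \<longleftrightarrow> integrable lborel f"
proof -
  have "integral\<^sup>L lborel f = integral\<^sup>L (distr lborel borel ((+) (-a))) f" by (simp add: lborel_distr_plus)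
  also have "\<dots> = integral\<^sup>L lborel (\<lambda>x. f (x - a))" by (subst integral_distr) auto
  finally show "integral\<^sup>L lborel (\<lambda>x. f (x - a)) = integral\<^sup>L lborel f" by simp
  have "integrable lborel f \<longleftrightarrow> integrable (distr lborel borel ((+) (-a))) f" by (simp add: lborel_distr_plus)
  also have "\<dots> \<longleftrightarrow> integrable lborel (\<lambda>x. f (x - a))" by (subst integrable_distr_eq) auto
  finally show "integrable lborel (\<lambda>x. f (x - a)) \<longleftrightarrow> integrable lborel f" by simp
qed

text \<open>For fixed \<xi> the window is dominated, up to P^2 / g, by the Gaussian weight, so
  Bessel's inequality bounds that block. The blocks for different \<xi> are not orthogonal, but
  their supports lie in balls of radius R about lattice points and only boundedly many meet at a
  point.\<close>

lemma gabor_synthesis_bound: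
  fixes \<Lambda>1 \<Lambda>2 :: "'a::euclidean_space set"
  assumes \<Lambda>1: "is_lattice \<Lambda>1" and \<Lambda>2: "is_lattice \<Lambda>2"
  obtains C where "C \<ge> 0"
    "\<And>\<psi> P X \<Xi> c. \<psi> \<in> borel_measurable borel \<Longrightarrow> (\<And>\<eta>. norm (\<psi> \<eta>) \<le> P) \<Longrightarrow> (\<And>\<eta>. \<psi> \<eta> \<noteq> 0 \<Longrightarrow> norm \<eta> \<le> R) \<Longrightarrow>
      finite X \<Longrightarrow> X \<subseteq> \<Lambda>1 \<Longrightarrow> finite \<Xi> \<Longrightarrow> \<Xi> \<subseteq> \<Lambda>2 \<Longrightarrow>
      integrable lborel (\<lambda>\<eta>. (norm (\<Sum>\<xi>\<in>\<Xi>. \<Sum>x\<in>X. c x \<xi> * (\<psi> (\<eta> - \<xi>) * cis (- 2 * pi * (x \<bullet> (\<eta> - \<xi>))))))\<^sup>2) \<and>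
      (\<integral>\<eta>. (norm (\<Sum>\<xi>\<in>\<Xi>. \<Sum>x\<in>X. c x \<xi> * (\<psi> (\<eta> - \<xi>) * cis (- 2 * pi * (x \<bullet> (\<eta> - \<xi>))))))\<^sup>2 \<partial>lborel)
        \<le> C * P\<^sup>2 * (\<Sum>\<xi>\<in>\<Xi>. \<Sum>x\<in>X. (norm (c x \<xi>))\<^sup>2)"
proof -
  obtain A where A: "A \<ge> 0"
    "\<And>X b. finite X \<Longrightarrow> X \<subseteq> \<Lambda>1 \<Longrightarrow>
      integrable lborel (\<lambda>\<eta>. (norm (\<Sum>x\<in>X. b x * cis (- 2 * pi * (x \<bullet> \<eta>))))\<^sup>2 * gauss \<eta>) \<and>
      (\<integral>\<eta>. (norm (\<Sum>x\<in>X. b x * cis (- 2 * pi * (x \<bullet> \<eta>))))\<^sup>2 * gauss \<eta> \<partial>lborel) \<le> A * (\<Sum>x\<in>X. (norm (b x))\<^sup>2)"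
    using bessel[OF \<Lambda>1] by blast
  \<comment> \<open>A lower bound for \<open>gauss\<close> on the ball of radius R, in which the
    window lives.\<close>
  define g where "g = std_normal_density R ^ DIM('a)"
  have g: "g > 0" unfolding g_def by (intro zero_less_power normal_density_pos) simp
  define K where "K = real (overlap \<Lambda>2 R)"
  show thesis
  proof (rule that[of "K\<^sup>2 * (A / g)"])
    fix \<psi> :: "'a \<Rightarrow> complex" and P X \<Xi> and c :: "'a \<Rightarrow> 'a \<Rightarrow> complex"
    assume [measurable]: "\<psi> \<in> borel_measurable borel" and P: "\<And>\<eta>. norm (\<psi> \<eta>) \<le> P"
      and R: "\<And>\<eta>. \<psi> \<eta> \<noteq> 0 \<Longrightarrow> norm \<eta> \<le> R"
      and X: "finite X" "X \<subseteq> \<Lambda>1" and \<Xi>: "finite \<Xi>" "\<Xi> \<subseteq> \<Lambda>2"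
    define G where "G \<xi> \<eta> = (\<Sum>x\<in>X. c x \<xi> * (\<psi> \<eta> * cis (- 2 * pi * (x \<bullet> \<eta>))))" for \<xi> \<eta>
    define E where "E \<xi> \<eta> = (norm (\<Sum>x\<in>X. c x \<xi> * cis (- 2 * pi * (x \<bullet> \<eta>))))\<^sup>2 * gauss \<eta>" for \<xi> \<eta>
    have Gm [measurable]: "G \<xi> \<in> borel_measurable borel" for \<xi> unfolding G_def by measurable
    have GE: "(norm (G \<xi> \<eta>))\<^sup>2 \<le> P\<^sup>2 / g * E \<xi> \<eta>" for \<xi> \<eta>
    proof (cases "\<psi> \<eta> = 0")
      case True
      then show ?thesis using g by (simp add: G_def E_def less_imp_le[OF gauss_pos])
    next
      case False
      have "g \<le> gauss \<eta>" using gauss_lower_bound[OF R[OF False]] by (simp add: g_def)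
      then have "1 \<le> gauss \<eta> / g" using g by simp
      have "G \<xi> \<eta> = \<psi> \<eta> * (\<Sum>x\<in>X. c x \<xi> * cis (- 2 * pi * (x \<bullet> \<eta>)))"
        by (simp add: G_def sum_distrib_left mult_ac)
      then have "(norm (G \<xi> \<eta>))\<^sup>2 = (norm (\<psi> \<eta>))\<^sup>2 * (norm (\<Sum>x\<in>X. c x \<xi> * cis (- 2 * pi * (x \<bullet> \<eta>))))\<^sup>2"
        by (simp only: norm_mult power_mult_distrib)
      also have "\<dots> \<le> P\<^sup>2 * ((norm (\<Sum>x\<in>X. c x \<xi> * cis (- 2 * pi * (x \<bullet> \<eta>))))\<^sup>2 * (gauss \<eta> / g))"
        using mult_left_mono[OF \<open>1 \<le> gauss \<eta> / g\<close>, of "(norm (\<Sum>x\<in>X. c x \<xi> * cis (- 2 * pi * (x \<bullet> \<eta>))))\<^sup>2"]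
        by (intro mult_mono power_mono P) auto
      finally show ?thesis by (simp add: E_def)
    qed
    have Gint: "integrable lborel (\<lambda>\<eta>. (norm (G \<xi> \<eta>))\<^sup>2)" for \<xi>
    proof (rule integrable_nonneg_bound[OF _ _ _ GE])
      have "integrable lborel (E \<xi>)" unfolding E_def using A(2)[OF X, of "\<lambda>x. c x \<xi>"] by blast
      then show "integrable lborel (\<lambda>\<eta>. P\<^sup>2 / g * E \<xi> \<eta>)" by (rule integrable_mult_right)
    qed auto
    have Gle: "(\<integral>\<eta>. (norm (G \<xi> \<eta>))\<^sup>2 \<partial>lborel) \<le> P\<^sup>2 / g * (A * (\<Sum>x\<in>X. (norm (c x \<xi>))\<^sup>2))" for \<xi>
    proof -
      have "integrable lborel (E \<xi>)" unfolding E_def using A(2)[OF X, of "\<lambda>x. c x \<xi>"] by blast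
      then have "(\<integral>\<eta>. (norm (G \<xi> \<eta>))\<^sup>2 \<partial>lborel) \<le> (\<integral>\<eta>. P\<^sup>2 / g * E \<xi> \<eta> \<partial>lborel)"
        by (intro integral_mono Gint GE) auto
      also have "\<dots> = P\<^sup>2 / g * (\<integral>\<eta>. E \<xi> \<eta> \<partial>lborel)" by simp
      also have "\<dots> \<le> P\<^sup>2 / g * (A * (\<Sum>x\<in>X. (norm (c x \<xi>))\<^sup>2))"
        unfolding E_def using A(2)[OF X, of "\<lambda>x. c x \<xi>"] g by (intro mult_left_mono) auto
      finally show ?thesis .
    qed
    let ?H = "\<lambda>\<eta>. (norm (\<Sum>\<xi>\<in>\<Xi>. G \<xi> (\<eta> - \<xi>)))\<^sup>2"
    let ?B = "\<lambda>\<eta>. K\<^sup>2 * (\<Sum>\<xi>\<in>\<Xi>. (norm (G \<xi> (\<eta> - \<xi>)))\<^sup>2)"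
    have HB: "?H \<eta> \<le> ?B \<eta>" for \<eta>
    proof -
      have "{\<xi> \<in> \<Xi>. G \<xi> (\<eta> - \<xi>) \<noteq> 0} \<subseteq> {\<xi> \<in> \<Xi>. norm (\<eta> - \<xi>) \<le> R}"
      proof clarify
        fix \<xi> assume "\<xi> \<in> \<Xi>" "G \<xi> (\<eta> - \<xi>) \<noteq> 0"
        then have "\<psi> (\<eta> - \<xi>) \<noteq> 0" by (auto simp: G_def)
        then show "norm (\<eta> - \<xi>) \<le> R" by (rule R)
      qed
      then have "card {\<xi> \<in> \<Xi>. G \<xi> (\<eta> - \<xi>) \<noteq> 0} \<le> overlap \<Lambda>2 R"
        using overlap_bound[OF \<Lambda>2 \<Xi>(2)] card_mono order_trans by meson
      from norm_sum_power_le[OF \<Xi>(1) this, of 2] show ?thesis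
        by (simp add: K_def)
    qed
    have Bint: "integrable lborel ?B"
      using lborel_translate(2)[of "\<lambda>\<eta>. (norm (G \<xi> \<eta>))\<^sup>2" \<xi> for \<xi>] Gint
      by (intro integrable_mult_right Bochner_Integration.integrable_sum) simp
    have Hint: "integrable lborel ?H"
      by (rule integrable_nonneg_bound[OF Bint _ _ HB]) auto
    have "integral\<^sup>L lborel ?H \<le> integral\<^sup>L lborel ?B" by (intro integral_mono Hint Bint HB)
    also have "\<dots> = K\<^sup>2 * (\<Sum>\<xi>\<in>\<Xi>. \<integral>\<eta>. (norm (G \<xi> (\<eta> - \<xi>)))\<^sup>2 \<partial>lborel)"
      using lborel_translate(2)[of "\<lambda>\<eta>. (norm (G \<xi> \<eta>))\<^sup>2" \<xi> for \<xi>] Gint by simp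
    also have "\<dots> = K\<^sup>2 * (\<Sum>\<xi>\<in>\<Xi>. \<integral>\<eta>. (norm (G \<xi> \<eta>))\<^sup>2 \<partial>lborel)"
      using lborel_translate(1)[of "\<lambda>\<eta>. (norm (G \<xi> \<eta>))\<^sup>2" \<xi> for \<xi>] by simp
    also have "\<dots> \<le> K\<^sup>2 * (\<Sum>\<xi>\<in>\<Xi>. P\<^sup>2 / g * (A * (\<Sum>x\<in>X. (norm (c x \<xi>))\<^sup>2)))"
      by (intro mult_left_mono sum_mono Gle) auto
    also have "\<dots> = K\<^sup>2 * (A / g) * P\<^sup>2 * (\<Sum>\<xi>\<in>\<Xi>. \<Sum>x\<in>X. (norm (c x \<xi>))\<^sup>2)"
      by (simp add: sum_distrib_left sum_divide_distrib mult_ac)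
    finally have "integral\<^sup>L lborel ?H \<le> K\<^sup>2 * (A / g) * P\<^sup>2 * (\<Sum>\<xi>\<in>\<Xi>. \<Sum>x\<in>X. (norm (c x \<xi>))\<^sup>2)" .
    with Hint show "integrable lborel (\<lambda>\<eta>. (norm (\<Sum>\<xi>\<in>\<Xi>. \<Sum>x\<in>X. c x \<xi> * (\<psi> (\<eta> - \<xi>) * cis (- 2 * pi * (x \<bullet> (\<eta> - \<xi>))))))\<^sup>2) \<and>
      (\<integral>\<eta>. (norm (\<Sum>\<xi>\<in>\<Xi>. \<Sum>x\<in>X. c x \<xi> * (\<psi> (\<eta> - \<xi>) * cis (- 2 * pi * (x \<bullet> (\<eta> - \<xi>))))))\<^sup>2 \<partial>lborel)
        \<le> K\<^sup>2 * (A / g) * P\<^sup>2 * (\<Sum>\<xi>\<in>\<Xi>. \<Sum>x\<in>X. (norm (c x \<xi>))\<^sup>2)"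
      by (simp only: G_def)
  qed (use A g in auto)
qed

subsection \<open>Weighted Lebesgue spaces\<close>

lemma weight_pos: "poly_bounded_weight w \<Longrightarrow> w x > 0"
  by (simp add: poly_bounded_weight_def)

lemma weight_measurable [measurable_dest]: "poly_bounded_weight w \<Longrightarrow> w \<in> borel_measurable lebesgue"
  by (simp add: poly_bounded_weight_def)

lemma weight_moderate:
  assumes "poly_bounded_weight w"
  obtains C where "C > 0" "\<And>x y. norm (x - y) \<le> R \<Longrightarrow> w x \<le> C * w y"
proof -
  obtain C \<tau> where C: "C > 0" "\<tau> > 0" "\<And>x y. w (x + y) \<le> C * w x * (1 + norm y) powr \<tau>"
    using assms unfolding poly_bounded_weight_def by blast
  show thesis
  proof (rule that[of "C * (1 + \<bar>R\<bar>) powr \<tau>"])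
    fix x y :: 'a assume "norm (x - y) \<le> R"
    then have "(1 + norm (x - y)) powr \<tau> \<le> (1 + \<bar>R\<bar>) powr \<tau>"
      using C(2) by (intro powr_mono2) auto
    then have "C * w y * (1 + norm (x - y)) powr \<tau> \<le> C * w y * (1 + \<bar>R\<bar>) powr \<tau>"
      using C(1) weight_pos[OF assms, of y] by (intro mult_left_mono) auto
    then show "w x \<le> C * (1 + \<bar>R\<bar>) powr \<tau> * w y"
      using C(3)[of y "x - y"] by (simp add: mult_ac)
  qed (use C(1) in auto)
qed

text \<open>Moderateness applied to the step from x back to 0. This later turns a bound on weighted
  coefficients into polynomial growth of the coefficients, without which the synthesised function
  would not be seen to be tempered.\<close>

lemma weight_lower_bound:
  assumes "poly_bounded_weight w"
  obtains C N where "C > 0" "\<And>x. 1 \<le> C * w x * (1 + norm x) ^ N"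
proof -
  obtain C \<tau> where C: "C > 0" "\<tau> > 0" "\<And>x y. w (x + y) \<le> C * w x * (1 + norm y) powr \<tau>"
    using assms unfolding poly_bounded_weight_def by blast
  have w0: "w 0 > 0" by (rule weight_pos[OF assms])
  define N where "N = nat \<lceil>\<tau>\<rceil>"
  have "1 \<le> C / w 0 * w x * (1 + norm x) ^ N" for x
  proof -
    have "w 0 \<le> C * w x * (1 + norm x) powr \<tau>" using C(3)[of x "- x"] by simp
    also have "(1 + norm x) powr \<tau> \<le> (1 + norm x) powr real N"
      by (intro powr_mono) (auto simp: N_def real_nat_ceiling_ge)
    also have "\<dots> = (1 + norm x) ^ N" by (intro powr_realpow) (auto intro: add_pos_nonneg)
    finally show ?thesis using w0 C(1) weight_pos[OF assms, of x] by (simp add: field_simps)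
  qed
  then show thesis using that[of "C / w 0" N] C(1) w0 by simp
qed

section \<open>Weighted L^p norms and inequalities of Hoelder type\<close>

lemma nrm_Lp_eq: "nrm (Lp p w) f = (\<integral>x. (norm (f x) * w x) powr p \<partial>lebesgue) powr (1 / p)"
  by (simp add: Lp_def)

lemma nrm_Lp_nonneg: "nrm (Lp p w) f \<ge> 0"
  by (simp add: Lp_def)

lemma nrm_Lp_powr: "p > 0 \<Longrightarrow> nrm (Lp p w) f powr p = (\<integral>x. (norm (f x) * w x) powr p \<partial>lebesgue)"
  by (simp add: Lp_def powr_powr)

lemma Lp_measurable: "f \<in> elems (Lp p w) \<Longrightarrow> f \<in> borel_measurable lebesgue"
  by (simp add: Lp_def)

lemma Lp_integrable: "f \<in> elems (Lp p w) \<Longrightarrow> integrable lebesgue (\<lambda>x. (norm (f x) * w x) powr p)"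
  by (simp add: Lp_def)

text \<open>Only membership is at stake, so (a + b)^p \<le> 2^p (a^p + b^p) takes the place of
  Minkowski's inequality.\<close>

lemma Lp_add:
  assumes f: "f \<in> elems (Lp p w)" and g: "g \<in> elems (Lp p w)" and w: "poly_bounded_weight w" and p: "p \<ge> 1"
  shows "(\<lambda>x. f x + g x) \<in> elems (Lp p w)"
proof -
  have [measurable]: "f \<in> borel_measurable lebesgue" "g \<in> borel_measurable lebesgue" "w \<in> borel_measurable lebesgue"
    using f g w by (auto simp: Lp_measurable weight_measurable)
  have "integrable lebesgue (\<lambda>x. (norm (f x + g x) * w x) powr p)"
  proof (rule integrable_nonneg_bound)
    show "integrable lebesgue (\<lambda>x. 2 powr p * ((norm (f x) * w x) powr p + (norm (g x) * w x) powr p))"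
      using f g by (intro integrable_mult_right Bochner_Integration.integrable_add Lp_integrable)
    fix x
    let ?a = "norm (f x) * w x" and ?b = "norm (g x) * w x"
    have w0: "w x > 0" by (rule weight_pos[OF w])
    have "norm (f x + g x) * w x \<le> ?a + ?b"
      using mult_right_mono[OF norm_triangle_ineq[of "f x" "g x"], of "w x"] w0 by (simp add: distrib_right)
    also have "\<dots> \<le> 2 * max ?a ?b" by linarith
    finally have "(norm (f x + g x) * w x) powr p \<le> (2 * max ?a ?b) powr p"
      using p w0 by (intro powr_mono2) auto
    also have "\<dots> = 2 powr p * max ?a ?b powr p" by (rule powr_mult)
    also have "max ?a ?b powr p \<le> ?a powr p + ?b powr p" by (simp add: max_def)
    finally show "(norm (f x + g x) * w x) powr p \<le> 2 powr p * (?a powr p + ?b powr p)" by simp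
  qed auto
  then show ?thesis by (simp add: Lp_def)
qed

lemma Lp_cmult:
  assumes f: "f \<in> elems (Lp p w)" and w: "poly_bounded_weight w"
  shows "(\<lambda>x. a * f x) \<in> elems (Lp p w)"
proof -
  have [measurable]: "f \<in> borel_measurable lebesgue" using f by (rule Lp_measurable)
  have "(norm (a * f x) * w x) powr p = norm a powr p * (norm (f x) * w x) powr p" for x
    using weight_pos[OF w, of x] by (simp add: norm_mult powr_mult mult.assoc)
  then show ?thesis using Lp_integrable[OF f] by (simp add: Lp_def)
qed

lemma nrm_Lp_cmult:
  assumes w: "poly_bounded_weight w" and p: "p > 0"
  shows "nrm (Lp p w) (\<lambda>x. a * f x) = norm a * nrm (Lp p w) f"
proof -
  have "(norm (a * f x) * w x) powr p = norm a powr p * (norm (f x) * w x) powr p" for x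
    using weight_pos[OF w, of x] by (simp add: norm_mult powr_mult mult.assoc)
  then have "(\<integral>x. (norm (a * f x) * w x) powr p \<partial>lebesgue) = norm a powr p * (\<integral>x. (norm (f x) * w x) powr p \<partial>lebesgue)"
    by (simp only: integral_mult_right_zero)
  then show ?thesis using p by (simp only: nrm_Lp_eq powr_mult powr_powr) simp
qed

lemma nrm_Lp_cong_AE:
  assumes "AE x in lebesgue. f x = g x" "f \<in> elems (Lp p w)" "g \<in> elems (Lp p w)"
  shows "nrm (Lp p w) f = nrm (Lp p w) g"
proof -
  have "(\<integral>x. (norm (f x) * w x) powr p \<partial>lebesgue) = (\<integral>x. (norm (g x) * w x) powr p \<partial>lebesgue)"
  proof (rule integral_cong_AE)
    show "AE x in lebesgue. (norm (f x) * w x) powr p = (norm (g x) * w x) powr p"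
      using assms(1) by eventually_elim simp
  qed (use Lp_integrable assms in blast)+
  then show ?thesis by (simp add: Lp_def)
qed

lemma Lp_zero: "(\<lambda>_. 0) \<in> elems (Lp p w)" "nrm (Lp p w) (\<lambda>_. 0) = 0"
  by (auto simp: Lp_def)

lemma Lp_sum:
  assumes "\<And>i. i \<in> I \<Longrightarrow> f i \<in> elems (Lp p w)" and w: "poly_bounded_weight w" and p: "p \<ge> 1"
  shows "(\<lambda>x. \<Sum>i\<in>I. f i x) \<in> elems (Lp p w)"
  using assms(1)
proof (induction I rule: infinite_finite_induct)
  case (insert i I)
  then have "(\<lambda>x. f i x + (\<Sum>i\<in>I. f i x)) \<in> elems (Lp p w)" by (intro Lp_add w p) auto
  then show ?case using insert by simp
qed (auto intro: Lp_zero)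

lemma weight_one: "poly_bounded_weight (\<lambda>_. 1)"
  unfolding poly_bounded_weight_def
proof (intro conjI exI[of _ 1] allI)
  show "1 \<le> 1 * 1 * (1 + norm y) powr 1" for y :: 'a by simp
qed auto

text \<open>Split at a level l: u is at most l where it is small, and at most l^(1 - p) u^p where it
  exceeds l. Taking for l the p-norm of u makes both contributions proportional to l, with factor
  |S| + 1 in place of the sharp power of |S|.\<close>

lemma crude_Hoelder:
  fixes u :: "'a \<Rightarrow> real"
  assumes p: "p \<ge> 1" and u: "u \<in> borel_measurable M" "\<And>x. u x \<ge> 0" "\<And>x. x \<notin> S \<Longrightarrow> u x = 0"
    and S: "S \<in> sets M" "emeasure M S < \<infinity>" and int: "integrable M (\<lambda>x. u x powr p)"
  shows "integrable M u" "integral\<^sup>L M u \<le> (measure M S + 1) * (\<integral>x. u x powr p \<partial>M) powr (1 / p)"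
proof -
  have intS: "integrable M (\<lambda>x. indicator S x :: real)" using S by simp
  have le: "u x \<le> l * indicator S x + l powr (1 - p) * u x powr p" if l: "l > 0" for l x
  proof (cases "x \<in> S \<and> u x > l")
    case True
    then have "u x = u x powr (1 - p) * u x powr p" using l by (simp flip: powr_add)
    also have "\<dots> \<le> l powr (1 - p) * u x powr p"
      using True l p by (intro mult_right_mono powr_mono2') auto
    finally show ?thesis using l by (simp add: add_increasing)
  next
    case False
    then show ?thesis using u(3)[of x] l by (cases "x \<in> S") (auto simp: add_increasing2)
  qed
  show ui: "integrable M u"
    by (rule integrable_nonneg_bound[OF _ u(1,2) le[of 1]])
      (use intS int in \<open>auto intro!: Bochner_Integration.integrable_add\<close>)
  let ?I = "\<integral>x. u x powr p \<partial>M"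
  show "integral\<^sup>L M u \<le> (measure M S + 1) * ?I powr (1 / p)"
  proof (cases "?I = 0")
    case True
    have "AE x in M. u x powr p = 0"
      using integral_nonneg_eq_0_iff_AE[OF int] True by simp
    then have "AE x in M. u x = 0" by eventually_elim (use p in auto)
    then have "integral\<^sup>L M u = 0" by (rule integral_eq_zero_AE)
    then show ?thesis by simp
  next
    case False
    have "?I \<ge> 0" by (rule integral_nonneg_AE) auto
    then have I: "?I > 0" using False by linarith
    define l where "l = ?I powr (1 / p)"
    have l: "l > 0" using I by (simp add: l_def)
    have "integral\<^sup>L M u \<le> (\<integral>x. l * indicator S x + l powr (1 - p) * u x powr p \<partial>M)"
      using intS int by (intro integral_mono ui le l Bochner_Integration.integrable_add integrable_mult_right) 
    also have "\<dots> = l * measure M S + l powr (1 - p) * ?I"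
      using intS int S by simp
    also have "?I = l powr p" using p I by (simp add: l_def powr_powr)
    also have "l powr (1 - p) * l powr p = l" using l by (simp flip: powr_add)
    finally show ?thesis by (simp add: l_def algebra_simps)
  qed
qed

lemma Cauchy_Schwarz_L2:
  fixes f g :: "'a::euclidean_space \<Rightarrow> complex"
  assumes f: "f \<in> elems L2" and g: "g \<in> elems L2"
  shows "integrable lebesgue (\<lambda>x. f x * g x)" "norm (\<integral>x. f x * g x \<partial>lebesgue) \<le> nrm L2 f * nrm L2 g"
proof -
  have [measurable]: "f \<in> borel_measurable lebesgue" "g \<in> borel_measurable lebesgue"
    using f g by (auto intro: Lp_measurable)
  let ?A = "\<integral>x. (norm (f x))\<^sup>2 \<partial>lebesgue" and ?D = "\<integral>x. (norm (g x))\<^sup>2 \<partial>lebesgue"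
  let ?B = "\<integral>x. norm (f x * g x) \<partial>lebesgue"
  have intA: "integrable lebesgue (\<lambda>x. (norm (f x))\<^sup>2)" and intD: "integrable lebesgue (\<lambda>x. (norm (g x))\<^sup>2)"
    using Lp_integrable[OF f] Lp_integrable[OF g] by simp_all
  have le: "norm (f x * g x) \<le> s / 2 * (norm (f x))\<^sup>2 + 1 / (2 * s) * (norm (g x))\<^sup>2" if "s > 0" for s x
  proof -
    have "0 \<le> (s * norm (f x) - norm (g x))\<^sup>2 / (2 * s)" using that by simp
    then show ?thesis using that by (simp add: norm_mult field_simps power2_eq_square)
  qed
  have int: "integrable lebesgue (\<lambda>x. norm (f x * g x))"
    by (rule integrable_nonneg_bound[OF _ _ _ le[of 1]]) (use intA intD in auto)
  then show "integrable lebesgue (\<lambda>x. f x * g x)" by (subst (asm) integrable_norm_iff) auto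
  have AD: "?A \<ge> 0" "?D \<ge> 0" by auto
  have B: "?B \<le> s / 2 * ?A + 1 / (2 * s) * ?D" if "s > 0" for s
  proof -
    have "?B \<le> (\<integral>x. s / 2 * (norm (f x))\<^sup>2 + 1 / (2 * s) * (norm (g x))\<^sup>2 \<partial>lebesgue)"
      using intA intD by (intro integral_mono int le that Bochner_Integration.integrable_add integrable_mult_right)
    also have "\<dots> = s / 2 * ?A + 1 / (2 * s) * ?D" using intA intD by simp
    finally show ?thesis .
  qed
  have "?B \<le> sqrt ?A * sqrt ?D"
  proof (cases "?A = 0 \<or> ?D = 0")
    case True
    then have "(AE x in lebesgue. (norm (f x))\<^sup>2 = 0) \<or> (AE x in lebesgue. (norm (g x))\<^sup>2 = 0)"
      using integral_nonneg_eq_0_iff_AE[OF intA] integral_nonneg_eq_0_iff_AE[OF intD] by auto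
    then have "AE x in lebesgue. norm (f x * g x) = 0" by (auto elim: eventually_mono)
    then have "?B = 0" by (rule integral_eq_zero_AE)
    then show ?thesis using AD by simp
  next
    case False
    then have pos: "?A > 0" "?D > 0" using AD by (auto simp: less_le)
    define a d where "a = sqrt ?A" and "d = sqrt ?D"
    have ad: "a > 0" "d > 0" "?A = a * a" "?D = d * d" using pos by (auto simp: a_def d_def)
    \<comment> \<open>The choice s = d / a minimises the bound \<open>B\<close>.\<close>
    show ?thesis unfolding a_def[symmetric] d_def[symmetric]
      using B[of "d / a"] ad by (simp add: field_simps)
  qed
  then have "norm (\<integral>x. f x * g x \<partial>lebesgue) \<le> sqrt ?A * sqrt ?D"
    by (rule order_trans[OF integral_norm_bound])
  moreover have "nrm L2 f = sqrt ?A" "nrm L2 g = sqrt ?D" by (auto simp: Lp_def powr_half_sqrt)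
  ultimately show "norm (\<integral>x. f x * g x \<partial>lebesgue) \<le> nrm L2 f * nrm L2 g" by (simp only:)
qed

section \<open>Lattice translates of a compactly supported window in weighted L^p\<close>

lemma bounded_compact_support_Lp:
  assumes [measurable]: "\<phi> \<in> borel_measurable borel" and P: "\<And>t. norm (\<phi> t) \<le> P"
    and R: "\<And>t. \<phi> t \<noteq> 0 \<Longrightarrow> norm (t - a) \<le> R" and w: "poly_bounded_weight w" and p: "p \<ge> 1"
  shows "\<phi> \<in> elems (Lp p w)"
proof -
  obtain C where C: "C > 0" "\<And>x y. norm (x - y) \<le> R \<Longrightarrow> w x \<le> C * w y"
    using weight_moderate[OF w] by blast
  have [measurable]: "w \<in> borel_measurable lebesgue" "\<phi> \<in> borel_measurable lebesgue"
    using w assms(1) by (auto simp: weight_measurable intro: measurable_completion)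
  have "integrable lebesgue (\<lambda>x. (norm (\<phi> x) * w x) powr p)"
  proof (rule integrable_nonneg_bound)
    have "integrable lebesgue (\<lambda>t. indicator (cball a R) t :: real)"
      using lmeasurable_cball[of a R] by (intro integrable_real_indicator) (auto simp: fmeasurable_def)
    then show "integrable lebesgue (\<lambda>t. (P * (C * w a)) powr p * indicator (cball a R) t)" by (rule integrable_mult_right)
    fix t
    show "(norm (\<phi> t) * w t) powr p \<le> (P * (C * w a)) powr p * indicator (cball a R) t"
    proof (cases "\<phi> t = 0")
      case False
      from R[OF this] have "w t \<le> C * w a" "t \<in> cball a R" by (auto intro: C simp: dist_norm norm_minus_commute)
      moreover have "norm (\<phi> t) * w t \<le> P * (C * w a)"
        using calculation weight_pos[OF w, of t] by (intro mult_mono P) (auto intro: order_trans[OF norm_ge_zero P])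
      ultimately show ?thesis using p weight_pos[OF w, of t] by (auto intro!: powr_mono2)
    qed auto
  qed auto
  then show ?thesis by (simp add: Lp_def)
qed

text \<open>The p-norm of \<phi> is kept as a factor, with C independent of \<phi> and P: the
  windows used later are differences of indicators carried by thin slabs, and the smallness of their
  p-norm is what makes the dyadic series converge. The weight is moved from t to x at bounded cost,
  since they differ by at most R on the support.\<close>

lemma translates_synthesis_bound:
  fixes \<Lambda> :: "'a::euclidean_space set"
  assumes \<Lambda>: "is_lattice \<Lambda>" and w: "poly_bounded_weight w" and p: "p \<ge> 1"
  obtains C where "C \<ge> 0"
    "\<And>\<phi> P X a. \<phi> \<in> borel_measurable borel \<Longrightarrow> (\<And>t. norm (\<phi> t) \<le> P) \<Longrightarrow> (\<And>t. \<phi> t \<noteq> 0 \<Longrightarrow> norm t \<le> R) \<Longrightarrow>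
      finite X \<Longrightarrow> X \<subseteq> \<Lambda> \<Longrightarrow>
      nrm (Lp p w) (\<lambda>t. \<Sum>x\<in>X. a x * \<phi> (t - x)) \<le>
        C * (\<integral>t. norm (\<phi> t) powr p \<partial>lborel) powr (1 / p) * (\<Sum>x\<in>X. (norm (a x) * w x) powr p) powr (1 / p)"
proof -
  obtain C where C: "C > 0" "\<And>x y. norm (x - y) \<le> R \<Longrightarrow> w x \<le> C * w y"
    using weight_moderate[OF w] by blast
  define K where "K = real (overlap \<Lambda> R)"
  show thesis
  proof (rule that[of "K * C"])
    fix \<phi> :: "'a \<Rightarrow> complex" and P X and a :: "'a \<Rightarrow> complex"
    assume \<phi> [measurable]: "\<phi> \<in> borel_measurable borel" and P: "\<And>t. norm (\<phi> t) \<le> P" and R: "\<And>t. \<phi> t \<noteq> 0 \<Longrightarrow> norm t \<le> R"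
      and X: "finite X" "X \<subseteq> \<Lambda>"
    let ?f = "\<lambda>t. \<Sum>x\<in>X. a x * \<phi> (t - x)"
    let ?J = "\<integral>t. norm (\<phi> t) powr p \<partial>lborel"
    let ?g = "\<lambda>t. (K * C) powr p * (\<Sum>x\<in>X. (norm (a x) * w x) powr p * norm (\<phi> (t - x)) powr p)"
    have w0: "w x > 0" for x by (rule weight_pos[OF w])
    have "\<phi> \<in> elems (Lp p (\<lambda>_. 1))" by (rule bounded_compact_support_Lp[OF \<phi> P _ weight_one p, of 0 R]) (use R in auto)
    then have "integrable lebesgue (\<lambda>t. norm (\<phi> t) powr p)" using Lp_integrable by fastforce
    then have intphi: "integrable lborel (\<lambda>t. norm (\<phi> t) powr p)" by (subst (asm) integrable_completion) auto
    then have inttr: "integrable lborel (\<lambda>t. norm (\<phi> (t - x)) powr p)" for x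
      using lborel_translate(2)[of "\<lambda>t. norm (\<phi> t) powr p" x] by simp
    have tr: "(\<integral>t. norm (\<phi> (t - x)) powr p \<partial>lborel) = ?J" for x
      using lborel_translate(1)[of "\<lambda>t. norm (\<phi> t) powr p" x] by simp
    have le: "(norm (?f t) * w t) powr p \<le> ?g t" for t
    proof -
      have "{x \<in> X. a x * \<phi> (t - x) \<noteq> 0} \<subseteq> {x \<in> X. norm (t - x) \<le> R}" using R by auto
      then have "card {x \<in> X. a x * \<phi> (t - x) \<noteq> 0} \<le> overlap \<Lambda> R"
        using overlap_bound[OF \<Lambda> X(2)] card_mono order_trans by meson
      from norm_sum_power_le[OF X(1) this p]
      have "norm (?f t) powr p \<le> K powr p * (\<Sum>x\<in>X. norm (a x * \<phi> (t - x)) powr p)" by (simp add: K_def)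
      then have "(norm (?f t) * w t) powr p \<le> K powr p * (\<Sum>x\<in>X. norm (a x * \<phi> (t - x)) powr p) * w t powr p"
        by (simp add: powr_mult mult_right_mono)
      also have "\<dots> = K powr p * (\<Sum>x\<in>X. (norm (a x * \<phi> (t - x)) * w t) powr p)"
        by (simp add: powr_mult sum_distrib_right mult.assoc)
      also have "\<dots> \<le> K powr p * (\<Sum>x\<in>X. (C * (norm (a x) * w x) * norm (\<phi> (t - x))) powr p)"
      proof (intro mult_left_mono sum_mono powr_mono2)
        fix x
        show "norm (a x * \<phi> (t - x)) * w t \<le> C * (norm (a x) * w x) * norm (\<phi> (t - x))"
        proof (cases "\<phi> (t - x) = 0")
          case False
          then have "w t \<le> C * w x" by (intro C(2) R)
          from mult_left_mono[OF this, of "norm (a x * \<phi> (t - x))"] show ?thesis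
            by (simp add: norm_mult mult_ac)
        qed auto
      qed (use p w0[of t] in auto)
      also have "\<dots> = ?g t"
        by (simp add: powr_mult sum_distrib_left mult_ac)
      finally show ?thesis .
    qed
    have gm [measurable]: "?g \<in> borel_measurable borel" by measurable
    have gint: "integrable lborel ?g"
      by (intro integrable_mult_right Bochner_Integration.integrable_sum inttr)
    then have gint': "integrable lebesgue ?g" by (subst integrable_completion) auto
    have f_Lp: "?f \<in> elems (Lp p w)"
    proof (intro Lp_sum Lp_cmult w p)
      fix x
      show "(\<lambda>t. \<phi> (t - x)) \<in> elems (Lp p w)"
        by (rule bounded_compact_support_Lp[OF _ P _ w p, of _ x R]) (use R in auto)
    qed
    have "(\<integral>t. (norm (?f t) * w t) powr p \<partial>lebesgue) \<le> (\<integral>t. ?g t \<partial>lebesgue)"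
      by (intro integral_mono gint' le) (use Lp_integrable[OF f_Lp] in simp)
    also have "\<dots> = (\<integral>t. ?g t \<partial>lborel)" by (rule integral_completion) measurable
    also have "\<dots> = (K * C) powr p * (\<Sum>x\<in>X. (norm (a x) * w x) powr p * ?J)"
      using inttr by (simp add: tr)
    also have "\<dots> = (K * C) powr p * (?J * (\<Sum>x\<in>X. (norm (a x) * w x) powr p))"
      by (simp add: sum_distrib_left mult_ac)
    finally have "nrm (Lp p w) ?f \<le> ((K * C) powr p * (?J * (\<Sum>x\<in>X. (norm (a x) * w x) powr p))) powr (1 / p)"
      unfolding nrm_Lp_eq using p by (intro powr_mono2) auto
    also have "\<dots> = K * C * ?J powr (1 / p) * (\<Sum>x\<in>X. (norm (a x) * w x) powr p) powr (1 / p)"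
      using p C(1) by (simp add: powr_mult powr_powr K_def)
    finally show "nrm (Lp p w) ?f \<le> K * C * ?J powr (1 / p) * (\<Sum>x\<in>X. (norm (a x) * w x) powr p) powr (1 / p)" .
  qed (use C in \<open>auto simp: K_def\<close>)
qed

text \<open>The p-th power of a local norm. Left without the root it is additive and sums over
  lattice points.\<close>

definition local_Lp :: "real \<Rightarrow> real \<Rightarrow> ('a::euclidean_space \<Rightarrow> real) \<Rightarrow> ('a \<Rightarrow> complex) \<Rightarrow> 'a \<Rightarrow> real" where
  "local_Lp R p w f x = (\<integral>t. indicator (cball x R) t * (norm (f t) * w t) powr p \<partial>lebesgue)"

lemma local_Lp_nonneg: "local_Lp R p w f x \<ge> 0"
  unfolding local_Lp_def by (intro integral_nonneg_AE AE_I2) auto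

lemma integrable_local_Lp:
  assumes "f \<in> elems (Lp p w)"
  shows "integrable lebesgue (\<lambda>t. indicator (cball x R) t * (norm (f t) * w t) powr p)"
proof -
  have "integrable lebesgue (\<lambda>t. (norm (f t) * w t) powr p)" by (rule Lp_integrable[OF assms])
  then have "integrable lebesgue (\<lambda>t. indicator (cball x R) t *\<^sub>R (norm (f t) * w t) powr p)"
    by (rule integrable_mult_indicator[rotated]) auto
  then show ?thesis by simp
qed

lemma sum_local_Lp_le:
  assumes \<Lambda>: "is_lattice \<Lambda>" and X: "finite X" "X \<subseteq> \<Lambda>" and f: "f \<in> elems (Lp p w)" and p: "p > 0"
  shows "(\<Sum>x\<in>X. local_Lp R p w f x) \<le> real (overlap \<Lambda> R) * nrm (Lp p w) f powr p"
proof -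
  have "(\<Sum>x\<in>X. local_Lp R p w f x) = (\<integral>t. (\<Sum>x\<in>X. indicator (cball x R) t * (norm (f t) * w t) powr p) \<partial>lebesgue)"
    unfolding local_Lp_def by (rule Bochner_Integration.integral_sum[symmetric]) (rule integrable_local_Lp[OF f])
  also have "\<dots> \<le> (\<integral>t. real (overlap \<Lambda> R) * (norm (f t) * w t) powr p \<partial>lebesgue)"
  proof (rule integral_mono)
    fix t
    have "(\<Sum>x\<in>X. indicator (cball x R) t :: real) = (\<Sum>x\<in>{x\<in>X. norm (t - x) \<le> R}. 1)"
      using X(1) by (intro sum.mono_neutral_cong_right) (auto simp: indicator_def dist_norm norm_minus_commute)
    also have "\<dots> \<le> real (overlap \<Lambda> R)" using overlap_bound(2)[OF \<Lambda> X(2)] by simp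
    finally have "(\<Sum>x\<in>X. indicator (cball x R) t :: real) \<le> real (overlap \<Lambda> R)" .
    then show "(\<Sum>x\<in>X. indicator (cball x R) t * (norm (f t) * w t) powr p) \<le> real (overlap \<Lambda> R) * (norm (f t) * w t) powr p"
      by (simp only: sum_distrib_right[symmetric]) (intro mult_right_mono, auto)
  qed (use integrable_local_Lp[OF f] Lp_integrable[OF f] in auto)
  also have "\<dots> = real (overlap \<Lambda> R) * nrm (Lp p w) f powr p"
    using p by (simp add: nrm_Lp_powr)
  finally show ?thesis .
qed

text \<open>The right side is local on purpose: summed over x it gives an \<ell>^p bound, and for a
  single f it tends to 0 along the lattice, which the c_0 condition will need.\<close>

lemma translates_analysis_bound:
  fixes w :: "'a::euclidean_space \<Rightarrow> real"
  assumes w: "poly_bounded_weight w" and p: "p \<ge> 1"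
  obtains C where "C \<ge> 0"
    "\<And>\<phi> P f x. \<phi> \<in> borel_measurable borel \<Longrightarrow> (\<And>t. norm (\<phi> t) \<le> P) \<Longrightarrow> (\<And>t. \<phi> t \<noteq> 0 \<Longrightarrow> norm t \<le> R) \<Longrightarrow>
      f \<in> elems (Lp p w) \<Longrightarrow> integrable lebesgue (\<lambda>t. f t * \<phi> (t - x)) \<and>
      w x * norm (\<integral>t. f t * \<phi> (t - x) \<partial>lebesgue) \<le> C * P * local_Lp R p w f x powr (1 / p)"
proof -
  obtain C where C: "C > 0" "\<And>x y. norm (x - y) \<le> R \<Longrightarrow> w x \<le> C * w y"
    using weight_moderate[OF w] by blast
  have w0: "w x > 0" for x by (rule weight_pos[OF w])
  \<comment> \<open>The volume of the ball plus 1, as demanded by \<open>crude_Hoelder\<close>. The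
    absolute value also covers the empty ball of a negative R.\<close>
  define V where "V = unit_ball_vol (real DIM('a)) * \<bar>R\<bar> ^ DIM('a) + 1"
  show thesis
  proof (rule that[of "C * V"])
    fix \<phi> f :: "'a \<Rightarrow> complex" and P x
    assume [measurable]: "\<phi> \<in> borel_measurable borel" and P: "\<And>t. norm (\<phi> t) \<le> P" and R: "\<And>t. \<phi> t \<noteq> 0 \<Longrightarrow> norm t \<le> R"
      and f: "f \<in> elems (Lp p w)"
    have P0: "P \<ge> 0" using P norm_ge_zero order_trans by blast
    have "(\<lambda>t. \<phi> (t - x)) \<in> borel_measurable borel" by measurable
    then have [measurable]: "(\<lambda>t. \<phi> (t - x)) \<in> borel_measurable lebesgue"
      by (auto intro: measurable_completion)
    have [measurable]: "f \<in> borel_measurable lebesgue" "w \<in> borel_measurable lebesgue"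
      using f w by (auto simp: Lp_measurable weight_measurable)
    define u where "u t = indicator (cball x R) t * (norm (f t) * w t)" for t
    have up: "u t powr p = indicator (cball x R) t * (norm (f t) * w t) powr p" for t
      by (auto simp: u_def indicator_def)
    have um: "u \<in> borel_measurable lebesgue" unfolding u_def
      by (intro borel_measurable_times borel_measurable_indicator borel_measurable_norm) (use \<open>f \<in> borel_measurable lebesgue\<close> \<open>w \<in> borel_measurable lebesgue\<close> in auto)
    have ball: "cball x R \<in> sets lebesgue" "emeasure lebesgue (cball x R) < \<infinity>"
      using lmeasurable_cball[of x R] by (auto simp: fmeasurable_def)
    have "measure lebesgue (cball x R) + 1 \<le> V"
      by (cases "R \<ge> 0") (simp_all add: V_def content_cball)
    have H: "integrable lebesgue u"
      "integral\<^sup>L lebesgue u \<le> (measure lebesgue (cball x R) + 1) * (\<integral>t. u t powr p \<partial>lebesgue) powr (1 / p)"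
      using crude_Hoelder[OF p um _ _ ball] integrable_local_Lp[OF f, of x R] w0 unfolding up
      by (auto simp: u_def less_imp_le)
    then have ui: "integrable lebesgue u" by blast
    have "integral\<^sup>L lebesgue u \<le> (measure lebesgue (cball x R) + 1) * local_Lp R p w f x powr (1 / p)"
      using H(2) unfolding up local_Lp_def .
    also have "\<dots> \<le> V * local_Lp R p w f x powr (1 / p)"
      by (intro mult_right_mono) (fact, simp)
    finally have ule: "integral\<^sup>L lebesgue u \<le> V * local_Lp R p w f x powr (1 / p)" .
    have le: "w x * norm (f t * \<phi> (t - x)) \<le> C * P * u t" for t
    proof (cases "\<phi> (t - x) = 0")
      case True
      then show ?thesis using C(1) P0 w0[of t] by (simp add: u_def)
    next
      case False
      then have t: "norm (x - t) \<le> R" using R[OF False] by (simp add: norm_minus_commute)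
      have "w x * norm (f t * \<phi> (t - x)) \<le> (C * w t) * (norm (f t) * P)"
        unfolding norm_mult using C w0[of t] w0[of x] t P0 by (intro mult_mono C(2) P) auto
      then show ?thesis using t by (simp add: u_def dist_norm mult_ac)
    qed
    have int: "integrable lebesgue (\<lambda>t. w x * norm (f t * \<phi> (t - x)))"
      by (rule integrable_nonneg_bound[OF _ _ _ le]) (use ui w0[of x] in \<open>auto intro: less_imp_le\<close>)
    then have int': "integrable lebesgue (\<lambda>t. norm (f t * \<phi> (t - x)))"
      using w0[of x] by simp
    then have "integrable lebesgue (\<lambda>t. f t * \<phi> (t - x))" by (subst (asm) integrable_norm_iff) auto
    moreover have "w x * norm (\<integral>t. f t * \<phi> (t - x) \<partial>lebesgue) \<le> C * V * P * local_Lp R p w f x powr (1 / p)"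
    proof -
      have "w x * norm (\<integral>t. f t * \<phi> (t - x) \<partial>lebesgue) \<le> w x * (\<integral>t. norm (f t * \<phi> (t - x)) \<partial>lebesgue)"
        using w0[of x] by (intro mult_left_mono integral_norm_bound) auto
      also have "\<dots> = (\<integral>t. w x * norm (f t * \<phi> (t - x)) \<partial>lebesgue)" by simp
      also have "\<dots> \<le> (\<integral>t. C * P * u t \<partial>lebesgue)"
        using ui by (intro integral_mono int le) auto
      also have "\<dots> \<le> C * P * (V * local_Lp R p w f x powr (1 / p))"
        using ule C(1) P0 by (simp add: mult_left_mono)
      finally show ?thesis by (simp add: mult_ac)
    qed
    ultimately show "integrable lebesgue (\<lambda>t. f t * \<phi> (t - x)) \<and>
      w x * norm (\<integral>t. f t * \<phi> (t - x) \<partial>lebesgue) \<le> C * V * P * local_Lp R p w f x powr (1 / p)" by blast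
  qed (use C in \<open>simp add: V_def\<close>)
qed

lemma gabor_synthesis_L2:
  fixes \<Lambda>1 \<Lambda>2 :: "'a::euclidean_space set"
  assumes \<Lambda>1: "is_lattice \<Lambda>1" and \<Lambda>2: "is_lattice \<Lambda>2"
  obtains C where "C \<ge> 0"
    "\<And>\<psi> P X \<Xi> c. \<psi> \<in> borel_measurable borel \<Longrightarrow> (\<And>\<eta>. norm (\<psi> \<eta>) \<le> P) \<Longrightarrow> (\<And>\<eta>. \<psi> \<eta> \<noteq> 0 \<Longrightarrow> norm \<eta> \<le> R) \<Longrightarrow>
      finite X \<Longrightarrow> X \<subseteq> \<Lambda>1 \<Longrightarrow> finite \<Xi> \<Longrightarrow> \<Xi> \<subseteq> \<Lambda>2 \<Longrightarrow>
      (\<lambda>\<eta>. \<Sum>\<xi>\<in>\<Xi>. \<Sum>x\<in>X. c x \<xi> * (\<psi> (\<eta> - \<xi>) * cis (- 2 * pi * (x \<bullet> (\<eta> - \<xi>))))) \<in> elems L2 \<and>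
      nrm L2 (\<lambda>\<eta>. \<Sum>\<xi>\<in>\<Xi>. \<Sum>x\<in>X. c x \<xi> * (\<psi> (\<eta> - \<xi>) * cis (- 2 * pi * (x \<bullet> (\<eta> - \<xi>)))))
        \<le> C * P * sqrt (\<Sum>\<xi>\<in>\<Xi>. \<Sum>x\<in>X. (norm (c x \<xi>))\<^sup>2)"
proof -
  obtain C where C: "C \<ge> 0"
    "\<And>\<psi> P X \<Xi> c. \<psi> \<in> borel_measurable borel \<Longrightarrow> (\<And>\<eta>. norm (\<psi> \<eta>) \<le> P) \<Longrightarrow> (\<And>\<eta>. \<psi> \<eta> \<noteq> 0 \<Longrightarrow> norm \<eta> \<le> R) \<Longrightarrow>
      finite X \<Longrightarrow> X \<subseteq> \<Lambda>1 \<Longrightarrow> finite \<Xi> \<Longrightarrow> \<Xi> \<subseteq> \<Lambda>2 \<Longrightarrow>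
      integrable lborel (\<lambda>\<eta>. (norm (\<Sum>\<xi>\<in>\<Xi>. \<Sum>x\<in>X. c x \<xi> * (\<psi> (\<eta> - \<xi>) * cis (- 2 * pi * (x \<bullet> (\<eta> - \<xi>))))))\<^sup>2) \<and>
      (\<integral>\<eta>. (norm (\<Sum>\<xi>\<in>\<Xi>. \<Sum>x\<in>X. c x \<xi> * (\<psi> (\<eta> - \<xi>) * cis (- 2 * pi * (x \<bullet> (\<eta> - \<xi>))))))\<^sup>2 \<partial>lborel)
        \<le> C * P\<^sup>2 * (\<Sum>\<xi>\<in>\<Xi>. \<Sum>x\<in>X. (norm (c x \<xi>))\<^sup>2)"
    using gabor_synthesis_bound[OF assms, of R] by blast
  show thesis
  proof (rule that[of "sqrt C"])
    fix \<psi> :: "'a \<Rightarrow> complex" and P X \<Xi> and c :: "'a \<Rightarrow> 'a \<Rightarrow> complex"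
    assume a: "\<psi> \<in> borel_measurable borel" "\<And>\<eta>. norm (\<psi> \<eta>) \<le> P" "\<And>\<eta>. \<psi> \<eta> \<noteq> 0 \<Longrightarrow> norm \<eta> \<le> R"
      "finite X" "X \<subseteq> \<Lambda>1" "finite \<Xi>" "\<Xi> \<subseteq> \<Lambda>2"
    note [measurable] = a(1)
    let ?G = "\<lambda>\<eta>. \<Sum>\<xi>\<in>\<Xi>. \<Sum>x\<in>X. c x \<xi> * (\<psi> (\<eta> - \<xi>) * cis (- 2 * pi * (x \<bullet> (\<eta> - \<xi>))))"
    have P0: "P \<ge> 0" using a(2) norm_ge_zero order_trans by blast
    have G [measurable]: "?G \<in> borel_measurable borel" by measurable
    then have G': "?G \<in> borel_measurable lebesgue" by (auto intro: measurable_completion)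
    have int: "integrable lborel (\<lambda>\<eta>. (norm (?G \<eta>))\<^sup>2)"
      and le: "(\<integral>\<eta>. (norm (?G \<eta>))\<^sup>2 \<partial>lborel) \<le> C * P\<^sup>2 * (\<Sum>\<xi>\<in>\<Xi>. \<Sum>x\<in>X. (norm (c x \<xi>))\<^sup>2)"
      using C(2)[OF a, of c] by blast+
    have "integrable lebesgue (\<lambda>\<eta>. (norm (?G \<eta>))\<^sup>2)" using int by (subst integrable_completion) measurable
    then have mem: "?G \<in> elems L2" using G' by (simp add: Lp_def)
    have "(\<integral>\<eta>. (norm (?G \<eta>))\<^sup>2 \<partial>lebesgue) = (\<integral>\<eta>. (norm (?G \<eta>))\<^sup>2 \<partial>lborel)"
      by (rule integral_completion) measurable
    then have "nrm L2 ?G \<le> sqrt (C * P\<^sup>2 * (\<Sum>\<xi>\<in>\<Xi>. \<Sum>x\<in>X. (norm (c x \<xi>))\<^sup>2))"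
      using le by (simp add: Lp_def powr_half_sqrt)
    also have "\<dots> = sqrt C * P * sqrt (\<Sum>\<xi>\<in>\<Xi>. \<Sum>x\<in>X. (norm (c x \<xi>))\<^sup>2)"
      using P0 by (simp add: real_sqrt_mult)
    finally show "?G \<in> elems L2 \<and> nrm L2 ?G \<le> sqrt C * P * sqrt (\<Sum>\<xi>\<in>\<Xi>. \<Sum>x\<in>X. (norm (c x \<xi>))\<^sup>2)"
      using mem by blast
  qed (use C(1) in simp)
qed

text \<open>Duality with \<open>gabor_synthesis_L2\<close>. The sum S of squared coefficients is the
  pairing of g with the combination \<open>?H\<close> whose coefficients are their conjugates. As
  \<open>?H\<close> is the conjugate of a synthesis with window \<open>cnj \<psi>\<close>, its norm
  is at most C P sqrt S, and one factor sqrt S cancels.\<close>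

lemma gabor_analysis_L2:
  fixes \<Lambda>1 \<Lambda>2 :: "'a::euclidean_space set"
  assumes \<Lambda>1: "is_lattice \<Lambda>1" and \<Lambda>2: "is_lattice \<Lambda>2"
  obtains C where "C \<ge> 0"
    "\<And>\<psi> P X \<Xi> g. \<psi> \<in> borel_measurable borel \<Longrightarrow> (\<And>\<eta>. norm (\<psi> \<eta>) \<le> P) \<Longrightarrow> (\<And>\<eta>. \<psi> \<eta> \<noteq> 0 \<Longrightarrow> norm \<eta> \<le> R) \<Longrightarrow>
      finite X \<Longrightarrow> X \<subseteq> \<Lambda>1 \<Longrightarrow> finite \<Xi> \<Longrightarrow> \<Xi> \<subseteq> \<Lambda>2 \<Longrightarrow> g \<in> elems L2 \<Longrightarrow>
      (\<forall>x\<in>X. \<forall>\<xi>\<in>\<Xi>. integrable lebesgue (\<lambda>\<eta>. g \<eta> * (\<psi> (\<eta> - \<xi>) * cis (2 * pi * (x \<bullet> (\<eta> - \<xi>)))))) \<and>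
      sqrt (\<Sum>\<xi>\<in>\<Xi>. \<Sum>x\<in>X. (norm (\<integral>\<eta>. g \<eta> * (\<psi> (\<eta> - \<xi>) * cis (2 * pi * (x \<bullet> (\<eta> - \<xi>)))) \<partial>lebesgue))\<^sup>2) \<le> C * P * nrm L2 g"
proof -
  obtain C where C: "C \<ge> 0"
    "\<And>\<psi> P X \<Xi> c. \<psi> \<in> borel_measurable borel \<Longrightarrow> (\<And>\<eta>. norm (\<psi> \<eta>) \<le> P) \<Longrightarrow> (\<And>\<eta>. \<psi> \<eta> \<noteq> 0 \<Longrightarrow> norm \<eta> \<le> R) \<Longrightarrow>
      finite X \<Longrightarrow> X \<subseteq> \<Lambda>1 \<Longrightarrow> finite \<Xi> \<Longrightarrow> \<Xi> \<subseteq> \<Lambda>2 \<Longrightarrow>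
      (\<lambda>\<eta>. \<Sum>\<xi>\<in>\<Xi>. \<Sum>x\<in>X. c x \<xi> * (\<psi> (\<eta> - \<xi>) * cis (- 2 * pi * (x \<bullet> (\<eta> - \<xi>))))) \<in> elems L2 \<and>
      nrm L2 (\<lambda>\<eta>. \<Sum>\<xi>\<in>\<Xi>. \<Sum>x\<in>X. c x \<xi> * (\<psi> (\<eta> - \<xi>) * cis (- 2 * pi * (x \<bullet> (\<eta> - \<xi>)))))
        \<le> C * P * sqrt (\<Sum>\<xi>\<in>\<Xi>. \<Sum>x\<in>X. (norm (c x \<xi>))\<^sup>2)"
    using gabor_synthesis_L2[OF assms, of R] by blast
  show thesis
  proof (rule that[OF C(1)])
    fix \<psi> g :: "'a \<Rightarrow> complex" and P X \<Xi>
    assume a: "\<psi> \<in> borel_measurable borel" "\<And>\<eta>. norm (\<psi> \<eta>) \<le> P" "\<And>\<eta>. \<psi> \<eta> \<noteq> 0 \<Longrightarrow> norm \<eta> \<le> R"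
      "finite X" "X \<subseteq> \<Lambda>1" "finite \<Xi>" "\<Xi> \<subseteq> \<Lambda>2" and g: "g \<in> elems L2"
    note [measurable] = a(1)
    have P0: "P \<ge> 0" using a(2) norm_ge_zero order_trans by blast
    let ?e = "\<lambda>x \<xi> \<eta>. \<psi> (\<eta> - \<xi>) * cis (2 * pi * (x \<bullet> (\<eta> - \<xi>)))"
    have e_L2: "?e x \<xi> \<in> elems L2" for x \<xi>
    proof (rule bounded_compact_support_Lp[OF _ _ _ weight_one, of _ P \<xi> R])
      show "norm (?e x \<xi> \<eta>) \<le> P" for \<eta> using a(2)[of "\<eta> - \<xi>"] by (simp add: norm_mult)
    qed (use a(3) in auto)
    have int: "integrable lebesgue (\<lambda>\<eta>. g \<eta> * ?e x \<xi> \<eta>)" for x \<xi>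
      by (rule Cauchy_Schwarz_L2(1)[OF g e_L2])
    define V where "V x \<xi> = (\<integral>\<eta>. g \<eta> * ?e x \<xi> \<eta> \<partial>lebesgue)" for x \<xi>
    define S where "S = (\<Sum>\<xi>\<in>\<Xi>. \<Sum>x\<in>X. (norm (V x \<xi>))\<^sup>2)"
    let ?G = "\<lambda>\<eta>. \<Sum>\<xi>\<in>\<Xi>. \<Sum>x\<in>X. V x \<xi> * (cnj (\<psi> (\<eta> - \<xi>)) * cis (- 2 * pi * (x \<bullet> (\<eta> - \<xi>))))"
    let ?H = "\<lambda>\<eta>. \<Sum>\<xi>\<in>\<Xi>. \<Sum>x\<in>X. cnj (V x \<xi>) * ?e x \<xi> \<eta>"
    have GH: "?H \<eta> = cnj (?G \<eta>)" for \<eta> by (simp add: cis_cnj)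
    have "?H \<in> elems L2" by (intro Lp_sum Lp_cmult e_L2 weight_one) auto
    have cm: "(\<lambda>\<eta>. cnj (\<psi> \<eta>)) \<in> borel_measurable borel"
      using measurable_compose[OF a(1) borel_measurable_continuous_onI[OF continuous_on_cnj[OF continuous_on_id]]] .
    have "nrm L2 ?H = nrm L2 ?G" unfolding nrm_Lp_eq GH complex_mod_cnj ..
    also have "\<dots> \<le> C * P * sqrt S"
      unfolding S_def using C(2)[OF cm _ _ a(4-7), of P V] a(2,3) by simp
    finally have H: "nrm L2 ?H \<le> C * P * sqrt S" .
    have "of_real S = (\<Sum>\<xi>\<in>\<Xi>. \<Sum>x\<in>X. cnj (V x \<xi>) * (\<integral>\<eta>. g \<eta> * ?e x \<xi> \<eta> \<partial>lebesgue))"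
      unfolding S_def of_real_sum complex_norm_square V_def[symmetric] by (simp only: mult.commute)
    also have "\<dots> = (\<integral>\<eta>. (\<Sum>\<xi>\<in>\<Xi>. \<Sum>x\<in>X. cnj (V x \<xi>) * (g \<eta> * ?e x \<xi> \<eta>)) \<partial>lebesgue)"
    proof -
      have "(\<integral>\<eta>. (\<Sum>\<xi>\<in>\<Xi>. \<Sum>x\<in>X. cnj (V x \<xi>) * (g \<eta> * ?e x \<xi> \<eta>)) \<partial>lebesgue)
        = (\<Sum>\<xi>\<in>\<Xi>. \<integral>\<eta>. (\<Sum>x\<in>X. cnj (V x \<xi>) * (g \<eta> * ?e x \<xi> \<eta>)) \<partial>lebesgue)"
        by (intro Bochner_Integration.integral_sum Bochner_Integration.integrable_sum integrable_mult_right int)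
      also have "\<dots> = (\<Sum>\<xi>\<in>\<Xi>. \<Sum>x\<in>X. \<integral>\<eta>. cnj (V x \<xi>) * (g \<eta> * ?e x \<xi> \<eta>) \<partial>lebesgue)"
        by (intro sum.cong refl Bochner_Integration.integral_sum integrable_mult_right int)
      finally show ?thesis by simp
    qed
    also have "\<dots> = (\<integral>\<eta>. g \<eta> * ?H \<eta> \<partial>lebesgue)"
      by (simp add: sum_distrib_left mult_ac)
    finally have eq: "of_real S = (\<integral>\<eta>. g \<eta> * ?H \<eta> \<partial>lebesgue)" .
    have S0: "S \<ge> 0" unfolding S_def by (intro sum_nonneg) auto
    have "S = norm (of_real S :: complex)" using S0 by simp
    also have "\<dots> \<le> nrm L2 g * nrm L2 ?H" unfolding eq by (rule Cauchy_Schwarz_L2(2)) fact+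
    also have "\<dots> \<le> nrm L2 g * (C * P * sqrt S)" by (intro mult_left_mono H nrm_Lp_nonneg)
    finally have SS: "sqrt S * sqrt S \<le> (C * P * nrm L2 g) * sqrt S" using S0 by (simp add: mult_ac)
    have "sqrt S \<le> C * P * nrm L2 g"
    proof (cases "S = 0")
      case True then show ?thesis using C(1) P0 by (simp add: nrm_Lp_nonneg)
    next
      case False
      then have "sqrt S > 0" using S0 by simp
      then show ?thesis by (rule mult_right_le_imp_le[OF SS])
    qed
    then show "(\<forall>x\<in>X. \<forall>\<xi>\<in>\<Xi>. integrable lebesgue (\<lambda>\<eta>. g \<eta> * ?e x \<xi> \<eta>)) \<and>
      sqrt (\<Sum>\<xi>\<in>\<Xi>. \<Sum>x\<in>X. (norm (\<integral>\<eta>. g \<eta> * ?e x \<xi> \<eta> \<partial>lebesgue))\<^sup>2) \<le> C * P * nrm L2 g"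
      using int unfolding S_def V_def by blast
  qed
qed

section \<open>Integrals of elementary tensors\<close>

lemma complex_borel_version:
  fixes f :: "'a::euclidean_space \<Rightarrow> complex"
  assumes "f \<in> borel_measurable lebesgue"
  obtains f' where "f' \<in> borel_measurable borel" "AE x in lborel. f x = f' x"
proof -
  have "(\<lambda>x. Re (f x)) \<in> borel_measurable lebesgue" "(\<lambda>x. Im (f x)) \<in> borel_measurable lebesgue"
    using assms by auto
  then obtain u v where uv: "u \<in> borel_measurable lborel" "v \<in> borel_measurable lborel"
    "AE x in lborel. Re (f x) = u x" "AE x in lborel. Im (f x) = v x"
    using completion_ex_borel_measurable_real[of "\<lambda>x. Re (f x)" lborel]
      completion_ex_borel_measurable_real[of "\<lambda>x. Im (f x)" lborel] by blast
  note [measurable] = uv(1,2)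
  show thesis
  proof (rule that)
    show "(\<lambda>x. of_real (u x) + \<i> * of_real (v x)) \<in> borel_measurable borel" using uv(1,2) by simp
    show "AE x in lborel. f x = of_real (u x) + \<i> * of_real (v x)"
      using uv(3,4) by eventually_elim (simp add: complex_eq_iff)
  qed
qed

lemma AE_lborel_fst_snd:
  fixes P :: "'a::euclidean_space \<Rightarrow> bool" and Q :: "'b::euclidean_space \<Rightarrow> bool"
  assumes "AE x in lborel. P x" "AE y in lborel. Q y"
  shows "AE z in (lborel :: ('a \<times> 'b) measure). P (fst z) \<and> Q (snd z)"
proof -
  obtain M where M: "{x. \<not> P x} \<subseteq> M" "M \<in> null_sets lborel" using assms(1) unfolding eventually_ae_filter by auto
  obtain N where N: "{y. \<not> Q y} \<subseteq> N" "N \<in> null_sets lborel" using assms(2) unfolding eventually_ae_filter by auto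
  have "M \<times> UNIV \<in> null_sets (lborel \<Otimes>\<^sub>M (lborel :: 'b measure))"
    using M(2) by (intro lborel.times_in_null_sets1) auto
  moreover have "UNIV \<times> N \<in> null_sets ((lborel :: 'a measure) \<Otimes>\<^sub>M lborel)"
    using N(2) by (intro lborel.times_in_null_sets2) auto
  ultimately have "AE z in (lborel :: ('a \<times> 'b) measure). z \<notin> M \<times> UNIV \<and> z \<notin> UNIV \<times> N"
    unfolding lborel_prod by (auto intro: AE_not_in)
  then show ?thesis by eventually_elim (use M N in auto)
qed

lemma integral_lebesgue_cong_AE:
  fixes f g :: "'a::euclidean_space \<Rightarrow> complex"
  assumes "g \<in> borel_measurable lebesgue" "AE x in lebesgue. f x = g x"
  shows "integral\<^sup>L lebesgue f = integral\<^sup>L lebesgue g"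
proof (rule integral_cong_AE)
  show "f \<in> borel_measurable lebesgue"
    by (rule borel_measurable_AE[OF assms(1)]) (use assms(2) in \<open>auto elim: eventually_mono\<close>)
qed (use assms in auto)

text \<open>The Lebesgue measure of the product is the completion of a product measure and not
  itself one. Fubini is therefore applied to Borel versions of a and b, and the exceptional null
  sets are carried to the product.\<close>

lemma integral_tensor:
  fixes a :: "'a::euclidean_space \<Rightarrow> complex" and b :: "'b::euclidean_space \<Rightarrow> complex"
  assumes a: "integrable lebesgue a" and b: "integrable lebesgue b"
  shows "integrable lebesgue (\<lambda>z. a (fst z) * b (snd z))"
    and "(\<integral>z. a (fst z) * b (snd z) \<partial>lebesgue) = integral\<^sup>L lebesgue a * integral\<^sup>L lebesgue b"
proof -
  obtain a' where a' [measurable]: "a' \<in> borel_measurable borel" and aa: "AE x in lborel. a x = a' x"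
    using complex_borel_version borel_measurable_integrable[OF a] by blast
  obtain b' where b' [measurable]: "b' \<in> borel_measurable borel" and bb: "AE x in lborel. b x = b' x"
    using complex_borel_version borel_measurable_integrable[OF b] by blast
  have a'L: "a' \<in> borel_measurable lebesgue" "b' \<in> borel_measurable lebesgue"
    using a' b' by (auto intro: measurable_completion)
  have ia: "integral\<^sup>L lebesgue a = integral\<^sup>L lborel a'"
    using integral_lebesgue_cong_AE[OF a'L(1) AE_completion[OF aa]] a' by (simp add: integral_completion)
  have ib: "integral\<^sup>L lebesgue b = integral\<^sup>L lborel b'"
    using integral_lebesgue_cong_AE[OF a'L(2) AE_completion[OF bb]] b' by (simp add: integral_completion)
  have "integrable lebesgue a'"
    using integrable_cong_AE_imp[OF a a'L(1)] AE_completion[OF aa] by (auto elim: eventually_mono)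
  then have inta: "integrable lborel a'" using a' by (simp add: integrable_completion)
  have "integrable lebesgue b'"
    using integrable_cong_AE_imp[OF b a'L(2)] AE_completion[OF bb] by (auto elim: eventually_mono)
  then have intb: "integrable lborel b'" using b' by (simp add: integrable_completion)
  let ?h = "\<lambda>z. a' (fst z) * b' (snd z)"
  have hm [measurable]: "?h \<in> borel_measurable (borel :: ('a \<times> 'b) measure)"
    unfolding borel_prod[symmetric] by measurable
  have hint: "integrable (lborel \<Otimes>\<^sub>M lborel) (\<lambda>(x, y). a' x * b' y)"
  proof (rule lborel_pair.Fubini_integrable)
    show "(\<lambda>(x, y). a' x * b' y) \<in> borel_measurable (lborel \<Otimes>\<^sub>M lborel)" by measurable
    show "integrable lborel (\<lambda>x. \<integral>y. norm (case (x, y) of (x, y) \<Rightarrow> a' x * b' y) \<partial>lborel)"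
      using inta by (simp add: norm_mult)
    show "AE x in lborel. integrable lborel (\<lambda>y. case (x, y) of (x, y) \<Rightarrow> a' x * b' y)"
      using intb by (intro AE_I2) auto
  qed
  then have hint': "integrable lborel ?h" by (simp add: lborel_prod case_prod_beta')
  have "AE z in lborel. a (fst z) * b (snd z) = ?h z"
    using AE_lborel_fst_snd[OF aa bb] by eventually_elim auto
  then have ae: "AE z in lebesgue. a (fst z) * b (snd z) = ?h z" by (rule AE_completion)
  have hL: "?h \<in> borel_measurable lebesgue" using hm by (auto intro: measurable_completion)
  have mL: "(\<lambda>z. a (fst z) * b (snd z)) \<in> borel_measurable lebesgue"
    by (rule borel_measurable_AE[OF hL]) (use ae in \<open>auto elim: eventually_mono\<close>)
  have "integrable lebesgue ?h" using hint' hm by (simp add: integrable_completion)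
  then show "integrable lebesgue (\<lambda>z. a (fst z) * b (snd z))"
    by (rule integrable_cong_AE_imp) (use mL ae in \<open>auto elim: eventually_mono\<close>)
  have "(\<integral>z. a (fst z) * b (snd z) \<partial>lebesgue) = integral\<^sup>L lborel ?h"
    using integral_lebesgue_cong_AE[OF hL ae] hm by (simp add: integral_completion)
  also have "\<dots> = (\<integral>(x, y). a' x * b' y \<partial>(lborel \<Otimes>\<^sub>M lborel))" by (simp add: lborel_prod case_prod_beta')
  also have "\<dots> = (\<integral>x. (\<integral>y. a' x * b' y \<partial>lborel) \<partial>lborel)"
    using lborel_pair.integral_fst'[OF hint] by simp
  also have "\<dots> = integral\<^sup>L lborel a' * integral\<^sup>L lborel b'" by simp
  finally show "(\<integral>z. a (fst z) * b (snd z) \<partial>lebesgue) = integral\<^sup>L lebesgue a * integral\<^sup>L lebesgue b"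
    by (simp add: ia ib)
qed

lemma pairing_tensor:
  assumes rep: "represents_tensor E F r h"
    and int: "\<And>f g. (f, g) \<in> set r \<Longrightarrow> integrable lebesgue (\<lambda>x. f x * \<phi> x)" "\<And>f g. (f, g) \<in> set r \<Longrightarrow> integrable lebesgue (\<lambda>y. g y * \<psi> y)"
  shows "pairing h (\<lambda>z. \<phi> (fst z) * \<psi> (snd z))
    = (\<Sum>(f, g)\<leftarrow>r. (\<integral>x. f x * \<phi> x \<partial>lebesgue) * (\<integral>y. g y * \<psi> y \<partial>lebesgue))"
proof -
  let ?k = "\<lambda>r z. (\<Sum>(f, g)\<leftarrow>r. (f (fst z) * \<phi> (fst z)) * (g (snd z) * \<psi> (snd z)))"
  have k: "integrable lebesgue (?k r) \<and> integral\<^sup>L lebesgue (?k r)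
    = (\<Sum>(f, g)\<leftarrow>r. (\<integral>x. f x * \<phi> x \<partial>lebesgue) * (\<integral>y. g y * \<psi> y \<partial>lebesgue))"
    using int
  proof (induction r)
    case (Cons fg r)
    obtain f g where fg: "fg = (f, g)" by force
    note T = integral_tensor[OF Cons.prems(1)[of f g] Cons.prems(2)[of f g]]
    have IH: "integrable lebesgue (?k r)" "integral\<^sup>L lebesgue (?k r)
      = (\<Sum>(f, g)\<leftarrow>r. (\<integral>x. f x * \<phi> x \<partial>lebesgue) * (\<integral>y. g y * \<psi> y \<partial>lebesgue))"
      using Cons by auto
    show ?case using T IH by (simp add: fg)
  qed auto
  have "pairing h (\<lambda>z. \<phi> (fst z) * \<psi> (snd z)) = integral\<^sup>L lebesgue (?k r)"
    unfolding pairing_def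
  proof (rule integral_lebesgue_cong_AE)
    show "?k r \<in> borel_measurable lebesgue" using k by auto
    have *: "(\<Sum>(f, g)\<leftarrow>r. f (fst z) * g (snd z)) * (\<phi> (fst z) * \<psi> (snd z)) = ?k r z" for z
      by (induction r) (auto simp: algebra_simps)
    show "AE z in lebesgue. h z * (\<phi> (fst z) * \<psi> (snd z)) = ?k r z"
    proof -
      have "AE z in lebesgue. h z = (\<Sum>(f, g)\<leftarrow>r. f (fst z) * g (snd z))"
        using rep by (simp add: represents_tensor_def)
      then show ?thesis by eventually_elim (simp only: *)
    qed
  qed
  then show ?thesis using k by simp
qed

subsection \<open>Tensor norms\<close>

definition tensor_neg :: "(('a \<Rightarrow> complex) \<times> ('b \<Rightarrow> complex)) list \<Rightarrow> (('a \<Rightarrow> complex) \<times> ('b \<Rightarrow> complex)) list" where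
  "tensor_neg r = map (\<lambda>(f, g). (\<lambda>x. (-1) * f x, g)) r"

lemma represents_add:
  assumes "represents_tensor E F r h" "represents_tensor E F s k"
  shows "represents_tensor E F (r @ s) (\<lambda>z. h z + k z)"
  using assms unfolding represents_tensor_def by (auto elim: eventually_elim2)

lemma represents_neg:
  assumes "represents_tensor (Lp p w) F s k" "poly_bounded_weight w"
  shows "represents_tensor (Lp p w) F (tensor_neg s) (\<lambda>z. - k z)"
proof -
  have *: "(\<Sum>(f, g)\<leftarrow>tensor_neg s. f x * g y) = - (\<Sum>(f, g)\<leftarrow>s. f x * g y)" for x y
    by (induction s) (auto simp: tensor_neg_def)
  have "set (tensor_neg s) \<subseteq> elems (Lp p w) \<times> elems F"
    using assms Lp_cmult[of _ p w "-1"] by (auto simp: tensor_neg_def represents_tensor_def)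
  then show ?thesis using assms(1) unfolding represents_tensor_def * by (auto elim: eventually_mono)
qed

lemma represents_diff:
  assumes "represents_tensor (Lp p w) F r h" "represents_tensor (Lp p w) F s k" "poly_bounded_weight w"
  shows "represents_tensor (Lp p w) F (r @ tensor_neg s) (\<lambda>z. h z - k z)"
  using represents_add[OF assms(1) represents_neg[OF assms(2,3)]] by simp

text \<open>The interface through which the projective and the injective norm enter the arguments on
  completions. Subadditivity for differences stands in for homogeneity.\<close>

definition tensor_seminorm :: "('a \<Rightarrow> complex) set \<Rightarrow> (('a \<Rightarrow> complex) \<Rightarrow> real) \<Rightarrow> bool" where
  "tensor_seminorm H N \<longleftrightarrow> (\<lambda>_. 0) \<in> H \<and> N (\<lambda>_. 0) \<le> 0 \<and> (\<forall>h\<in>H. N h \<ge> 0) \<and>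
     (\<forall>h\<in>H. \<forall>k\<in>H. (\<lambda>z. h z + k z) \<in> H \<and> N (\<lambda>z. h z + k z) \<le> N h + N k) \<and>
     (\<forall>h\<in>H. \<forall>k\<in>H. (\<lambda>z. h z - k z) \<in> H \<and> N (\<lambda>z. h z - k z) \<le> N h + N k)"

lemma represents_zero: "represents_tensor E F [] (\<lambda>_. 0)"
  by (simp add: represents_tensor_def)

lemma proj_cost_nonneg: "(\<Sum>(f, g)\<leftarrow>r. nrm (Lp p w) f * nrm (Lp q v) g) \<ge> 0"
  by (intro sum_list_nonneg) (auto intro!: mult_nonneg_nonneg nrm_Lp_nonneg)

lemma proj_tensor_norm_le:
  assumes "represents_tensor (Lp p w) (Lp q v) r h"
  shows "proj_tensor_norm (Lp p w) (Lp q v) h \<le> (\<Sum>(f, g)\<leftarrow>r. nrm (Lp p w) f * nrm (Lp q v) g)"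
  unfolding proj_tensor_norm_def
  by (rule cInf_lower) (use assms proj_cost_nonneg in \<open>auto intro!: bdd_belowI[of _ 0]\<close>)

lemma proj_tensor_norm_ge:
  assumes "h \<in> alg_tensor (Lp p w) (Lp q v)"
    and "\<And>r. represents_tensor (Lp p w) (Lp q v) r h \<Longrightarrow> B \<le> (\<Sum>(f, g)\<leftarrow>r. nrm (Lp p w) f * nrm (Lp q v) g)"
  shows "B \<le> proj_tensor_norm (Lp p w) (Lp q v) h"
  unfolding proj_tensor_norm_def
  by (rule cInf_greatest) (use assms in \<open>auto simp: alg_tensor_def\<close>)

lemma proj_tensor_seminorm:
  assumes w: "poly_bounded_weight w" and p: "p > 0"
  shows "tensor_seminorm (alg_tensor (Lp p w) (Lp q v)) (proj_tensor_norm (Lp p w) (Lp q v))"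
  unfolding tensor_seminorm_def
proof (intro conjI ballI)
  let ?N = "proj_tensor_norm (Lp p w) (Lp q v)" and ?H = "alg_tensor (Lp p w) (Lp q v)"
  let ?c = "\<lambda>r. \<Sum>(f, g)\<leftarrow>r. nrm (Lp p w) f * nrm (Lp q v) g"
  show "(\<lambda>_. 0) \<in> ?H" using represents_zero by (auto simp: alg_tensor_def)
  show "?N (\<lambda>_. 0) \<le> 0" using proj_tensor_norm_le[OF represents_zero] by simp
  show "?N h \<ge> 0" if "h \<in> ?H" for h by (rule proj_tensor_norm_ge[OF that proj_cost_nonneg])
  fix h k assume h: "h \<in> ?H" and k: "k \<in> ?H"
  show "(\<lambda>z. h z + k z) \<in> ?H" using h k represents_add unfolding alg_tensor_def by blast
  show "(\<lambda>z. h z - k z) \<in> ?H" using h k represents_diff w unfolding alg_tensor_def by blast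
  have neg: "?c (tensor_neg r) = ?c r" for r
    by (induction r) (auto simp: tensor_neg_def nrm_Lp_cmult[OF w p, of "-1", simplified])
  \<comment> \<open>The two infima are taken one after the other, each time with all remaining terms
    moved to the left.\<close>
  have "?N (\<lambda>z. h z + k z) - ?N k \<le> ?N h"
  proof (rule proj_tensor_norm_ge[OF h])
    fix r assume r: "represents_tensor (Lp p w) (Lp q v) r h"
    have "?N (\<lambda>z. h z + k z) - ?c r \<le> ?N k"
    proof (rule proj_tensor_norm_ge[OF k])
      fix s assume "represents_tensor (Lp p w) (Lp q v) s k"
      from proj_tensor_norm_le[OF represents_add[OF r this]] show "?N (\<lambda>z. h z + k z) - ?c r \<le> ?c s" by simp
    qed
    then show "?N (\<lambda>z. h z + k z) - ?N k \<le> ?c r" by simp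
  qed
  then show "?N (\<lambda>z. h z + k z) \<le> ?N h + ?N k" by simp
  have "?N (\<lambda>z. h z - k z) - ?N k \<le> ?N h"
  proof (rule proj_tensor_norm_ge[OF h])
    fix r assume r: "represents_tensor (Lp p w) (Lp q v) r h"
    have "?N (\<lambda>z. h z - k z) - ?c r \<le> ?N k"
    proof (rule proj_tensor_norm_ge[OF k])
      fix s assume "represents_tensor (Lp p w) (Lp q v) s k"
      from proj_tensor_norm_le[OF represents_diff[OF r this w]] show "?N (\<lambda>z. h z - k z) - ?c r \<le> ?c s"
        by (simp add: neg)
    qed
    then show "?N (\<lambda>z. h z - k z) - ?N k \<le> ?c r" by simp
  qed
  then show "?N (\<lambda>z. h z - k z) \<le> ?N h + ?N k" by simp
qed

section \<open>Functionals and the injective norm\<close>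

lemma dual_ballD:
  assumes "l \<in> dual_ball E"
  shows "f \<in> elems E \<Longrightarrow> g \<in> elems E \<Longrightarrow> l (\<lambda>x. f x + g x) = l f + l g"
    "f \<in> elems E \<Longrightarrow> l (\<lambda>x. a * f x) = a * l f"
    "f \<in> elems E \<Longrightarrow> norm (l f) \<le> nrm E f"
  using assms by (auto simp: dual_ball_def)

lemma dual_ball_list:
  assumes l: "l \<in> dual_ball (Lp p w)" and w: "poly_bounded_weight w" and p: "p \<ge> 1"
    and "\<And>i. i \<in> set is \<Longrightarrow> f i \<in> elems (Lp p w)"
  shows "(\<lambda>x. \<Sum>i\<leftarrow>is. a i * f i x) \<in> elems (Lp p w)"
    "l (\<lambda>x. \<Sum>i\<leftarrow>is. a i * f i x) = (\<Sum>i\<leftarrow>is. a i * l (f i))"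
proof -
  have add: "l (\<lambda>x. f x + g x) = l f + l g" if "f \<in> elems (Lp p w)" "g \<in> elems (Lp p w)" for f g
    using l that by (simp add: dual_ball_def)
  have mul: "l (\<lambda>x. a * f x) = a * l f" if "f \<in> elems (Lp p w)" for a f
    using l that by (simp add: dual_ball_def)
  have z: "l (\<lambda>_. 0) = 0" using mul[OF Lp_zero(1), of 0] by simp
  have "(\<lambda>x. \<Sum>i\<leftarrow>is. a i * f i x) \<in> elems (Lp p w) \<and> l (\<lambda>x. \<Sum>i\<leftarrow>is. a i * f i x) = (\<Sum>i\<leftarrow>is. a i * l (f i))"
    using assms(4)
  proof (induction "is")
    case Nil then show ?case using z Lp_zero by simp
  next
    case (Cons i "is")
    have fi: "(\<lambda>x. a i * f i x) \<in> elems (Lp p w)" using Cons by (intro Lp_cmult w) auto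
    then show ?case using Cons add[OF fi] mul Lp_add[OF fi _ w p] by simp
  qed
  then show "(\<lambda>x. \<Sum>i\<leftarrow>is. a i * f i x) \<in> elems (Lp p w)"
    "l (\<lambda>x. \<Sum>i\<leftarrow>is. a i * f i x) = (\<Sum>i\<leftarrow>is. a i * l (f i))" by auto
qed

text \<open>A functional bounded by the seminorm kills functions of seminorm 0, in particular the
  difference of f and g. This is what makes unidentified functions harmless.\<close>

lemma dual_ball_cong_AE:
  assumes l: "l \<in> dual_ball (Lp p w)" and w: "poly_bounded_weight w" and p: "p \<ge> 1"
    and f: "f \<in> elems (Lp p w)" and g: "g \<in> elems (Lp p w)" and ae: "AE x in lebesgue. f x = g x"
  shows "l f = l g"
proof -
  have mg: "(\<lambda>x. (-1) * g x) \<in> elems (Lp p w)" by (rule Lp_cmult[OF g w])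
  have d: "(\<lambda>x. f x + (-1) * g x) \<in> elems (Lp p w)" by (rule Lp_add[OF f mg w p])
  have "nrm (Lp p w) (\<lambda>x. f x + (-1) * g x) = nrm (Lp p w) (\<lambda>_. 0)"
    by (rule nrm_Lp_cong_AE[OF _ d Lp_zero(1)]) (use ae in \<open>auto elim: eventually_mono\<close>)
  moreover have "norm (l (\<lambda>x. f x + (-1) * g x)) \<le> nrm (Lp p w) (\<lambda>x. f x + (-1) * g x)"
    by (rule dual_ballD(3)[OF l d])
  moreover have "l (\<lambda>x. f x + (-1) * g x) = l f + l (\<lambda>x. (-1) * g x)"
    by (rule dual_ballD(1)[OF l f mg])
  moreover have "l (\<lambda>x. (-1) * g x) = (-1) * l g"
    by (rule dual_ballD(2)[OF l g])
  ultimately show ?thesis by (simp add: Lp_zero)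
qed

text \<open>For almost every x the slices of the two representations agree almost everywhere in the
  second variable, so m takes equal values on them. The resulting functions of x agree almost
  everywhere, and l finishes the argument.\<close>

lemma inj_value_unique:
  assumes w: "poly_bounded_weight w" "poly_bounded_weight v" and p: "p \<ge> 1" "q \<ge> 1"
    and l: "l \<in> dual_ball (Lp p w)" and m: "m \<in> dual_ball (Lp q v)"
    and r: "represents_tensor (Lp p w) (Lp q v) r h" and s: "represents_tensor (Lp p w) (Lp q v) s h"
  shows "(\<Sum>(f, g)\<leftarrow>r. l f * m g) = (\<Sum>(f, g)\<leftarrow>s. l f * m g)"
proof -
  let ?S = "\<lambda>r x y. \<Sum>i\<leftarrow>r. fst i x * snd i y"
  have mem: "fst i \<in> elems (Lp p w)" "snd i \<in> elems (Lp q v)" if "i \<in> set r \<or> i \<in> set s" for i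
    using that r s by (auto simp: represents_tensor_def)
  have "AE z in lebesgue. ?S r (fst z) (snd z) = ?S s (fst z) (snd z)"
    using r s unfolding represents_tensor_def case_prod_beta by (auto elim: eventually_elim2)
  then have "AE z in (lborel \<Otimes>\<^sub>M lborel). ?S r (fst z) (snd z) = ?S s (fst z) (snd z)"
    unfolding lborel_prod AE_completion_iff .
  from lborel_pair.AE_pair[OF this]
  have "AE x in lborel. AE y in lborel. ?S r x y = ?S s x y" by simp
  then have "AE x in lborel. (\<Sum>i\<leftarrow>r. m (snd i) * fst i x) = (\<Sum>i\<leftarrow>s. m (snd i) * fst i x)"
  proof eventually_elim
    case (elim x)
    have "m (\<lambda>y. ?S r x y) = m (\<lambda>y. ?S s x y)"
      by (rule dual_ball_cong_AE[OF m w(2) p(2)])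
        (use mem AE_completion[OF elim] in \<open>auto intro!: dual_ball_list(1)[OF m w(2) p(2)]\<close>)
    then show ?case
      by (subst (asm) (1 2) dual_ball_list(2)[OF m w(2) p(2)]) (use mem in \<open>auto simp: mult.commute\<close>)
  qed
  then have "l (\<lambda>x. \<Sum>i\<leftarrow>r. m (snd i) * fst i x) = l (\<lambda>x. \<Sum>i\<leftarrow>s. m (snd i) * fst i x)"
    using mem by (intro dual_ball_cong_AE[OF l w(1) p(1)] dual_ball_list(1)[OF l w(1) p(1)] AE_completion) auto
  then show ?thesis
    by (subst (asm) (1 2) dual_ball_list(2)[OF l w(1) p(1)]) (use mem in \<open>auto simp: mult.commute case_prod_unfold\<close>)
qed

lemma dual_ball_zero: "(\<lambda>_. 0) \<in> dual_ball (Lp p w)"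
  by (simp add: dual_ball_def nrm_Lp_nonneg)

lemma inj_value_le_cost:
  assumes l: "l \<in> dual_ball (Lp p w)" and m: "m \<in> dual_ball (Lp q v)" and "set r \<subseteq> elems (Lp p w) \<times> elems (Lp q v)"
  shows "norm (\<Sum>(f, g)\<leftarrow>r. l f * m g) \<le> (\<Sum>(f, g)\<leftarrow>r. nrm (Lp p w) f * nrm (Lp q v) g)"
  using assms(3)
proof (induction r)
  case (Cons fg r)
  obtain f g where fg: "fg = (f, g)" by force
  have "norm (l f) \<le> nrm (Lp p w) f" "norm (m g) \<le> nrm (Lp q v) g"
    using l m Cons.prems by (auto simp: dual_ball_def fg)
  then have "norm (l f * m g) \<le> nrm (Lp p w) f * nrm (Lp q v) g"
    unfolding norm_mult by (intro mult_mono nrm_Lp_nonneg) auto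
  then show ?case using Cons norm_triangle_ineq[of "l f * m g" "\<Sum>(f, g)\<leftarrow>r. l f * m g"] by (simp add: fg)
qed auto

text \<open>By \<open>inj_value_unique\<close> it is enough to estimate the values of a single
  representation.\<close>

lemma inj_tensor_norm_le:
  assumes w: "poly_bounded_weight w" "poly_bounded_weight v" and p: "p \<ge> 1" "q \<ge> 1"
    and r: "represents_tensor (Lp p w) (Lp q v) r h"
    and B: "\<And>l m. l \<in> dual_ball (Lp p w) \<Longrightarrow> m \<in> dual_ball (Lp q v) \<Longrightarrow> norm (\<Sum>(f, g)\<leftarrow>r. l f * m g) \<le> B"
  shows "inj_tensor_norm (Lp p w) (Lp q v) h \<le> B"
  unfolding inj_tensor_norm_def
proof (rule cSup_least)
  show "{norm (\<Sum>(f, g)\<leftarrow>r. l f * m g) | r l m.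
    represents_tensor (Lp p w) (Lp q v) r h \<and> l \<in> dual_ball (Lp p w) \<and> m \<in> dual_ball (Lp q v)} \<noteq> {}"
    by (rule ex_in_conv[THEN iffD1], intro exI CollectI conjI, rule refl, rule r, (rule dual_ball_zero)+)
next
  fix y assume "y \<in> {norm (\<Sum>(f, g)\<leftarrow>r. l f * m g) | r l m.
    represents_tensor (Lp p w) (Lp q v) r h \<and> l \<in> dual_ball (Lp p w) \<and> m \<in> dual_ball (Lp q v)}"
  then obtain r' l m where y: "y = norm (\<Sum>(f, g)\<leftarrow>r'. l f * m g)" "represents_tensor (Lp p w) (Lp q v) r' h"
    and lm: "l \<in> dual_ball (Lp p w)" "m \<in> dual_ball (Lp q v)" by blast
  show "y \<le> B" unfolding y(1) inj_value_unique[OF w p lm y(2) r] by (rule B[OF lm])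
qed

text \<open>The real-valued supremum is an upper bound only if the set is bounded; the projective
  cost of the one representation r bounds it.\<close>

lemma inj_tensor_norm_ge:
  assumes w: "poly_bounded_weight w" "poly_bounded_weight v" and p: "p \<ge> 1" "q \<ge> 1"
    and r: "represents_tensor (Lp p w) (Lp q v) r h"
    and l: "l \<in> dual_ball (Lp p w)" and m: "m \<in> dual_ball (Lp q v)"
  shows "norm (\<Sum>(f, g)\<leftarrow>r. l f * m g) \<le> inj_tensor_norm (Lp p w) (Lp q v) h"
  unfolding inj_tensor_norm_def
proof (rule cSup_upper)
  show "bdd_above {norm (\<Sum>(f, g)\<leftarrow>r. l f * m g) | r l m.
    represents_tensor (Lp p w) (Lp q v) r h \<and> l \<in> dual_ball (Lp p w) \<and> m \<in> dual_ball (Lp q v)}"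
  proof (rule bdd_aboveI, safe)
    fix r' l m assume a: "represents_tensor (Lp p w) (Lp q v) r' h" "l \<in> dual_ball (Lp p w)" "m \<in> dual_ball (Lp q v)"
    show "norm (\<Sum>(f, g)\<leftarrow>r'. l f * m g) \<le> (\<Sum>(f, g)\<leftarrow>r. nrm (Lp p w) f * nrm (Lp q v) g)"
      unfolding inj_value_unique[OF w p a(2,3,1) r]
      by (rule inj_value_le_cost[OF a(2,3)]) (use r in \<open>auto simp: represents_tensor_def\<close>)
  qed
  show "norm (\<Sum>(f, g)\<leftarrow>r. l f * m g) \<in> {norm (\<Sum>(f, g)\<leftarrow>r. l f * m g) | r l m.
    represents_tensor (Lp p w) (Lp q v) r h \<and> l \<in> dual_ball (Lp p w) \<and> m \<in> dual_ball (Lp q v)}"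
    by (intro CollectI exI conjI, rule refl, rule r, rule l, rule m)
qed

lemma inj_tensor_seminorm:
  assumes w: "poly_bounded_weight w" "poly_bounded_weight v" and p: "p \<ge> 1" "q \<ge> 1"
  shows "tensor_seminorm (alg_tensor (Lp p w) (Lp q v)) (inj_tensor_norm (Lp p w) (Lp q v))"
  unfolding tensor_seminorm_def
proof (intro conjI ballI)
  let ?N = "inj_tensor_norm (Lp p w) (Lp q v)" and ?H = "alg_tensor (Lp p w) (Lp q v)"
  note le = inj_tensor_norm_le[OF w p] and ge = inj_tensor_norm_ge[OF w p]
  show "(\<lambda>_. 0) \<in> ?H" using represents_zero by (auto simp: alg_tensor_def)
  show "?N (\<lambda>_. 0) \<le> 0" by (rule le[OF represents_zero]) simp
  show "?N h \<ge> 0" if "h \<in> ?H" for h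
  proof -
    obtain r where "represents_tensor (Lp p w) (Lp q v) r h" using \<open>h \<in> ?H\<close> by (auto simp: alg_tensor_def)
    from order_trans[OF norm_ge_zero ge[OF this dual_ball_zero dual_ball_zero]] show ?thesis .
  qed
  fix h k assume h: "h \<in> ?H" and k: "k \<in> ?H"
  show "(\<lambda>z. h z + k z) \<in> ?H" using h k represents_add unfolding alg_tensor_def by blast
  show "(\<lambda>z. h z - k z) \<in> ?H" using h k represents_diff w unfolding alg_tensor_def by blast
  obtain r s where r: "represents_tensor (Lp p w) (Lp q v) r h" and s: "represents_tensor (Lp p w) (Lp q v) s k"
    using h k by (auto simp: alg_tensor_def)
  show "?N (\<lambda>z. h z + k z) \<le> ?N h + ?N k"
  proof (rule le[OF represents_add[OF r s]])
    fix l m assume lm: "l \<in> dual_ball (Lp p w)" "m \<in> dual_ball (Lp q v)"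
    show "norm (\<Sum>(f, g)\<leftarrow>r @ s. l f * m g) \<le> ?N h + ?N k"
      using norm_triangle_mono[OF ge[OF r lm] ge[OF s lm]] by simp
  qed
  show "?N (\<lambda>z. h z - k z) \<le> ?N h + ?N k"
  proof (rule le[OF represents_diff[OF r s w(1)]])
    fix l m assume lm: "l \<in> dual_ball (Lp p w)" "m \<in> dual_ball (Lp q v)"
    have "l (\<lambda>x. (-1) * f x) = (-1) * l f" if "f \<in> elems (Lp p w)" for f
      by (rule dual_ballD(2)[OF lm(1) that])
    moreover have "set s \<subseteq> elems (Lp p w) \<times> elems (Lp q v)" using s by (simp add: represents_tensor_def)
    ultimately have "(\<Sum>(f, g)\<leftarrow>tensor_neg s. l f * m g) = - (\<Sum>(f, g)\<leftarrow>s. l f * m g)"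
      by (induction s) (auto simp: tensor_neg_def)
    then show "norm (\<Sum>(f, g)\<leftarrow>r @ tensor_neg s. l f * m g) \<le> ?N h + ?N k"
      using norm_triangle_mono[OF ge[OF r lm], of "- (\<Sum>(f, g)\<leftarrow>s. l f * m g)" "?N k"] ge[OF s lm] by simp
  qed
qed

section \<open>The norm of the completion\<close>

lemma tensor_seminormD:
  assumes "tensor_seminorm H N"
  shows "(\<lambda>_. 0) \<in> H" "N (\<lambda>_. 0) \<le> 0" "h \<in> H \<Longrightarrow> N h \<ge> 0"
    "h \<in> H \<Longrightarrow> k \<in> H \<Longrightarrow> (\<lambda>z. h z + k z) \<in> H" "h \<in> H \<Longrightarrow> k \<in> H \<Longrightarrow> N (\<lambda>z. h z + k z) \<le> N h + N k"
    "h \<in> H \<Longrightarrow> k \<in> H \<Longrightarrow> (\<lambda>z. h z - k z) \<in> H" "h \<in> H \<Longrightarrow> k \<in> H \<Longrightarrow> N (\<lambda>z. h z - k z) \<le> N h + N k"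
  using assms by (auto simp: tensor_seminorm_def)

lemma seminorm_abs_diff:
  assumes "tensor_seminorm H N" "h \<in> H" "k \<in> H"
  shows "\<bar>N h - N k\<bar> \<le> N (\<lambda>z. h z - k z)"
proof -
  have d: "(\<lambda>z. h z - k z) \<in> H" using assms by (auto simp: tensor_seminorm_def)
  have "N (\<lambda>z. (h z - k z) + k z) \<le> N (\<lambda>z. h z - k z) + N k"
    by (rule tensor_seminormD(5)[OF assms(1) d assms(3)])
  moreover have "N (\<lambda>z. h z - (h z - k z)) \<le> N h + N (\<lambda>z. h z - k z)"
    by (rule tensor_seminormD(7)[OF assms(1,2) d])
  ultimately show ?thesis by simp
qed

text \<open>Norms along a Cauchy sequence converge, so the infimum defining the norm of the
  completion is never taken over the empty set.\<close>

lemma approximates_norm_convergent: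
  assumes "tensor_seminorm H N" "approximates H N h u"
  shows "convergent (\<lambda>k. N (h k))"
proof -
  have "Cauchy (\<lambda>k. N (h k))"
  proof (rule metric_CauchyI)
    fix e :: real assume "e > 0"
    then obtain M where "\<And>j k. j \<ge> M \<Longrightarrow> k \<ge> M \<Longrightarrow> N (\<lambda>z. h j z - h k z) < e"
      using assms(2) unfolding approximates_def by blast
    moreover have "\<bar>N (h j) - N (h k)\<bar> \<le> N (\<lambda>z. h j z - h k z)" for j k
      by (rule seminorm_abs_diff[OF assms(1)]) (use assms(2) in \<open>auto simp: approximates_def\<close>)
    ultimately show "\<exists>M. \<forall>m\<ge>M. \<forall>n\<ge>M. dist (N (h m)) (N (h n)) < e"
      unfolding dist_real_def by (meson le_less_trans)
  qed
  then show ?thesis by (simp add: Cauchy_convergent_iff)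
qed

lemma completion_norm_le:
  assumes N: "tensor_seminorm H N" and h: "approximates H N h u" and K: "\<And>k. N (h k) \<le> K"
  shows "nrm (completion H N) u \<le> K"
proof -
  obtain L where L: "(\<lambda>k. N (h k)) \<longlonglongrightarrow> L"
    using approximates_norm_convergent[OF N h] by (auto simp: convergent_def)
  have "nrm (completion H N) u \<le> L"
    unfolding completion_def nspace.simps
  proof (rule cInf_lower)
    show "bdd_below {L. \<exists>h. approximates H N h u \<and> (\<lambda>k. N (h k)) \<longlonglongrightarrow> L}"
    proof (rule bdd_belowI[of _ 0], clarify)
      fix L h assume "approximates H N h u" and lim: "(\<lambda>k. N (h k)) \<longlonglongrightarrow> L"
      then have "N (h k) \<ge> 0" for k using N by (simp add: approximates_def tensor_seminorm_def)
      then show "0 \<le> L" by (intro LIMSEQ_le_const[OF lim]) auto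
    qed
  qed (use h L in blast)
  also have "L \<le> K" by (intro LIMSEQ_le_const2[OF L]) (use K in auto)
  finally show ?thesis .
qed

lemma completion_norm_ge:
  assumes N: "tensor_seminorm H N" and u: "u \<in> elems (completion H N)"
    and B: "\<And>h L. approximates H N h u \<Longrightarrow> (\<lambda>k. N (h k)) \<longlonglongrightarrow> L \<Longrightarrow> B \<le> L"
  shows "B \<le> nrm (completion H N) u"
proof -
  obtain h where h: "approximates H N h u" using u by (auto simp: completion_def)
  then obtain L where "(\<lambda>k. N (h k)) \<longlonglongrightarrow> L"
    using approximates_norm_convergent[OF N h] by (auto simp: convergent_def)
  with h show ?thesis
    unfolding completion_def nspace.simps by (intro cInf_greatest) (use B in auto)
qed

subsection \<open>Dyadic tensor decomposition of a smooth function\<close>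

text \<open>The sum over a cube of index vectors, unfolded into one sum per coordinate so that
  telescoping can be done coordinate by coordinate. Coordinates outside the list keep their value in
  m.\<close>

fun grid_sum :: "nat \<Rightarrow> 'a list \<Rightarrow> (('a \<Rightarrow> int) \<Rightarrow> complex) \<Rightarrow> ('a \<Rightarrow> int) \<Rightarrow> complex" where
  "grid_sum L [] F m = F m"
| "grid_sum L (b # bs) F m = (\<Sum>a\<in>{-int L..int L}. grid_sum L bs F (m(b := a)))"

text \<open>The discrete analogue of the mixed derivative of first order in each listed coordinate,
  by backward differences.\<close>

fun mixed_diff :: "'a list \<Rightarrow> (('a \<Rightarrow> int) \<Rightarrow> complex) \<Rightarrow> ('a \<Rightarrow> int) \<Rightarrow> complex" where
  "mixed_diff [] F m = F m"
| "mixed_diff (b # bs) F m = mixed_diff bs (\<lambda>m. F m - F (m(b := m b - 1))) m"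

lemma grid_sum_cong:
  assumes "\<And>k. (\<And>b. b \<notin> set bs \<Longrightarrow> k b = m b) \<Longrightarrow> F k = G k"
  shows "grid_sum L bs F m = grid_sum L bs G m"
  using assms
proof (induction bs arbitrary: m)
  case (Cons b bs)
  have "grid_sum L bs F (m(b := a)) = grid_sum L bs G (m(b := a))" for a
    by (rule Cons.IH) (rule Cons.prems, auto)
  then show ?case by simp
qed simp

lemma grid_sum_cmult: "grid_sum L bs (\<lambda>m. c * F m) m = c * grid_sum L bs F m"
  by (induction bs arbitrary: m) (auto simp: sum_distrib_left)

lemma grid_sum_diff: "grid_sum L bs (\<lambda>m. F m - G m) m = grid_sum L bs F m - grid_sum L bs G m"
  by (induction bs arbitrary: m) (auto simp: sum_subtractf)

text \<open>The lower boundary term is g(-L - 1) = 0. For j outside the range both sides vanish as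
  well: below it the sum is empty, above it the total is g(L) = 0.\<close>

lemma telescope_int:
  fixes g :: "int \<Rightarrow> complex"
  assumes "\<And>a. \<bar>a\<bar> \<ge> int L \<Longrightarrow> g a = 0"
  shows "(\<Sum>a\<in>{-int L..int L}. of_bool (a \<le> j) * (g a - g (a - 1))) = g j"
proof -
  have tel: "(\<Sum>a\<in>{-int L..-int L + int n}. g a - g (a - 1)) = g (-int L + int n)" for n
  proof (induction n)
    case 0 show ?case using assms[of "- int L - 1"] by simp
  next
    case (Suc n)
    have "{-int L..-int L + int (Suc n)} = insert (-int L + int (Suc n)) {-int L..-int L + int n}" by auto
    then show ?case using Suc by (simp add: algebra_simps)
  qed
  have "(\<Sum>a\<in>{-int L..int L}. of_bool (a \<le> j) * (g a - g (a - 1))) = (\<Sum>a\<in>{-int L..min j (int L)}. g a - g (a - 1))"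
    by (rule sum.mono_neutral_cong_right) auto
  also have "\<dots> = g j"
  proof (cases "j < - int L")
    case True then show ?thesis using assms[of j] by simp
  next
    case False
    define n where "n = nat (min j (int L) + int L)"
    have n: "min j (int L) = - int L + int n" using False by (auto simp: n_def)
    show ?thesis
      unfolding n tel unfolding n[symmetric] using assms[of j] assms[of "int L"] by (auto simp: min_def)
  qed
  finally show ?thesis .
qed

text \<open>The discrete fundamental theorem of calculus: the value at j is the sum of the mixed
  differences over the orthant below j. In the induction, vanishing for large indices passes from F
  to its difference \<open>?D\<close>, because b differs from the coordinates still to be
  summed.\<close>

lemma grid_sum_mixed_diff:
  assumes "distinct bs" "\<And>m b. b \<in> set bs \<Longrightarrow> \<bar>m b\<bar> \<ge> int L \<Longrightarrow> F m = 0"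
  shows "grid_sum L bs (\<lambda>m. (\<Prod>b\<in>set bs. of_bool (m b \<le> j b)) * mixed_diff bs F m) m0
    = F (\<lambda>b. if b \<in> set bs then j b else m0 b)"
  using assms
proof (induction bs arbitrary: F m0)
  case (Cons b bs)
  let ?D = "\<lambda>m. F m - F (m(b := m b - 1))"
  let ?J = "\<lambda>m0 c. if c \<in> set bs then j c else m0 c"
  have b: "b \<notin> set bs" "distinct bs" using Cons.prems by auto
  have "grid_sum L bs (\<lambda>m. (\<Prod>c\<in>set (b # bs). of_bool (m c \<le> j c)) * mixed_diff (b # bs) F m) (m0(b := a))
    = of_bool (a \<le> j b) * (F ((?J m0)(b := a)) - F ((?J m0)(b := a - 1)))" for a
  proof -
    have "grid_sum L bs (\<lambda>m. (\<Prod>c\<in>set (b # bs). of_bool (m c \<le> j c)) * mixed_diff (b # bs) F m) (m0(b := a))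
      = grid_sum L bs (\<lambda>m. of_bool (a \<le> j b) * ((\<Prod>c\<in>set bs. of_bool (m c \<le> j c)) * mixed_diff bs ?D m)) (m0(b := a))"
      using b by (intro grid_sum_cong) simp
    also have "\<dots> = of_bool (a \<le> j b) * ?D (?J (m0(b := a)))"
      unfolding grid_sum_cmult
    proof (subst Cons.IH[OF b(2)])
      fix m c assume "c \<in> set bs" "\<bar>m c\<bar> \<ge> int L"
      moreover have "c \<noteq> b" using b \<open>c \<in> set bs\<close> by auto
      ultimately show "?D m = 0" using Cons.prems(2)[of c] by simp
    qed simp
    also have "?J (m0(b := a)) = (?J m0)(b := a)" using b by auto
    finally show ?thesis by (simp add: fun_upd_def[symmetric])
  qed
  then have "grid_sum L (b # bs) (\<lambda>m. (\<Prod>c\<in>set (b # bs). of_bool (m c \<le> j c)) * mixed_diff (b # bs) F m) m0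
    = (\<Sum>a\<in>{-int L..int L}. of_bool (a \<le> j b) * (F ((?J m0)(b := a)) - F ((?J m0)(b := a - 1))))"
    by (simp only: grid_sum.simps)
  also have "\<dots> = F ((?J m0)(b := j b))"
    by (rule telescope_int[where g="\<lambda>a. F ((?J m0)(b := a))"]) (rule Cons.prems(2)[of b], auto)
  also have "(?J m0)(b := j b) = (\<lambda>c. if c \<in> set (b # bs) then j c else m0 c)" by auto
  finally show ?case .
qed simp

lemma mixed_diff_measurable:
  assumes "\<And>m. (\<lambda>\<eta>. F \<eta> m) \<in> borel_measurable M"
  shows "(\<lambda>\<eta>. mixed_diff bs (F \<eta>) m) \<in> borel_measurable M"
  using assms
proof (induction bs arbitrary: F m)
  case (Cons b bs)
  show ?case unfolding mixed_diff.simps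
    by (rule Cons.IH) (intro borel_measurable_diff Cons.prems)
qed simp

lemma mixed_diff_zero: "(\<And>m. F m = 0) \<Longrightarrow> mixed_diff bs F m = 0"
  by (induction bs arbitrary: F m) auto

section \<open>Grids in Euclidean space and tensor costs\<close>

definition grid_point :: "real \<Rightarrow> ('a::euclidean_space \<Rightarrow> int) \<Rightarrow> 'a" where
  "grid_point h m = (\<Sum>b\<in>Basis. (h * real_of_int (m b)) *\<^sub>R b)"

lemma grid_point_inner: "b \<in> Basis \<Longrightarrow> grid_point h m \<bullet> b = h * real_of_int (m b)"
  by (simp add: grid_point_def inner_sum_left_Basis)

lemma grid_point_upd: "b \<in> Basis \<Longrightarrow> grid_point h (m(b := m b - 1)) = grid_point h m - h *\<^sub>R b"
  by (rule euclidean_eqI) (auto simp: grid_point_inner inner_diff_left inner_Basis algebra_simps)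

text \<open>Each difference is traded for h times a partial derivative. Differences commute with the
  remaining partials, so the induction hypothesis applies to the difference g, whose partials are
  already of size h B.\<close>

lemma mixed_diff_bound:
  fixes f :: "'a::euclidean_space \<times> 'a \<Rightarrow> complex"
  assumes "smooth f" "set bs \<subseteq> Basis" "h \<ge> 0" "\<And>z. norm (partials (map (\<lambda>b. (b, 0)) bs) f z) \<le> B"
  shows "norm (mixed_diff bs (\<lambda>m. f (grid_point h m, \<eta>)) m) \<le> h ^ length bs * B"
  using assms
proof (induction bs arbitrary: f B)
  case Nil then show ?case by simp
next
  case (Cons b bs)
  let ?us = "map (\<lambda>b. (b, 0::'a)) bs"
  have b: "b \<in> Basis" "set bs \<subseteq> Basis" using Cons.prems by auto
  have bB: "(b, 0::'a) \<in> Basis" using b by (auto simp: Basis_prod_def)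
  have us: "?us \<in> lists Basis" using b by (auto simp: Basis_prod_def subset_iff)
  \<comment> \<open>The backward difference, written as a linear combination with an affine argument
    so that \<open>partials_lincomb\<close> and \<open>partials_affine\<close> apply.\<close>
  define g where "g = (\<lambda>z. (-1) * f (1 *\<^sub>R z + - h *\<^sub>R (b, 0)) + f z)"
  have sg: "smooth g" unfolding g_def using Cons.prems(1) by (intro smooth_add smooth_mult smooth_const smooth_scale)
  have pf: "smooth (partials ?us f)" by (rule smooth_partials[OF Cons.prems(1) us])
  have "partials ?us g = (\<lambda>z. (-1) * partials ?us (\<lambda>z. f (1 *\<^sub>R z + - h *\<^sub>R (b, 0))) z + partials ?us f z)"
    unfolding g_def by (rule partials_lincomb[OF smooth_scale[OF Cons.prems(1)] Cons.prems(1) us])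
  also have "\<dots> = (\<lambda>z. partials ?us f z - partials ?us f (z + - h *\<^sub>R (b, 0)))"
    unfolding partials_affine[OF Cons.prems(1) us] by simp
  finally have pg: "partials ?us g = (\<lambda>z. partials ?us f z - partials ?us f (z + - h *\<^sub>R (b, 0)))" .
  have "norm (partials ?us g z) \<le> h * B" for z
  proof -
    have "norm (partials ?us f (z + - h *\<^sub>R (b, 0)) - partials ?us f z) \<le> B * \<bar>- h\<bar>"
      by (rule partial_bound_imp_diff_bound[OF pf]) (use Cons.prems(4) in simp)
    then show ?thesis unfolding pg using Cons.prems(3) by (simp add: norm_minus_commute mult.commute)
  qed
  from Cons.IH[OF sg b(2) Cons.prems(3) this]
  have "norm (mixed_diff bs (\<lambda>m. g (grid_point h m, \<eta>)) m) \<le> h ^ length bs * (h * B)" .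
  moreover have "(\<lambda>m. g (grid_point h m, \<eta>)) = (\<lambda>m. f (grid_point h m, \<eta>) - f (grid_point h (m(b := m b - 1)), \<eta>))"
    by (simp add: g_def grid_point_upd[OF b(1)] fun_eq_iff)
  ultimately show ?case by (simp add: mult_ac)
qed

text \<open>\<open>q\<close> bounds the sum of \<open>\<parallel>\<phi>\<parallel>\<^sub>p \<parallel>\<psi>\<parallel>\<^sub>\<infinity>\<close> over the terms of one representation of the function as a
  finite sum of products.\<close>

inductive tensor_cost :: "real \<Rightarrow> real \<Rightarrow> ('a::euclidean_space \<times> 'a \<Rightarrow> complex) \<Rightarrow> real \<Rightarrow> bool" for p R where
  zero: "tensor_cost p R (\<lambda>_. 0) 0"
| step: "tensor_cost p R \<rho> q \<Longrightarrow> \<phi> \<in> borel_measurable borel \<Longrightarrow> (\<And>t. norm (\<phi> t) \<le> 1) \<Longrightarrow> (\<And>t. \<phi> t \<noteq> 0 \<Longrightarrow> norm t \<le> R) \<Longrightarrow>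
    \<psi> \<in> borel_measurable borel \<Longrightarrow> (\<And>\<eta>. norm (\<psi> \<eta>) \<le> P) \<Longrightarrow> (\<And>\<eta>. \<psi> \<eta> \<noteq> 0 \<Longrightarrow> norm \<eta> \<le> R) \<Longrightarrow>
    (\<integral>t. norm (\<phi> t) powr p \<partial>lborel) powr (1 / p) \<le> A \<Longrightarrow>
    tensor_cost p R (\<lambda>z. \<phi> (fst z) * \<psi> (snd z) + \<rho> z) (A * P + q)"

lemma tensor_cost_add: "tensor_cost p R \<rho> q \<Longrightarrow> tensor_cost p R \<sigma> r \<Longrightarrow> tensor_cost p R (\<lambda>z. \<rho> z + \<sigma> z) (q + r)"
proof (induction rule: tensor_cost.induct)
  case (step \<rho> q \<phi> \<psi> P A)
  have "tensor_cost p R (\<lambda>z. \<phi> (fst z) * \<psi> (snd z) + (\<rho> z + \<sigma> z)) (A * P + (q + r))"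
    by (rule tensor_cost.step) (use step in auto)
  then show ?case by (simp add: add.assoc)
qed auto

lemma tensor_cost_sum:
  assumes "finite I" "\<And>i. i \<in> I \<Longrightarrow> tensor_cost p R (\<rho> i) (q i)"
  shows "tensor_cost p R (\<lambda>z. \<Sum>i\<in>I. \<rho> i z) (\<Sum>i\<in>I. q i)"
  using assms by (induction rule: finite_induct) (auto intro: tensor_cost.zero tensor_cost_add)

lemma tensor_cost_grid_sum:
  assumes "\<And>m. tensor_cost p R (\<rho> m) q"
  shows "tensor_cost p R (\<lambda>z. grid_sum L bs (\<lambda>m. \<rho> m z) m) (real (2 * L + 1) ^ length bs * q)"
proof (induction bs arbitrary: m)
  case (Cons b bs)
  have "tensor_cost p R (\<lambda>z. \<Sum>a\<in>{-int L..int L}. grid_sum L bs (\<lambda>m. \<rho> m z) (m(b := a)))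
    (\<Sum>a\<in>{-int L..int L}. real (2 * L + 1) ^ length bs * q)"
    by (rule tensor_cost_sum) (simp, rule Cons.IH)
  moreover have "(\<Sum>a\<in>{-int L..int L}. real (2 * L + 1) ^ length bs * q) = real (2 * L + 1) ^ length (b # bs) * q"
    by simp
  ultimately show ?case by (simp only: grid_sum.simps)
qed (use assms in simp)

lemma tensor_cost_borel: "tensor_cost p R \<rho> q \<Longrightarrow> \<rho> \<in> borel_measurable borel"
proof (induction rule: tensor_cost.induct)
  case (step \<rho> q \<phi> \<psi> P A)
  note [measurable] = step
  have "(\<lambda>z. \<phi> (fst z) * \<psi> (snd z)) \<in> borel_measurable borel"
    unfolding borel_prod[symmetric] by measurable
  then show ?case using step by (intro borel_measurable_add)
qed simp

definition grid_index :: "real \<Rightarrow> 'a::euclidean_space \<Rightarrow> 'a \<Rightarrow> int" where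
  "grid_index h t b = \<lfloor>(t \<bullet> b) / h\<rfloor>"

lemma grid_index_measurable [measurable]: "(\<lambda>t. grid_index h t b) \<in> measurable borel (count_space UNIV)"
  unfolding grid_index_def by measurable

lemma grid_point_grid_index_close:
  fixes t :: "'a::euclidean_space"
  assumes "h > 0"
  shows "norm (grid_point h (grid_index h t) - t) \<le> real DIM('a) * h"
proof -
  have "norm (grid_point h (grid_index h t) - t) \<le> (\<Sum>b\<in>Basis. \<bar>(grid_point h (grid_index h t) - t) \<bullet> b\<bar>)"
    by (rule norm_le_l1)
  also have "\<dots> \<le> (\<Sum>b\<in>(Basis::'a set). h)"
  proof (rule sum_mono)
    fix b :: 'a assume b: "b \<in> Basis"
    have "\<bar>of_int \<lfloor>(t \<bullet> b) / h\<rfloor> - (t \<bullet> b) / h\<bar> \<le> 1" by linarith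
    then have "h * \<bar>of_int \<lfloor>(t \<bullet> b) / h\<rfloor> - (t \<bullet> b) / h\<bar> \<le> h * 1" using assms by (intro mult_left_mono) auto
    also have "h * \<bar>of_int \<lfloor>(t \<bullet> b) / h\<rfloor> - (t \<bullet> b) / h\<bar> = \<bar>h * of_int \<lfloor>(t \<bullet> b) / h\<rfloor> - t \<bullet> b\<bar>"
    proof -
      have "h * of_int \<lfloor>(t \<bullet> b) / h\<rfloor> - t \<bullet> b = h * (of_int \<lfloor>(t \<bullet> b) / h\<rfloor> - (t \<bullet> b) / h)"
        using assms by (simp add: right_diff_distrib)
      then show ?thesis using assms by (simp only: abs_mult abs_of_pos)
    qed
    finally show "\<bar>(grid_point h (grid_index h t) - t) \<bullet> b\<bar> \<le> h"
      by (simp add: inner_diff_left grid_point_inner[OF b] grid_index_def)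
  qed
  finally show ?thesis by simp
qed

text \<open>The variables are separated: j, later the rounded first variable, enters only through
  0-1 factors, and \<eta> only through the mixed differences. The condition h L > R pushes the ends
  of the index range beyond the support.\<close>

lemma grid_representation:
  fixes chi :: "'a::euclidean_space \<times> 'a \<Rightarrow> complex"
  assumes supp: "\<And>z. chi z \<noteq> 0 \<Longrightarrow> norm z \<le> R" and h: "h > 0" "h * real L > R" and bs: "distinct bs" "set bs = Basis"
  shows "chi (grid_point h j, \<eta>) = grid_sum L bs (\<lambda>m. (\<Prod>b\<in>Basis. of_bool (m b \<le> j b)) * mixed_diff bs (\<lambda>m. chi (grid_point h m, \<eta>)) m) (\<lambda>_. 0)"
proof -
  have "grid_sum L bs (\<lambda>m. (\<Prod>b\<in>set bs. of_bool (m b \<le> j b)) * mixed_diff bs (\<lambda>m. chi (grid_point h m, \<eta>)) m) (\<lambda>_. 0)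
    = chi (grid_point h (\<lambda>b. if b \<in> set bs then j b else 0), \<eta>)"
  proof (rule grid_sum_mixed_diff[OF bs(1)])
    fix m b assume b: "b \<in> set bs" "int L \<le> \<bar>m b\<bar>"
    then have "real L \<le> \<bar>real_of_int (m b)\<bar>" by linarith
    then have "h * real L \<le> h * \<bar>real_of_int (m b)\<bar>" using h by (intro mult_left_mono) auto
    then have "R < h * \<bar>real_of_int (m b)\<bar>" using h(2) by linarith
    then have "R < \<bar>grid_point h m \<bullet> b\<bar>" using h b bs by (simp add: grid_point_inner abs_mult)
    also have "\<dots> \<le> norm (grid_point h m)" using b bs by (intro Basis_le_norm) auto
    also have "\<dots> \<le> norm (grid_point h m, \<eta>)" by (metis fst_conv norm_fst_le)
    finally show "chi (grid_point h m, \<eta>) = 0" using supp[of "(grid_point h m, \<eta>)"] by linarith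
  qed
  also have "grid_point h (\<lambda>b. if b \<in> set bs then j b else 0) = grid_point h j"
    unfolding grid_point_def bs(2) by (rule sum.cong) auto
  finally show ?thesis by (simp add: bs(2))
qed

text \<open>Covers, within the box, the points where the step approximations of mesh \<open>h\<close> and \<open>2 h\<close> to the
  indicator of the orthant with vertex \<open>grid_point h m\<close> differ. Its measure is \<open>O(h)\<close>,
  which is what makes the tensor costs summable.\<close>

definition slabs :: "real \<Rightarrow> real \<Rightarrow> ('a::euclidean_space \<Rightarrow> int) \<Rightarrow> 'a set" where
  "slabs r h m = (\<Union>b\<in>Basis. {t\<in>cbox (- r *\<^sub>R One) (r *\<^sub>R One). t \<bullet> b \<in> {of_int (m b) * h..of_int (m b) * h + 2 * h}})"

lemma slab_measure:
  fixes m :: "'a::euclidean_space \<Rightarrow> int"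
  assumes "h > 0" "r > 0"
  shows "slabs r h m \<in> sets borel"
    and "emeasure lborel (slabs r h m) \<le> ennreal (real DIM('a) * (2 * h * (2 * r) ^ (DIM('a) - 1)))"
proof -
  \<comment> \<open>Corners of a box around the b-th slab: its b-th side is the slab interval, the
    others are sides of the cube. It may stick out of the cube, hence only an upper bound for the
    measure.\<close>
  define l where "l b = (\<Sum>c\<in>Basis. (if c = b then of_int (m b) * h else - r) *\<^sub>R c)" for b :: 'a
  define u where "u b = (\<Sum>c\<in>Basis. (if c = b then of_int (m b) * h + 2 * h else r) *\<^sub>R c)" for b :: 'a
  let ?T = "\<lambda>b. {t\<in>cbox (- r *\<^sub>R One) (r *\<^sub>R One). t \<bullet> b \<in> {of_int (m b) * h..of_int (m b) * h + 2 * h}}"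
  have T: "?T b \<in> sets borel" for b :: 'a
  proof -
    have "closed {t::'a. t \<bullet> b \<in> {of_int (m b) * h..of_int (m b) * h + 2 * h}}"
      by (simp add: closed_Collect_conj closed_Collect_le continuous_intros)
    then have "closed (cbox (- r *\<^sub>R One) (r *\<^sub>R One) \<inter> {t::'a. t \<bullet> b \<in> {of_int (m b) * h..of_int (m b) * h + 2 * h}})"
      by (intro closed_Int) auto
    then show ?thesis by (simp add: Collect_conj_eq borel_closed)
  qed
  then show S: "slabs r h m \<in> sets borel" unfolding slabs_def by (intro sets.finite_UN) auto
  have lu: "l b \<bullet> c = (if c = b then of_int (m b) * h else - r)" "u b \<bullet> c = (if c = b then of_int (m b) * h + 2 * h else r)"
    if "c \<in> Basis" for b c using that by (auto simp: l_def u_def inner_sum_left_Basis)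
  have sub: "?T b \<subseteq> cbox (l b) (u b)" if "b \<in> Basis" for b
    using that by (auto simp: mem_box lu)
  have vol: "emeasure lborel (cbox (l b) (u b)) = ennreal (2 * h * (2 * r) ^ (DIM('a) - 1))" if b: "b \<in> Basis" for b
  proof -
    have "emeasure lborel (cbox (l b) (u b)) = ennreal (\<Prod>c\<in>Basis. (u b - l b) \<bullet> c)"
      using assms by (intro emeasure_lborel_cbox) (auto simp: lu)
    also have "(\<Prod>c\<in>Basis. (u b - l b) \<bullet> c) = (\<Prod>c\<in>Basis. if c = b then 2 * h else 2 * r)"
      by (intro prod.cong) (auto simp: inner_diff_left lu)
    also have "\<dots> = 2 * h * (\<Prod>c\<in>Basis - {b}. 2 * r)"
      using b by (subst prod.remove[of _ b]) (auto intro!: prod.cong)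
    finally show ?thesis using b by simp
  qed
  have "emeasure lborel (slabs r h m) \<le> (\<Sum>b\<in>(Basis::'a set). emeasure lborel (?T b))"
    unfolding slabs_def using T by (intro emeasure_subadditive_finite) auto
  also have "\<dots> \<le> (\<Sum>b\<in>(Basis::'a set). emeasure lborel (cbox (l b) (u b)))"
    by (intro sum_mono emeasure_mono sub) auto
  also have "\<dots> = (\<Sum>b\<in>(Basis::'a set). ennreal (2 * h * (2 * r) ^ (DIM('a) - 1)))"
    by (intro sum.cong refl vol)
  also have "\<dots> = ennreal (\<Sum>b\<in>(Basis::'a set). 2 * h * (2 * r) ^ (DIM('a) - 1))"
    using assms by (intro sum_ennreal) auto
  finally show "emeasure lborel (slabs r h m) \<le> ennreal (real DIM('a) * (2 * h * (2 * r) ^ (DIM('a) - 1)))" by simp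
qed

lemma integral_powr_indicator_le:
  fixes \<phi> :: "'a::euclidean_space \<Rightarrow> complex"
  assumes S: "S \<in> sets borel" "emeasure lborel S \<le> ennreal v" "v \<ge> 0" and \<phi>: "\<And>t. norm (\<phi> t) \<le> indicator S t"
    and p: "p > 0" and [measurable]: "\<phi> \<in> borel_measurable borel"
  shows "(\<integral>t. norm (\<phi> t) powr p \<partial>lborel) \<le> v"
proof -
  have fin: "emeasure lborel S < \<infinity>" using S(2) by (simp add: le_less_trans)
  have le: "norm (\<phi> t) powr p \<le> indicator S t" for t
  proof -
    have "norm (\<phi> t) powr p \<le> indicator S t powr p" using p by (intro powr_mono2 \<phi>) auto
    then show ?thesis using \<phi>[of t] p by (cases "t \<in> S") auto
  qed
  have int: "integrable lborel (\<lambda>t. indicator S t :: real)" using S(1) fin by simp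
  have "(\<integral>t. norm (\<phi> t) powr p \<partial>lborel) \<le> (\<integral>t. indicator S t \<partial>lborel)"
    by (intro integral_mono int le integrable_nonneg_bound[OF int]) auto
  also have "\<dots> = measure lborel S" using S(1) by simp
  also have "\<dots> \<le> v" unfolding measure_def using S(2,3) by (intro enn2real_leI) auto
  finally show ?thesis .
qed

text \<open>At mesh h there are about h^(-n) grid terms (n the dimension), each carrying a mixed
  difference of size h^n, so these two effects cancel. What remains is the p-norm of the difference
  of indicators, O(h^(1/p)), which is geometric in k for every finite p. Support and supremum bounds
  hold uniformly in k.\<close>

lemma dyadic_decomposition:
  fixes chi :: "'a::euclidean_space \<times> 'a \<Rightarrow> complex"
  assumes chi: "chi \<in> test_functions U" and p: "p \<ge> 1"
  obtains X q R M where "R > 0" "M \<ge> 0" "tensor_cost p R (X 0) (q 0)"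
    "\<And>k. tensor_cost p R (\<lambda>z. X (Suc k) z - X k z) (q (Suc k))" "summable q" "\<And>k. q k \<ge> 0"
    "\<And>k z. norm (X k z) \<le> M" "\<And>k z. X k z \<noteq> 0 \<Longrightarrow> norm z \<le> R" "\<And>z. (\<lambda>k. X k z) \<longlonglongrightarrow> chi z"
    "\<And>z. chi z \<noteq> 0 \<Longrightarrow> norm z \<le> R"
proof -
  have schi: "smooth chi" using chi by (rule test_functions_smooth)
  have "bounded {x. chi x \<noteq> 0}"
    using chi compact_imp_bounded bounded_subset[OF _ closure_subset] by (auto simp: test_functions_def)
  then obtain R0 where "\<And>z. chi z \<noteq> 0 \<Longrightarrow> norm z \<le> R0" by (auto simp: bounded_iff)
  moreover obtain r :: nat where "real r > max R0 1" using reals_Archimedean2 by blast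
  ultimately have supp: "\<And>z. chi z \<noteq> 0 \<Longrightarrow> norm z \<le> max R0 1" and r: "real r > max R0 1" "real r > 1"
    by (auto simp: le_max_iff_disj)
  have suppr: "norm z \<le> real r" if "chi z \<noteq> 0" for z using supp[OF that] r(1) by linarith
  obtain bs where bs: "set bs = (Basis::'a set)" "distinct bs" using finite_distinct_list[OF finite_Basis] by blast
  have len: "length bs = DIM('a)" using bs distinct_card by fastforce
  let ?us = "map (\<lambda>b. (b, 0::'a)) bs"
  have us: "?us \<in> lists Basis" using bs by (auto simp: Basis_prod_def)
  obtain B where B: "\<And>z. norm (partials ?us chi z) \<le> B"
    using test_functions_partials_bounded[OF chi us, of 0] by auto
  have B0: "B \<ge> 0" using B norm_ge_zero order_trans by blast
  obtain M where M: "\<And>z. norm (chi z) \<le> M"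
    using test_functions_partials_bounded[OF chi, of "[]" 0] by auto
  have M0: "M \<ge> 0" using M norm_ge_zero order_trans by blast
  have bor: "chi \<in> borel_measurable borel" by (rule smooth_borel[OF schi])
  define h where "h k = (1 / 2 ^ k :: real)" for k :: nat
  have h: "h k > 0" "h k \<le> 1" "h (Suc k) = h k / 2" for k by (auto simp: h_def)
  define J where "J k t = grid_index (h k) t" for k and t :: 'a
  \<comment> \<open>Only the first variable is rounded down to the grid; the dependence on the
    second stays exact.\<close>
  define X where "X k z = chi (grid_point (h k) (J k (fst z)), snd z)" for k z
  define n where "n = real DIM('a)"
  have n: "n \<ge> 1" using DIM_positive[where 'a='a] by (simp add: n_def Suc_le_eq)
  \<comment> \<open>Rounding moves t by at most n h \<le> n, so the t-support grows to radius r + n.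
    \<open>R\<close> adds r for the second variable and thus bounds the norm of the pair.\<close>
  define r' where "r' = real r + n"
  define R where "R = 2 * real r + n"
  have Xfst: "norm t \<le> r'" "norm \<eta> \<le> real r" if "X k (t, \<eta>) \<noteq> 0" for k t \<eta>
  proof -
    have le: "norm (grid_point (h k) (J k t), \<eta>) \<le> real r" using suppr that by (auto simp: X_def)
    have "norm (grid_point (h k) (J k t)) \<le> real r" "norm \<eta> \<le> real r"
      using order_trans[OF norm_fst_le le] order_trans[OF norm_snd_le le] by auto
    moreover have "norm (grid_point (h k) (J k t) - t) \<le> n * h k"
      unfolding J_def n_def by (rule grid_point_grid_index_close[OF h(1)])
    moreover have "n * h k \<le> n * 1" using h(2)[of k] n by (intro mult_left_mono) auto
    ultimately show "norm t \<le> r'" "norm \<eta> \<le> real r"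
      using norm_triangle_ineq3[of "grid_point (h k) (J k t)" t] norm_triangle_sub[of t "grid_point (h k) (J k t)"]
      by (auto simp: r'_def norm_minus_commute)
  qed
  \<comment> \<open>Makes h L equal to r at every level, beyond the support of
    \<open>chi\<close>.\<close>
  define L where "L k = r * 2 ^ k" for k :: nat
  have L: "h k * real (L k) > max R0 1" for k using r by (simp add: h_def L_def)
  define \<psi> where "\<psi> k m \<eta> = mixed_diff bs (\<lambda>m. chi (grid_point (h k) m, \<eta>)) m" for k m \<eta>
  have \<psi>m: "\<psi> k m \<in> borel_measurable borel" for k m
    unfolding \<psi>_def by (rule mixed_diff_measurable) (rule measurable_compose[OF _ bor], simp)
  have \<psi>b: "norm (\<psi> k m \<eta>) \<le> h k ^ DIM('a) * B" for k m \<eta>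
    unfolding \<psi>_def len[symmetric] by (rule mixed_diff_bound[OF schi _ _ B]) (use bs h(1)[of k] in auto)
  have \<psi>s: "norm \<eta> \<le> R" if "\<psi> k m \<eta> \<noteq> 0" for k m \<eta>
  proof (rule ccontr)
    assume "\<not> norm \<eta> \<le> R"
    then have "chi (x, \<eta>) = 0" for x using suppr[of "(x, \<eta>)"] norm_snd_le[of \<eta> x] n r by (cases "chi (x, \<eta>) = 0") (auto simp: R_def)
    then have "\<psi> k m \<eta> = 0" unfolding \<psi>_def by (intro mixed_diff_zero)
    then show False using that by simp
  qed
  define \<pi> where "\<pi> m j = (\<Prod>b\<in>Basis. of_bool (m b \<le> j b) :: complex)" for m j :: "'a \<Rightarrow> int"
  have \<pi>01: "\<pi> m j = of_bool (\<forall>b\<in>Basis. m b \<le> j b)" for m j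
    by (auto simp: \<pi>_def intro!: prod_zero)
  have repX: "chi (grid_point (h k) j, \<eta>) = grid_sum (L k) bs (\<lambda>m. \<pi> m j * \<psi> k m \<eta>) (\<lambda>_. 0)" for k j \<eta>
    unfolding \<pi>_def \<psi>_def by (rule grid_representation[OF supp h(1) L bs(2,1)])
  \<comment> \<open>The coarse grid point j is the fine grid point 2 j. Both \<open>X k\<close> and
    \<open>X (Suc k)\<close> can therefore be expanded over the fine grid with the same \<psi>, and
    only the indicators differ.\<close>
  have grid2: "grid_point (h k) j = grid_point (h (Suc k)) (\<lambda>b. 2 * j b)" for k and j :: "'a \<Rightarrow> int"
    unfolding grid_point_def h(3) by simp
  \<comment> \<open>Orthant indicators have infinite p-norm. Cutting them off to the ball of radius
    r' changes nothing, as \<open>X k\<close> vanishes for larger t.\<close>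
  define ind where "ind t = (indicator (cball 0 r') t :: complex)" for t :: 'a
  define \<phi>0 where "\<phi>0 m t = ind t * \<pi> m (J 0 t)" for m t
  define \<phi> where "\<phi> k m t = ind t * (\<pi> m (J (Suc k) t) - \<pi> m (\<lambda>b. 2 * J k t b))" for k m t
  have Jm [measurable]: "(\<lambda>t. J k t b) \<in> measurable borel (count_space UNIV)" for k b unfolding J_def by measurable
  have J2m [measurable]: "(\<lambda>t. 2 * J k t b) \<in> measurable borel (count_space UNIV)" for k b
    by (rule measurable_compose[OF Jm]) simp
  have indm [measurable]: "ind \<in> borel_measurable borel" unfolding ind_def by (intro borel_measurable_indicator) auto
  have \<phi>0m [measurable]: "\<phi>0 m \<in> borel_measurable borel" for m unfolding \<phi>0_def \<pi>_def by measurable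
  have \<phi>m [measurable]: "\<phi> k m \<in> borel_measurable borel" for k m unfolding \<phi>_def \<pi>_def by measurable
  have R'R: "r' \<le> R" "r' > 0" using r n by (auto simp: R_def r'_def)
  have \<phi>s: "norm t \<le> R" if "\<phi> k m t \<noteq> 0" for k m t using that R'R by (auto simp: \<phi>_def ind_def indicator_def split: if_splits)
  have \<phi>0s: "norm t \<le> R" if "\<phi>0 m t \<noteq> 0" for m t using that R'R by (auto simp: \<phi>0_def ind_def indicator_def split: if_splits)
  have \<phi>b: "norm (\<phi> k m t) \<le> 1" for k m t by (auto simp: \<phi>_def ind_def \<pi>01 indicator_def)
  have \<phi>0b: "norm (\<phi>0 m t) \<le> 1" for m t by (auto simp: \<phi>0_def ind_def \<pi>01 indicator_def)
  have X0: "X 0 z = grid_sum (L 0) bs (\<lambda>m. \<phi>0 m (fst z) * \<psi> 0 m (snd z)) (\<lambda>_. 0)" for z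
  proof -
    have "grid_sum (L 0) bs (\<lambda>m. \<phi>0 m (fst z) * \<psi> 0 m (snd z)) (\<lambda>_. 0) = ind (fst z) * X 0 z"
      unfolding \<phi>0_def X_def repX mult.assoc grid_sum_cmult ..
    also have "\<dots> = X 0 z" using Xfst(1)[of 0 "fst z" "snd z"] by (auto simp: ind_def indicator_def)
    finally show ?thesis by simp
  qed
  have Xd: "X (Suc k) z - X k z = grid_sum (L (Suc k)) bs (\<lambda>m. \<phi> k m (fst z) * \<psi> (Suc k) m (snd z)) (\<lambda>_. 0)" for k z
  proof -
    have "grid_sum (L (Suc k)) bs (\<lambda>m. \<phi> k m (fst z) * \<psi> (Suc k) m (snd z)) (\<lambda>_. 0) = ind (fst z) * (X (Suc k) z - X k z)"
      unfolding \<phi>_def X_def grid2[of k] repX mult.assoc grid_sum_cmult left_diff_distrib grid_sum_diff ..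
    also have "\<dots> = X (Suc k) z - X k z"
    proof (cases "norm (fst z) \<le> r'")
      case False
      then have "X i z = 0" for i using Xfst(1)[of i "fst z" "snd z"] by auto
      then show ?thesis by simp
    qed (simp add: ind_def)
    finally show ?thesis by simp
  qed
  define v where "v k = n * (2 * h (Suc k) * (2 * r') ^ (DIM('a) - 1))" for k
  have v0: "v k \<ge> 0" for k using n h(1)[of "Suc k"] R'R by (simp add: v_def)
  have \<phi>I: "(\<integral>t. norm (\<phi> k m t) powr p \<partial>lborel) \<le> v k" for k m
  proof (rule integral_powr_indicator_le)
    let ?S = "slabs r' (h (Suc k)) m"
    show "?S \<in> sets borel" by (rule slab_measure[OF h(1) R'R(2)])
    show "emeasure lborel ?S \<le> ennreal (v k)" unfolding v_def n_def by (rule slab_measure[OF h(1) R'R(2)])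
    fix t
    show "norm (\<phi> k m t) \<le> indicator ?S t"
    proof (cases "\<phi> k m t = 0")
      case False
      let ?g = "h (Suc k)"
      have g: "?g > 0" "h k = 2 * ?g" using h(1)[of "Suc k"] h(3)[of k] by auto
      have t: "norm t \<le> r'" using False by (auto simp: \<phi>_def ind_def indicator_def split: if_splits)
      have J: "2 * J k t b \<le> J (Suc k) t b" for b
      proof -
        have "2 * of_int \<lfloor>(t \<bullet> b) / h k\<rfloor> \<le> 2 * ((t \<bullet> b) / h k)" by (intro mult_left_mono of_int_floor_le) simp
        also have "\<dots> = (t \<bullet> b) / ?g" using g by simp
        finally show ?thesis unfolding J_def grid_index_def by (simp add: le_floor_iff)
      qed
      \<comment> \<open>Since 2 floor(a / 2) \<le> floor(a), passing to the finer index can only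
        enlarge the set of m whose orthant indicator is 1. If the two indicators differ, some
        coordinate \<open>m b\<close> lies between the two indices, and this confines t . b to a
        slab of width twice the fine mesh.\<close>
      have "\<exists>b\<in>Basis. 2 * J k t b < m b \<and> m b \<le> J (Suc k) t b"
      proof (rule ccontr)
        assume "\<not> ?thesis"
        then have "m b \<le> 2 * J k t b \<longleftrightarrow> m b \<le> J (Suc k) t b" if "b \<in> Basis" for b
          using J[of b] that by force
        then have "\<pi> m (J (Suc k) t) = \<pi> m (\<lambda>b. 2 * J k t b)" by (simp add: \<pi>01)
        then show False using False by (simp add: \<phi>_def)
      qed
      then obtain b where b: "b \<in> Basis" "2 * J k t b < m b" "m b \<le> J (Suc k) t b" by blast
      have "real_of_int (m b) \<le> (t \<bullet> b) / ?g" using b(3) unfolding J_def grid_index_def by (simp add: le_floor_iff)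
      moreover have "(t \<bullet> b) / ?g < real_of_int (m b) + 2"
      proof -
        have "(t \<bullet> b) / h k < of_int (J k t b) + 1" unfolding J_def grid_index_def by linarith
        then have "2 * ((t \<bullet> b) / h k) < 2 * of_int (J k t b) + 2" by simp
        also have "2 * of_int (J k t b) + 2 < real_of_int (m b) + 2" using b(2) by linarith
        finally show ?thesis using g by simp
      qed
      ultimately have "t \<bullet> b \<in> {of_int (m b) * ?g..of_int (m b) * ?g + 2 * ?g}"
        using g(1) by (auto simp: field_simps)
      moreover have "t \<in> cbox (- r' *\<^sub>R One) (r' *\<^sub>R One)"
      proof -
        have "\<bar>t \<bullet> c\<bar> \<le> r'" if "c \<in> Basis" for c using Basis_le_norm[OF that, of t] t by linarith
        then show ?thesis by (auto simp: mem_box abs_le_iff) (smt (verit))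
      qed
      ultimately have "t \<in> ?S" using b(1) unfolding slabs_def by blast
      then show ?thesis using \<phi>b[of k m t] by simp
    qed auto
  qed (use v0 p in auto)
  \<comment> \<open>Number of grid terms, times the p-norm of an indicator factor, times the bound
    for a mixed difference. At level 0 there is no slab, so the indicator is only bounded by a
    ball.\<close>
  define q where "q k = (case k of
      0 \<Rightarrow> real (2 * L 0 + 1) ^ DIM('a) * (measure lborel (cball (0::'a) R) powr (1 / p) * (h 0 ^ DIM('a) * B))
    | Suc k \<Rightarrow> real (2 * L (Suc k) + 1) ^ DIM('a) * (v k powr (1 / p) * (h (Suc k) ^ DIM('a) * B)))" for k
  have tc: "tensor_cost p R (\<lambda>z. f (fst z) * \<psi> k m (snd z)) (A * (h k ^ DIM('a) * B))"
    if "f \<in> borel_measurable borel" "\<And>t. norm (f t) \<le> 1" "\<And>t. f t \<noteq> 0 \<Longrightarrow> norm t \<le> R"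
      "(\<integral>t. norm (f t) powr p \<partial>lborel) powr (1 / p) \<le> A" for f k m A
    using tensor_cost.step[OF tensor_cost.zero that(1-3) \<psi>m \<psi>b \<psi>s that(4), of k m] by simp
  have t0: "tensor_cost p R (X 0) (q 0)"
  proof -
    have "tensor_cost p R (\<lambda>z. \<phi>0 m (fst z) * \<psi> 0 m (snd z)) (measure lborel (cball (0::'a) R) powr (1 / p) * (h 0 ^ DIM('a) * B))" for m
    proof (rule tc[OF \<phi>0m \<phi>0b \<phi>0s])
      have "(\<integral>t. norm (\<phi>0 m t) powr p \<partial>lborel) \<le> measure lborel (cball (0::'a) R)"
      proof (rule integral_powr_indicator_le[of "cball 0 R"])
        show "emeasure lborel (cball (0::'a) R) \<le> ennreal (measure lborel (cball (0::'a) R))"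
          by (subst emeasure_eq_ennreal_measure) (use emeasure_bounded_finite[OF bounded_cball, of "0::'a" R] in auto)
        show "norm (\<phi>0 m t) \<le> indicator (cball 0 R) t" for t
          using \<phi>0b[of m t] \<phi>0s[of m t] by (cases "\<phi>0 m t = 0") auto
      qed (use p in auto)
      then show "(\<integral>t. norm (\<phi>0 m t) powr p \<partial>lborel) powr (1 / p) \<le> measure lborel (cball (0::'a) R) powr (1 / p)"
        using p by (intro powr_mono2) (auto intro!: integral_nonneg_AE)
    qed auto
    then have "tensor_cost p R (\<lambda>z. grid_sum (L 0) bs (\<lambda>m. \<phi>0 m (fst z) * \<psi> 0 m (snd z)) (\<lambda>_. 0)) (q 0)"
      unfolding q_def nat.case len[symmetric] by (rule tensor_cost_grid_sum)
    then show ?thesis unfolding X0[symmetric] .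
  qed
  have tS: "tensor_cost p R (\<lambda>z. X (Suc k) z - X k z) (q (Suc k))" for k
  proof -
    have "tensor_cost p R (\<lambda>z. \<phi> k m (fst z) * \<psi> (Suc k) m (snd z)) (v k powr (1 / p) * (h (Suc k) ^ DIM('a) * B))" for m
      using \<phi>I[of k m] p by (intro tc[OF \<phi>m \<phi>b \<phi>s] powr_mono2) (auto intro!: integral_nonneg_AE)
    then have "tensor_cost p R (\<lambda>z. grid_sum (L (Suc k)) bs (\<lambda>m. \<phi> k m (fst z) * \<psi> (Suc k) m (snd z)) (\<lambda>_. 0)) (q (Suc k))"
      unfolding q_def nat.case len[symmetric] by (rule tensor_cost_grid_sum)
    then show ?thesis unfolding Xd[symmetric] .
  qed
  have q0: "q k \<ge> 0" for k using B0 h(1) by (auto simp: q_def less_imp_le split: nat.split)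
  define D where "D = (3 * real r) ^ DIM('a) * B * (n * (2 * r') ^ (DIM('a) - 1)) powr (1 / p)"
  have qle: "q (Suc k) \<le> D * ((1 / 2) powr (1 / p)) ^ k" for k
  proof -
    have "v k = (n * (2 * r') ^ (DIM('a) - 1)) * h k" by (simp add: v_def h(3))
    then have "v k powr (1 / p) = (n * (2 * r') ^ (DIM('a) - 1)) powr (1 / p) * h k powr (1 / p)"
      by (simp only: powr_mult)
    also have "h k powr (1 / p) = ((1 / 2) powr (1 / p)) ^ k"
    proof -
      have "h k = (1 / 2) powr real k" by (simp add: h_def powr_realpow power_one_over)
      then show ?thesis by (simp add: powr_powr powr_realpow[symmetric] mult.commute)
    qed
    finally have v: "v k powr (1 / p) = (n * (2 * r') ^ (DIM('a) - 1)) powr (1 / p) * ((1 / 2) powr (1 / p)) ^ k" .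
    \<comment> \<open>In each coordinate the number of grid terms cancels the mesh: the product is 2
      r + h, and h \<le> 1 < r.\<close>
    have "real (2 * L (Suc k) + 1) * h (Suc k) \<le> 3 * real r"
    proof -
      have "real (2 * L (Suc k) + 1) * h (Suc k) = 2 * real r + h (Suc k)" by (simp add: L_def h_def field_simps)
      then show ?thesis using h(2)[of "Suc k"] r by simp
    qed
    then have "(real (2 * L (Suc k) + 1) * h (Suc k)) ^ DIM('a) \<le> (3 * real r) ^ DIM('a)"
      using h(1)[of "Suc k"] by (intro power_mono) auto
    moreover have "q (Suc k) = (real (2 * L (Suc k) + 1) * h (Suc k)) ^ DIM('a) * (B * v k powr (1 / p))"
      by (simp add: q_def power_mult_distrib)
    ultimately have "q (Suc k) \<le> (3 * real r) ^ DIM('a) * (B * v k powr (1 / p))"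
      using B0 by (simp add: mult_right_mono)
    then show ?thesis unfolding v D_def by (simp add: mult_ac)
  qed
  have "summable (\<lambda>k. D * ((1 / 2) powr (1 / p)) ^ k)"
  proof (intro summable_mult summable_geometric)
    have "(1 / 2 :: real) powr (1 / p) < 1 powr (1 / p)" using p by (intro powr_less_mono2) auto
    then show "norm ((1 / 2 :: real) powr (1 / p)) < 1" by simp
  qed
  then have "summable (\<lambda>k. q (Suc k))"
    by (rule summable_comparison_test') (use qle q0 in auto)
  then have sq: "summable q" by (simp add: summable_Suc_iff)
  have lim: "(\<lambda>k. X k z) \<longlonglongrightarrow> chi z" for z
  proof -
    have "(\<lambda>k. n * h k) \<longlonglongrightarrow> n * 0"
      unfolding h_def by (intro tendsto_mult tendsto_const LIMSEQ_divide_realpow_zero) auto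
    then have nh: "(\<lambda>k. n * h k) \<longlonglongrightarrow> 0" by simp
    have "\<forall>k. norm (grid_point (h k) (J k (fst z)) - fst z) \<le> n * h k"
      unfolding J_def n_def by (intro allI grid_point_grid_index_close[OF h(1)])
    from Lim_null_comparison[OF always_eventually[OF this] nh]
    have "(\<lambda>k. grid_point (h k) (J k (fst z)) - fst z) \<longlonglongrightarrow> 0" .
    then have "(\<lambda>k. grid_point (h k) (J k (fst z))) \<longlonglongrightarrow> fst z" by (simp add: LIM_zero_iff)
    then have "(\<lambda>k. (grid_point (h k) (J k (fst z)), snd z)) \<longlonglongrightarrow> (fst z, snd z)" by (intro tendsto_Pair tendsto_const)
    moreover have "isCont chi z" using smooth_differentiable[OF schi] differentiable_imp_continuous_within by blast
    ultimately show ?thesis unfolding X_def by (intro isCont_tendsto_compose[of z chi]) auto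
  qed
  show thesis
  proof (rule that[of R M X q])
    show "R > 0" using r n by (simp add: R_def)
    show "norm (X k z) \<le> M" for k z using M by (simp add: X_def)
    show "norm z \<le> R" if "X k z \<noteq> 0" for k z
      using Xfst[of k "fst z" "snd z"] that norm_Pair_le[of "fst z" "snd z"] by (simp add: R_def r'_def)
    show "norm z \<le> R" if "chi z \<noteq> 0" for z using suppr[OF that] n by (simp add: R_def)
  qed (use M0 t0 tS sq q0 lim in auto)
qed

subsection \<open>Finite Gabor sums\<close>

text \<open>Every a_x^r is at most the full sum S, so the surplus power a_x^(s - r) can be replaced
  by S^((s - r)/r).\<close>

lemma lp_norm_antimono:
  fixes a :: "'i \<Rightarrow> real"
  assumes "finite X" "\<And>x. x \<in> X \<Longrightarrow> a x \<ge> 0" "0 < r" "r \<le> s"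
  shows "(\<Sum>x\<in>X. a x powr s) powr (1 / s) \<le> (\<Sum>x\<in>X. a x powr r) powr (1 / r)"
proof -
  define S where "S = (\<Sum>x\<in>X. a x powr r)"
  have S0: "S \<ge> 0" unfolding S_def by (intro sum_nonneg) auto
  have le: "a x powr s \<le> S powr ((s - r) / r) * a x powr r" if "x \<in> X" for x
  proof -
    have "a x powr r \<le> S" unfolding S_def using assms that by (intro member_le_sum) auto
    then have "(a x powr r) powr ((s - r) / r) \<le> S powr ((s - r) / r)"
      using assms by (intro powr_mono2) auto
    then have "a x powr (s - r) \<le> S powr ((s - r) / r)" using assms by (simp add: powr_powr)
    then have "a x powr (s - r) * a x powr r \<le> S powr ((s - r) / r) * a x powr r" by (intro mult_right_mono) auto
    then show ?thesis by (simp flip: powr_add)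
  qed
  have "(\<Sum>x\<in>X. a x powr s) \<le> (\<Sum>x\<in>X. S powr ((s - r) / r) * a x powr r)" by (intro sum_mono le)
  also have "\<dots> = S powr ((s - r) / r) * S" by (simp add: S_def sum_distrib_left)
  also have "\<dots> = S powr (s / r)"
  proof -
    have "S powr ((s - r) / r) * S powr 1 = S powr ((s - r) / r + 1)" by (simp only: powr_add)
    moreover have "(s - r) / r + 1 = s / r" using assms by (simp add: field_simps)
    ultimately show ?thesis using S0 by simp
  qed
  finally have "(\<Sum>x\<in>X. a x powr s) powr (1 / s) \<le> (S powr (s / r)) powr (1 / s)"
    using assms by (intro powr_mono2) (auto intro: sum_nonneg)
  then show ?thesis using assms by (simp add: S_def powr_powr)
qed

lemma sum_list_distinct: "distinct xs \<Longrightarrow> set xs = X \<Longrightarrow> (\<Sum>x\<leftarrow>xs. f x) = sum f X"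
  by (auto simp: sum.distinct_set_conv_list)

lemma T_B0_eq: "T_B0 \<mu> f z = f (z - \<mu>) * cis (- 2 * pi * (fst \<mu> \<bullet> (snd z - snd \<mu>)))"
  by (cases \<mu>; cases z) (simp add: T_B0_def)

definition fin_synth :: "('a::euclidean_space \<times> 'a) set \<Rightarrow> ('a \<times> 'a \<Rightarrow> complex) \<Rightarrow> ('a \<times> 'a \<Rightarrow> complex) \<Rightarrow> 'a \<times> 'a \<Rightarrow> complex" where
  "fin_synth M c \<rho> z = (\<Sum>\<mu>\<in>M. c \<mu> * T_B0 \<mu> \<rho> z)"

lemma fin_synth_add: "fin_synth M c (\<lambda>z. \<rho> z + \<sigma> z) z = fin_synth M c \<rho> z + fin_synth M c \<sigma> z"
  by (simp add: fin_synth_def T_B0_eq algebra_simps sum.distrib)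

lemma fin_synth_diff: "fin_synth M c (\<lambda>z. \<rho> z - \<sigma> z) z = fin_synth M c \<rho> z - fin_synth M c \<sigma> z"
  by (simp add: fin_synth_def T_B0_eq algebra_simps sum_subtractf)

lemma fin_synth_zero: "fin_synth M c (\<lambda>_. 0) z = 0"
  by (simp add: fin_synth_def T_B0_eq)

text \<open>For fixed x the phase of \<open>T_B0\<close> acts on \<eta> alone. This is why a product
  window produces one elementary tensor per x, with the whole row of c gathered in the second
  factor.\<close>

definition gabor_row :: "'a::euclidean_space set \<Rightarrow> ('a \<times> 'a \<Rightarrow> complex) \<Rightarrow> ('a \<Rightarrow> complex) \<Rightarrow> 'a \<Rightarrow> 'a \<Rightarrow> complex" where
  "gabor_row \<Xi> c \<psi> x \<eta> = (\<Sum>\<xi>\<in>\<Xi>. c (x, \<xi>) * (\<psi> (\<eta> - \<xi>) * cis (- 2 * pi * (x \<bullet> (\<eta> - \<xi>)))))"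

lemma fin_synth_tensor:
  "fin_synth (X \<times> \<Xi>) c (\<lambda>z. \<phi> (fst z) * \<psi> (snd z)) z = (\<Sum>x\<in>X. \<phi> (fst z - x) * gabor_row \<Xi> c \<psi> x (snd z))"
  by (simp add: fin_synth_def T_B0_eq gabor_row_def sum.cartesian_product case_prod_unfold sum_distrib_left mult_ac)

lemma fin_synth_represents:
  assumes "finite X" "\<And>x. x \<in> X \<Longrightarrow> (\<lambda>t. \<phi> (t - x)) \<in> elems E" "\<And>x. x \<in> X \<Longrightarrow> gabor_row \<Xi> c \<psi> x \<in> elems F"
    and xs: "distinct xs" "set xs = X"
  shows "represents_tensor E F (map (\<lambda>x. (\<lambda>t. \<phi> (t - x), gabor_row \<Xi> c \<psi> x)) xs) (fin_synth (X \<times> \<Xi>) c (\<lambda>z. \<phi> (fst z) * \<psi> (snd z)))"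
  using assms unfolding represents_tensor_def
  by (auto simp: fin_synth_tensor sum_list_distinct[OF xs] o_def)

lemma dual_ball_sum:
  assumes l: "l \<in> dual_ball (Lp p w)" and w: "poly_bounded_weight w" and p: "p \<ge> 1"
    and X: "finite X" "\<And>x. x \<in> X \<Longrightarrow> f x \<in> elems (Lp p w)"
  shows "l (\<lambda>t. \<Sum>x\<in>X. a x * f x t) = (\<Sum>x\<in>X. a x * l (f x))"
proof -
  obtain xs where xs: "set xs = X" "distinct xs" using finite_distinct_list[OF X(1)] by blast
  show ?thesis
    using dual_ball_list(2)[OF l w p, of xs f a] X(2) xs by (simp add: sum_list_distinct[OF xs(2,1)])
qed

text \<open>The end of a duality argument: S \<le> B sqrt S is divided by sqrt S, with S = 0 treated
  apart. The hypothesis presents S as the value z of a functional on a vector built from S.\<close>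

lemma square_norm_bound:
  fixes z :: complex
  assumes "of_real S = z" "norm z \<le> B * sqrt S" "S \<ge> 0" "B \<ge> 0"
  shows "sqrt S \<le> B"
proof (cases "S = 0")
  case False
  have "S \<le> B * sqrt S" using assms(1-3) by auto
  then have "sqrt S * sqrt S \<le> B * sqrt S" using assms(3) by simp
  then show ?thesis using False assms(3) by (intro mult_right_le_imp_le[of "sqrt S" "sqrt S"]) auto
qed (use assms in simp)

text \<open>The weighted \<ell>^2 norm of a finite piece of the row at x. Working with finite pieces
  avoids summability questions until the sequence spaces are reached.\<close>

definition row_norm :: "('a \<Rightarrow> real) \<Rightarrow> 'a set \<Rightarrow> ('a \<times> 'a \<Rightarrow> complex) \<Rightarrow> 'a \<Rightarrow> real" where
  "row_norm w \<Xi> c x = w x * L2_set (\<lambda>\<xi>. norm (c (x, \<xi>))) \<Xi>"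

section \<open>Tensor norms of finite Gabor sums with a product window\<close>

locale gabor =
  fixes \<Lambda>1 \<Lambda>2 :: "'a::euclidean_space set" and w :: "'a \<Rightarrow> real" and p :: real
  assumes lattice1: "is_lattice \<Lambda>1" and lattice2: "is_lattice \<Lambda>2"
    and weight: "poly_bounded_weight w" and p1: "p \<ge> 1"
begin

lemma row_norm_nonneg: "row_norm w \<Xi> c x \<ge> 0"
  unfolding row_norm_def using weight_pos[OF weight, of x] by simp

lemma translate_mem:
  assumes "\<phi> \<in> borel_measurable borel" "\<And>t. norm (\<phi> t) \<le> P" "\<And>t. \<phi> t \<noteq> 0 \<Longrightarrow> norm t \<le> R"
  shows "(\<lambda>t. \<phi> (t - x)) \<in> elems (Lp p w)"
  by (rule bounded_compact_support_Lp[OF _ assms(2) _ weight p1, of _ x R]) (use assms in auto)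

lemma gabor_row_bound:
  obtains C where "C \<ge> 0"
    "\<And>\<psi> P \<Xi> c x. \<psi> \<in> borel_measurable borel \<Longrightarrow> (\<And>\<eta>. norm (\<psi> \<eta>) \<le> P) \<Longrightarrow> (\<And>\<eta>. \<psi> \<eta> \<noteq> 0 \<Longrightarrow> norm \<eta> \<le> R) \<Longrightarrow>
      x \<in> \<Lambda>1 \<Longrightarrow> finite \<Xi> \<Longrightarrow> \<Xi> \<subseteq> \<Lambda>2 \<Longrightarrow>
      gabor_row \<Xi> c \<psi> x \<in> elems L2 \<and> nrm L2 (gabor_row \<Xi> c \<psi> x) \<le> C * P * L2_set (\<lambda>\<xi>. norm (c (x, \<xi>))) \<Xi>"
proof -
  obtain C where C: "C \<ge> 0"
    "\<And>\<psi> P X \<Xi> c. \<psi> \<in> borel_measurable borel \<Longrightarrow> (\<And>\<eta>. norm (\<psi> \<eta>) \<le> P) \<Longrightarrow> (\<And>\<eta>. \<psi> \<eta> \<noteq> 0 \<Longrightarrow> norm \<eta> \<le> R) \<Longrightarrow>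
      finite X \<Longrightarrow> X \<subseteq> \<Lambda>1 \<Longrightarrow> finite \<Xi> \<Longrightarrow> \<Xi> \<subseteq> \<Lambda>2 \<Longrightarrow>
      (\<lambda>\<eta>. \<Sum>\<xi>\<in>\<Xi>. \<Sum>x\<in>X. c x \<xi> * (\<psi> (\<eta> - \<xi>) * cis (- 2 * pi * (x \<bullet> (\<eta> - \<xi>))))) \<in> elems L2 \<and>
      nrm L2 (\<lambda>\<eta>. \<Sum>\<xi>\<in>\<Xi>. \<Sum>x\<in>X. c x \<xi> * (\<psi> (\<eta> - \<xi>) * cis (- 2 * pi * (x \<bullet> (\<eta> - \<xi>)))))
        \<le> C * P * sqrt (\<Sum>\<xi>\<in>\<Xi>. \<Sum>x\<in>X. (norm (c x \<xi>))\<^sup>2)"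
    using gabor_synthesis_L2[OF lattice1 lattice2, of R] by blast
  show thesis
  proof (rule that[OF C(1)])
    fix \<psi> :: "'a \<Rightarrow> complex" and P \<Xi> c and x :: 'a
    assume a: "\<psi> \<in> borel_measurable borel" "\<And>\<eta>. norm (\<psi> \<eta>) \<le> P" "\<And>\<eta>. \<psi> \<eta> \<noteq> 0 \<Longrightarrow> norm \<eta> \<le> R"
      "x \<in> \<Lambda>1" "finite \<Xi>" "\<Xi> \<subseteq> \<Lambda>2"
    have "gabor_row \<Xi> c \<psi> x = (\<lambda>\<eta>. \<Sum>\<xi>\<in>\<Xi>. \<Sum>x'\<in>{x}. c (x', \<xi>) * (\<psi> (\<eta> - \<xi>) * cis (- 2 * pi * (x' \<bullet> (\<eta> - \<xi>)))))"
      by (simp add: gabor_row_def fun_eq_iff)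
    then show "gabor_row \<Xi> c \<psi> x \<in> elems L2 \<and> nrm L2 (gabor_row \<Xi> c \<psi> x) \<le> C * P * L2_set (\<lambda>\<xi>. norm (c (x, \<xi>))) \<Xi>"
      using C(2)[OF a(1-3), of "{x}" \<Xi> "\<lambda>x \<xi>. c (x, \<xi>)"] a(4-6) by (simp add: L2_set_def)
  qed
qed

text \<open>The triangle inequality over x. The bound is linear in A P, with C independent of
  windows and coefficients, so that it can be added up along a \<open>tensor_cost\<close>
  derivation.\<close>

lemma proj_rank_one_bound:
  obtains C where "C \<ge> 0"
    "\<And>\<phi> \<psi> A P X \<Xi> c. \<phi> \<in> borel_measurable borel \<Longrightarrow> (\<And>t. norm (\<phi> t) \<le> 1) \<Longrightarrow> (\<And>t. \<phi> t \<noteq> 0 \<Longrightarrow> norm t \<le> R) \<Longrightarrow>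
      \<psi> \<in> borel_measurable borel \<Longrightarrow> (\<And>\<eta>. norm (\<psi> \<eta>) \<le> P) \<Longrightarrow> (\<And>\<eta>. \<psi> \<eta> \<noteq> 0 \<Longrightarrow> norm \<eta> \<le> R) \<Longrightarrow>
      (\<integral>t. norm (\<phi> t) powr p \<partial>lborel) powr (1 / p) \<le> A \<Longrightarrow>
      finite X \<Longrightarrow> X \<subseteq> \<Lambda>1 \<Longrightarrow> finite \<Xi> \<Longrightarrow> \<Xi> \<subseteq> \<Lambda>2 \<Longrightarrow>
      fin_synth (X \<times> \<Xi>) c (\<lambda>z. \<phi> (fst z) * \<psi> (snd z)) \<in> alg_tensor (Lp p w) L2 \<and>
      proj_tensor_norm (Lp p w) L2 (fin_synth (X \<times> \<Xi>) c (\<lambda>z. \<phi> (fst z) * \<psi> (snd z)))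
        \<le> C * (A * P) * (\<Sum>x\<in>X. row_norm w \<Xi> c x)"
proof -
  obtain C1 where C1: "C1 \<ge> 0"
    "\<And>\<phi> P X a. \<phi> \<in> borel_measurable borel \<Longrightarrow> (\<And>t. norm (\<phi> t) \<le> P) \<Longrightarrow> (\<And>t. \<phi> t \<noteq> 0 \<Longrightarrow> norm t \<le> R) \<Longrightarrow>
      finite X \<Longrightarrow> X \<subseteq> \<Lambda>1 \<Longrightarrow>
      nrm (Lp p w) (\<lambda>t. \<Sum>x\<in>X. a x * \<phi> (t - x)) \<le>
        C1 * (\<integral>t. norm (\<phi> t) powr p \<partial>lborel) powr (1 / p) * (\<Sum>x\<in>X. (norm (a x) * w x) powr p) powr (1 / p)"
    using translates_synthesis_bound[OF lattice1 weight p1, of R] by blast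
  obtain C2 where C2: "C2 \<ge> 0"
    "\<And>\<psi> P \<Xi> c x. \<psi> \<in> borel_measurable borel \<Longrightarrow> (\<And>\<eta>. norm (\<psi> \<eta>) \<le> P) \<Longrightarrow> (\<And>\<eta>. \<psi> \<eta> \<noteq> 0 \<Longrightarrow> norm \<eta> \<le> R) \<Longrightarrow>
      x \<in> \<Lambda>1 \<Longrightarrow> finite \<Xi> \<Longrightarrow> \<Xi> \<subseteq> \<Lambda>2 \<Longrightarrow>
      gabor_row \<Xi> c \<psi> x \<in> elems L2 \<and> nrm L2 (gabor_row \<Xi> c \<psi> x) \<le> C2 * P * L2_set (\<lambda>\<xi>. norm (c (x, \<xi>))) \<Xi>"
    using gabor_row_bound[of R] by blast
  show thesis
  proof (rule that[of "C1 * C2"])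
    fix \<phi> \<psi> :: "'a \<Rightarrow> complex" and A P X \<Xi> and c :: "'a \<times> 'a \<Rightarrow> complex"
    assume \<phi>: "\<phi> \<in> borel_measurable borel" "\<And>t. norm (\<phi> t) \<le> 1" "\<And>t. \<phi> t \<noteq> 0 \<Longrightarrow> norm t \<le> R"
      and \<psi>: "\<psi> \<in> borel_measurable borel" "\<And>\<eta>. norm (\<psi> \<eta>) \<le> P" "\<And>\<eta>. \<psi> \<eta> \<noteq> 0 \<Longrightarrow> norm \<eta> \<le> R"
      and A: "(\<integral>t. norm (\<phi> t) powr p \<partial>lborel) powr (1 / p) \<le> A"
      and X: "finite X" "X \<subseteq> \<Lambda>1" and \<Xi>: "finite \<Xi>" "\<Xi> \<subseteq> \<Lambda>2"
    obtain xs where xs: "set xs = X" "distinct xs" using finite_distinct_list[OF X(1)] by blast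
    have P0: "P \<ge> 0" using \<psi>(2) norm_ge_zero order_trans by blast
    have A0: "A \<ge> 0" using A powr_ge_zero order_trans by blast
    have row: "gabor_row \<Xi> c \<psi> x \<in> elems L2" "nrm L2 (gabor_row \<Xi> c \<psi> x) \<le> C2 * P * L2_set (\<lambda>\<xi>. norm (c (x, \<xi>))) \<Xi>"
      if "x \<in> X" for x using C2(2)[OF \<psi> _ \<Xi>, of x c] that X(2) by blast+
    have rep: "represents_tensor (Lp p w) L2 (map (\<lambda>x. (\<lambda>t. \<phi> (t - x), gabor_row \<Xi> c \<psi> x)) xs)
      (fin_synth (X \<times> \<Xi>) c (\<lambda>z. \<phi> (fst z) * \<psi> (snd z)))"
      by (rule fin_synth_represents[OF X(1) translate_mem[OF \<phi>] row(1) xs(2,1)])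
    have tr: "nrm (Lp p w) (\<lambda>t. \<phi> (t - x)) \<le> C1 * A * w x" if "x \<in> X" for x
    proof -
      have "nrm (Lp p w) (\<lambda>t. \<Sum>x\<in>{x}. 1 * \<phi> (t - x)) \<le>
        C1 * (\<integral>t. norm (\<phi> t) powr p \<partial>lborel) powr (1 / p) * (\<Sum>x\<in>{x}. (norm (1::complex) * w x) powr p) powr (1 / p)"
        using that X(2) by (intro C1(2)[OF \<phi>]) auto
      also have "\<dots> = C1 * (\<integral>t. norm (\<phi> t) powr p \<partial>lborel) powr (1 / p) * w x"
        using p1 weight_pos[OF weight, of x] by (simp add: powr_powr)
      also have "\<dots> \<le> C1 * A * w x"
        using A C1(1) weight_pos[OF weight, of x] by (intro mult_right_mono mult_left_mono) auto
      finally show ?thesis by simp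
    qed
    have "proj_tensor_norm (Lp p w) L2 (fin_synth (X \<times> \<Xi>) c (\<lambda>z. \<phi> (fst z) * \<psi> (snd z)))
      \<le> (\<Sum>x\<leftarrow>xs. nrm (Lp p w) (\<lambda>t. \<phi> (t - x)) * nrm L2 (gabor_row \<Xi> c \<psi> x))"
      using proj_tensor_norm_le[OF rep] by (simp add: o_def)
    also have "\<dots> = (\<Sum>x\<in>X. nrm (Lp p w) (\<lambda>t. \<phi> (t - x)) * nrm L2 (gabor_row \<Xi> c \<psi> x))"
      by (rule sum_list_distinct[OF xs(2,1)])
    also have "\<dots> \<le> (\<Sum>x\<in>X. (C1 * A * w x) * (C2 * P * L2_set (\<lambda>\<xi>. norm (c (x, \<xi>))) \<Xi>))"
      using C1(1) A0 by (intro sum_mono mult_mono tr row(2) nrm_Lp_nonneg)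
        (auto simp: less_imp_le[OF weight_pos[OF weight]])
    also have "\<dots> = C1 * C2 * (A * P) * (\<Sum>x\<in>X. row_norm w \<Xi> c x)"
      by (simp add: row_norm_def sum_distrib_left mult_ac)
    finally show "fin_synth (X \<times> \<Xi>) c (\<lambda>z. \<phi> (fst z) * \<psi> (snd z)) \<in> alg_tensor (Lp p w) L2 \<and>
      proj_tensor_norm (Lp p w) L2 (fin_synth (X \<times> \<Xi>) c (\<lambda>z. \<phi> (fst z) * \<psi> (snd z)))
        \<le> C1 * C2 * (A * P) * (\<Sum>x\<in>X. row_norm w \<Xi> c x)" using rep by (auto simp: alg_tensor_def)
  qed (use C1 C2 in simp)
qed

text \<open>For l, m in the dual balls the value is the sum over x of l(\<phi>(. - x)) m(row x).
  After the weight is moved from one factor to the other, the Cauchy-Schwarz inequality asks for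
  both sequences in \<ell>^2. Each bound comes from feeding the functional the combination with
  conjugate coefficients.\<close>

lemma inj_rank_one_bound:
  assumes p2: "p \<ge> 2"
  obtains C where "C \<ge> 0"
    "\<And>\<phi> \<psi> A P X \<Xi> c K. \<phi> \<in> borel_measurable borel \<Longrightarrow> (\<And>t. norm (\<phi> t) \<le> 1) \<Longrightarrow> (\<And>t. \<phi> t \<noteq> 0 \<Longrightarrow> norm t \<le> R) \<Longrightarrow>
      \<psi> \<in> borel_measurable borel \<Longrightarrow> (\<And>\<eta>. norm (\<psi> \<eta>) \<le> P) \<Longrightarrow> (\<And>\<eta>. \<psi> \<eta> \<noteq> 0 \<Longrightarrow> norm \<eta> \<le> R) \<Longrightarrow>
      (\<integral>t. norm (\<phi> t) powr p \<partial>lborel) powr (1 / p) \<le> A \<Longrightarrow>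
      finite X \<Longrightarrow> X \<subseteq> \<Lambda>1 \<Longrightarrow> finite \<Xi> \<Longrightarrow> \<Xi> \<subseteq> \<Lambda>2 \<Longrightarrow> K \<ge> 0 \<Longrightarrow> (\<And>x. x \<in> X \<Longrightarrow> row_norm w \<Xi> c x \<le> K) \<Longrightarrow>
      fin_synth (X \<times> \<Xi>) c (\<lambda>z. \<phi> (fst z) * \<psi> (snd z)) \<in> alg_tensor (Lp p w) L2 \<and>
      inj_tensor_norm (Lp p w) L2 (fin_synth (X \<times> \<Xi>) c (\<lambda>z. \<phi> (fst z) * \<psi> (snd z))) \<le> C * (A * P) * K"
proof -
  obtain C1 where C1: "C1 \<ge> 0"
    "\<And>\<phi> P X a. \<phi> \<in> borel_measurable borel \<Longrightarrow> (\<And>t. norm (\<phi> t) \<le> P) \<Longrightarrow> (\<And>t. \<phi> t \<noteq> 0 \<Longrightarrow> norm t \<le> R) \<Longrightarrow>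
      finite X \<Longrightarrow> X \<subseteq> \<Lambda>1 \<Longrightarrow>
      nrm (Lp p w) (\<lambda>t. \<Sum>x\<in>X. a x * \<phi> (t - x)) \<le>
        C1 * (\<integral>t. norm (\<phi> t) powr p \<partial>lborel) powr (1 / p) * (\<Sum>x\<in>X. (norm (a x) * w x) powr p) powr (1 / p)"
    using translates_synthesis_bound[OF lattice1 weight p1, of R] by blast
  obtain C2 where C2: "C2 \<ge> 0"
    "\<And>\<psi> P X \<Xi> c. \<psi> \<in> borel_measurable borel \<Longrightarrow> (\<And>\<eta>. norm (\<psi> \<eta>) \<le> P) \<Longrightarrow> (\<And>\<eta>. \<psi> \<eta> \<noteq> 0 \<Longrightarrow> norm \<eta> \<le> R) \<Longrightarrow>
      finite X \<Longrightarrow> X \<subseteq> \<Lambda>1 \<Longrightarrow> finite \<Xi> \<Longrightarrow> \<Xi> \<subseteq> \<Lambda>2 \<Longrightarrow>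
      (\<lambda>\<eta>. \<Sum>\<xi>\<in>\<Xi>. \<Sum>x\<in>X. c x \<xi> * (\<psi> (\<eta> - \<xi>) * cis (- 2 * pi * (x \<bullet> (\<eta> - \<xi>))))) \<in> elems L2 \<and>
      nrm L2 (\<lambda>\<eta>. \<Sum>\<xi>\<in>\<Xi>. \<Sum>x\<in>X. c x \<xi> * (\<psi> (\<eta> - \<xi>) * cis (- 2 * pi * (x \<bullet> (\<eta> - \<xi>)))))
        \<le> C2 * P * sqrt (\<Sum>\<xi>\<in>\<Xi>. \<Sum>x\<in>X. (norm (c x \<xi>))\<^sup>2)"
    using gabor_synthesis_L2[OF lattice1 lattice2, of R] by blast
  obtain C3 where C3: "C3 \<ge> 0"
    "\<And>\<psi> P \<Xi> c x. \<psi> \<in> borel_measurable borel \<Longrightarrow> (\<And>\<eta>. norm (\<psi> \<eta>) \<le> P) \<Longrightarrow> (\<And>\<eta>. \<psi> \<eta> \<noteq> 0 \<Longrightarrow> norm \<eta> \<le> R) \<Longrightarrow>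
      x \<in> \<Lambda>1 \<Longrightarrow> finite \<Xi> \<Longrightarrow> \<Xi> \<subseteq> \<Lambda>2 \<Longrightarrow>
      gabor_row \<Xi> c \<psi> x \<in> elems L2 \<and> nrm L2 (gabor_row \<Xi> c \<psi> x) \<le> C3 * P * L2_set (\<lambda>\<xi>. norm (c (x, \<xi>))) \<Xi>"
    using gabor_row_bound[of R] by blast
  show thesis
  proof (rule that[of "C1 * C2"])
    fix \<phi> \<psi> :: "'a \<Rightarrow> complex" and A P X \<Xi> and c :: "'a \<times> 'a \<Rightarrow> complex" and K
    assume \<phi>: "\<phi> \<in> borel_measurable borel" "\<And>t. norm (\<phi> t) \<le> 1" "\<And>t. \<phi> t \<noteq> 0 \<Longrightarrow> norm t \<le> R"
      and \<psi>: "\<psi> \<in> borel_measurable borel" "\<And>\<eta>. norm (\<psi> \<eta>) \<le> P" "\<And>\<eta>. \<psi> \<eta> \<noteq> 0 \<Longrightarrow> norm \<eta> \<le> R"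
      and A: "(\<integral>t. norm (\<phi> t) powr p \<partial>lborel) powr (1 / p) \<le> A"
      and X: "finite X" "X \<subseteq> \<Lambda>1" and \<Xi>: "finite \<Xi>" "\<Xi> \<subseteq> \<Lambda>2"
      and K: "K \<ge> 0" "\<And>x. x \<in> X \<Longrightarrow> row_norm w \<Xi> c x \<le> K"
    obtain xs where xs: "set xs = X" "distinct xs" using finite_distinct_list[OF X(1)] by blast
    have P0: "P \<ge> 0" using \<psi>(2) norm_ge_zero order_trans by blast
    have A0: "A \<ge> 0" using A powr_ge_zero order_trans by blast
    have w0: "w x > 0" for x by (rule weight_pos[OF weight])
    have row: "gabor_row \<Xi> c \<psi> x \<in> elems L2" if "x \<in> X" for x using C3(2)[OF \<psi> _ \<Xi>, of x c] that X(2) by blast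
    have rep: "represents_tensor (Lp p w) L2 (map (\<lambda>x. (\<lambda>t. \<phi> (t - x), gabor_row \<Xi> c \<psi> x)) xs)
      (fin_synth (X \<times> \<Xi>) c (\<lambda>z. \<phi> (fst z) * \<psi> (snd z)))"
      by (rule fin_synth_represents[OF X(1) translate_mem[OF \<phi>] row xs(2,1)])
    have "inj_tensor_norm (Lp p w) L2 (fin_synth (X \<times> \<Xi>) c (\<lambda>z. \<phi> (fst z) * \<psi> (snd z))) \<le> C1 * C2 * (A * P) * K"
    proof (rule inj_tensor_norm_le[OF weight weight_one p1 _ rep])
      fix l m :: "('a \<Rightarrow> complex) \<Rightarrow> complex" assume l: "l \<in> dual_ball (Lp p w)" and m: "m \<in> dual_ball L2"
      \<comment> \<open>A translate has weighted norm of order w x, so dividing by w x normalises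
        the first sequence; the factor returned to \<open>Mx\<close> is the one in
        \<open>row_norm\<close>.\<close>
      define Lx where "Lx x = l (\<lambda>t. \<phi> (t - x)) / of_real (w x)" for x
      define Mx where "Mx x = m (gabor_row \<Xi> c \<psi> x) * of_real (w x)" for x
      define S1 where "S1 = (\<Sum>x\<in>X. (norm (Lx x))\<^sup>2)"
      define S2 where "S2 = (\<Sum>x\<in>X. (norm (Mx x))\<^sup>2)"
      have S0: "S1 \<ge> 0" "S2 \<ge> 0" by (auto simp: S1_def S2_def intro: sum_nonneg)
      have 1: "sqrt S1 \<le> C1 * A"
      proof (rule square_norm_bound[OF _ _ S0(1)])
        \<comment> \<open>Chosen so that l maps the combination to the sum of |Lx|^2, while the
          weighted coefficients have absolute value |Lx|.\<close>
        let ?a = "\<lambda>x. cnj (Lx x) / of_real (w x)"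
        have e: "l (\<lambda>t. \<Sum>x\<in>X. ?a x * \<phi> (t - x)) = (\<Sum>x\<in>X. ?a x * l (\<lambda>t. \<phi> (t - x)))"
          by (rule dual_ball_sum[OF l weight p1 X(1) translate_mem[OF \<phi>]])
        show "of_real S1 = l (\<lambda>t. \<Sum>x\<in>X. ?a x * \<phi> (t - x))"
          unfolding e S1_def of_real_sum complex_norm_square
          by (intro sum.cong refl) (simp add: Lx_def)
        have "(\<lambda>t. \<Sum>x\<in>X. ?a x * \<phi> (t - x)) \<in> elems (Lp p w)"
          by (intro Lp_sum Lp_cmult translate_mem[OF \<phi>] weight p1)
        then have "norm (l (\<lambda>t. \<Sum>x\<in>X. ?a x * \<phi> (t - x))) \<le> nrm (Lp p w) (\<lambda>t. \<Sum>x\<in>X. ?a x * \<phi> (t - x))"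
          by (rule dual_ballD(3)[OF l])
        also have "\<dots> \<le> C1 * (\<integral>t. norm (\<phi> t) powr p \<partial>lborel) powr (1 / p) * (\<Sum>x\<in>X. (norm (?a x) * w x) powr p) powr (1 / p)"
          by (rule C1(2)[OF \<phi> X])
        also have "(\<Sum>x\<in>X. (norm (?a x) * w x) powr p) = (\<Sum>x\<in>X. norm (Lx x) powr p)"
          using w0 by (intro sum.cong refl) (simp add: norm_divide less_imp_neq[symmetric] abs_of_pos)
        also have "C1 * (\<integral>t. norm (\<phi> t) powr p \<partial>lborel) powr (1 / p) * (\<Sum>x\<in>X. norm (Lx x) powr p) powr (1 / p)
          \<le> C1 * A * sqrt S1"
        proof (intro mult_mono A)
          \<comment> \<open>Here \<open>p \<ge> 2\<close> enters.\<close>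
          have "(\<Sum>x\<in>X. norm (Lx x) powr p) powr (1 / p) \<le> (\<Sum>x\<in>X. norm (Lx x) powr 2) powr (1 / 2)"
            by (rule lp_norm_antimono[OF X(1)]) (use p2 in auto)
          then show "(\<Sum>x\<in>X. norm (Lx x) powr p) powr (1 / p) \<le> sqrt S1" using S0 by (simp add: S1_def powr_half_sqrt)
        qed (use C1(1) A0 in auto)
        finally show "norm (l (\<lambda>t. \<Sum>x\<in>X. ?a x * \<phi> (t - x))) \<le> C1 * A * sqrt S1" .
      qed (use C1(1) A0 in simp)
      have 2: "sqrt S2 \<le> C2 * P * K"
      proof (rule square_norm_bound[OF _ _ S0(2)])
        let ?a = "\<lambda>x. cnj (Mx x) * of_real (w x)"
        let ?G = "\<lambda>\<eta>. \<Sum>x\<in>X. ?a x * gabor_row \<Xi> c \<psi> x \<eta>"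
        have e: "m ?G = (\<Sum>x\<in>X. ?a x * m (gabor_row \<Xi> c \<psi> x))"
          by (rule dual_ball_sum[OF m weight_one _ X(1) row]) simp
        show "of_real S2 = m ?G"
          unfolding e S2_def of_real_sum complex_norm_square
          by (intro sum.cong refl) (simp add: Mx_def)
        have "?G \<in> elems L2" by (intro Lp_sum Lp_cmult row weight_one) auto
        then have "norm (m ?G) \<le> nrm L2 ?G" by (rule dual_ballD(3)[OF m])
        \<comment> \<open>The rows are merged into one double Gabor sum. Estimating them separately
          would give an \<ell>^1 sum over x; near-orthogonality of different frequencies x gives the
          \<ell>^2 sum.\<close>
        also have "nrm L2 ?G = nrm L2 (\<lambda>\<eta>. \<Sum>\<xi>\<in>\<Xi>. \<Sum>x\<in>X. (?a x * c (x, \<xi>)) * (\<psi> (\<eta> - \<xi>) * cis (- 2 * pi * (x \<bullet> (\<eta> - \<xi>)))))"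
          by (subst sum.swap) (simp add: gabor_row_def sum_distrib_left mult.assoc)
        also have "\<dots> \<le> C2 * P * sqrt (\<Sum>\<xi>\<in>\<Xi>. \<Sum>x\<in>X. (norm (?a x * c (x, \<xi>)))\<^sup>2)"
          using C2(2)[OF \<psi> X \<Xi>, of "\<lambda>x \<xi>. ?a x * c (x, \<xi>)"] by blast
        also have "(\<Sum>\<xi>\<in>\<Xi>. \<Sum>x\<in>X. (norm (?a x * c (x, \<xi>)))\<^sup>2) = (\<Sum>x\<in>X. (norm (Mx x))\<^sup>2 * (row_norm w \<Xi> c x)\<^sup>2)"
          by (subst sum.swap)
            (simp add: row_norm_def L2_set_def norm_mult power_mult_distrib sum_distrib_left mult_ac sum_nonneg)
        also have "C2 * P * sqrt \<dots> \<le> C2 * P * sqrt (\<Sum>x\<in>X. (norm (Mx x))\<^sup>2 * K\<^sup>2)"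
          using C2(1) P0 by (intro mult_left_mono real_sqrt_le_mono sum_mono power_mono K row_norm_nonneg) auto
        also have "\<dots> = C2 * P * K * sqrt S2"
          using K(1) by (simp add: S2_def sum_distrib_right[symmetric] real_sqrt_mult)
        finally show "norm (m ?G) \<le> C2 * P * K * sqrt S2" .
      qed (use C2(1) P0 K(1) in simp)
      have "(\<Sum>(f, g)\<leftarrow>map (\<lambda>x. (\<lambda>t. \<phi> (t - x), gabor_row \<Xi> c \<psi> x)) xs. l f * m g) = (\<Sum>x\<in>X. Lx x * Mx x)"
        using w0 by (simp add: o_def Lx_def Mx_def sum_list_distinct[OF xs(2,1)] less_imp_neq[symmetric])
      then have "norm (\<Sum>(f, g)\<leftarrow>map (\<lambda>x. (\<lambda>t. \<phi> (t - x), gabor_row \<Xi> c \<psi> x)) xs. l f * m g)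
        \<le> (\<Sum>x\<in>X. \<bar>norm (Lx x)\<bar> * \<bar>norm (Mx x)\<bar>)"
        by (simp only:) (rule order_trans[OF norm_sum], simp add: norm_mult)
      also have "\<dots> \<le> L2_set (\<lambda>x. norm (Lx x)) X * L2_set (\<lambda>x. norm (Mx x)) X" by (rule L2_set_mult_ineq)
      also have "\<dots> = sqrt S1 * sqrt S2" by (simp add: L2_set_def S1_def S2_def)
      also have "\<dots> \<le> (C1 * A) * (C2 * P * K)" using 1 2 S0 C1(1) A0 by (intro mult_mono) auto
      finally show "norm (\<Sum>(f, g)\<leftarrow>map (\<lambda>x. (\<lambda>t. \<phi> (t - x), gabor_row \<Xi> c \<psi> x)) xs. l f * m g) \<le> C1 * C2 * (A * P) * K"
        by (simp add: mult_ac)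
    qed simp
    then show "fin_synth (X \<times> \<Xi>) c (\<lambda>z. \<phi> (fst z) * \<psi> (snd z)) \<in> alg_tensor (Lp p w) L2 \<and>
      inj_tensor_norm (Lp p w) L2 (fin_synth (X \<times> \<Xi>) c (\<lambda>z. \<phi> (fst z) * \<psi> (snd z))) \<le> C1 * C2 * (A * P) * K"
      using rep by (auto simp: alg_tensor_def)
  qed (use C1 C2 in simp)
qed

end

subsection \<open>Synthesis\<close>

lemma schwartz_add: "\<phi> \<in> schwartz \<Longrightarrow> \<psi> \<in> schwartz \<Longrightarrow> (\<lambda>x. \<phi> x + \<psi> x) \<in> schwartz"
proof (rule schwartzI)
  fix N and vs :: "'a list" assume a: "\<phi> \<in> schwartz" "\<psi> \<in> schwartz" "vs \<in> lists Basis"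
  obtain C where C: "\<And>x. (1 + norm x) ^ N * norm (partials vs \<phi> x) \<le> C" using schwartz_bound[OF a(1,3)] by blast
  obtain D where D: "\<And>x. (1 + norm x) ^ N * norm (partials vs \<psi> x) \<le> D" using schwartz_bound[OF a(2,3)] by blast
  have "(1 + norm x) ^ N * norm (partials vs (\<lambda>x. \<phi> x + \<psi> x) x) \<le> C + D" for x
  proof -
    have "(1 + norm x) ^ N * norm (partials vs \<phi> x + partials vs \<psi> x)
      \<le> (1 + norm x) ^ N * (norm (partials vs \<phi> x) + norm (partials vs \<psi> x))"
      by (intro mult_left_mono norm_triangle_ineq) simp
    then show ?thesis
      unfolding partials_add[OF a(1,2)[THEN schwartzD] a(3)] using C[of x] D[of x] by (simp add: distrib_left)
  qed
  then show "\<exists>C. \<forall>x. (1 + norm x) ^ N * norm (partials vs (\<lambda>x. \<phi> x + \<psi> x) x) \<le> C" by blast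
qed (auto intro: smooth_add schwartzD)

lemma schwartz_cmult: "\<phi> \<in> schwartz \<Longrightarrow> (\<lambda>x. a * \<phi> x) \<in> schwartz"
proof (rule schwartzI)
  fix N and vs :: "'a list" assume \<phi>: "\<phi> \<in> schwartz" "vs \<in> lists Basis"
  obtain C where C: "\<And>x. (1 + norm x) ^ N * norm (partials vs \<phi> x) \<le> C" using schwartz_bound[OF \<phi>] by blast
  have "(1 + norm x) ^ N * norm (partials vs (\<lambda>x. a * \<phi> x) x) \<le> norm a * C" for x
    unfolding partials_cmult[OF schwartzD[OF \<phi>(1)] \<phi>(2)]
    using mult_left_mono[OF C[of x], of "norm a"] by (simp add: norm_mult mult_ac)
  then show "\<exists>C. \<forall>x. (1 + norm x) ^ N * norm (partials vs (\<lambda>x. a * \<phi> x) x) \<le> C" by blast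
qed (auto intro: smooth_mult smooth_const schwartzD)

section \<open>Functions of polynomial growth as tempered distributions\<close>

lemma schwartz_decay:
  fixes \<phi> :: "'a::euclidean_space \<Rightarrow> complex"
  assumes "\<phi> \<in> schwartz"
  shows "(1 + norm z) ^ n * norm (\<phi> z) \<le> schwartz_seminorm (n + 2 * DIM('a)) \<phi> * (1 / (1 + norm z) ^ (2 * DIM('a)))"
  using schwartz_seminorm_ge[OF assms, of z "n + 2 * DIM('a)"]
  by (simp add: field_simps power_add add_pos_nonneg)

lemma integrable_polynomial_decay_lebesgue:
  "integrable lebesgue (\<lambda>x::'a::euclidean_space. 1 / (1 + norm x) ^ (2 * DIM('a)))"
  using integrable_polynomial_decay by (subst integrable_completion) auto

lemma polynomial_growth_pairing:
  fixes h :: "'a::euclidean_space \<Rightarrow> complex"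
  assumes h: "h \<in> borel_measurable borel" "\<And>z. norm (h z) \<le> B * (1 + norm z) ^ n" and \<phi>: "\<phi> \<in> schwartz"
  shows "integrable lebesgue (\<lambda>z. h z * \<phi> z)"
    and "norm (h z * \<phi> z) \<le> B * schwartz_seminorm (n + 2 * DIM('a)) \<phi> * (1 / (1 + norm z) ^ (2 * DIM('a)))"
proof -
  have B: "B \<ge> 0" using order_trans[OF norm_ge_zero h(2)[of 0]] by simp
  show bd: "norm (h z * \<phi> z) \<le> B * schwartz_seminorm (n + 2 * DIM('a)) \<phi> * (1 / (1 + norm z) ^ (2 * DIM('a)))" for z
  proof -
    have "norm (h z * \<phi> z) \<le> (B * (1 + norm z) ^ n) * norm (\<phi> z)"
      unfolding norm_mult by (intro mult_right_mono h(2)) simp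
    also have "\<dots> \<le> B * (schwartz_seminorm (n + 2 * DIM('a)) \<phi> * (1 / (1 + norm z) ^ (2 * DIM('a))))"
      using mult_left_mono[OF schwartz_decay[OF \<phi>, of z n] B] by (simp add: mult.assoc)
    finally show ?thesis by (simp add: mult.assoc)
  qed
  show "integrable lebesgue (\<lambda>z. h z * \<phi> z)"
  proof (rule Bochner_Integration.integrable_bound)
    show "integrable lebesgue (\<lambda>z::'a. B * schwartz_seminorm (n + 2 * DIM('a)) \<phi> * (1 / (1 + norm z) ^ (2 * DIM('a))))"
      by (rule integrable_mult_right[OF integrable_polynomial_decay_lebesgue])
    have "(\<lambda>z. h z * \<phi> z) \<in> borel_measurable borel"
      using h(1) smooth_borel[OF schwartzD[OF \<phi>]] by simp
    then show "(\<lambda>z. h z * \<phi> z) \<in> borel_measurable lebesgue" by (auto intro: measurable_completion)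
    show "AE z in lebesgue. norm (h z * \<phi> z) \<le> norm (B * schwartz_seminorm (n + 2 * DIM('a)) \<phi> * (1 / (1 + norm z) ^ (2 * DIM('a))))"
      by (intro AE_I2) (simp only: real_norm_def, rule order_trans[OF bd abs_ge_self])
  qed
qed

lemma polynomial_growth_tempered:
  fixes h :: "'a::euclidean_space \<Rightarrow> complex"
  assumes h: "h \<in> borel_measurable borel" "\<And>z. norm (h z) \<le> B * (1 + norm z) ^ n"
  shows "restrict (pairing h) schwartz \<in> tempered"
  unfolding tempered_def
proof (intro CollectI conjI ballI allI)
  note P = polynomial_growth_pairing[OF h]
  show "restrict (pairing h) schwartz (\<lambda>x. \<phi> x + \<psi> x) = restrict (pairing h) schwartz \<phi> + restrict (pairing h) schwartz \<psi>"
    if "\<phi> \<in> schwartz" "\<psi> \<in> schwartz" for \<phi> \<psi>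
    using that P(1)[OF that(1)] P(1)[OF that(2)] by (simp add: schwartz_add pairing_def distrib_left)
  show "restrict (pairing h) schwartz (\<lambda>x. a * \<phi> x) = a * restrict (pairing h) schwartz \<phi>" if "\<phi> \<in> schwartz" for a \<phi>
  proof -
    have "(\<lambda>x. h x * (a * \<phi> x)) = (\<lambda>x. a * (h x * \<phi> x))" by (simp add: mult_ac)
    then show ?thesis using that by (simp add: schwartz_cmult pairing_def)
  qed
  let ?I = "\<integral>z. 1 / (1 + norm (z::'a)) ^ (2 * DIM('a)) \<partial>lebesgue"
  have "norm (restrict (pairing h) schwartz \<phi>) \<le> (B * ?I) * schwartz_seminorm (n + 2 * DIM('a)) \<phi>" if \<phi>: "\<phi> \<in> schwartz" for \<phi>
  proof -
    have "norm (pairing h \<phi>) \<le> (\<integral>z. norm (h z * \<phi> z) \<partial>lebesgue)" unfolding pairing_def by (rule integral_norm_bound)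
    also have "\<dots> \<le> (\<integral>z. B * schwartz_seminorm (n + 2 * DIM('a)) \<phi> * (1 / (1 + norm (z::'a)) ^ (2 * DIM('a))) \<partial>lebesgue)"
      by (rule integral_mono[OF integrable_norm[OF P(1)[OF \<phi>]]
            integrable_mult_right[OF integrable_polynomial_decay_lebesgue] P(2)[OF \<phi>]])
    also have "\<dots> = B * schwartz_seminorm (n + 2 * DIM('a)) \<phi> * ?I" by (rule integral_mult_right_zero)
    finally show ?thesis using \<phi> by (simp add: mult_ac)
  qed
  then show "\<exists>C N. \<forall>\<phi>\<in>schwartz. norm (restrict (pairing h) schwartz \<phi>) \<le> C * schwartz_seminorm N \<phi>" by blast
qed simp

section \<open>Truncation to lattice balls and convergence in the completion\<close>

definition lattice_ball :: "'a::euclidean_space set \<Rightarrow> nat \<Rightarrow> 'a set" where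
  "lattice_ball \<Lambda> k = \<Lambda> \<inter> cball 0 (real k)"

lemma lattice_ball_finite: "is_lattice \<Lambda> \<Longrightarrow> finite (lattice_ball \<Lambda> k)"
  unfolding lattice_ball_def by (rule lattice_finite_cball)

lemma lattice_ball_mono: "j \<le> k \<Longrightarrow> lattice_ball \<Lambda> j \<subseteq> lattice_ball \<Lambda> k"
  unfolding lattice_ball_def by auto

lemma lattice_ball_subset: "lattice_ball \<Lambda> k \<subseteq> \<Lambda>"
  unfolding lattice_ball_def by auto

lemma seminorm_sym:
  assumes N: "tensor_seminorm H N" and "h \<in> H" "k \<in> H"
  shows "N (\<lambda>z. h z - k z) \<le> N (\<lambda>z. k z - h z)"
  using tensor_seminormD(7)[OF N tensor_seminormD(1)[OF N] tensor_seminormD(6)[OF N assms(3,2)]]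
    tensor_seminormD(2)[OF N] by simp

text \<open>\<open>adm X \<Xi> c K\<close> stands for the statement that the block of c over X and
  \<Xi> has sequence norm at most K: a sum of row norms in the projective case, a maximum in the
  injective one. With it the synthesis argument is carried out once for both.\<close>

definition rank_one_bounded where
  "rank_one_bounded \<Lambda>1 \<Lambda>2 p H N adm R C \<longleftrightarrow> (\<forall>\<phi> \<psi> A P X \<Xi> c K.
      \<phi> \<in> borel_measurable borel \<longrightarrow> (\<forall>t. norm (\<phi> t) \<le> 1) \<longrightarrow> (\<forall>t. \<phi> t \<noteq> 0 \<longrightarrow> norm t \<le> R) \<longrightarrow>
      \<psi> \<in> borel_measurable borel \<longrightarrow> (\<forall>\<eta>. norm (\<psi> \<eta>) \<le> P) \<longrightarrow> (\<forall>\<eta>. \<psi> \<eta> \<noteq> 0 \<longrightarrow> norm \<eta> \<le> R) \<longrightarrow>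
      (\<integral>t. norm (\<phi> t) powr p \<partial>lborel) powr (1 / p) \<le> A \<longrightarrow>
      finite X \<longrightarrow> X \<subseteq> \<Lambda>1 \<longrightarrow> finite \<Xi> \<longrightarrow> \<Xi> \<subseteq> \<Lambda>2 \<longrightarrow> adm X \<Xi> c K \<longrightarrow>
      fin_synth (X \<times> \<Xi>) c (\<lambda>z. \<phi> (fst z) * \<psi> (snd z)) \<in> H \<and>
      N (fin_synth (X \<times> \<Xi>) c (\<lambda>z. \<phi> (fst z) * \<psi> (snd z))) \<le> C * (A * P) * K)"

text \<open>Finite synthesis is additive in the window and N is subadditive, so rank-one bounds add
  up to the total cost q. The constant does not grow with the number of terms.\<close>

lemma fin_synth_tensor_cost:
  assumes N: "tensor_seminorm H N" and r1: "rank_one_bounded \<Lambda>1 \<Lambda>2 p H N adm R C"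
    and X: "finite X" "X \<subseteq> \<Lambda>1" "finite \<Xi>" "\<Xi> \<subseteq> \<Lambda>2" "adm X \<Xi> c K"
    and t: "tensor_cost p R \<rho> q"
  shows "fin_synth (X \<times> \<Xi>) c \<rho> \<in> H \<and> N (fin_synth (X \<times> \<Xi>) c \<rho>) \<le> C * q * K"
  using t
proof induction
  case zero
  show ?case using tensor_seminormD(1,2)[OF N] by (simp add: fin_synth_zero[abs_def])
next
  case (step \<rho> q \<phi> \<psi> P A)
  have "fin_synth (X \<times> \<Xi>) c (\<lambda>z. \<phi> (fst z) * \<psi> (snd z)) \<in> H \<and>
      N (fin_synth (X \<times> \<Xi>) c (\<lambda>z. \<phi> (fst z) * \<psi> (snd z))) \<le> C * (A * P) * K"
    using r1 X step.hyps unfolding rank_one_bounded_def by blast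
  moreover have "fin_synth (X \<times> \<Xi>) c (\<lambda>z. \<phi> (fst z) * \<psi> (snd z) + \<rho> z)
    = (\<lambda>z. fin_synth (X \<times> \<Xi>) c (\<lambda>z. \<phi> (fst z) * \<psi> (snd z)) z + fin_synth (X \<times> \<Xi>) c \<rho> z)"
    by (rule ext) (rule fin_synth_add)
  ultimately show ?case
    using step.IH tensor_seminormD(4,5)[OF N, of "fin_synth (X \<times> \<Xi>) c (\<lambda>z. \<phi> (fst z) * \<psi> (snd z))" "fin_synth (X \<times> \<Xi>) c \<rho>"]
    by (auto simp: algebra_simps)
qed

lemma fin_synth_borel:
  assumes [measurable]: "\<rho> \<in> borel_measurable borel"
  shows "fin_synth M c \<rho> \<in> borel_measurable borel"
proof -
  have "(\<lambda>z. T_B0 \<mu> \<rho> z) \<in> borel_measurable borel" for \<mu> :: "'a \<times> 'a"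
  proof -
    have "(\<lambda>z. \<rho> (z - \<mu>)) \<in> borel_measurable borel" by measurable
    moreover have "(\<lambda>z::'a \<times> 'a. - 2 * pi * (fst \<mu> \<bullet> (snd z - snd \<mu>))) \<in> borel_measurable borel"
      by (intro borel_measurable_continuous_onI continuous_intros)
    ultimately show ?thesis unfolding T_B0_eq by measurable
  qed
  then show ?thesis unfolding fin_synth_def[abs_def] by (intro borel_measurable_sum borel_measurable_times) auto
qed

text \<open>At a point z only boundedly many lattice points contribute, and for those x is within R
  of the first component of z, so growth in x becomes growth in z. The bound is independent of X and
  \<Xi> and can serve in dominated convergence.\<close>

lemma fin_synth_growth:
  fixes \<Lambda>1 \<Lambda>2 :: "'a::euclidean_space set"
  assumes \<Lambda>: "is_lattice \<Lambda>1" "is_lattice \<Lambda>2" and X: "finite X" "X \<subseteq> \<Lambda>1" "finite \<Xi>" "\<Xi> \<subseteq> \<Lambda>2"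
    and c: "\<And>x \<xi>. x \<in> \<Lambda>1 \<Longrightarrow> \<xi> \<in> \<Lambda>2 \<Longrightarrow> norm (c (x, \<xi>)) \<le> D * (1 + norm x) ^ n" "D \<ge> 0"
    and \<rho>: "\<And>z. norm (\<rho> z) \<le> B" "B \<ge> 0" "\<And>z. \<rho> z \<noteq> 0 \<Longrightarrow> norm z \<le> R" "R \<ge> 0"
  shows "norm (fin_synth (X \<times> \<Xi>) c \<rho> z) \<le> (real (overlap \<Lambda>1 R * overlap \<Lambda>2 R) * (D * B * (1 + R) ^ n)) * (1 + norm z) ^ n"
proof -
  obtain t \<eta> where z: "z = (t, \<eta>)" by force
  let ?S = "{x\<in>X. norm (t - x) \<le> R} \<times> {\<xi>\<in>\<Xi>. norm (\<eta> - \<xi>) \<le> R}"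
  have supp: "norm (t - x) \<le> R \<and> norm (\<eta> - \<xi>) \<le> R" if "\<rho> (z - (x, \<xi>)) \<noteq> 0" for x \<xi>
    using \<rho>(3)[OF that] norm_fst_le[of "t - x" "\<eta> - \<xi>"] norm_snd_le[of "\<eta> - \<xi>" "t - x"]
    by (auto simp: z)
  have S: "finite ?S" "?S \<subseteq> X \<times> \<Xi>" using X by auto
  have "fin_synth (X \<times> \<Xi>) c \<rho> z = (\<Sum>\<mu>\<in>?S. c \<mu> * T_B0 \<mu> \<rho> z)"
    unfolding fin_synth_def
  proof (rule sum.mono_neutral_right)
    show "\<forall>\<mu>\<in>X \<times> \<Xi> - ?S. c \<mu> * T_B0 \<mu> \<rho> z = 0"
    proof
      fix \<mu> assume "\<mu> \<in> X \<times> \<Xi> - ?S"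
      then have "\<rho> (z - \<mu>) = 0" using supp by (cases \<mu>) blast
      then show "c \<mu> * T_B0 \<mu> \<rho> z = 0" by (simp add: T_B0_eq)
    qed
  qed (use S X in auto)
  also have "norm \<dots> \<le> (\<Sum>\<mu>\<in>?S. D * B * (1 + R) ^ n * (1 + norm z) ^ n)"
  proof (rule sum_norm_le)
    fix \<mu> assume \<mu>: "\<mu> \<in> ?S"
    then obtain x \<xi> where m: "\<mu> = (x, \<xi>)" "x \<in> \<Lambda>1" "\<xi> \<in> \<Lambda>2" "norm (t - x) \<le> R" using X by auto
    have "norm x \<le> norm t + R" using m(4) norm_triangle_sub[of x t] by (simp add: norm_minus_commute)
    also have "norm t \<le> norm z" unfolding z by (rule norm_fst_le)
    finally have "1 + norm x \<le> 1 + R + norm z + R * norm z"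
      using mult_nonneg_nonneg[OF \<rho>(4) norm_ge_zero[of z]] by linarith
    also have "\<dots> = (1 + R) * (1 + norm z)" by (simp add: algebra_simps)
    finally have "1 + norm x \<le> (1 + R) * (1 + norm z)" .
    then have "(1 + norm x) ^ n \<le> ((1 + R) * (1 + norm z)) ^ n" by (intro power_mono) auto
    then have "D * (1 + norm x) ^ n \<le> D * ((1 + R) ^ n * (1 + norm z) ^ n)"
      using c(2) by (simp add: power_mult_distrib mult_left_mono)
    with c(1)[OF m(2,3)] have "norm (c \<mu>) \<le> D * ((1 + R) ^ n * (1 + norm z) ^ n)" unfolding m(1) by linarith
    moreover have "norm (T_B0 \<mu> \<rho> z) \<le> B" using \<rho>(1)[of "z - \<mu>"] by (simp add: T_B0_eq norm_mult)
    ultimately have "norm (c \<mu> * T_B0 \<mu> \<rho> z) \<le> D * ((1 + R) ^ n * (1 + norm z) ^ n) * B"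
      unfolding norm_mult by (intro mult_mono) (auto intro: order_trans[OF norm_ge_zero])
    then show "norm (c \<mu> * T_B0 \<mu> \<rho> z) \<le> D * B * (1 + R) ^ n * (1 + norm z) ^ n" by (simp add: mult_ac)
  qed
  also have "\<dots> = real (card ?S) * (D * B * (1 + R) ^ n * (1 + norm z) ^ n)" by simp
  also have "\<dots> \<le> real (overlap \<Lambda>1 R * overlap \<Lambda>2 R) * (D * B * (1 + R) ^ n * (1 + norm z) ^ n)"
  proof (intro mult_right_mono)
    have "card ?S \<le> overlap \<Lambda>1 R * overlap \<Lambda>2 R"
      unfolding card_cartesian_product by (intro mult_mono overlap_bound \<Lambda> X) auto
    then show "real (card ?S) \<le> real (overlap \<Lambda>1 R * overlap \<Lambda>2 R)" by (rule of_nat_mono)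
  qed (use c(2) \<rho>(2,4) in auto)
  finally show ?thesis by (simp add: mult_ac)
qed

text \<open>Coefficient block and window change with the same k. Near a fixed z only the finite set
  \<open>F\<close> of lattice points matters, for all windows at once since they share the radius R,
  and from some k on it lies inside the block.\<close>

lemma fin_synth_tendsto_synth:
  fixes \<Lambda>1 \<Lambda>2 :: "'a::euclidean_space set"
  assumes \<Lambda>: "is_lattice \<Lambda>1" "is_lattice \<Lambda>2"
    and X: "\<And>z. (\<lambda>k. X k z) \<longlonglongrightarrow> chi z" "\<And>k z. X k z \<noteq> 0 \<Longrightarrow> norm z \<le> R" "\<And>z. chi z \<noteq> 0 \<Longrightarrow> norm z \<le> R"
  shows "(\<lambda>k. fin_synth (lattice_ball \<Lambda>1 k \<times> lattice_ball \<Lambda>2 k) c (X k) z) \<longlonglongrightarrow> synth (\<Lambda>1 \<times> \<Lambda>2) chi c z"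
proof -
  define F where "F = {\<mu>\<in>\<Lambda>1 \<times> \<Lambda>2. norm (z - \<mu>) \<le> R}"
  have "F \<subseteq> (\<Lambda>1 \<inter> cball (fst z) R) \<times> (\<Lambda>2 \<inter> cball (snd z) R)"
  proof
    fix \<mu> assume "\<mu> \<in> F"
    then show "\<mu> \<in> (\<Lambda>1 \<inter> cball (fst z) R) \<times> (\<Lambda>2 \<inter> cball (snd z) R)"
      using norm_fst_le[of "fst z - fst \<mu>" "snd z - snd \<mu>"] norm_snd_le[of "snd z - snd \<mu>" "fst z - fst \<mu>"]
      by (cases \<mu>; cases z) (auto simp: F_def dist_norm)
  qed
  then have F: "finite F" by (rule finite_subset) (intro finite_cartesian_product lattice_finite_cball \<Lambda>)
  have syn: "synth (\<Lambda>1 \<times> \<Lambda>2) chi c z = (\<Sum>\<mu>\<in>F. c \<mu> * T_B0 \<mu> chi z)"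
  proof -
    have "synth (\<Lambda>1 \<times> \<Lambda>2) chi c z = (\<Sum>\<^sub>\<infinity>\<mu>\<in>F. c \<mu> * T_B0 \<mu> chi z)"
      unfolding synth_def
    proof (rule infsum_cong_neutral)
      fix \<mu> assume "\<mu> \<in> \<Lambda>1 \<times> \<Lambda>2 - F"
      then have "chi (z - \<mu>) = 0" using X(3)[of "z - \<mu>"] by (auto simp: F_def)
      then show "c \<mu> * T_B0 \<mu> chi z = 0" by (simp add: T_B0_eq)
    qed (auto simp: F_def)
    then show ?thesis using F by simp
  qed
  obtain r where r: "\<And>\<mu>. \<mu> \<in> F \<Longrightarrow> norm \<mu> \<le> r" using finite_imp_bounded[OF F] by (auto simp: bounded_iff)
  have fs: "fin_synth (lattice_ball \<Lambda>1 k \<times> lattice_ball \<Lambda>2 k) c (X k) z = (\<Sum>\<mu>\<in>F. c \<mu> * T_B0 \<mu> (X k) z)" if k: "real k \<ge> r" for k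
    unfolding fin_synth_def
  proof (rule sum.mono_neutral_right)
    show "finite (lattice_ball \<Lambda>1 k \<times> lattice_ball \<Lambda>2 k)" by (intro finite_cartesian_product lattice_ball_finite \<Lambda>)
    show "F \<subseteq> lattice_ball \<Lambda>1 k \<times> lattice_ball \<Lambda>2 k"
    proof
      fix \<mu> assume m: "\<mu> \<in> F"
      then show "\<mu> \<in> lattice_ball \<Lambda>1 k \<times> lattice_ball \<Lambda>2 k"
        using r[OF m] k norm_fst_le[of "fst \<mu>" "snd \<mu>"] norm_snd_le[of "snd \<mu>" "fst \<mu>"]
        by (cases \<mu>) (auto simp: F_def lattice_ball_def)
    qed
    show "\<forall>\<mu>\<in>lattice_ball \<Lambda>1 k \<times> lattice_ball \<Lambda>2 k - F. c \<mu> * T_B0 \<mu> (X k) z = 0"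
    proof
      fix \<mu> assume "\<mu> \<in> lattice_ball \<Lambda>1 k \<times> lattice_ball \<Lambda>2 k - F"
      then have "X k (z - \<mu>) = 0" using X(2)[of k "z - \<mu>"] by (auto simp: F_def lattice_ball_def)
      then show "c \<mu> * T_B0 \<mu> (X k) z = 0" by (simp add: T_B0_eq)
    qed
  qed
  have "(\<lambda>k. \<Sum>\<mu>\<in>F. c \<mu> * T_B0 \<mu> (X k) z) \<longlonglongrightarrow> (\<Sum>\<mu>\<in>F. c \<mu> * T_B0 \<mu> chi z)"
    unfolding T_B0_eq by (intro tendsto_intros X(1))
  moreover have "\<forall>\<^sub>F k in sequentially. (\<Sum>\<mu>\<in>F. c \<mu> * T_B0 \<mu> (X k) z) = fin_synth (lattice_ball \<Lambda>1 k \<times> lattice_ball \<Lambda>2 k) c (X k) z"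
  proof (rule eventually_sequentiallyI[of "nat \<lceil>r\<rceil>"])
    fix k assume "nat \<lceil>r\<rceil> \<le> k"
    then have "real k \<ge> r" by linarith
    then show "(\<Sum>\<mu>\<in>F. c \<mu> * T_B0 \<mu> (X k) z) = fin_synth (lattice_ball \<Lambda>1 k \<times> lattice_ball \<Lambda>2 k) c (X k) z" by (simp add: fs)
  qed
  ultimately show ?thesis unfolding syn by (rule Lim_transform_eventually)
qed

text \<open>The witness is the k-th block of coefficients synthesised with the k-th step
  approximation. It is Cauchy in N by the tail hypothesis and the summability of q. The polynomial
  bound on c dominates all pairings, so the limit in the sense of distributions is the pointwise
  limit, that is, the synthesis with \<open>chi\<close>.\<close>

lemma synthesis_in_completion:
  fixes \<Lambda>1 \<Lambda>2 :: "'a::euclidean_space set" and chi :: "'a \<times> 'a \<Rightarrow> complex"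
  assumes \<Lambda>: "is_lattice \<Lambda>1" "is_lattice \<Lambda>2" and p: "p \<ge> 1" and chi: "chi \<in> test_functions U"
    and N: "tensor_seminorm H N" and r1: "\<And>R. \<exists>C\<ge>0. rank_one_bounded \<Lambda>1 \<Lambda>2 p H N adm R C"
  obtains B where "B \<ge> 0"
    "\<And>c K D n. (\<And>x \<xi>. x \<in> \<Lambda>1 \<Longrightarrow> \<xi> \<in> \<Lambda>2 \<Longrightarrow> norm (c (x, \<xi>)) \<le> D * (1 + norm x) ^ n) \<Longrightarrow> K \<ge> 0 \<Longrightarrow>
      (\<And>k. adm (lattice_ball \<Lambda>1 k) (lattice_ball \<Lambda>2 k) c K) \<Longrightarrow>
      (\<And>e. e > 0 \<Longrightarrow> \<exists>J. \<forall>j\<ge>J. \<forall>k\<ge>j. adm (lattice_ball \<Lambda>1 k) (lattice_ball \<Lambda>2 k) (\<lambda>\<mu>. if \<mu> \<in> lattice_ball \<Lambda>1 j \<times> lattice_ball \<Lambda>2 j then 0 else c \<mu>) e) \<Longrightarrow>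
      \<exists>u\<in>tempered. \<exists>h. approximates H N h u \<and> (\<forall>k. N (h k) \<le> B * K) \<and> represents_dist (synth (\<Lambda>1 \<times> \<Lambda>2) chi c) u"
proof -
  obtain X q R M where R: "R > 0" and M: "M \<ge> 0" and t0: "tensor_cost p R (X 0) (q 0)"
    and tS: "\<And>k. tensor_cost p R (\<lambda>z. X (Suc k) z - X k z) (q (Suc k))" and sq: "summable q" and q0: "\<And>k. q k \<ge> 0"
    and XM: "\<And>k z. norm (X k z) \<le> M" and XR: "\<And>k z. X k z \<noteq> 0 \<Longrightarrow> norm z \<le> R"
    and Xlim: "\<And>z. (\<lambda>k. X k z) \<longlonglongrightarrow> chi z" and chiR: "\<And>z. chi z \<noteq> 0 \<Longrightarrow> norm z \<le> R"
    by (rule dyadic_decomposition[OF chi p]) (rule that)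
  obtain C where C: "C \<ge> 0" "rank_one_bounded \<Lambda>1 \<Lambda>2 p H N adm R C" using r1 by blast
  note fst = fin_synth_tensor_cost[OF N C(2)]
  define Q where "Q k = (\<Sum>i\<le>k. q i)" for k
  define S where "S = suminf q"
  have QS: "Q k \<le> S" for k unfolding Q_def S_def by (intro sum_le_suminf sq) (use q0 in auto)
  have Q0: "Q k \<ge> 0" for k unfolding Q_def by (intro sum_nonneg q0)
  have S0: "S \<ge> 0" using Q0[of 0] QS[of 0] by linarith
  have Qlim: "Q \<longlonglongrightarrow> S" unfolding Q_def S_def by (rule summable_LIMSEQ'[OF sq])
  have tX: "tensor_cost p R (X k) (Q k)" for k
  proof (induction k)
    case (Suc k)
    have "tensor_cost p R (\<lambda>z. X k z + (X (Suc k) z - X k z)) (Q k + q (Suc k))" by (rule tensor_cost_add[OF Suc tS])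
    then show ?case by (simp add: Q_def)
  qed (use t0 in \<open>simp add: Q_def\<close>)
  have tD: "tensor_cost p R (\<lambda>z. X k z - X j z) (Q k - Q j)" if "j \<le> k" for j k
    using that
  proof (induction k rule: dec_induct)
    case base show ?case using tensor_cost.zero by simp
  next
    case (step k)
    have "tensor_cost p R (\<lambda>z. (X k z - X j z) + (X (Suc k) z - X k z)) ((Q k - Q j) + q (Suc k))" by (rule tensor_cost_add[OF step.IH tS])
    moreover have "(Q k - Q j) + q (Suc k) = Q (Suc k) - Q j" by (simp add: Q_def)
    ultimately show ?case by simp
  qed
  show thesis
  proof (rule that[of "C * S"])
    fix c :: "'a \<times> 'a \<Rightarrow> complex" and K D n
    assume growth: "\<And>x \<xi>. x \<in> \<Lambda>1 \<Longrightarrow> \<xi> \<in> \<Lambda>2 \<Longrightarrow> norm (c (x, \<xi>)) \<le> D * (1 + norm x) ^ n" and K: "K \<ge> 0"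
      and adm: "\<And>k. adm (lattice_ball \<Lambda>1 k) (lattice_ball \<Lambda>2 k) c K"
      and tail: "\<And>e. e > 0 \<Longrightarrow> \<exists>J. \<forall>j\<ge>J. \<forall>k\<ge>j. adm (lattice_ball \<Lambda>1 k) (lattice_ball \<Lambda>2 k) (\<lambda>\<mu>. if \<mu> \<in> lattice_ball \<Lambda>1 j \<times> lattice_ball \<Lambda>2 j then 0 else c \<mu>) e"
    \<comment> \<open>The growth bound at the lattice point 0 forces D to be nonnegative.\<close>
    have "0 \<in> \<Lambda>1" "0 \<in> \<Lambda>2" using \<Lambda> by (auto simp: is_lattice_def)
    from order_trans[OF norm_ge_zero growth[OF this]] have D: "D \<ge> 0" by simp
    let ?M = "\<lambda>k. lattice_ball \<Lambda>1 k \<times> lattice_ball \<Lambda>2 k"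
    note lats = lattice_ball_finite[OF \<Lambda>(1)] lattice_ball_subset lattice_ball_finite[OF \<Lambda>(2)] lattice_ball_subset
    define h where "h k = fin_synth (?M k) c (X k)" for k
    have h: "h k \<in> H" "N (h k) \<le> C * Q k * K" for k
      using fst[OF lats adm tX] by (auto simp: h_def)
    have hle: "N (h k) \<le> C * S * K" for k
      using h(2)[of k] mult_right_mono[OF mult_left_mono[OF QS[of k] C(1)] K] by linarith
    let ?h = "synth (\<Lambda>1 \<times> \<Lambda>2) chi c"
    define B where "B = real (overlap \<Lambda>1 R * overlap \<Lambda>2 R) * (D * M * (1 + R) ^ n)"
    have hB: "norm (h k z) \<le> B * (1 + norm z) ^ n" for k z
      unfolding h_def B_def by (rule fin_synth_growth[OF \<Lambda> lats growth D XM M XR less_imp_le[OF R]])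
    have hlim: "(\<lambda>k. h k z) \<longlonglongrightarrow> ?h z" for z
      unfolding h_def by (rule fin_synth_tendsto_synth[OF \<Lambda> Xlim XR chiR])
    have hm: "h k \<in> borel_measurable borel" for k unfolding h_def by (intro fin_synth_borel tensor_cost_borel[OF tX])
    have sm: "?h \<in> borel_measurable borel" by (rule borel_measurable_LIMSEQ_metric[OF hm hlim])
    have sB: "norm (?h z) \<le> B * (1 + norm z) ^ n" for z
      by (rule LIMSEQ_le_const2[OF tendsto_norm[OF hlim]]) (use hB in blast)
    define u where "u = restrict (pairing ?h) schwartz"
    have u: "u \<in> tempered" unfolding u_def by (rule polynomial_growth_tempered[OF sm sB])
    have rep: "represents_dist ?h u"
      using test_functions_schwartz by (auto simp: represents_dist_def u_def)
    have pl: "(\<lambda>k. pairing (h k) \<phi>) \<longlonglongrightarrow> u \<phi>" if \<phi>: "\<phi> \<in> schwartz" for \<phi>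
    proof -
      have "(\<lambda>k. \<integral>z. h k z * \<phi> z \<partial>lebesgue) \<longlonglongrightarrow> (\<integral>z. ?h z * \<phi> z \<partial>lebesgue)"
      proof (rule integral_dominated_convergence)
        show "(\<lambda>z. ?h z * \<phi> z) \<in> borel_measurable lebesgue" "(\<lambda>z. h k z * \<phi> z) \<in> borel_measurable lebesgue" for k
          using polynomial_growth_pairing(1)[OF sm sB \<phi>] polynomial_growth_pairing(1)[OF hm hB \<phi>, of k] by auto
        show "integrable lebesgue (\<lambda>z::'a\<times>'a. B * schwartz_seminorm (n + 2 * DIM('a \<times> 'a)) \<phi> * (1 / (1 + norm z) ^ (2 * DIM('a \<times> 'a))))"
          by (rule integrable_mult_right[OF integrable_polynomial_decay_lebesgue])
        show "AE z in lebesgue. (\<lambda>k. h k z * \<phi> z) \<longlonglongrightarrow> ?h z * \<phi> z"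
          by (intro AE_I2 tendsto_mult hlim tendsto_const)
        show "AE z in lebesgue. norm (h k z * \<phi> z) \<le> B * schwartz_seminorm (n + 2 * DIM('a \<times> 'a)) \<phi> * (1 / (1 + norm z) ^ (2 * DIM('a \<times> 'a)))" for k
          by (intro AE_I2 polynomial_growth_pairing(2)[OF hm hB \<phi>])
      qed
      then show ?thesis using \<phi> by (simp add: u_def pairing_def)
    qed
    have diff: "N (\<lambda>z. h k z - h j z) \<le> C * S * e + C * (S - Q j) * K"
      if jk: "j \<le> k" and e: "e \<ge> 0" and a: "adm (lattice_ball \<Lambda>1 k) (lattice_ball \<Lambda>2 k) (\<lambda>\<mu>. if \<mu> \<in> ?M j then 0 else c \<mu>) e" for j k e
    proof -
      let ?f = "fin_synth (?M k) (\<lambda>\<mu>. if \<mu> \<in> ?M j then 0 else c \<mu>) (X k)"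
      let ?g = "fin_synth (?M j) c (\<lambda>z. X k z - X j z)"
      have f: "?f \<in> H" "N ?f \<le> C * Q k * e" using fst[OF lats a tX] by auto
      have g: "?g \<in> H" "N ?g \<le> C * (Q k - Q j) * K" using fst[OF lats adm tD[OF jk]] by auto
      have sub: "?M j \<subseteq> ?M k" using lattice_ball_mono[OF jk] by blast
      have fin: "finite (?M k)" by (intro finite_cartesian_product lats)
      \<comment> \<open>Coefficients outside the j-th block with the window \<open>X k\<close>, plus
        the j-th block with the window \<open>X k - X j\<close>: one error from truncation, one from
        discretisation.\<close>
      have "h k z - h j z = ?f z + ?g z" for z
      proof -
        have "?f z = (\<Sum>\<mu>\<in>?M k - ?M j. c \<mu> * T_B0 \<mu> (X k) z)"
          unfolding fin_synth_def by (rule sum.mono_neutral_cong_right) (use fin in auto)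
        also have "\<dots> = h k z - fin_synth (?M j) c (X k) z"
          unfolding h_def fin_synth_def using sum_diff[OF fin sub] by auto
        finally show ?thesis by (simp add: fin_synth_diff h_def)
      qed
      then have "N (\<lambda>z. h k z - h j z) \<le> N ?f + N ?g" using tensor_seminormD(5)[OF N f(1) g(1)] by simp
      also have "\<dots> \<le> C * Q k * e + C * (Q k - Q j) * K" using f g by linarith
      also have "\<dots> \<le> C * S * e + C * (S - Q j) * K"
        using QS[of k] C(1) K e by (intro add_mono mult_right_mono mult_left_mono) auto
      finally show ?thesis .
    qed
    have cauchy: "\<exists>J. \<forall>j\<ge>J. \<forall>k\<ge>J. N (\<lambda>z. h j z - h k z) < e" if e: "e > 0" for e
    proof -
      \<comment> \<open>Leaves e / 2 for each of the two errors; the 1 in the denominator covers C S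
        = 0.\<close>
      define e1 where "e1 = e / (2 * (C * S + 1))"
      have CS: "C * S \<ge> 0" "C * K \<ge> 0" using C(1) S0 K by auto
      have e1: "e1 > 0" unfolding e1_def using e CS by (intro divide_pos_pos) auto
      have l1: "C * S * e1 < e / 2"
      proof -
        have "C * S * e1 < (C * S + 1) * e1" using e1 by simp
        also have "\<dots> = e / 2" using CS by (simp add: e1_def field_simps)
        finally show ?thesis .
      qed
      obtain J1 where J1: "\<And>j k. j \<ge> J1 \<Longrightarrow> k \<ge> j \<Longrightarrow> adm (lattice_ball \<Lambda>1 k) (lattice_ball \<Lambda>2 k) (\<lambda>\<mu>. if \<mu> \<in> ?M j then 0 else c \<mu>) e1"
        using tail[OF e1] by blast
      have "(\<lambda>j. C * (S - Q j) * K) \<longlonglongrightarrow> C * (S - S) * K" by (intro tendsto_intros Qlim)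
      then have "\<forall>\<^sub>F j in sequentially. C * (S - Q j) * K < e / 2" using e by (intro order_tendstoD(2)) auto
      then obtain J2 where J2: "\<And>j. j \<ge> J2 \<Longrightarrow> C * (S - Q j) * K < e / 2" by (auto simp: eventually_sequentially)
      have lt: "N (\<lambda>z. h k z - h j z) < e" if "j \<ge> max J1 J2" "k \<ge> j" for j k
        using diff[OF that(2) less_imp_le[OF e1] J1] J2[of j] l1 that by auto
      have "N (\<lambda>z. h j z - h k z) < e" if "j \<ge> max J1 J2" "k \<ge> max J1 J2" for j k
      proof (cases "k \<ge> j")
        case True
        then show ?thesis using seminorm_sym[OF N h(1)[of j] h(1)[of k]] lt[OF that(1) True] by linarith
      next
        case False
        then show ?thesis using lt[OF that(2), of j] by simp
      qed
      then show ?thesis by blast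
    qed
    have "approximates H N h u" unfolding approximates_def using h(1) cauchy pl by blast
    then show "\<exists>u\<in>tempered. \<exists>h. approximates H N h u \<and> (\<forall>k. N (h k) \<le> C * S * K) \<and> represents_dist ?h u"
      using u hle rep by blast
  qed (use C(1) S0 in simp)
qed

subsection \<open>Analysis with a product window\<close>

lemma smooth_fst: "smooth \<phi> \<Longrightarrow> smooth (\<lambda>z::'a::euclidean_space \<times> 'b::euclidean_space. \<phi> (fst z + a))"
proof (rule smooth_affine)
  show "linear (fst :: 'a \<times> 'b \<Rightarrow> 'a)" by (rule linear_fst)
  show "\<exists>r. \<exists>b'\<in>Basis. fst b = r *\<^sub>R b'" if "b \<in> Basis" for b :: "'a \<times> 'b"
  proof (cases "fst b = 0")
    case True
    then show ?thesis by (intro exI[of _ 0] bexI[OF _ SOME_Basis]) simp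
  next
    case False
    then have "fst b \<in> Basis" using that by (auto simp: Basis_prod_def)
    then show ?thesis by (intro exI[of _ 1] bexI[of _ "fst b"]) auto
  qed
qed

lemma smooth_snd: "smooth \<psi> \<Longrightarrow> smooth (\<lambda>z::'a::euclidean_space \<times> 'b::euclidean_space. \<psi> (snd z + a))"
proof (rule smooth_affine)
  show "linear (snd :: 'a \<times> 'b \<Rightarrow> 'b)" by (rule linear_snd)
  show "\<exists>r. \<exists>b'\<in>Basis. snd b = r *\<^sub>R b'" if "b \<in> Basis" for b :: "'a \<times> 'b"
  proof (cases "snd b = 0")
    case True
    then show ?thesis by (intro exI[of _ 0] bexI[OF _ SOME_Basis]) simp
  next
    case False
    then have "snd b \<in> Basis" using that by (auto simp: Basis_prod_def)
    then show ?thesis by (intro exI[of _ 1] bexI[of _ "snd b"]) auto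
  qed
qed

lemma smooth_slice_fst:
  fixes chi :: "'a::euclidean_space \<times> 'b::euclidean_space \<Rightarrow> complex"
  assumes "smooth chi" shows "smooth (\<lambda>t. chi (r *\<^sub>R t + a, \<eta>))"
proof -
  have "smooth (\<lambda>t. chi ((r *\<^sub>R t, 0) + (a, \<eta>)))"
  proof (rule smooth_affine[OF _ _ assms])
    show "linear (\<lambda>t::'a. (r *\<^sub>R t, 0::'b))" by (rule linearI) (auto simp: algebra_simps)
    show "\<exists>s. \<exists>b'\<in>Basis. (r *\<^sub>R b, 0::'b) = s *\<^sub>R b'" if "b \<in> Basis" for b :: 'a
      by (intro exI[of _ r] bexI[of _ "(b, 0)"]) (use that in \<open>auto simp: Basis_prod_def\<close>)
  qed
  then show ?thesis by simp
qed

lemma smooth_slice_snd: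
  fixes chi :: "'a::euclidean_space \<times> 'b::euclidean_space \<Rightarrow> complex"
  assumes "smooth chi" shows "smooth (\<lambda>\<eta>. chi (t, r *\<^sub>R \<eta> + a))"
proof -
  have "smooth (\<lambda>\<eta>. chi ((0, r *\<^sub>R \<eta>) + (t, a)))"
  proof (rule smooth_affine[OF _ _ assms])
    show "linear (\<lambda>\<eta>::'b. (0::'a, r *\<^sub>R \<eta>))" by (rule linearI) (auto simp: algebra_simps)
    show "\<exists>s. \<exists>b'\<in>Basis. (0::'a, r *\<^sub>R b) = s *\<^sub>R b'" if "b \<in> Basis" for b :: 'b
      by (intro exI[of _ r] bexI[of _ "(0, b)"]) (use that in \<open>auto simp: Basis_prod_def\<close>)
  qed
  then show ?thesis by simp
qed

lemma test_functions_support_bounded: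
  assumes "\<phi> \<in> test_functions U"
  obtains R where "R > 0" "\<And>z. \<phi> z \<noteq> 0 \<Longrightarrow> norm z \<le> R"
proof -
  have "bounded {x. \<phi> x \<noteq> 0}"
    using assms compact_imp_bounded bounded_subset[OF _ closure_subset] by (auto simp: test_functions_def)
  then obtain R where "\<And>z. \<phi> z \<noteq> 0 \<Longrightarrow> norm z \<le> R" by (auto simp: bounded_iff)
  then have "\<And>z. \<phi> z \<noteq> 0 \<Longrightarrow> norm z \<le> \<bar>R\<bar> + 1" by (meson abs_ge_self add_increasing2 order_trans zero_le_one)
  then show thesis using that[of "\<bar>R\<bar> + 1"] by simp
qed

lemma integral_pos_of_continuous:
  fixes g :: "'a::euclidean_space \<Rightarrow> real"
  assumes int: "integrable lebesgue g" and g: "continuous_on UNIV g" "\<And>z. g z \<ge> 0" "g a > 0"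
  shows "integral\<^sup>L lebesgue g > 0"
proof -
  have "integral\<^sup>L lebesgue g \<noteq> 0"
  proof
    assume "integral\<^sup>L lebesgue g = 0"
    then have "AE z in lebesgue. g z = 0" using integral_nonneg_eq_0_iff_AE[OF int] g(2) by simp
    then have "negligible {z. g z \<noteq> 0}" by (simp add: negligible_iff_null_sets eventually_ae_filter) (meson completion.complete2)
    moreover have "open {z. g z \<noteq> 0}" using g(1) by (intro open_Collect_neq continuous_on_const)
    ultimately show False using open_not_negligible g(3) by fastforce
  qed
  moreover have "integral\<^sup>L lebesgue g \<ge> 0" by (intro integral_nonneg_AE AE_I2 g(2))
  ultimately show ?thesis by linarith
qed

lemma smooth_bounded_support_bound:
  fixes \<phi> :: "'a::euclidean_space \<Rightarrow> complex"
  assumes "smooth \<phi>" "\<And>t. \<phi> t \<noteq> 0 \<Longrightarrow> norm t \<le> R"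
  obtains P where "P > 0" "\<And>t. norm (\<phi> t) \<le> P"
proof -
  have "\<phi> \<in> test_functions UNIV" by (rule test_functionsI[OF assms])
  from test_functions_partials_bounded[OF this, of "[]" 0] obtain P where "\<And>t. norm (\<phi> t) \<le> P" by auto
  then have "\<And>t. norm (\<phi> t) \<le> \<bar>P\<bar> + 1" by (meson abs_ge_self add_increasing2 order_trans zero_le_one)
  then show thesis using that[of "\<bar>P\<bar> + 1"] by simp
qed

text \<open>A product window inside \<open>U\<close> that is not orthogonal to \<open>chi\<close>: slices of \<open>|chi|\<^sup>2\<close> through a point
  where \<open>chi\<close> does not vanish, contracted towards that point.\<close>

lemma product_window:
  fixes chi :: "'a::euclidean_space \<times> 'a \<Rightarrow> complex"
  assumes chi: "chi \<in> test_functions U" and nz: "chi \<noteq> (\<lambda>_. 0)"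
  obtains \<phi> \<psi> :: "'a \<Rightarrow> complex" and R P where "smooth \<phi>" "smooth \<psi>"
    "\<And>t. \<phi> t \<noteq> 0 \<Longrightarrow> norm t \<le> R" "\<And>\<eta>. \<psi> \<eta> \<noteq> 0 \<Longrightarrow> norm \<eta> \<le> R" "R > 0"
    "\<And>t. norm (\<phi> t) \<le> P" "\<And>\<eta>. norm (\<psi> \<eta>) \<le> P" "P > 0"
    "\<And>t \<eta>. \<phi> t \<noteq> 0 \<Longrightarrow> \<psi> \<eta> \<noteq> 0 \<Longrightarrow> (t, \<eta>) \<in> U"
    "(\<integral>z. chi z * (\<phi> (fst z) * \<psi> (snd z)) \<partial>lborel) \<noteq> 0"
proof -
  have s: "smooth chi" using chi by (rule test_functions_smooth)
  obtain a b where ab: "chi (a, b) \<noteq> 0" using nz by force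
  define v where "v = chi (a, b)"
  have v: "v \<noteq> 0" using ab by (simp add: v_def)
  obtain R0 where R0: "R0 > 0" "\<And>z. chi z \<noteq> 0 \<Longrightarrow> norm z \<le> R0" using test_functions_support_bounded[OF chi] by blast
  have cont: "continuous_on UNIV (\<lambda>z. Re (cnj v * chi z))"
    using smooth_continuous[OF s] by (intro continuous_intros)
  have "Re (cnj v * chi (a, b)) = (norm v)\<^sup>2"
    by (simp add: v_def[symmetric] cmod_power2 flip: power2_eq_square)
  then have "Re (cnj v * chi (a, b)) > 0" using v by simp
  then have "\<exists>d>0. \<forall>z. dist z (a, b) < d \<longrightarrow> Re (cnj v * chi z) > 0"
  proof -
    have "open {z. Re (cnj v * chi z) > 0}" using cont by (intro open_Collect_less continuous_on_const)
    then obtain d where "d > 0" "ball (a, b) d \<subseteq> {z. Re (cnj v * chi z) > 0}"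
      using \<open>Re (cnj v * chi (a, b)) > 0\<close> unfolding open_contains_ball by blast
    then show ?thesis by (auto simp: dist_commute subset_iff intro!: exI[of _ d])
  qed
  then obtain d where d: "d > 0" "\<And>z. dist z (a, b) < d \<Longrightarrow> Re (cnj v * chi z) > 0" by blast
  \<comment> \<open>T bounds r |t - a| and r |\<eta> - b| on the supports of the contracted slices.
    With the r below, T / r < d / 2, so the product support lies in the ball of radius d where the
    real part of cnj(v) chi is positive.\<close>
  define T where "T = R0 + norm a + norm b"
  define r where "r = 1 + 2 * T / d"
  have T: "T > 0" using R0 by (simp add: T_def add_pos_nonneg)
  have r: "r > 1" "T / r < d / 2"
  proof -
    show "r > 1" using T d(1) by (simp add: r_def)
    have "T < (d / 2) * r" using T d(1) by (simp add: r_def algebra_simps)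
    then show "T / r < d / 2" using \<open>r > 1\<close> by (simp add: field_simps)
  qed
  define f where "f t = chi (r *\<^sub>R t + (1 - r) *\<^sub>R a, b)" for t
  define g where "g \<eta> = chi (a, r *\<^sub>R \<eta> + (1 - r) *\<^sub>R b)" for \<eta>
  \<comment> \<open>The squared modulus is nonnegative like the modulus, but also smooth.\<close>
  define \<phi> where "\<phi> t = f t * cnj (f t)" for t
  define \<psi> where "\<psi> \<eta> = g \<eta> * cnj (g \<eta>)" for \<eta>
  have sf: "smooth f" unfolding f_def by (rule smooth_slice_fst[OF s])
  have sg: "smooth g" unfolding g_def by (rule smooth_slice_snd[OF s])
  have s\<phi>: "smooth \<phi>" unfolding \<phi>_def by (intro smooth_mult smooth_cnj sf)
  have s\<psi>: "smooth \<psi>" unfolding \<psi>_def by (intro smooth_mult smooth_cnj sg)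
  have \<phi>r: "\<phi> t = of_real ((norm (f t))\<^sup>2)" for t unfolding \<phi>_def by (simp only: complex_norm_square)
  have \<psi>r: "\<psi> \<eta> = of_real ((norm (g \<eta>))\<^sup>2)" for \<eta> unfolding \<psi>_def by (simp only: complex_norm_square)
  have near1: "norm (t - a) < d / 2" if "\<phi> t \<noteq> 0" for t
  proof -
    have "norm (r *\<^sub>R t + (1 - r) *\<^sub>R a) \<le> R0"
      using order_trans[OF norm_fst_le R0(2)[of "(r *\<^sub>R t + (1 - r) *\<^sub>R a, b)"]] that by (auto simp: \<phi>_def f_def)
    moreover have "r *\<^sub>R (t - a) = (r *\<^sub>R t + (1 - r) *\<^sub>R a) - a" by (simp add: algebra_simps)
    ultimately have "norm (r *\<^sub>R (t - a)) \<le> R0 + norm a" using norm_triangle_ineq4 order_trans by (metis add_right_mono)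
    then have "r * norm (t - a) \<le> R0 + norm a" using r(1) by simp
    then have "r * norm (t - a) \<le> T" unfolding T_def using norm_ge_zero[of b] by linarith
    then have "norm (t - a) \<le> T / r" using r(1) by (simp add: field_simps)
    then show ?thesis using r(2) by linarith
  qed
  have near2: "norm (\<eta> - b) < d / 2" if "\<psi> \<eta> \<noteq> 0" for \<eta>
  proof -
    have "norm (r *\<^sub>R \<eta> + (1 - r) *\<^sub>R b) \<le> R0"
      using order_trans[OF norm_snd_le R0(2)[of "(a, r *\<^sub>R \<eta> + (1 - r) *\<^sub>R b)"]] that by (auto simp: \<psi>_def g_def)
    moreover have "r *\<^sub>R (\<eta> - b) = (r *\<^sub>R \<eta> + (1 - r) *\<^sub>R b) - b" by (simp add: algebra_simps)
    ultimately have "norm (r *\<^sub>R (\<eta> - b)) \<le> R0 + norm b" using norm_triangle_ineq4 order_trans by (metis add_right_mono)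
    then have "r * norm (\<eta> - b) \<le> R0 + norm b" using r(1) by simp
    then have "r * norm (\<eta> - b) \<le> T" unfolding T_def using norm_ge_zero[of a] by linarith
    then have "norm (\<eta> - b) \<le> T / r" using r(1) by (simp add: field_simps)
    then show ?thesis using r(2) by linarith
  qed
  have pos: "Re (cnj v * chi (t, \<eta>)) > 0" if "\<phi> t \<noteq> 0" "\<psi> \<eta> \<noteq> 0" for t \<eta>
  proof (rule d(2))
    have "dist (t, \<eta>) (a, b) \<le> norm (t - a) + norm (\<eta> - b)"
      using norm_Pair_le[of "t - a" "\<eta> - b"] by (simp add: dist_norm)
    then show "dist (t, \<eta>) (a, b) < d" using near1[OF that(1)] near2[OF that(2)] by linarith
  qed
  have inU: "(t, \<eta>) \<in> U" if "\<phi> t \<noteq> 0" "\<psi> \<eta> \<noteq> 0" for t \<eta>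
  proof -
    have "chi (t, \<eta>) \<noteq> 0" using pos[OF that] by auto
    then have "(t, \<eta>) \<in> closure {z. chi z \<noteq> 0}" by (intro subsetD[OF closure_subset]) simp
    then show ?thesis using chi by (auto simp: test_functions_def)
  qed
  define R where "R = norm a + norm b + d"
  have \<phi>R: "norm t \<le> R" if "\<phi> t \<noteq> 0" for t
    using near1[OF that] norm_triangle_sub[of t a] norm_ge_zero[of b] d(1) unfolding R_def by linarith
  have \<psi>R: "norm \<eta> \<le> R" if "\<psi> \<eta> \<noteq> 0" for \<eta>
    using near2[OF that] norm_triangle_sub[of \<eta> b] norm_ge_zero[of a] d(1) unfolding R_def by linarith
  obtain P1 where P1: "P1 > 0" "\<And>t. norm (\<phi> t) \<le> P1" using smooth_bounded_support_bound[OF s\<phi> \<phi>R] by blast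
  obtain P2 where P2: "P2 > 0" "\<And>t. norm (\<psi> t) \<le> P2" using smooth_bounded_support_bound[OF s\<psi> \<psi>R] by blast
  let ?h = "\<lambda>z. chi z * (\<phi> (fst z) * \<psi> (snd z))"
  have sh: "smooth ?h"
    using smooth_fst[OF s\<phi>, of 0] smooth_snd[OF s\<psi>, of 0] by (intro smooth_mult s) simp_all
  have hS: "norm z \<le> R0" if "?h z \<noteq> 0" for z using that R0(2)[of z] by auto
  have "?h \<in> test_functions UNIV" by (rule test_functionsI[OF sh hS])
  then have "?h \<in> schwartz" by (rule test_functions_schwartz)
  then have "integrable lebesgue (\<lambda>z. 1 * ?h z)"
    by (intro polynomial_growth_pairing(1)[where B=1 and n=0]) auto
  then have int: "integrable lebesgue ?h" by simp
  \<comment> \<open>The integrand after multiplication by cnj(v) and passage to real parts: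
    nonnegative everywhere and positive at (a, b), which both contractions fix.\<close>
  let ?g = "\<lambda>z. (norm (f (fst z)))\<^sup>2 * (norm (g (snd z)))\<^sup>2 * Re (cnj v * chi z)"
  have gh: "?g z = Re (cnj v * ?h z)" for z by (simp add: \<phi>r \<psi>r algebra_simps)
  have "integrable lebesgue (\<lambda>z. Re (cnj v * ?h z))" by (intro integrable_Re integrable_mult_right int)
  then have intg: "integrable lebesgue ?g" unfolding gh .
  have "integral\<^sup>L lebesgue ?g > 0"
  proof (rule integral_pos_of_continuous[OF intg])
    have "continuous_on UNIV (\<lambda>z. Re (cnj v * ?h z))"
      using smooth_continuous[OF sh] by (intro continuous_on_Re continuous_on_mult_left)
    then show "continuous_on UNIV ?g" unfolding gh .
    show "?g z \<ge> 0" for z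
    proof (cases "f (fst z) = 0 \<or> g (snd z) = 0")
      case False
      then have "Re (cnj v * chi (fst z, snd z)) > 0" by (intro pos) (auto simp: \<phi>_def \<psi>_def)
      then show ?thesis by simp
    qed auto
    have "f a = v" "g b = v" by (simp_all add: f_def g_def v_def algebra_simps flip: scaleR_add_left)
    then show "?g (a, b) > 0" using v \<open>Re (cnj v * chi (a, b)) > 0\<close> by simp
  qed
  moreover have "integral\<^sup>L lebesgue ?g = Re (cnj v * integral\<^sup>L lebesgue ?h)"
    unfolding gh integral_mult_right_zero[symmetric] by (rule integral_Re[OF integrable_mult_right[OF int]])
  ultimately have nz: "integral\<^sup>L lebesgue ?h \<noteq> 0" by auto
  have "integral\<^sup>L lebesgue ?h = integral\<^sup>L lborel ?h"
    using smooth_borel[OF sh] by (intro integral_completion) simp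
  show thesis
  proof (rule that[of \<phi> \<psi> R "max P1 P2"])
    show "R > 0" using d(1) by (simp add: R_def add_nonneg_pos)
  qed (use s\<phi> s\<psi> \<phi>R \<psi>R P1 P2 inU nz \<open>integral\<^sup>L lebesgue ?h = integral\<^sup>L lborel ?h\<close> in \<open>auto simp: le_max_iff_disj\<close>)
qed

text \<open>The cutoff needed for density is \<open>chi\<close> itself, recentred at a point where
  it does not vanish and normalised there.\<close>

lemma unit_test_function:
  fixes chi :: "'a::euclidean_space \<Rightarrow> complex"
  assumes chi: "chi \<in> test_functions U" and nz: "chi \<noteq> (\<lambda>_. 0)"
  obtains k where "k \<in> test_functions (UNIV :: 'a set)" "k 0 = 1"
proof -
  obtain a where a: "chi a \<noteq> 0" using nz by blast
  obtain R where R: "\<And>z. chi z \<noteq> 0 \<Longrightarrow> norm z \<le> R" using test_functions_support_bounded[OF chi] by blast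
  let ?k = "\<lambda>z. (1 / chi a) * chi (1 *\<^sub>R z + a)"
  show thesis
  proof (rule that[of ?k])
    show "?k \<in> test_functions UNIV"
    proof (rule test_functionsI[where R="R + norm a"])
      show "smooth ?k" by (intro smooth_mult smooth_const smooth_scale test_functions_smooth[OF chi])
      show "norm z \<le> R + norm a" if "?k z \<noteq> 0" for z
        using R[of "z + a"] that norm_triangle_sub[of z "z + a"] by simp
    qed
  qed (use a in simp)
qed

text \<open>The phase is opposite to that of \<open>T_B0\<close>. The pairing is bilinear, so the
  two cancel without conjugation.\<close>

definition window :: "('a::euclidean_space \<Rightarrow> complex) \<Rightarrow> ('a \<Rightarrow> complex) \<Rightarrow> 'a \<times> 'a \<Rightarrow> 'a \<times> 'a \<Rightarrow> complex" where
  "window \<phi> \<psi> \<mu> z = \<phi> (fst z - fst \<mu>) * (\<psi> (snd z - snd \<mu>) * cis (2 * pi * (fst \<mu> \<bullet> (snd z - snd \<mu>))))"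

lemma window_test_function:
  assumes s: "smooth \<phi>" "smooth \<psi>" and R: "\<And>t. \<phi> t \<noteq> 0 \<Longrightarrow> norm t \<le> R" "\<And>\<eta>. \<psi> \<eta> \<noteq> 0 \<Longrightarrow> norm \<eta> \<le> R"
  shows "window \<phi> \<psi> \<mu> \<in> test_functions UNIV"
proof (rule test_functionsI[where R="2 * R + norm \<mu>"])
  have "smooth (\<lambda>z. \<phi> (fst z + - fst \<mu>) * (\<psi> (snd z + - snd \<mu>) * cis ((0, (2 * pi) *\<^sub>R fst \<mu>) \<bullet> z + - 2 * pi * (fst \<mu> \<bullet> snd \<mu>))))"
    by (rule smooth_mult[OF smooth_fst[OF s(1)] smooth_mult[OF smooth_snd[OF s(2)] smooth_cis]])
  moreover have "(0, (2 * pi) *\<^sub>R fst \<mu>) \<bullet> z + - 2 * pi * (fst \<mu> \<bullet> snd \<mu>) = 2 * pi * (fst \<mu> \<bullet> (snd z - snd \<mu>))" for z :: "'a \<times> 'a"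
    by (simp add: inner_prod_def inner_diff_right algebra_simps)
  ultimately show "smooth (window \<phi> \<psi> \<mu>)" unfolding window_def[abs_def] by simp
  show "norm z \<le> 2 * R + norm \<mu>" if "window \<phi> \<psi> \<mu> z \<noteq> 0" for z
  proof -
    have "norm (fst (z - \<mu>)) \<le> R" "norm (snd (z - \<mu>)) \<le> R" using that R by (auto simp: window_def)
    moreover have "norm (z - \<mu>) \<le> norm (fst (z - \<mu>)) + norm (snd (z - \<mu>))"
      using norm_Pair_le[of "fst (z - \<mu>)" "snd (z - \<mu>)"] by (simp only: prod.collapse)
    ultimately have "norm (z - \<mu>) \<le> 2 * R" by linarith
    then show ?thesis using norm_triangle_sub[of z \<mu>] by linarith
  qed
qed

text \<open>The window lives in the translate \<mu> + U. As the translates are disjoint, only the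
  term of \<mu> survives there; the phases cancel and a translation removes \<mu> from the
  integral.\<close>

lemma pairing_synth_window:
  fixes \<Lambda> :: "('a::euclidean_space \<times> 'a) set"
  assumes chi: "chi \<in> test_functions U" and disj: "disjoint_family_on (\<lambda>\<mu>. (+) \<mu> ` U) \<Lambda>" and \<mu>: "\<mu> \<in> \<Lambda>"
    and bor: "\<phi> \<in> borel_measurable borel" "\<psi> \<in> borel_measurable borel"
    and U: "\<And>t \<eta>. \<phi> t \<noteq> 0 \<Longrightarrow> \<psi> \<eta> \<noteq> 0 \<Longrightarrow> (t, \<eta>) \<in> U"
  shows "pairing (synth \<Lambda> chi c) (window \<phi> \<psi> \<mu>) = c \<mu> * (\<integral>z. chi z * (\<phi> (fst z) * \<psi> (snd z)) \<partial>lborel)"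
proof -
  note [measurable] = bor
  let ?h = "\<lambda>z. chi z * (\<phi> (fst z) * \<psi> (snd z))"
  have inU: "z \<in> U" if "chi z \<noteq> 0" for z
    using chi that closure_subset[of "{z. chi z \<noteq> 0}"] by (auto simp: test_functions_def)
  have eq: "synth \<Lambda> chi c z * window \<phi> \<psi> \<mu> z = c \<mu> * ?h (z - \<mu>)" for z
  proof (cases "window \<phi> \<psi> \<mu> z = 0")
    case True
    then have "\<phi> (fst z - fst \<mu>) = 0 \<or> \<psi> (snd z - snd \<mu>) = 0" by (auto simp: window_def)
    then show ?thesis using True by auto
  next
    case False
    then have "(fst z - fst \<mu>, snd z - snd \<mu>) \<in> U" by (intro U) (auto simp: window_def)
    moreover have "(fst z - fst \<mu>, snd z - snd \<mu>) = z - \<mu>" by (simp add: prod_eq_iff)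
    ultimately have zU: "z \<in> (+) \<mu> ` U" by (intro image_eqI[of _ _ "z - \<mu>"]) auto
    have zero: "T_B0 \<nu> chi z = 0" if \<nu>: "\<nu> \<in> \<Lambda>" "\<nu> \<noteq> \<mu>" for \<nu>
    proof (rule ccontr)
      assume "T_B0 \<nu> chi z \<noteq> 0"
      then have "z - \<nu> \<in> U" using inU by (auto simp: T_B0_eq)
      then have "z \<in> (+) \<nu> ` U" by (intro image_eqI[of _ _ "z - \<nu>"]) auto
      then show False using disj \<nu> \<mu> zU unfolding disjoint_family_on_def by blast
    qed
    have "synth \<Lambda> chi c z = (\<Sum>\<^sub>\<infinity>\<nu>\<in>{\<mu>}. c \<nu> * T_B0 \<nu> chi z)"
      unfolding synth_def by (rule infsum_cong_neutral) (use zero \<mu> in auto)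
    then have "synth \<Lambda> chi c z = c \<mu> * T_B0 \<mu> chi z" by simp
    then show ?thesis
      by (simp add: T_B0_eq window_def cis_mult mult_ac flip: mult.assoc[of "cis _"])
  qed
  have hm [measurable]: "?h \<in> borel_measurable borel"
    using smooth_borel[OF test_functions_smooth[OF chi]] unfolding borel_prod[symmetric] by measurable
  have "pairing (synth \<Lambda> chi c) (window \<phi> \<psi> \<mu>) = c \<mu> * (\<integral>z. ?h (z - \<mu>) \<partial>lebesgue)"
    unfolding pairing_def eq by (rule integral_mult_right_zero)
  also have "(\<integral>z. ?h (z - \<mu>) \<partial>lebesgue) = (\<integral>z. ?h (z - \<mu>) \<partial>lborel)"
    by (rule integral_completion) (use measurable_compose[OF _ hm, of "\<lambda>z. z - \<mu>"] in simp)
  also have "\<dots> = integral\<^sup>L lborel ?h" by (rule lborel_translate(1)[OF hm])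
  finally show ?thesis .
qed

section \<open>Coefficients of tensors against a fixed product window\<close>

lemma row_norm_triangle:
  assumes "w x \<ge> 0"
  shows "row_norm w \<Xi> (\<lambda>\<mu>. c \<mu> + d \<mu>) x \<le> row_norm w \<Xi> c x + row_norm w \<Xi> d x"
proof -
  have "L2_set (\<lambda>\<xi>. norm (c (x, \<xi>) + d (x, \<xi>))) \<Xi> \<le> L2_set (\<lambda>\<xi>. norm (c (x, \<xi>)) + norm (d (x, \<xi>))) \<Xi>"
    by (intro L2_set_mono norm_triangle_ineq) auto
  also have "\<dots> \<le> L2_set (\<lambda>\<xi>. norm (c (x, \<xi>))) \<Xi> + L2_set (\<lambda>\<xi>. norm (d (x, \<xi>))) \<Xi>"
    by (rule L2_set_triangle_ineq)
  finally show ?thesis using assms unfolding row_norm_def distrib_left[symmetric] by (rule mult_left_mono)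
qed

lemma row_norm_scale: "row_norm w \<Xi> (\<lambda>\<mu>. a * c \<mu>) x = norm a * row_norm w \<Xi> c x"
  by (simp add: row_norm_def norm_mult L2_set_right_distrib[symmetric])

lemma row_norm_tendsto:
  assumes "\<And>\<mu>. \<mu> \<in> {x} \<times> \<Xi> \<Longrightarrow> (\<lambda>k. c k \<mu>) \<longlonglongrightarrow> d \<mu>"
  shows "(\<lambda>k. row_norm w \<Xi> (c k) x) \<longlonglongrightarrow> row_norm w \<Xi> d x"
  unfolding row_norm_def L2_set_def by (intro tendsto_intros assms) auto

lemma row_norm_zero: "row_norm w \<Xi> (\<lambda>_. 0) x = 0"
  by (simp add: row_norm_def L2_set_def)

locale gabor_window = gabor \<Lambda>1 \<Lambda>2 w p for \<Lambda>1 \<Lambda>2 :: "'a::euclidean_space set" and w p +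
  fixes \<phi> \<psi> :: "'a \<Rightarrow> complex" and R P :: real
  assumes \<phi>_borel: "\<phi> \<in> borel_measurable borel" and \<psi>_borel: "\<psi> \<in> borel_measurable borel"
    and \<phi>_bound: "\<And>t. norm (\<phi> t) \<le> P" and \<psi>_bound: "\<And>\<eta>. norm (\<psi> \<eta>) \<le> P"
    and \<phi>_supp: "\<And>t. \<phi> t \<noteq> 0 \<Longrightarrow> norm t \<le> R" and \<psi>_supp: "\<And>\<eta>. \<psi> \<eta> \<noteq> 0 \<Longrightarrow> norm \<eta> \<le> R"
    and P_pos: "P > 0" and R_pos: "R > 0"
begin

definition fst_coef where "fst_coef f x = (\<integral>t. f t * \<phi> (t - x) \<partial>lebesgue)"

definition snd_coef where "snd_coef g x \<xi> = (\<integral>\<eta>. g \<eta> * (\<psi> (\<eta> - \<xi>) * cis (2 * pi * (x \<bullet> (\<eta> - \<xi>)))) \<partial>lebesgue)"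

definition coef where "coef h \<mu> = pairing h (window \<phi> \<psi> \<mu>)"

text \<open>One constant for the local and the \<ell>^p estimate. The first makes rows vanish at
  infinity, the second gives the norm inequalities.\<close>

definition fst_coef_ok where
  "fst_coef_ok C \<longleftrightarrow> C > 0 \<and> (\<forall>f x. f \<in> elems (Lp p w) \<longrightarrow> integrable lebesgue (\<lambda>t. f t * \<phi> (t - x))) \<and>
     (\<forall>f x. f \<in> elems (Lp p w) \<longrightarrow> w x * norm (fst_coef f x) \<le> C * local_Lp R p w f x powr (1 / p)) \<and>
     (\<forall>f X. f \<in> elems (Lp p w) \<longrightarrow> finite X \<longrightarrow> X \<subseteq> \<Lambda>1 \<longrightarrow>
        (\<Sum>x\<in>X. (w x * norm (fst_coef f x)) powr p) powr (1 / p) \<le> C * nrm (Lp p w) f)"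

lemma fst_coef_okD:
  assumes "fst_coef_ok C"
  shows "C > 0"
    "\<And>f x. f \<in> elems (Lp p w) \<Longrightarrow> integrable lebesgue (\<lambda>t. f t * \<phi> (t - x))"
    "\<And>f x. f \<in> elems (Lp p w) \<Longrightarrow> w x * norm (fst_coef f x) \<le> C * local_Lp R p w f x powr (1 / p)"
    "\<And>f X. f \<in> elems (Lp p w) \<Longrightarrow> finite X \<Longrightarrow> X \<subseteq> \<Lambda>1 \<Longrightarrow> (\<Sum>x\<in>X. (w x * norm (fst_coef f x)) powr p) powr (1 / p) \<le> C * nrm (Lp p w) f"
  using assms unfolding fst_coef_ok_def by blast+

lemma fst_coef_bound: "\<exists>C. fst_coef_ok C"
proof -
  obtain C where C: "C \<ge> 0"
    "\<And>\<phi> P f x. \<phi> \<in> borel_measurable borel \<Longrightarrow> (\<And>t. norm (\<phi> t) \<le> P) \<Longrightarrow> (\<And>t. \<phi> t \<noteq> 0 \<Longrightarrow> norm t \<le> R) \<Longrightarrow>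
      f \<in> elems (Lp p w) \<Longrightarrow> integrable lebesgue (\<lambda>t. f t * \<phi> (t - x)) \<and>
      w x * norm (\<integral>t. f t * \<phi> (t - x) \<partial>lebesgue) \<le> C * P * local_Lp R p w f x powr (1 / p)"
    using translates_analysis_bound[OF weight p1, of R] by blast
  define V where "V = real (overlap \<Lambda>1 R)"
  have V: "V \<ge> 1" using overlap_ge_1[OF lattice1, of R] R_pos by (simp add: V_def)
  \<comment> \<open>The added 1 makes the constant positive, since it will be divided by.\<close>
  define B where "B = C * P + 1"
  have B: "B > 0" using C(1) P_pos by (simp add: B_def add_nonneg_pos)
  have int: "integrable lebesgue (\<lambda>t. f t * \<phi> (t - x))" and le: "w x * norm (fst_coef f x) \<le> B * local_Lp R p w f x powr (1 / p)"
    if "f \<in> elems (Lp p w)" for f x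
  proof -
    have *: "integrable lebesgue (\<lambda>t. f t * \<phi> (t - x)) \<and> w x * norm (fst_coef f x) \<le> C * P * local_Lp R p w f x powr (1 / p)"
      unfolding fst_coef_def by (rule C(2)[OF \<phi>_borel \<phi>_bound \<phi>_supp that])
    then show "integrable lebesgue (\<lambda>t. f t * \<phi> (t - x))" by blast
    have "C * P * local_Lp R p w f x powr (1 / p) \<le> B * local_Lp R p w f x powr (1 / p)"
      by (intro mult_right_mono) (auto simp: B_def)
    with * show "w x * norm (fst_coef f x) \<le> B * local_Lp R p w f x powr (1 / p)" by linarith
  qed
  have V1: "V powr (1 / p) \<ge> 1" using V p1 by (intro ge_one_powr_ge_zero) auto
  show ?thesis
    unfolding fst_coef_ok_def
  proof (intro exI[of _ "B * V powr (1 / p)"] conjI allI impI)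
    show "B * V powr (1 / p) > 0" using B V by simp
    fix f x assume f: "f \<in> elems (Lp p w)"
    show "integrable lebesgue (\<lambda>t. f t * \<phi> (t - x))" by (rule int[OF f])
  next
    fix f x assume f: "f \<in> elems (Lp p w)"
    have "B * 1 \<le> B * V powr (1 / p)" using B V1 by (intro mult_left_mono) auto
    then have "B * local_Lp R p w f x powr (1 / p) \<le> B * V powr (1 / p) * local_Lp R p w f x powr (1 / p)"
      by (intro mult_right_mono) auto
    then show "w x * norm (fst_coef f x) \<le> B * V powr (1 / p) * local_Lp R p w f x powr (1 / p)" using le[OF f, of x] by linarith
  next
    fix f X assume f: "f \<in> elems (Lp p w)" and X: "finite X" "X \<subseteq> \<Lambda>1"
    have "(\<Sum>x\<in>X. (w x * norm (fst_coef f x)) powr p) \<le> (\<Sum>x\<in>X. B powr p * local_Lp R p w f x)"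
    proof (rule sum_mono)
      fix x
      have "(w x * norm (fst_coef f x)) powr p \<le> (B * local_Lp R p w f x powr (1 / p)) powr p"
        using p1 weight_pos[OF weight, of x] by (intro powr_mono2 le[OF f]) auto
      also have "\<dots> = B powr p * local_Lp R p w f x"
        using p1 local_Lp_nonneg[of R p w f x] by (simp add: powr_mult powr_powr)
      finally show "(w x * norm (fst_coef f x)) powr p \<le> B powr p * local_Lp R p w f x" .
    qed
    also have "\<dots> = B powr p * (\<Sum>x\<in>X. local_Lp R p w f x)" by (simp add: sum_distrib_left)
    also have "\<dots> \<le> B powr p * (V * nrm (Lp p w) f powr p)"
      unfolding V_def by (intro mult_left_mono sum_local_Lp_le[OF lattice1 X f]) (use p1 in auto)
    finally have "(\<Sum>x\<in>X. (w x * norm (fst_coef f x)) powr p) powr (1 / p) \<le> (B powr p * (V * nrm (Lp p w) f powr p)) powr (1 / p)"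
      using p1 by (intro powr_mono2) (auto intro: sum_nonneg)
    also have "\<dots> = B * V powr (1 / p) * nrm (Lp p w) f"
      using p1 B by (simp add: powr_mult powr_powr nrm_Lp_nonneg)
    finally show "(\<Sum>x\<in>X. (w x * norm (fst_coef f x)) powr p) powr (1 / p) \<le> B * V powr (1 / p) * nrm (Lp p w) f" .
  qed
qed

definition snd_coef_ok where
  "snd_coef_ok C \<longleftrightarrow> C > 0 \<and>
     (\<forall>g x \<xi>. g \<in> elems L2 \<longrightarrow> integrable lebesgue (\<lambda>\<eta>. g \<eta> * (\<psi> (\<eta> - \<xi>) * cis (2 * pi * (x \<bullet> (\<eta> - \<xi>)))))) \<and>
     (\<forall>g X \<Xi>. g \<in> elems L2 \<longrightarrow> finite X \<longrightarrow> X \<subseteq> \<Lambda>1 \<longrightarrow> finite \<Xi> \<longrightarrow> \<Xi> \<subseteq> \<Lambda>2 \<longrightarrow>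
        sqrt (\<Sum>\<xi>\<in>\<Xi>. \<Sum>x\<in>X. (norm (snd_coef g x \<xi>))\<^sup>2) \<le> C * nrm L2 g)"

lemma snd_coef_okD:
  assumes "snd_coef_ok C"
  shows "C > 0"
    "\<And>g x \<xi>. g \<in> elems L2 \<Longrightarrow> integrable lebesgue (\<lambda>\<eta>. g \<eta> * (\<psi> (\<eta> - \<xi>) * cis (2 * pi * (x \<bullet> (\<eta> - \<xi>)))))"
    "\<And>g X \<Xi>. g \<in> elems L2 \<Longrightarrow> finite X \<Longrightarrow> X \<subseteq> \<Lambda>1 \<Longrightarrow> finite \<Xi> \<Longrightarrow> \<Xi> \<subseteq> \<Lambda>2 \<Longrightarrow>
      sqrt (\<Sum>\<xi>\<in>\<Xi>. \<Sum>x\<in>X. (norm (snd_coef g x \<xi>))\<^sup>2) \<le> C * nrm L2 g"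
  using assms unfolding snd_coef_ok_def by blast+

lemma snd_coef_bound: "\<exists>C. snd_coef_ok C"
proof -
  obtain C where C: "C \<ge> 0"
    "\<And>\<psi> P X \<Xi> g. \<psi> \<in> borel_measurable borel \<Longrightarrow> (\<And>\<eta>. norm (\<psi> \<eta>) \<le> P) \<Longrightarrow> (\<And>\<eta>. \<psi> \<eta> \<noteq> 0 \<Longrightarrow> norm \<eta> \<le> R) \<Longrightarrow>
      finite X \<Longrightarrow> X \<subseteq> \<Lambda>1 \<Longrightarrow> finite \<Xi> \<Longrightarrow> \<Xi> \<subseteq> \<Lambda>2 \<Longrightarrow> g \<in> elems L2 \<Longrightarrow>
      (\<forall>x\<in>X. \<forall>\<xi>\<in>\<Xi>. integrable lebesgue (\<lambda>\<eta>. g \<eta> * (\<psi> (\<eta> - \<xi>) * cis (2 * pi * (x \<bullet> (\<eta> - \<xi>)))))) \<and>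
      sqrt (\<Sum>\<xi>\<in>\<Xi>. \<Sum>x\<in>X. (norm (\<integral>\<eta>. g \<eta> * (\<psi> (\<eta> - \<xi>) * cis (2 * pi * (x \<bullet> (\<eta> - \<xi>)))) \<partial>lebesgue))\<^sup>2) \<le> C * P * nrm L2 g"
    using gabor_analysis_L2[OF lattice1 lattice2, of R] by blast
  show ?thesis
    unfolding snd_coef_ok_def
  proof (intro exI[of _ "C * P + 1"] conjI allI impI)
    show "C * P + 1 > 0" using C(1) P_pos by (simp add: add_nonneg_pos)
    fix g :: "'a \<Rightarrow> complex" and x \<xi> assume g: "g \<in> elems L2"
    have [measurable]: "\<psi> \<in> borel_measurable borel" by (rule \<psi>_borel)
    have "(\<lambda>\<eta>. \<psi> (\<eta> - \<xi>) * cis (2 * pi * (x \<bullet> (\<eta> - \<xi>)))) \<in> elems L2"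
    proof (rule bounded_compact_support_Lp[OF _ _ _ weight_one, of _ P \<xi> R])
      show "norm (\<psi> (\<eta> - \<xi>) * cis (2 * pi * (x \<bullet> (\<eta> - \<xi>)))) \<le> P" for \<eta>
        using \<psi>_bound[of "\<eta> - \<xi>"] by (simp add: norm_mult)
    qed (use \<psi>_supp in auto)
    then show "integrable lebesgue (\<lambda>\<eta>. g \<eta> * (\<psi> (\<eta> - \<xi>) * cis (2 * pi * (x \<bullet> (\<eta> - \<xi>)))))"
      by (rule Cauchy_Schwarz_L2(1)[OF g])
  next
    fix g :: "'a \<Rightarrow> complex" and X \<Xi> assume g: "g \<in> elems L2" and X: "finite X" "X \<subseteq> \<Lambda>1" "finite \<Xi>" "\<Xi> \<subseteq> \<Lambda>2"
    have "sqrt (\<Sum>\<xi>\<in>\<Xi>. \<Sum>x\<in>X. (norm (snd_coef g x \<xi>))\<^sup>2) \<le> C * P * nrm L2 g"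
      unfolding snd_coef_def using C(2)[OF \<psi>_borel \<psi>_bound \<psi>_supp X g] by blast
    also have "\<dots> \<le> (C * P + 1) * nrm L2 g" by (intro mult_right_mono nrm_Lp_nonneg) simp
    finally show "sqrt (\<Sum>\<xi>\<in>\<Xi>. \<Sum>x\<in>X. (norm (snd_coef g x \<xi>))\<^sup>2) \<le> (C * P + 1) * nrm L2 g" .
  qed
qed

lemma coef_represents:
  assumes r: "represents_tensor (Lp p w) L2 r h"
  shows "coef h (x, \<xi>) = (\<Sum>(f, g)\<leftarrow>r. fst_coef f x * snd_coef g x \<xi>)"
proof -
  obtain C1 where "fst_coef_ok C1" using fst_coef_bound by blast
  note C1 = fst_coef_okD[OF this]
  obtain C2 where "snd_coef_ok C2" using snd_coef_bound by blast
  note C2 = snd_coef_okD[OF this]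
  have mem: "f \<in> elems (Lp p w)" "g \<in> elems L2" if "(f, g) \<in> set r" for f g
    using r that by (auto simp: represents_tensor_def)
  have "window \<phi> \<psi> (x, \<xi>) = (\<lambda>z. (\<lambda>t. \<phi> (t - x)) (fst z) * (\<lambda>\<eta>. \<psi> (\<eta> - \<xi>) * cis (2 * pi * (x \<bullet> (\<eta> - \<xi>)))) (snd z))"
    by (simp add: window_def fun_eq_iff)
  then show ?thesis
    unfolding coef_def fst_coef_def snd_coef_def using pairing_tensor[OF r, of "\<lambda>t. \<phi> (t - x)" "\<lambda>\<eta>. \<psi> (\<eta> - \<xi>) * cis (2 * pi * (x \<bullet> (\<eta> - \<xi>)))"] C1(2) C2(2) mem
    by simp
qed

text \<open>Argued on representations: there the coefficients are finite sums of products, and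
  integrability of h against the window need not be discussed.\<close>

lemma coef_diff:
  assumes h: "h \<in> alg_tensor (Lp p w) L2" and k: "k \<in> alg_tensor (Lp p w) L2"
  shows "coef (\<lambda>z. h z - k z) \<mu> = coef h \<mu> - coef k \<mu>"
proof -
  obtain r s where r: "represents_tensor (Lp p w) L2 r h" and s: "represents_tensor (Lp p w) L2 s k"
    using h k by (auto simp: alg_tensor_def)
  have "fst_coef (\<lambda>t. (-1) * f t) x = - fst_coef f x" for f x
    unfolding fst_coef_def by (simp flip: integral_minus)
  then have "(\<Sum>(f, g)\<leftarrow>tensor_neg s. fst_coef f x * snd_coef g x \<xi>) = - (\<Sum>(f, g)\<leftarrow>s. fst_coef f x * snd_coef g x \<xi>)" for x \<xi>
    by (induction s) (auto simp: tensor_neg_def)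
  then show ?thesis
    by (cases \<mu>) (simp add: coef_represents[OF represents_diff[OF r s weight]] coef_represents[OF r] coef_represents[OF s])
qed

lemma row_norm_coef_le:
  assumes "represents_tensor (Lp p w) L2 r h"
  shows "row_norm w \<Xi> (coef h) x \<le> (\<Sum>(f, g)\<leftarrow>r. w x * norm (fst_coef f x) * L2_set (\<lambda>\<xi>. norm (snd_coef g x \<xi>)) \<Xi>)"
proof -
  have "row_norm w \<Xi> (coef h) x = row_norm w \<Xi> (\<lambda>\<mu>. \<Sum>(f, g)\<leftarrow>r. fst_coef f x * snd_coef g x (snd \<mu>)) x"
    by (simp add: row_norm_def coef_represents[OF assms])
  also have "\<dots> \<le> (\<Sum>(f, g)\<leftarrow>r. w x * norm (fst_coef f x) * L2_set (\<lambda>\<xi>. norm (snd_coef g x \<xi>)) \<Xi>)"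
  proof (induction r)
    case Nil show ?case by (simp add: row_norm_zero)
  next
    case (Cons fg r)
    obtain f g where fg: "fg = (f, g)" by force
    have "row_norm w \<Xi> (\<lambda>\<mu>. fst_coef f x * snd_coef g x (snd \<mu>)) x = w x * norm (fst_coef f x) * L2_set (\<lambda>\<xi>. norm (snd_coef g x \<xi>)) \<Xi>"
      unfolding row_norm_scale by (simp add: row_norm_def)
    then show ?case
      using row_norm_triangle[of w x \<Xi> "\<lambda>\<mu>. fst_coef f x * snd_coef g x (snd \<mu>)"
          "\<lambda>\<mu>. \<Sum>(f, g)\<leftarrow>r. fst_coef f x * snd_coef g x (snd \<mu>)"] Cons weight_pos[OF weight, of x]
      by (simp add: fg)
  qed
  finally show ?thesis .
qed

lemma proj_analysis_bound:
  assumes p2: "p \<le> 2"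
  obtains C where "C > 0"
    "\<And>(h :: 'a \<times> 'a \<Rightarrow> complex) X \<Xi>. h \<in> alg_tensor (Lp p w) L2 \<Longrightarrow> finite X \<Longrightarrow> X \<subseteq> \<Lambda>1 \<Longrightarrow> finite \<Xi> \<Longrightarrow> \<Xi> \<subseteq> \<Lambda>2 \<Longrightarrow>
      (\<Sum>x\<in>X. row_norm w \<Xi> (coef h) x) \<le> C * proj_tensor_norm (Lp p w) L2 h"
proof -
  obtain C1 where "fst_coef_ok C1" using fst_coef_bound by blast
  note C1 = fst_coef_okD[OF this]
  obtain C2 where "snd_coef_ok C2" using snd_coef_bound by blast
  note C2 = snd_coef_okD[OF this]
  show thesis
  proof (rule that[of "C1 * C2"])
    fix h :: "'a \<times> 'a \<Rightarrow> complex" and X \<Xi> assume h: "h \<in> alg_tensor (Lp p w) L2" and X: "finite X" "X \<subseteq> \<Lambda>1" "finite \<Xi>" "\<Xi> \<subseteq> \<Lambda>2"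
    have one: "(\<Sum>x\<in>X. w x * norm (fst_coef f x) * L2_set (\<lambda>\<xi>. norm (snd_coef g x \<xi>)) \<Xi>) \<le> C1 * C2 * (nrm (Lp p w) f * nrm L2 g)"
      if f: "f \<in> elems (Lp p w)" and g: "g \<in> elems L2" for f g
    proof -
      have w0: "w x > 0" for x by (rule weight_pos[OF weight])
      have "(\<Sum>x\<in>X. w x * norm (fst_coef f x) * L2_set (\<lambda>\<xi>. norm (snd_coef g x \<xi>)) \<Xi>)
        = (\<Sum>x\<in>X. \<bar>w x * norm (fst_coef f x)\<bar> * \<bar>L2_set (\<lambda>\<xi>. norm (snd_coef g x \<xi>)) \<Xi>\<bar>)"
        using w0 by (intro sum.cong refl) (simp add: abs_mult abs_of_pos)
      also have "\<dots> \<le> L2_set (\<lambda>x. w x * norm (fst_coef f x)) X * L2_set (\<lambda>x. L2_set (\<lambda>\<xi>. norm (snd_coef g x \<xi>)) \<Xi>) X"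
        by (rule L2_set_mult_ineq)
      also have "\<dots> \<le> (C1 * nrm (Lp p w) f) * (C2 * nrm L2 g)"
      proof (intro mult_mono)
        have "L2_set (\<lambda>x. w x * norm (fst_coef f x)) X = (\<Sum>x\<in>X. (w x * norm (fst_coef f x)) powr 2) powr (1 / 2)"
          using w0 by (simp add: L2_set_def powr_half_sqrt sum_nonneg less_imp_le)
        also have "\<dots> \<le> (\<Sum>x\<in>X. (w x * norm (fst_coef f x)) powr p) powr (1 / p)"
          by (rule lp_norm_antimono[OF X(1)]) (use p1 p2 in \<open>auto intro!: mult_nonneg_nonneg less_imp_le[OF w0]\<close>)
        also have "\<dots> \<le> C1 * nrm (Lp p w) f" by (rule C1(4)[OF f X(1,2)])
        finally show "L2_set (\<lambda>x. w x * norm (fst_coef f x)) X \<le> C1 * nrm (Lp p w) f" .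
        have "L2_set (\<lambda>x. L2_set (\<lambda>\<xi>. norm (snd_coef g x \<xi>)) \<Xi>) X = sqrt (\<Sum>\<xi>\<in>\<Xi>. \<Sum>x\<in>X. (norm (snd_coef g x \<xi>))\<^sup>2)"
          by (subst sum.swap) (simp add: L2_set_def sum_nonneg)
        also have "\<dots> \<le> C2 * nrm L2 g" by (rule C2(3)[OF g X])
        finally show "L2_set (\<lambda>x. L2_set (\<lambda>\<xi>. norm (snd_coef g x \<xi>)) \<Xi>) X \<le> C2 * nrm L2 g" .
      qed (use C1(1) in \<open>auto intro!: mult_nonneg_nonneg nrm_Lp_nonneg\<close>)
      finally show ?thesis by (simp add: mult_ac)
    qed
    have "(\<Sum>x\<in>X. row_norm w \<Xi> (coef h) x) / (C1 * C2) \<le> proj_tensor_norm (Lp p w) L2 h"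
    proof (rule proj_tensor_norm_ge[OF h])
      fix r assume r: "represents_tensor (Lp p w) L2 r h"
      have "(\<Sum>x\<in>X. row_norm w \<Xi> (coef h) x) \<le> (\<Sum>x\<in>X. \<Sum>(f, g)\<leftarrow>r. w x * norm (fst_coef f x) * L2_set (\<lambda>\<xi>. norm (snd_coef g x \<xi>)) \<Xi>)"
        by (intro sum_mono row_norm_coef_le[OF r])
      also have "\<dots> \<le> C1 * C2 * (\<Sum>(f, g)\<leftarrow>r. nrm (Lp p w) f * nrm L2 g)"
      proof -
        have "set r \<subseteq> elems (Lp p w) \<times> elems L2" using r by (simp add: represents_tensor_def)
        then show ?thesis
        proof (induction r)
          case (Cons fg r)
          obtain f g where fg: "fg = (f, g)" by force
          show ?case using Cons one[of f g] by (simp add: fg sum.distrib distrib_left)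
        qed simp
      qed
      finally show "(\<Sum>x\<in>X. row_norm w \<Xi> (coef h) x) / (C1 * C2) \<le> (\<Sum>(f, g)\<leftarrow>r. nrm (Lp p w) f * nrm L2 g)"
        using C1(1) C2(1) by (simp add: field_simps)
    qed
    then show "(\<Sum>x\<in>X. row_norm w \<Xi> (coef h) x) \<le> C1 * C2 * proj_tensor_norm (Lp p w) L2 h"
      using C1(1) C2(1) by (simp add: field_simps)
  qed (use C1(1) C2(1) in simp)
qed

text \<open>Rank-one functionals detect a whole row at once. At fixed x, l is the weighted
  coefficient functional, and m combines the coefficients over \<Xi> with the normalised conjugate
  row; their value on h is the row norm up to the constants that bring l and m into the dual
  balls.\<close>

lemma inj_analysis_bound:
  obtains C where "C > 0"
    "\<And>(h :: 'a \<times> 'a \<Rightarrow> complex) x \<Xi>. h \<in> alg_tensor (Lp p w) L2 \<Longrightarrow> x \<in> \<Lambda>1 \<Longrightarrow> finite \<Xi> \<Longrightarrow> \<Xi> \<subseteq> \<Lambda>2 \<Longrightarrow>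
      row_norm w \<Xi> (coef h) x \<le> C * inj_tensor_norm (Lp p w) L2 h"
proof -
  obtain C1 where "fst_coef_ok C1" using fst_coef_bound by blast
  note C1 = fst_coef_okD[OF this]
  obtain C2 where "snd_coef_ok C2" using snd_coef_bound by blast
  note C2 = snd_coef_okD[OF this]
  show thesis
  proof (rule that[of "C1 * C2"])
    fix h :: "'a \<times> 'a \<Rightarrow> complex" and x \<Xi> assume h: "h \<in> alg_tensor (Lp p w) L2" and x: "x \<in> \<Lambda>1" and \<Xi>: "finite \<Xi>" "\<Xi> \<subseteq> \<Lambda>2"
    obtain r where r: "represents_tensor (Lp p w) L2 r h" using h by (auto simp: alg_tensor_def)
    have w0: "w x > 0" by (rule weight_pos[OF weight])
    let ?V = "\<lambda>\<xi>. coef h (x, \<xi>)"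
    define n where "n = L2_set (\<lambda>\<xi>. norm (?V \<xi>)) \<Xi>"
    have n0: "n \<ge> 0" by (simp add: n_def)
    define l where "l f = of_real (w x / C1) * fst_coef f x" for f
    \<comment> \<open>A unit vector in \<ell>^2 unless n = 0; in that case division by 0 makes it 0,
      which is consistent.\<close>
    define \<beta> where "\<beta> \<xi> = cnj (?V \<xi>) / of_real n" for \<xi>
    define m where "m g = of_real (1 / C2) * (\<Sum>\<xi>\<in>\<Xi>. \<beta> \<xi> * snd_coef g x \<xi>)" for g
    have l: "l \<in> dual_ball (Lp p w)"
      unfolding dual_ball_def
    proof (intro CollectI conjI ballI allI)
      show "l (\<lambda>t. f t + g t) = l f + l g" if "f \<in> elems (Lp p w)" "g \<in> elems (Lp p w)" for f g
        using C1(2)[OF that(1), of x] C1(2)[OF that(2), of x] by (simp add: l_def fst_coef_def distrib_right distrib_left)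
      show "l (\<lambda>t. a * f t) = a * l f" for a f
        by (simp add: l_def fst_coef_def mult.assoc mult.left_commute)
      show "norm (l f) \<le> nrm (Lp p w) f" if f: "f \<in> elems (Lp p w)" for f
      proof -
        have "((w x * norm (fst_coef f x)) powr p) powr (1 / p) \<le> C1 * nrm (Lp p w) f"
          using C1(4)[OF f, of "{x}"] x by simp
        then have "w x * norm (fst_coef f x) \<le> C1 * nrm (Lp p w) f" using p1 w0 by (simp add: powr_powr)
        then show ?thesis using C1(1) w0 by (simp add: l_def norm_mult norm_divide field_simps)
      qed
    qed
    have \<beta>: "L2_set (\<lambda>\<xi>. norm (\<beta> \<xi>)) \<Xi> \<le> 1"
    proof (cases "n = 0")
      case True then show ?thesis by (simp add: \<beta>_def L2_set_def)
    next
      case False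
      have "L2_set (\<lambda>\<xi>. norm (\<beta> \<xi>)) \<Xi> = L2_set (\<lambda>\<xi>. (1 / n) * norm (?V \<xi>)) \<Xi>"
        using n0 by (simp add: \<beta>_def norm_divide)
      also have "\<dots> = (1 / n) * n" unfolding n_def[symmetric] using n0
        by (subst L2_set_right_distrib[symmetric]) (auto simp: n_def)
      finally show ?thesis using False by simp
    qed
    have m: "m \<in> dual_ball L2"
      unfolding dual_ball_def
    proof (intro CollectI conjI ballI allI)
      have add: "snd_coef (\<lambda>t. f t + g t) x \<xi> = snd_coef f x \<xi> + snd_coef g x \<xi>" if "f \<in> elems L2" "g \<in> elems L2" for f g \<xi>
        using C2(2)[OF that(1), of \<xi> x] C2(2)[OF that(2), of \<xi> x] by (simp add: snd_coef_def distrib_right)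
      show "m (\<lambda>t. f t + g t) = m f + m g" if "f \<in> elems L2" "g \<in> elems L2" for f g
        using add[OF that] by (simp add: m_def distrib_left sum.distrib)
      have mul: "snd_coef (\<lambda>t. a * f t) x \<xi> = a * snd_coef f x \<xi>" for a f \<xi>
        by (simp add: snd_coef_def mult.assoc)
      show "m (\<lambda>t. a * f t) = a * m f" for a f
        by (simp add: m_def mul sum_distrib_left mult.left_commute)
      show "norm (m g) \<le> nrm L2 g" if g: "g \<in> elems L2" for g
      proof -
        have "norm (\<Sum>\<xi>\<in>\<Xi>. \<beta> \<xi> * snd_coef g x \<xi>) \<le> (\<Sum>\<xi>\<in>\<Xi>. \<bar>norm (\<beta> \<xi>)\<bar> * \<bar>norm (snd_coef g x \<xi>)\<bar>)"
          by (rule order_trans[OF norm_sum]) (simp add: norm_mult)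
        also have "\<dots> \<le> L2_set (\<lambda>\<xi>. norm (\<beta> \<xi>)) \<Xi> * L2_set (\<lambda>\<xi>. norm (snd_coef g x \<xi>)) \<Xi>" by (rule L2_set_mult_ineq)
        also have "\<dots> \<le> 1 * (C2 * nrm L2 g)"
          using \<beta> C2(3)[OF g, of "{x}" \<Xi>] x \<Xi> by (intro mult_mono) (auto simp: L2_set_def sum_nonneg)
        finally show ?thesis using C2(1) by (simp add: m_def norm_mult norm_divide field_simps)
      qed
    qed
    have "(\<Sum>(f, g)\<leftarrow>r. l f * m g) = of_real (w x / (C1 * C2)) * (\<Sum>\<xi>\<in>\<Xi>. \<beta> \<xi> * (\<Sum>(f, g)\<leftarrow>r. fst_coef f x * snd_coef g x \<xi>))"
      by (induction r) (auto simp: l_def m_def sum.distrib distrib_left sum_distrib_left mult_ac)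
    also have "\<dots> = of_real (w x / (C1 * C2)) * (\<Sum>\<xi>\<in>\<Xi>. \<beta> \<xi> * ?V \<xi>)"
      by (simp add: coef_represents[OF r])
    also have "(\<Sum>\<xi>\<in>\<Xi>. \<beta> \<xi> * ?V \<xi>) = of_real n"
    proof (cases "n = 0")
      case True then show ?thesis by (simp add: \<beta>_def)
    next
      case False
      have "(\<Sum>\<xi>\<in>\<Xi>. \<beta> \<xi> * ?V \<xi>) = (\<Sum>\<xi>\<in>\<Xi>. of_real ((norm (?V \<xi>))\<^sup>2)) / of_real n"
        unfolding complex_norm_square sum_divide_distrib by (simp add: \<beta>_def mult.commute)
      also have "(\<Sum>\<xi>\<in>\<Xi>. of_real ((norm (?V \<xi>))\<^sup>2)) = complex_of_real (n * n)"
        by (simp add: n_def L2_set_def sum_nonneg flip: power2_eq_square)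
      finally show ?thesis using False by simp
    qed
    finally have "norm (\<Sum>(f, g)\<leftarrow>r. l f * m g) = w x / (C1 * C2) * n"
      using w0 C1(1) C2(1) n0 by (simp add: norm_mult norm_divide)
    then have "w x / (C1 * C2) * n \<le> inj_tensor_norm (Lp p w) L2 h"
      using inj_tensor_norm_ge[OF weight weight_one p1 _ r l m] by simp
    then show "row_norm w \<Xi> (coef h) x \<le> C1 * C2 * inj_tensor_norm (Lp p w) L2 h"
      using C1(1) C2(1) by (simp add: row_norm_def n_def field_simps)
  qed (use C1(1) C2(1) in simp)
qed

text \<open>Finite sums of these local integrals are bounded by one constant, so only finitely many
  lattice points can exceed a given level, and these lie in a ball.\<close>

lemma local_Lp_vanishes:
  assumes f: "f \<in> elems (Lp p w)"
  shows "(local_Lp R p w f \<longlongrightarrow> 0) (inf at_infinity (principal \<Lambda>1))"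
proof (rule order_tendstoI)
  fix e :: real assume "e < 0"
  then show "\<forall>\<^sub>F x in inf at_infinity (principal \<Lambda>1). e < local_Lp R p w f x"
    by (intro always_eventually allI) (rule less_le_trans[OF _ local_Lp_nonneg])
next
  fix e :: real assume e: "e > 0"
  define B where "B = real (overlap \<Lambda>1 R) * nrm (Lp p w) f powr p"
  have B0: "B \<ge> 0" by (simp add: B_def)
  let ?E = "{x \<in> \<Lambda>1. local_Lp R p w f x \<ge> e}"
  have "finite ?E"
  proof (rule ccontr)
    assume "infinite ?E"
    \<comment> \<open>More than B / e points of size at least e would exceed the total bound
      B.\<close>
    then obtain X where X: "X \<subseteq> ?E" "finite X" "card X = nat \<lceil>B / e\<rceil> + 1" using infinite_arbitrarily_large by blast
    have "real (card X) * e \<le> (\<Sum>x\<in>X. local_Lp R p w f x)"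
      using X by (intro sum_bounded_below) auto
    also have "\<dots> \<le> B" unfolding B_def by (rule sum_local_Lp_le[OF lattice1 X(2) _ f]) (use X p1 in auto)
    finally have "real (card X) \<le> B / e" using e by (simp add: field_simps)
    moreover have "B / e < real (card X)" unfolding X(3) using B0 e by linarith
    ultimately show False by simp
  qed
  then obtain b where b: "\<And>x. x \<in> ?E \<Longrightarrow> norm x \<le> b" using finite_imp_bounded by (metis bounded_iff)
  show "\<forall>\<^sub>F x in inf at_infinity (principal \<Lambda>1). local_Lp R p w f x < e"
    unfolding eventually_inf_principal eventually_at_infinity
  proof (intro exI[of _ "b + 1"] allI impI)
    fix x assume "b + 1 \<le> norm x" "x \<in> \<Lambda>1"
    then show "local_Lp R p w f x < e" using b[of x] by force
  qed
qed

text \<open>A finite tensor has finitely many first factors f, each with vanishing local norms. The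
  majorant G is independent of \<Xi>, so it survives passage to full rows.\<close>

lemma coef_row_vanishes:
  assumes h: "h \<in> alg_tensor (Lp p w) L2"
  obtains G where "(G \<longlongrightarrow> 0) (inf at_infinity (principal \<Lambda>1))"
    "\<And>x \<Xi>. x \<in> \<Lambda>1 \<Longrightarrow> finite \<Xi> \<Longrightarrow> \<Xi> \<subseteq> \<Lambda>2 \<Longrightarrow> row_norm w \<Xi> (coef h) x \<le> G x"
proof -
  obtain C1 where "fst_coef_ok C1" using fst_coef_bound by blast
  note C1 = fst_coef_okD[OF this]
  obtain C2 where "snd_coef_ok C2" using snd_coef_bound by blast
  note C2 = snd_coef_okD[OF this]
  obtain r where r: "represents_tensor (Lp p w) L2 r h" using h by (auto simp: alg_tensor_def)
  then have mem: "set r \<subseteq> elems (Lp p w) \<times> elems L2" by (simp add: represents_tensor_def)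
  let ?G = "\<lambda>r x. \<Sum>(f, g)\<leftarrow>r. (C1 * local_Lp R p w f x powr (1 / p)) * (C2 * nrm L2 g)"
  have "(?G r \<longlongrightarrow> 0) (inf at_infinity (principal \<Lambda>1))"
    using mem
  proof (induction r)
    case (Cons fg r)
    obtain f g where fg: "fg = (f, g)" by force
    have "((\<lambda>x. local_Lp R p w f x powr (1 / p)) \<longlongrightarrow> 0 powr (1 / p)) (inf at_infinity (principal \<Lambda>1))"
      using Cons.prems p1 by (intro tendsto_powr' tendsto_const local_Lp_vanishes) (auto simp: fg local_Lp_nonneg)
    then have "((\<lambda>x. (C1 * local_Lp R p w f x powr (1 / p)) * (C2 * nrm L2 g)) \<longlongrightarrow> (C1 * 0) * (C2 * nrm L2 g)) (inf at_infinity (principal \<Lambda>1))"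
      using p1 by (intro tendsto_intros) simp
    then show ?case using tendsto_add[OF _ Cons.IH] Cons.prems by (fastforce simp: fg)
  qed simp
  moreover have "row_norm w \<Xi> (coef h) x \<le> ?G r x" if x: "x \<in> \<Lambda>1" "finite \<Xi>" "\<Xi> \<subseteq> \<Lambda>2" for x \<Xi>
  proof -
    have "row_norm w \<Xi> (coef h) x \<le> (\<Sum>(f, g)\<leftarrow>r. w x * norm (fst_coef f x) * L2_set (\<lambda>\<xi>. norm (snd_coef g x \<xi>)) \<Xi>)"
      by (rule row_norm_coef_le[OF r])
    also have "\<dots> \<le> ?G r x"
    proof (rule sum_list_mono, clarify)
      fix f g assume "(f, g) \<in> set r"
      then have fg: "f \<in> elems (Lp p w)" "g \<in> elems L2" using mem by auto
      show "w x * norm (fst_coef f x) * L2_set (\<lambda>\<xi>. norm (snd_coef g x \<xi>)) \<Xi> \<le> (C1 * local_Lp R p w f x powr (1 / p)) * (C2 * nrm L2 g)"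
      proof (rule mult_mono[OF C1(3)[OF fg(1)]])
        show "L2_set (\<lambda>\<xi>. norm (snd_coef g x \<xi>)) \<Xi> \<le> C2 * nrm L2 g"
          using C2(3)[OF fg(2), of "{x}" \<Xi>] x by (simp add: L2_set_def)
      qed (use C1(1) in auto)
    qed
    finally show ?thesis .
  qed
  ultimately show thesis by (rule that)
qed

end

section \<open>Weighted sequence spaces through finite blocks\<close>

subsection \<open>Sequence spaces\<close>

lemma summable_on_tail:
  fixes f :: "'i \<Rightarrow> real"
  assumes f: "f summable_on I" and e: "e > 0"
  obtains F where "finite F" "F \<subseteq> I" "\<And>Y. finite Y \<Longrightarrow> Y \<subseteq> I \<Longrightarrow> Y \<inter> F = {} \<Longrightarrow> sum f Y \<le> e"
proof -
  have "(sum f \<longlongrightarrow> infsum f I) (finite_subsets_at_top I)" by (rule infsum_tendsto[OF f])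
  then have "\<forall>\<^sub>F Y in finite_subsets_at_top I. dist (sum f Y) (infsum f I) < e / 2"
    using e by (intro tendstoD) auto
  then obtain F where F: "finite F" "F \<subseteq> I" "\<forall>Y. finite Y \<and> F \<subseteq> Y \<and> Y \<subseteq> I \<longrightarrow> dist (sum f Y) (infsum f I) < e / 2"
    unfolding eventually_finite_subsets_at_top by blast
  show thesis
  proof (rule that[OF F(1,2)])
    fix Y assume Y: "finite Y" "Y \<subseteq> I" "Y \<inter> F = {}"
    have "dist (sum f (Y \<union> F)) (infsum f I) < e / 2" using Y F by auto
    moreover have "dist (sum f F) (infsum f I) < e / 2" using F by auto
    moreover have "sum f (Y \<union> F) = sum f Y + sum f F" using Y F(1) by (intro sum.union_disjoint) auto
    ultimately show "sum f Y \<le> e" unfolding dist_real_def by linarith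
  qed
qed

lemma l2_finite_le:
  assumes "d \<in> elems (l2 I)" "finite \<Xi>" "\<Xi> \<subseteq> I"
  shows "L2_set (\<lambda>j. norm (d j)) \<Xi> \<le> nrm (l2 I) d"
  unfolding L2_set_def l2_def nspace.simps
  by (intro real_sqrt_le_mono finite_sum_le_infsum) (use assms in \<open>auto simp: l2_def\<close>)

lemma l2I:
  assumes d: "d \<in> extensional I" and K: "K \<ge> 0" "\<And>\<Xi>. finite \<Xi> \<Longrightarrow> \<Xi> \<subseteq> I \<Longrightarrow> L2_set (\<lambda>j. norm (d j)) \<Xi> \<le> K"
  shows "d \<in> elems (l2 I)" "nrm (l2 I) d \<le> K"
proof -
  have le: "(\<Sum>j\<in>\<Xi>. (norm (d j))\<^sup>2) \<le> K\<^sup>2" if "finite \<Xi>" "\<Xi> \<subseteq> I" for \<Xi>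
  proof -
    have "sqrt (\<Sum>j\<in>\<Xi>. (norm (d j))\<^sup>2) \<le> K" using K(2)[OF that] by (simp add: L2_set_def)
    then show ?thesis using K(1) by (simp add: real_sqrt_le_iff' sqrt_le_D)
  qed
  have s: "(\<lambda>j. (norm (d j))\<^sup>2) summable_on I"
    by (rule nonneg_bdd_above_summable_on) (use le in \<open>auto intro!: bdd_aboveI2\<close>)
  then show "d \<in> elems (l2 I)" using d by (simp add: l2_def)
  have "(\<Sum>\<^sub>\<infinity>j\<in>I. (norm (d j))\<^sup>2) \<le> K\<^sup>2" by (rule infsum_le_finite_sums[OF s le])
  then show "nrm (l2 I) d \<le> K" using K(1) by (simp add: l2_def real_le_lsqrt)
qed

lemma l2_nrm_nonneg: "nrm (l2 I) d \<ge> 0"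
  by (simp add: l2_def infsum_nonneg)

lemma l2_tail:
  assumes d: "d \<in> elems (l2 I)" and e: "e > 0"
  obtains F where "finite F" "F \<subseteq> I" "\<And>Y. finite Y \<Longrightarrow> Y \<subseteq> I \<Longrightarrow> Y \<inter> F = {} \<Longrightarrow> L2_set (\<lambda>j. norm (d j)) Y \<le> e"
proof -
  have s: "(\<lambda>j. (norm (d j))\<^sup>2) summable_on I" using d by (simp add: l2_def)
  have e2: "e\<^sup>2 > 0" using e by simp
  obtain F where F: "finite F" "F \<subseteq> I"
    "\<And>Y. finite Y \<Longrightarrow> Y \<subseteq> I \<Longrightarrow> Y \<inter> F = {} \<Longrightarrow> (\<Sum>j\<in>Y. (norm (d j))\<^sup>2) \<le> e\<^sup>2"
    by (rule summable_on_tail[OF s e2]) (rule that)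
  show thesis
    by (rule that[OF F(1,2)]) (use F(3) e in \<open>auto simp: L2_set_def intro!: real_le_lsqrt sum_nonneg\<close>)
qed

lemma curry_extensional: "c \<in> extensional (I \<times> J) \<Longrightarrow> curry c i \<in> extensional J"
  by (auto simp: extensional_def)

lemma row_norm_le_l2:
  assumes "w x \<ge> 0" "curry c x \<in> elems (l2 J)" "finite \<Xi>" "\<Xi> \<subseteq> J"
  shows "row_norm w \<Xi> c x \<le> nrm (l2 J) (curry c x) * w x"
  using mult_left_mono[OF l2_finite_le[OF assms(2-4)] assms(1)] by (simp add: row_norm_def mult.commute)

lemma row_norm_bound_imp_l2:
  assumes w: "w x > 0" and c: "c \<in> extensional (I \<times> J)" and K: "K \<ge> 0" "\<And>\<Xi>. finite \<Xi> \<Longrightarrow> \<Xi> \<subseteq> J \<Longrightarrow> row_norm w \<Xi> c x \<le> K"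
  shows "curry c x \<in> elems (l2 J)" "nrm (l2 J) (curry c x) * w x \<le> K"
proof -
  have le: "L2_set (\<lambda>j. norm (curry c x j)) \<Xi> \<le> K / w x" if "finite \<Xi>" "\<Xi> \<subseteq> J" for \<Xi>
    using K(2)[OF that] w by (simp add: row_norm_def field_simps)
  have K': "0 \<le> K / w x" using K(1) w by simp
  show "curry c x \<in> elems (l2 J)" by (rule l2I(1)[OF curry_extensional[OF c] K' le])
  have "nrm (l2 J) (curry c x) \<le> K / w x" by (rule l2I(2)[OF curry_extensional[OF c] K' le])
  then show "nrm (l2 J) (curry c x) * w x \<le> K" by (simp only: pos_le_divide_eq[OF w])
qed

lemma row_norm_limit:
  assumes "curry c x \<in> elems (l2 J)"
  shows "((\<lambda>\<Xi>. row_norm w \<Xi> c x) \<longlongrightarrow> nrm (l2 J) (curry c x) * w x) (finite_subsets_at_top J)"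
proof -
  have "(\<lambda>j. (norm (curry c x j))\<^sup>2) summable_on J" using assms by (simp add: l2_def)
  from infsum_tendsto[OF this]
  have "((\<lambda>\<Xi>. w x * sqrt (\<Sum>j\<in>\<Xi>. (norm (curry c x j))\<^sup>2)) \<longlongrightarrow> w x * sqrt (\<Sum>\<^sub>\<infinity>j\<in>J. (norm (curry c x j))\<^sup>2)) (finite_subsets_at_top J)"
    by (intro tendsto_intros)
  then show ?thesis by (simp add: row_norm_def L2_set_def l2_def mult.commute)
qed

text \<open>Finite blocks decide membership and norm: for fixed finite X the pieces \<Xi> are
  exhausted first, then X is enlarged.\<close>

lemma l1wI:
  assumes w: "\<And>x. w x > 0" and c: "c \<in> extensional (I \<times> J)" and K: "K \<ge> 0"
    and le: "\<And>X \<Xi>. finite X \<Longrightarrow> X \<subseteq> I \<Longrightarrow> finite \<Xi> \<Longrightarrow> \<Xi> \<subseteq> J \<Longrightarrow> (\<Sum>x\<in>X. row_norm w \<Xi> c x) \<le> K"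
  shows "c \<in> elems (l1w w I J (l2 J))" "nrm (l1w w I J (l2 J)) c \<le> K"
proof -
  have row: "curry c x \<in> elems (l2 J)" if "x \<in> I" for x
    by (rule row_norm_bound_imp_l2(1)[OF w c K]) (use le[of "{x}"] that in auto)
  have fin: "(\<Sum>x\<in>X. nrm (l2 J) (curry c x) * w x) \<le> K" if X: "finite X" "X \<subseteq> I" for X
  proof (rule tendsto_upperbound)
    show "((\<lambda>\<Xi>. \<Sum>x\<in>X. row_norm w \<Xi> c x) \<longlongrightarrow> (\<Sum>x\<in>X. nrm (l2 J) (curry c x) * w x)) (finite_subsets_at_top J)"
      by (intro tendsto_sum row_norm_limit row) (use X in auto)
    show "\<forall>\<^sub>F \<Xi> in finite_subsets_at_top J. (\<Sum>x\<in>X. row_norm w \<Xi> c x) \<le> K"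
      by (rule eventually_finite_subsets_at_top_weakI) (rule le[OF X])
  qed simp
  have s: "(\<lambda>x. nrm (l2 J) (curry c x) * w x) summable_on I"
  proof (rule nonneg_bdd_above_summable_on)
    show "0 \<le> nrm (l2 J) (curry c x) * w x" for x by (intro mult_nonneg_nonneg l2_nrm_nonneg less_imp_le[OF w])
    show "bdd_above (sum (\<lambda>x. nrm (l2 J) (curry c x) * w x) ` {X. X \<subseteq> I \<and> finite X})"
      by (rule bdd_aboveI2[of _ _ K]) (use fin in blast)
  qed
  show "c \<in> elems (l1w w I J (l2 J))" using c row s by (simp add: l1w_def)
  show "nrm (l1w w I J (l2 J)) c \<le> K" unfolding l1w_def nspace.simps by (rule infsum_le_finite_sums[OF s fin])
qed

lemma c0wI:
  fixes I :: "'a::real_normed_vector set"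
  assumes w: "\<And>x. w x > 0" and c: "c \<in> extensional (I \<times> J)" and K: "K \<ge> 0" and I: "I \<noteq> {}"
    and le: "\<And>x \<Xi>. x \<in> I \<Longrightarrow> finite \<Xi> \<Longrightarrow> \<Xi> \<subseteq> J \<Longrightarrow> row_norm w \<Xi> c x \<le> K"
    and van: "\<And>e. e > 0 \<Longrightarrow> \<forall>\<^sub>F x in inf at_infinity (principal I). \<forall>\<Xi>. finite \<Xi> \<longrightarrow> \<Xi> \<subseteq> J \<longrightarrow> row_norm w \<Xi> c x \<le> e"
  shows "c \<in> elems (c0w w I J (l2 J))" "nrm (c0w w I J (l2 J)) c \<le> K"
proof -
  have row: "curry c x \<in> elems (l2 J)" "nrm (l2 J) (curry c x) * w x \<le> K" if "x \<in> I" for x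
    using row_norm_bound_imp_l2[OF w c K le[OF that]] by auto
  have "((\<lambda>x. nrm (l2 J) (curry c x) * w x) \<longlongrightarrow> 0) (inf at_infinity (principal I))"
  proof (rule order_tendstoI)
    fix e :: real assume "e < 0"
    then show "\<forall>\<^sub>F x in inf at_infinity (principal I). e < nrm (l2 J) (curry c x) * w x"
      by (intro always_eventually allI) (rule less_le_trans[of e 0], simp, intro mult_nonneg_nonneg l2_nrm_nonneg less_imp_le[OF w])
  next
    fix e :: real assume e: "e > 0"
    then have "e / 2 > 0" by simp
    from van[OF this] show "\<forall>\<^sub>F x in inf at_infinity (principal I). nrm (l2 J) (curry c x) * w x < e"
    proof (rule eventually_mono)
      fix x assume a: "\<forall>\<Xi>. finite \<Xi> \<longrightarrow> \<Xi> \<subseteq> J \<longrightarrow> row_norm w \<Xi> c x \<le> e / 2"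
      have "nrm (l2 J) (curry c x) * w x \<le> e / 2"
        by (rule row_norm_bound_imp_l2(2)[OF w c]) (use e a in auto)
      then show "nrm (l2 J) (curry c x) * w x < e" using e by linarith
    qed
  qed
  then show "c \<in> elems (c0w w I J (l2 J))" using c row by (simp add: c0w_def)
  show "nrm (c0w w I J (l2 J)) c \<le> K" unfolding c0w_def nspace.simps by (rule cSUP_least[OF I row(2)])
qed

lemma row_norm_mask:
  assumes "finite \<Xi>"
  shows "row_norm w \<Xi> (\<lambda>\<mu>. if \<mu> \<in> A \<times> B then 0 else c \<mu>) x = (if x \<in> A then row_norm w (\<Xi> - B) c x else row_norm w \<Xi> c x)"
proof (cases "x \<in> A")
  case True
  have "(\<Sum>\<xi>\<in>\<Xi>. (norm (if (x, \<xi>) \<in> A \<times> B then 0 else c (x, \<xi>)))\<^sup>2) = (\<Sum>\<xi>\<in>\<Xi> - B. (norm (c (x, \<xi>)))\<^sup>2)"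
    by (rule sum.mono_neutral_cong_right) (use assms True in auto)
  then show ?thesis using True by (simp add: row_norm_def L2_set_def)
qed (simp add: row_norm_def)

lemma finite_subset_lattice_ball:
  assumes "finite F" "F \<subseteq> \<Lambda>"
  obtains J where "\<And>j. j \<ge> J \<Longrightarrow> F \<subseteq> lattice_ball \<Lambda> j"
proof -
  obtain b where b: "\<And>x. x \<in> F \<Longrightarrow> norm x \<le> b" using finite_imp_bounded[OF assms(1)] by (auto simp: bounded_iff)
  show thesis
  proof (rule that[of "nat \<lceil>b\<rceil>"])
    fix j assume "nat \<lceil>b\<rceil> \<le> j"
    then have "b \<le> real j" by linarith
    then show "F \<subseteq> lattice_ball \<Lambda> j" using b assms(2) by (force simp: lattice_ball_def)
  qed
qed

text \<open>Only one constant is assumed positive; |B1| + 1 supplies the other, which is legitimate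
  because the norm on Y is nonnegative.\<close>

lemma eq_topI:
  assumes B2: "B2 > 0" and XY: "\<And>c. c \<in> elems X \<Longrightarrow> c \<in> elems Y \<and> nrm Y c \<le> B2 * nrm X c"
    and YX: "\<And>c. c \<in> elems Y \<Longrightarrow> c \<in> elems X \<and> nrm X c \<le> B1 * nrm Y c" and nn: "\<And>c. c \<in> elems Y \<Longrightarrow> nrm Y c \<ge> 0"
  shows "X \<approx>\<^sub>t\<^sub>o\<^sub>p Y"
proof -
  have "1 / (\<bar>B1\<bar> + 1) * nrm X c \<le> nrm Y c \<and> nrm Y c \<le> B2 * nrm X c" if c: "c \<in> elems X" for c
  proof
    have Y: "c \<in> elems Y" using XY[OF c] by blast
    have "nrm X c \<le> B1 * nrm Y c" using YX[OF Y] by blast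
    also have "\<dots> \<le> (\<bar>B1\<bar> + 1) * nrm Y c" using nn[OF Y] by (intro mult_right_mono) auto
    finally show "1 / (\<bar>B1\<bar> + 1) * nrm X c \<le> nrm Y c" by (simp add: field_simps)
    show "nrm Y c \<le> B2 * nrm X c" using XY[OF c] by blast
  qed
  moreover have "1 / (\<bar>B1\<bar> + 1) > 0" by simp
  moreover have "elems X = elems Y" using XY YX by blast
  ultimately show ?thesis unfolding eq_top_def using B2 by blast
qed

text \<open>The definite description in \<open>discrete_space\<close> denotes u, because a tempered
  distribution is determined by its values on test functions.\<close>

lemma discrete_space_nrm:
  fixes chi k :: "'a::euclidean_space \<times> 'a \<Rightarrow> complex"
  assumes k: "k \<in> test_functions UNIV" "k 0 = 1"
    and u: "u \<in> elems (completion H N)" "represents_dist (synth \<Lambda> chi c) u"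
  shows "nrm (discrete_space (completion H N) chi \<Lambda>) c = nrm (completion H N) u"
proof -
  have "(THE v. v \<in> elems (completion H N) \<and> represents_dist (synth \<Lambda> chi c) v) = u"
  proof (rule the_equality)
    fix v assume v: "v \<in> elems (completion H N) \<and> represents_dist (synth \<Lambda> chi c) v"
    show "v = u"
      by (rule tempered_eqI[OF k]) (use u v in \<open>auto simp: completion_def represents_dist_def\<close>)
  qed (use u in blast)
  then show ?thesis by (simp add: discrete_space_def)
qed

section \<open>The projective and the injective identification\<close>

locale gabor_discrete = gabor \<Lambda>1 \<Lambda>2 w p for \<Lambda>1 \<Lambda>2 :: "'a::euclidean_space set" and w p +
  fixes U :: "('a \<times> 'a) set" and chi :: "'a \<times> 'a \<Rightarrow> complex"
  assumes disjoint: "disjoint_family_on (\<lambda>\<mu>. (+) \<mu> ` U) (\<Lambda>1 \<times> \<Lambda>2)"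
    and chi_test: "chi \<in> test_functions U" and chi_nonzero: "chi \<noteq> (\<lambda>_. 0)"
begin

text \<open>The shifted windows are test functions, so convergence in the sense of distributions
  alone recovers each coefficient, along every approximating sequence and for any norm. The factor
  \<kappa> is the integral of \<open>chi\<close> against the product window.\<close>

lemma window_exists:
  obtains \<phi> \<psi> R P \<kappa> where "gabor_window \<Lambda>1 \<Lambda>2 w p \<phi> \<psi> R P" "\<kappa> \<noteq> 0"
    "\<And>c u H N h \<mu>. represents_dist (synth (\<Lambda>1 \<times> \<Lambda>2) chi c) u \<Longrightarrow> approximates H N h u \<Longrightarrow> \<mu> \<in> \<Lambda>1 \<times> \<Lambda>2 \<Longrightarrow>
      (\<lambda>k. gabor_window.coef \<phi> \<psi> (h k) \<mu>) \<longlonglongrightarrow> \<kappa> * c \<mu>"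
proof -
  obtain \<phi> \<psi> :: "'a \<Rightarrow> complex" and R P where s: "smooth \<phi>" "smooth \<psi>"
    and R: "\<And>t. \<phi> t \<noteq> 0 \<Longrightarrow> norm t \<le> R" "\<And>\<eta>. \<psi> \<eta> \<noteq> 0 \<Longrightarrow> norm \<eta> \<le> R" "R > 0"
    and P: "\<And>t. norm (\<phi> t) \<le> P" "\<And>\<eta>. norm (\<psi> \<eta>) \<le> P" "P > 0"
    and U: "\<And>t \<eta>. \<phi> t \<noteq> 0 \<Longrightarrow> \<psi> \<eta> \<noteq> 0 \<Longrightarrow> (t, \<eta>) \<in> U"
    and nz: "(\<integral>z. chi z * (\<phi> (fst z) * \<psi> (snd z)) \<partial>lborel) \<noteq> 0"
    by (rule product_window[OF chi_test chi_nonzero]) (rule that)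
  have W: "gabor_window \<Lambda>1 \<Lambda>2 w p \<phi> \<psi> R P"
    by unfold_locales (use smooth_borel[OF s(1)] smooth_borel[OF s(2)] R P in auto)
  interpret W: gabor_window \<Lambda>1 \<Lambda>2 w p \<phi> \<psi> R P by (rule W)
  show thesis
  proof (rule that[OF W nz])
    fix c u H N h and \<mu> :: "'a \<times> 'a"
    assume rep: "represents_dist (synth (\<Lambda>1 \<times> \<Lambda>2) chi c) u" and h: "approximates H N h u" and \<mu>: "\<mu> \<in> \<Lambda>1 \<times> \<Lambda>2"
    have t: "window \<phi> \<psi> \<mu> \<in> test_functions UNIV" by (rule window_test_function[OF s R(1,2)])
    have "u (window \<phi> \<psi> \<mu>) = pairing (synth (\<Lambda>1 \<times> \<Lambda>2) chi c) (window \<phi> \<psi> \<mu>)"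
      using rep t by (simp add: represents_dist_def)
    also have "\<dots> = c \<mu> * (\<integral>z. chi z * (\<phi> (fst z) * \<psi> (snd z)) \<partial>lborel)"
      by (rule pairing_synth_window[OF chi_test disjoint \<mu> W.\<phi>_borel W.\<psi>_borel U])
    finally have "u (window \<phi> \<psi> \<mu>) = (\<integral>z. chi z * (\<phi> (fst z) * \<psi> (snd z)) \<partial>lborel) * c \<mu>" by (simp add: mult.commute)
    moreover have "(\<lambda>k. pairing (h k) (window \<phi> \<psi> \<mu>)) \<longlonglongrightarrow> u (window \<phi> \<psi> \<mu>)"
      using h test_functions_schwartz[OF t] by (simp add: approximates_def)
    ultimately show "(\<lambda>k. W.coef (h k) \<mu>) \<longlonglongrightarrow> (\<integral>z. chi z * (\<phi> (fst z) * \<psi> (snd z)) \<partial>lborel) * c \<mu>"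
      by (simp add: W.coef_def)
  qed
qed

lemma w_pos: "w x > 0"
  by (rule weight_pos[OF weight])

text \<open>An entry is bounded by its row norm, hence by K / w x, and 1 / w grows at most
  polynomially. The quantifiers over c and K stay inside so that constant and exponent depend on the
  weight alone.\<close>

lemma coefficient_growth:
  obtains C n where "\<forall>c K. (\<forall>x\<in>\<Lambda>1. curry c x \<in> elems (l2 \<Lambda>2) \<and> nrm (l2 \<Lambda>2) (curry c x) * w x \<le> K) \<longrightarrow>
    (\<forall>x\<in>\<Lambda>1. \<forall>\<xi>\<in>\<Lambda>2. norm (c (x, \<xi>)) \<le> (K * C) * (1 + norm x) ^ n)"
proof -
  obtain C n where C: "C > 0" "\<And>x. 1 \<le> C * w x * (1 + norm x) ^ n" by (rule weight_lower_bound[OF weight]) (rule that)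
  show thesis
  proof (rule that, intro allI impI ballI)
    fix c :: "'a \<times> 'a \<Rightarrow> complex" and K x \<xi>
    assume row: "\<forall>x\<in>\<Lambda>1. curry c x \<in> elems (l2 \<Lambda>2) \<and> nrm (l2 \<Lambda>2) (curry c x) * w x \<le> K" and x: "x \<in> \<Lambda>1" "\<xi> \<in> \<Lambda>2"
    have "norm (c (x, \<xi>)) \<le> nrm (l2 \<Lambda>2) (curry c x)"
      using l2_finite_le[of "curry c x" \<Lambda>2 "{\<xi>}"] bspec[OF row x(1)] x by (simp add: L2_set_def)
    then have "norm (c (x, \<xi>)) * w x \<le> K"
      using bspec[OF row x(1)] mult_right_mono[of _ _ "w x"] w_pos[of x] by (meson less_imp_le order_trans)
    then have "(norm (c (x, \<xi>)) * w x) * (C * (1 + norm x) ^ n) \<le> K * (C * (1 + norm x) ^ n)"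
      using C(1) by (intro mult_right_mono) auto
    moreover have "norm (c (x, \<xi>)) * 1 \<le> norm (c (x, \<xi>)) * (C * w x * (1 + norm x) ^ n)" by (intro mult_left_mono C(2)) simp
    ultimately show "norm (c (x, \<xi>)) \<le> (K * C) * (1 + norm x) ^ n" by (simp add: mult_ac)
  qed
qed

text \<open>Each of finitely many rows has small tails outside a finite set; one lattice ball
  contains all these sets.\<close>

lemma row_tail:
  assumes row: "\<And>x. x \<in> X0 \<Longrightarrow> curry c x \<in> elems (l2 \<Lambda>2)" and X0: "finite X0" and e: "e > 0"
  obtains J where "\<And>j x \<Xi>. j \<ge> J \<Longrightarrow> x \<in> X0 \<Longrightarrow> finite \<Xi> \<Longrightarrow> \<Xi> \<subseteq> \<Lambda>2 \<Longrightarrow> row_norm w (\<Xi> - lattice_ball \<Lambda>2 j) c x \<le> e"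
proof -
  have "\<forall>x\<in>X0. \<exists>F. finite F \<and> F \<subseteq> \<Lambda>2 \<and> (\<forall>Y. finite Y \<longrightarrow> Y \<subseteq> \<Lambda>2 \<longrightarrow> Y \<inter> F = {} \<longrightarrow> row_norm w Y c x \<le> e)"
  proof
    fix x assume x: "x \<in> X0"
    have "e / w x > 0" using e w_pos[of x] by simp
    then obtain F where F: "finite F" "F \<subseteq> \<Lambda>2"
      "\<And>Y. finite Y \<Longrightarrow> Y \<subseteq> \<Lambda>2 \<Longrightarrow> Y \<inter> F = {} \<Longrightarrow> L2_set (\<lambda>j. norm (curry c x j)) Y \<le> e / w x"
      by (rule l2_tail[OF row[OF x]]) (rule that)
    have "row_norm w Y c x \<le> e" if "finite Y" "Y \<subseteq> \<Lambda>2" "Y \<inter> F = {}" for Y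
      using F(3)[OF that] w_pos[of x] by (simp add: row_norm_def field_simps)
    then show "\<exists>F. finite F \<and> F \<subseteq> \<Lambda>2 \<and> (\<forall>Y. finite Y \<longrightarrow> Y \<subseteq> \<Lambda>2 \<longrightarrow> Y \<inter> F = {} \<longrightarrow> row_norm w Y c x \<le> e)"
      using F(1,2) by blast
  qed
  from bchoice[OF this] obtain F where F: "\<forall>x\<in>X0. finite (F x) \<and> F x \<subseteq> \<Lambda>2 \<and>
    (\<forall>Y. finite Y \<longrightarrow> Y \<subseteq> \<Lambda>2 \<longrightarrow> Y \<inter> F x = {} \<longrightarrow> row_norm w Y c x \<le> e)" ..
  have "finite (\<Union>x\<in>X0. F x)" "(\<Union>x\<in>X0. F x) \<subseteq> \<Lambda>2" using F X0 by auto
  then obtain J where J: "\<And>j. j \<ge> J \<Longrightarrow> (\<Union>x\<in>X0. F x) \<subseteq> lattice_ball \<Lambda>2 j" by (rule finite_subset_lattice_ball) (rule that)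
  show thesis
  proof (rule that[of J])
    fix j x \<Xi> assume j: "J \<le> j" and x: "x \<in> X0" and \<Xi>: "finite \<Xi>" "\<Xi> \<subseteq> \<Lambda>2"
    have "finite (\<Xi> - lattice_ball \<Lambda>2 j)" "\<Xi> - lattice_ball \<Lambda>2 j \<subseteq> \<Lambda>2" "(\<Xi> - lattice_ball \<Lambda>2 j) \<inter> F x = {}" using J[OF j] x \<Xi> by auto
    then show "row_norm w (\<Xi> - lattice_ball \<Lambda>2 j) c x \<le> e" using bspec[OF F x] by blast
  qed
qed

theorem proj_discrete_space:
  assumes p2: "p \<le> 2"
  shows "discrete_space (Lp p w \<otimes>\<^sub>\<pi> L2) chi (\<Lambda>1 \<times> \<Lambda>2) \<approx>\<^sub>t\<^sub>o\<^sub>p l1w w \<Lambda>1 \<Lambda>2 (l2 \<Lambda>2)"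
proof -
  let ?H = "alg_tensor (Lp p w) L2 :: ('a \<times> 'a \<Rightarrow> complex) set"
  let ?N = "proj_tensor_norm (Lp p w) L2 :: ('a \<times> 'a \<Rightarrow> complex) \<Rightarrow> real"
  let ?F = "completion ?H ?N" and ?Y = "l1w w \<Lambda>1 \<Lambda>2 (l2 \<Lambda>2)"
  let ?X = "discrete_space ?F chi (\<Lambda>1 \<times> \<Lambda>2)"
  have N: "tensor_seminorm ?H ?N" using p1 by (intro proj_tensor_seminorm weight) auto
  obtain k0 :: "'a \<times> 'a \<Rightarrow> complex" where k0: "k0 \<in> test_functions UNIV" "k0 0 = 1"
    using unit_test_function[OF chi_test chi_nonzero] by blast
  obtain \<phi> \<psi> R P \<kappa> where W: "gabor_window \<Lambda>1 \<Lambda>2 w p \<phi> \<psi> R P" and \<kappa>: "\<kappa> \<noteq> 0"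
    and coef: "\<And>c u H N h \<mu>. represents_dist (synth (\<Lambda>1 \<times> \<Lambda>2) chi c) u \<Longrightarrow> approximates H N h u \<Longrightarrow> \<mu> \<in> \<Lambda>1 \<times> \<Lambda>2 \<Longrightarrow>
      (\<lambda>k. gabor_window.coef \<phi> \<psi> (h k) \<mu>) \<longlonglongrightarrow> \<kappa> * c \<mu>"
    by (rule window_exists) (rule that)
  interpret W: gabor_window \<Lambda>1 \<Lambda>2 w p \<phi> \<psi> R P by (rule W)
  obtain C where C: "C > 0"
    "\<And>h X \<Xi>. h \<in> ?H \<Longrightarrow> finite X \<Longrightarrow> X \<subseteq> \<Lambda>1 \<Longrightarrow> finite \<Xi> \<Longrightarrow> \<Xi> \<subseteq> \<Lambda>2 \<Longrightarrow> (\<Sum>x\<in>X. row_norm w \<Xi> (W.coef h) x) \<le> C * ?N h"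
    by (rule W.proj_analysis_bound[OF p2]) (rule that)
  define adm where "adm X \<Xi> c K \<longleftrightarrow> (\<Sum>x\<in>X. row_norm w \<Xi> c x) \<le> K" for X \<Xi> c K
  have r1: "\<exists>C\<ge>0. rank_one_bounded \<Lambda>1 \<Lambda>2 p ?H ?N adm R C" for R
  proof -
    obtain C where C: "C \<ge> 0"
      "\<And>\<phi> \<psi> A P X \<Xi> c. \<phi> \<in> borel_measurable borel \<Longrightarrow> (\<And>t. norm (\<phi> t) \<le> 1) \<Longrightarrow> (\<And>t. \<phi> t \<noteq> 0 \<Longrightarrow> norm t \<le> R) \<Longrightarrow>
      \<psi> \<in> borel_measurable borel \<Longrightarrow> (\<And>\<eta>. norm (\<psi> \<eta>) \<le> P) \<Longrightarrow> (\<And>\<eta>. \<psi> \<eta> \<noteq> 0 \<Longrightarrow> norm \<eta> \<le> R) \<Longrightarrow>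
      (\<integral>t. norm (\<phi> t) powr p \<partial>lborel) powr (1 / p) \<le> A \<Longrightarrow>
      finite X \<Longrightarrow> X \<subseteq> \<Lambda>1 \<Longrightarrow> finite \<Xi> \<Longrightarrow> \<Xi> \<subseteq> \<Lambda>2 \<Longrightarrow>
      fin_synth (X \<times> \<Xi>) c (\<lambda>z. \<phi> (fst z) * \<psi> (snd z)) \<in> ?H \<and>
      ?N (fin_synth (X \<times> \<Xi>) c (\<lambda>z. \<phi> (fst z) * \<psi> (snd z))) \<le> C * (A * P) * (\<Sum>x\<in>X. row_norm w \<Xi> c x)"
      apply (rule proj_rank_one_bound[of R])
      subgoal premises prems by (rule prems(1)[OF prems(2) prems(3)])
      done
    have "rank_one_bounded \<Lambda>1 \<Lambda>2 p ?H ?N adm R C"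
      unfolding rank_one_bounded_def
    proof (intro allI impI)
      fix \<phi> \<psi> :: "'a \<Rightarrow> complex" and A P X \<Xi> and c :: "'a \<times> 'a \<Rightarrow> complex" and K
      assume a: "\<phi> \<in> borel_measurable borel" "\<forall>t. norm (\<phi> t) \<le> 1" "\<forall>t. \<phi> t \<noteq> 0 \<longrightarrow> norm t \<le> R"
        "\<psi> \<in> borel_measurable borel" "\<forall>\<eta>. norm (\<psi> \<eta>) \<le> P" "\<forall>\<eta>. \<psi> \<eta> \<noteq> 0 \<longrightarrow> norm \<eta> \<le> R"
        "(\<integral>t. norm (\<phi> t) powr p \<partial>lborel) powr (1 / p) \<le> A" "finite X" "X \<subseteq> \<Lambda>1" "finite \<Xi>" "\<Xi> \<subseteq> \<Lambda>2" and adm: "adm X \<Xi> c K"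
      have *: "fin_synth (X \<times> \<Xi>) c (\<lambda>z. \<phi> (fst z) * \<psi> (snd z)) \<in> ?H \<and>
        ?N (fin_synth (X \<times> \<Xi>) c (\<lambda>z. \<phi> (fst z) * \<psi> (snd z))) \<le> C * (A * P) * (\<Sum>x\<in>X. row_norm w \<Xi> c x)"
        by (rule C(2)) (use a in auto)
      have "A \<ge> 0" using a(7) powr_ge_zero order_trans by blast
      moreover have "P \<ge> 0" using a(5) norm_ge_zero order_trans by blast
      ultimately have "C * (A * P) * (\<Sum>x\<in>X. row_norm w \<Xi> c x) \<le> C * (A * P) * K"
        using adm C(1) unfolding adm_def by (intro mult_left_mono) auto
      with * show "fin_synth (X \<times> \<Xi>) c (\<lambda>z. \<phi> (fst z) * \<psi> (snd z)) \<in> ?H \<and>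
        ?N (fin_synth (X \<times> \<Xi>) c (\<lambda>z. \<phi> (fst z) * \<psi> (snd z))) \<le> C * (A * P) * K" by linarith
    qed
    then show ?thesis using C(1) by blast
  qed
  obtain B where B: "B \<ge> 0"
    "\<And>c K D n. (\<And>x \<xi>. x \<in> \<Lambda>1 \<Longrightarrow> \<xi> \<in> \<Lambda>2 \<Longrightarrow> norm (c (x, \<xi>)) \<le> D * (1 + norm x) ^ n) \<Longrightarrow> K \<ge> 0 \<Longrightarrow>
      (\<And>k. adm (lattice_ball \<Lambda>1 k) (lattice_ball \<Lambda>2 k) c K) \<Longrightarrow>
      (\<And>e. e > 0 \<Longrightarrow> \<exists>J. \<forall>j\<ge>J. \<forall>k\<ge>j. adm (lattice_ball \<Lambda>1 k) (lattice_ball \<Lambda>2 k) (\<lambda>\<mu>. if \<mu> \<in> lattice_ball \<Lambda>1 j \<times> lattice_ball \<Lambda>2 j then 0 else c \<mu>) e) \<Longrightarrow>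
      \<exists>u\<in>tempered. \<exists>h. approximates ?H ?N h u \<and> (\<forall>k. ?N (h k) \<le> B * K) \<and> represents_dist (synth (\<Lambda>1 \<times> \<Lambda>2) chi c) u"
    apply (rule synthesis_in_completion[OF lattice1 lattice2 p1 chi_test N r1])
    subgoal premises prems by (rule prems(1)[OF prems(2) prems(3)])
    done
  have "?X \<approx>\<^sub>t\<^sub>o\<^sub>p ?Y"
  proof (rule eq_topI)
    show "C / norm \<kappa> > 0" using C(1) \<kappa> by simp
  next
    fix c assume "c \<in> elems ?X"
    then obtain u where c: "c \<in> extensional (\<Lambda>1 \<times> \<Lambda>2)" and u: "u \<in> elems ?F" "represents_dist (synth (\<Lambda>1 \<times> \<Lambda>2) chi c) u"
      by (auto simp: discrete_space_def)
    have nX: "nrm ?X c = nrm ?F u" by (rule discrete_space_nrm[OF k0 u])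
    have le: "(\<Sum>x\<in>X. row_norm w \<Xi> c x) \<le> C / norm \<kappa> * nrm ?F u" if X: "finite X" "X \<subseteq> \<Lambda>1" "finite \<Xi>" "\<Xi> \<subseteq> \<Lambda>2" for X \<Xi>
    proof -
      \<comment> \<open>The constants are moved to the left because
        \<open>completion_norm_ge\<close> needs a number below the limit of norms of every
        approximating sequence.\<close>
      have "norm \<kappa> / C * (\<Sum>x\<in>X. row_norm w \<Xi> c x) \<le> nrm ?F u"
      proof (rule completion_norm_ge[OF N u(1)])
        fix h L assume h: "approximates ?H ?N h u" and L: "(\<lambda>k. ?N (h k)) \<longlonglongrightarrow> L"
        have "(\<Sum>x\<in>X. row_norm w \<Xi> (\<lambda>\<mu>. \<kappa> * c \<mu>) x) \<le> C * L"
        proof (rule LIMSEQ_le)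
          show "(\<lambda>k. \<Sum>x\<in>X. row_norm w \<Xi> (W.coef (h k)) x) \<longlonglongrightarrow> (\<Sum>x\<in>X. row_norm w \<Xi> (\<lambda>\<mu>. \<kappa> * c \<mu>) x)"
            by (intro tendsto_sum row_norm_tendsto coef[OF u(2) h]) (use X in auto)
          show "(\<lambda>k. C * ?N (h k)) \<longlonglongrightarrow> C * L" by (intro tendsto_intros L)
          show "\<exists>M. \<forall>k\<ge>M. (\<Sum>x\<in>X. row_norm w \<Xi> (W.coef (h k)) x) \<le> C * ?N (h k)"
            using C(2)[OF _ X] h by (auto simp: approximates_def)
        qed
        then have "norm \<kappa> * (\<Sum>x\<in>X. row_norm w \<Xi> c x) \<le> C * L" by (simp add: row_norm_scale sum_distrib_left)
        then show "norm \<kappa> / C * (\<Sum>x\<in>X. row_norm w \<Xi> c x) \<le> L" using C(1) by (simp add: field_simps)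
      qed
      then show ?thesis using C(1) \<kappa> by (simp add: field_simps)
    qed
    have "0 \<le> C / norm \<kappa> * nrm ?F u" using le[of "{}" "{}"] by simp
    from l1wI[OF w_pos c this le] show "c \<in> elems ?Y \<and> nrm ?Y c \<le> C / norm \<kappa> * nrm ?X c" by (simp add: nX)
  next
    fix c assume cY: "c \<in> elems ?Y"
    let ?g = "\<lambda>x. nrm (l2 \<Lambda>2) (curry c x) * w x"
    have c: "c \<in> extensional (\<Lambda>1 \<times> \<Lambda>2)" and row: "\<And>x. x \<in> \<Lambda>1 \<Longrightarrow> curry c x \<in> elems (l2 \<Lambda>2)" and s: "?g summable_on \<Lambda>1"
      using cY by (auto simp: l1w_def)
    have g0: "?g x \<ge> 0" for x using w_pos[of x] by (intro mult_nonneg_nonneg l2_nrm_nonneg) auto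
    define K where "K = nrm ?Y c"
    have K: "K = infsum ?g \<Lambda>1" by (simp add: K_def l1w_def)
    have K0: "K \<ge> 0" unfolding K by (intro infsum_nonneg g0)
    have fin: "sum ?g X \<le> K" if "finite X" "X \<subseteq> \<Lambda>1" for X
      unfolding K by (intro finite_sum_le_infsum s that g0)
    have rg: "row_norm w \<Xi> c x \<le> ?g x" if "x \<in> \<Lambda>1" "finite \<Xi>" "\<Xi> \<subseteq> \<Lambda>2" for x \<Xi>
      by (rule row_norm_le_l2[OF less_imp_le[OF w_pos] row]) (use that in auto)
    obtain C0 n where growth: "\<forall>c K. (\<forall>x\<in>\<Lambda>1. curry c x \<in> elems (l2 \<Lambda>2) \<and> nrm (l2 \<Lambda>2) (curry c x) * w x \<le> K) \<longrightarrow>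
    (\<forall>x\<in>\<Lambda>1. \<forall>\<xi>\<in>\<Lambda>2. norm (c (x, \<xi>)) \<le> (K * C0) * (1 + norm x) ^ n)"
      by (rule coefficient_growth)
    have lattice_ball: "finite (lattice_ball \<Lambda>1 k)" "lattice_ball \<Lambda>1 k \<subseteq> \<Lambda>1" "finite (lattice_ball \<Lambda>2 k)" "lattice_ball \<Lambda>2 k \<subseteq> \<Lambda>2" for k
      by (intro lattice_ball_finite lattice1 lattice2 lattice_ball_subset)+
    have "\<exists>u\<in>tempered. \<exists>h. approximates ?H ?N h u \<and> (\<forall>k. ?N (h k) \<le> B * K) \<and> represents_dist (synth (\<Lambda>1 \<times> \<Lambda>2) chi c) u"
    proof (rule B(2)[OF _ K0])
      show "norm (c (x, \<xi>)) \<le> (K * C0) * (1 + norm x) ^ n" if "x \<in> \<Lambda>1" "\<xi> \<in> \<Lambda>2" for x \<xi>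
        using growth[rule_format, of c K x \<xi>] row fin[of "{x}" for x] that by auto
      show "adm (lattice_ball \<Lambda>1 k) (lattice_ball \<Lambda>2 k) c K" for k
      proof -
        have "(\<Sum>x\<in>lattice_ball \<Lambda>1 k. row_norm w (lattice_ball \<Lambda>2 k) c x) \<le> sum ?g (lattice_ball \<Lambda>1 k)"
          by (intro sum_mono rg lattice_ball) (use lattice_ball(2) in blast)
        also have "\<dots> \<le> K" by (intro fin lattice_ball)
        finally show ?thesis by (simp add: adm_def)
      qed
      fix e :: real assume e: "e > 0"
      then have "e / 2 > 0" by simp
      then obtain X0 where X0: "finite X0" "X0 \<subseteq> \<Lambda>1"
        "\<And>Y. finite Y \<Longrightarrow> Y \<subseteq> \<Lambda>1 \<Longrightarrow> Y \<inter> X0 = {} \<Longrightarrow> sum ?g Y \<le> e / 2"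
        by (rule summable_on_tail[OF s]) (rule that)
      \<comment> \<open>Rows outside \<open>X0\<close> may use e / 2 in total, and each row in
        \<open>X0\<close> gets an equal share of the rest; the 1 covers an empty
        \<open>X0\<close>.\<close>
      define e' where "e' = e / (2 * (real (card X0) + 1))"
      have e': "e' > 0" using e by (simp add: e'_def)
      obtain J1 where J1: "\<And>j x \<Xi>. j \<ge> J1 \<Longrightarrow> x \<in> X0 \<Longrightarrow> finite \<Xi> \<Longrightarrow> \<Xi> \<subseteq> \<Lambda>2 \<Longrightarrow> row_norm w (\<Xi> - lattice_ball \<Lambda>2 j) c x \<le> e'"
        by (rule row_tail[OF _ X0(1) e', of c]) (use X0(2) row in blast, rule that)
      obtain J2 where J2: "\<And>j. j \<ge> J2 \<Longrightarrow> X0 \<subseteq> lattice_ball \<Lambda>1 j" by (rule finite_subset_lattice_ball[OF X0(1,2)]) (rule that)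
      have "adm (lattice_ball \<Lambda>1 k) (lattice_ball \<Lambda>2 k) (\<lambda>\<mu>. if \<mu> \<in> lattice_ball \<Lambda>1 j \<times> lattice_ball \<Lambda>2 j then 0 else c \<mu>) e"
        if j: "j \<ge> max J1 J2" and jk: "k \<ge> j" for j k
      proof -
        let ?m = "\<lambda>\<mu>. if \<mu> \<in> lattice_ball \<Lambda>1 j \<times> lattice_ball \<Lambda>2 j then 0 else c \<mu>"
        \<comment> \<open>A row in \<open>X0\<close> belongs to the j-th ball, so the mask leaves
          only its tail beyond that ball. Every other row is bounded by its full norm.\<close>
        have m: "row_norm w (lattice_ball \<Lambda>2 k) ?m x \<le> (if x \<in> X0 then e' else ?g x)" if x: "x \<in> lattice_ball \<Lambda>1 k" for x
        proof (cases "x \<in> X0")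
          case True
          then have "x \<in> lattice_ball \<Lambda>1 j" using J2[of j] j by auto
          then have "row_norm w (lattice_ball \<Lambda>2 k) ?m x = row_norm w (lattice_ball \<Lambda>2 k - lattice_ball \<Lambda>2 j) c x"
            by (simp only: row_norm_mask[OF lattice_ball(3)] if_True)
          then show ?thesis using J1[OF _ True lattice_ball(3,4)] j True by simp
        next
          case False
          have "x \<in> \<Lambda>1" using x lattice_ball(2) by blast
          have "row_norm w (lattice_ball \<Lambda>2 k) ?m x \<le> ?g x"
            unfolding row_norm_mask[OF lattice_ball(3)]
            using rg[OF \<open>x \<in> \<Lambda>1\<close> lattice_ball(3,4), of k] rg[OF \<open>x \<in> \<Lambda>1\<close>, of "lattice_ball \<Lambda>2 k - lattice_ball \<Lambda>2 j"] lattice_ball(3,4)[of k] by auto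
          then show ?thesis using False by simp
        qed
        have "(\<Sum>x\<in>lattice_ball \<Lambda>1 k. row_norm w (lattice_ball \<Lambda>2 k) ?m x) \<le> (\<Sum>x\<in>lattice_ball \<Lambda>1 k. if x \<in> X0 then e' else ?g x)"
          by (intro sum_mono m)
        also have "\<dots> = (\<Sum>x\<in>lattice_ball \<Lambda>1 k \<inter> X0. e') + (\<Sum>x\<in>lattice_ball \<Lambda>1 k - X0. ?g x)"
          using sum.If_cases[OF lattice_ball(1)[of k], of "\<lambda>x. x \<in> X0" "\<lambda>_. e'" ?g] by (simp add: Diff_eq)
        also have "\<dots> \<le> real (card X0) * e' + e / 2"
        proof (intro add_mono)
          have "card (lattice_ball \<Lambda>1 k \<inter> X0) \<le> card X0" by (intro card_mono X0(1)) auto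
          then show "(\<Sum>x\<in>lattice_ball \<Lambda>1 k \<inter> X0. e') \<le> real (card X0) * e'" using e' by (simp add: mult_right_mono)
          show "(\<Sum>x\<in>lattice_ball \<Lambda>1 k - X0. ?g x) \<le> e / 2" using lattice_ball[of k] by (intro X0(3)) auto
        qed
        also have "real (card X0) * e' \<le> (real (card X0) + 1) * e'" using e' by simp
        also have "(real (card X0) + 1) * e' = e / 2" by (simp add: e'_def field_simps)
        finally show ?thesis by (simp add: adm_def)
      qed
      then show "\<exists>J. \<forall>j\<ge>J. \<forall>k\<ge>j. adm (lattice_ball \<Lambda>1 k) (lattice_ball \<Lambda>2 k) (\<lambda>\<mu>. if \<mu> \<in> lattice_ball \<Lambda>1 j \<times> lattice_ball \<Lambda>2 j then 0 else c \<mu>) e" by blast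
    qed
    then obtain u h where u: "u \<in> tempered" "approximates ?H ?N h u" "\<And>k. ?N (h k) \<le> B * K"
      "represents_dist (synth (\<Lambda>1 \<times> \<Lambda>2) chi c) u" by blast
    have uF: "u \<in> elems ?F" using u by (auto simp: completion_def)
    have "nrm ?X c \<le> B * K"
      unfolding discrete_space_nrm[OF k0 uF u(4)] by (rule completion_norm_le[OF N u(2,3)])
    then show "c \<in> elems ?X \<and> nrm ?X c \<le> B * nrm ?Y c"
      using c uF u(4) by (auto simp: discrete_space_def K_def)
  next
    fix c assume "c \<in> elems ?Y"
    show "nrm ?Y c \<ge> 0"
      using w_pos by (simp add: l1w_def) (intro infsum_nonneg mult_nonneg_nonneg l2_nrm_nonneg less_imp_le)
  qed
  then show ?thesis by (simp add: proj_tensor_def)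
qed

theorem inj_discrete_space:
  assumes p2: "p \<ge> 2"
  shows "discrete_space (Lp p w \<otimes>\<^sub>\<epsilon> L2) chi (\<Lambda>1 \<times> \<Lambda>2) \<approx>\<^sub>t\<^sub>o\<^sub>p c0w w \<Lambda>1 \<Lambda>2 (l2 \<Lambda>2)"
proof -
  let ?H = "alg_tensor (Lp p w) L2 :: ('a \<times> 'a \<Rightarrow> complex) set"
  let ?N = "inj_tensor_norm (Lp p w) L2 :: ('a \<times> 'a \<Rightarrow> complex) \<Rightarrow> real"
  let ?F = "completion ?H ?N" and ?Y = "c0w w \<Lambda>1 \<Lambda>2 (l2 \<Lambda>2)"
  let ?X = "discrete_space ?F chi (\<Lambda>1 \<times> \<Lambda>2)"
  let ?A = "inf at_infinity (principal \<Lambda>1)"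
  have N: "tensor_seminorm ?H ?N" using p1 by (intro inj_tensor_seminorm weight weight_one) auto
  have \<Lambda>0: "0 \<in> \<Lambda>1" "\<Lambda>1 \<noteq> {}" using lattice1 by (auto simp: is_lattice_def)
  obtain k0 :: "'a \<times> 'a \<Rightarrow> complex" where k0: "k0 \<in> test_functions UNIV" "k0 0 = 1"
    using unit_test_function[OF chi_test chi_nonzero] by blast
  obtain \<phi> \<psi> R P \<kappa> where W: "gabor_window \<Lambda>1 \<Lambda>2 w p \<phi> \<psi> R P" and \<kappa>: "\<kappa> \<noteq> 0"
    and coef: "\<And>c u H N h \<mu>. represents_dist (synth (\<Lambda>1 \<times> \<Lambda>2) chi c) u \<Longrightarrow> approximates H N h u \<Longrightarrow> \<mu> \<in> \<Lambda>1 \<times> \<Lambda>2 \<Longrightarrow>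
      (\<lambda>k. gabor_window.coef \<phi> \<psi> (h k) \<mu>) \<longlonglongrightarrow> \<kappa> * c \<mu>"
    by (rule window_exists) (rule that)
  interpret W: gabor_window \<Lambda>1 \<Lambda>2 w p \<phi> \<psi> R P by (rule W)
  obtain C where C: "C > 0"
    "\<And>h x \<Xi>. h \<in> ?H \<Longrightarrow> x \<in> \<Lambda>1 \<Longrightarrow> finite \<Xi> \<Longrightarrow> \<Xi> \<subseteq> \<Lambda>2 \<Longrightarrow> row_norm w \<Xi> (W.coef h) x \<le> C * ?N h"
    by (rule W.inj_analysis_bound) (rule that)
  \<comment> \<open>Nonnegativity of K is part of the condition because the bound on rows says
    nothing when X is empty.\<close>
  define adm where "adm X \<Xi> c K \<longleftrightarrow> K \<ge> 0 \<and> (\<forall>x\<in>X. row_norm w \<Xi> c x \<le> K)" for X \<Xi> c K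
  have r1: "\<exists>C\<ge>0. rank_one_bounded \<Lambda>1 \<Lambda>2 p ?H ?N adm R C" for R
  proof -
    obtain C where C: "C \<ge> 0"
      "\<And>\<phi> \<psi> A P X \<Xi> c K. \<phi> \<in> borel_measurable borel \<Longrightarrow> (\<And>t. norm (\<phi> t) \<le> 1) \<Longrightarrow> (\<And>t. \<phi> t \<noteq> 0 \<Longrightarrow> norm t \<le> R) \<Longrightarrow>
      \<psi> \<in> borel_measurable borel \<Longrightarrow> (\<And>\<eta>. norm (\<psi> \<eta>) \<le> P) \<Longrightarrow> (\<And>\<eta>. \<psi> \<eta> \<noteq> 0 \<Longrightarrow> norm \<eta> \<le> R) \<Longrightarrow>
      (\<integral>t. norm (\<phi> t) powr p \<partial>lborel) powr (1 / p) \<le> A \<Longrightarrow>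
      finite X \<Longrightarrow> X \<subseteq> \<Lambda>1 \<Longrightarrow> finite \<Xi> \<Longrightarrow> \<Xi> \<subseteq> \<Lambda>2 \<Longrightarrow> K \<ge> 0 \<Longrightarrow> (\<And>x. x \<in> X \<Longrightarrow> row_norm w \<Xi> c x \<le> K) \<Longrightarrow>
      fin_synth (X \<times> \<Xi>) c (\<lambda>z. \<phi> (fst z) * \<psi> (snd z)) \<in> ?H \<and>
      ?N (fin_synth (X \<times> \<Xi>) c (\<lambda>z. \<phi> (fst z) * \<psi> (snd z))) \<le> C * (A * P) * K"
      apply (rule inj_rank_one_bound[OF p2, of R])
      subgoal premises prems by (rule prems(1)[OF prems(2) prems(3)])
      done
    have "rank_one_bounded \<Lambda>1 \<Lambda>2 p ?H ?N adm R C"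
      unfolding rank_one_bounded_def
    proof (intro allI impI)
      fix \<phi> \<psi> :: "'a \<Rightarrow> complex" and A P X \<Xi> and c :: "'a \<times> 'a \<Rightarrow> complex" and K
      assume a: "\<phi> \<in> borel_measurable borel" "\<forall>t. norm (\<phi> t) \<le> 1" "\<forall>t. \<phi> t \<noteq> 0 \<longrightarrow> norm t \<le> R"
        "\<psi> \<in> borel_measurable borel" "\<forall>\<eta>. norm (\<psi> \<eta>) \<le> P" "\<forall>\<eta>. \<psi> \<eta> \<noteq> 0 \<longrightarrow> norm \<eta> \<le> R"
        "(\<integral>t. norm (\<phi> t) powr p \<partial>lborel) powr (1 / p) \<le> A" "finite X" "X \<subseteq> \<Lambda>1" "finite \<Xi>" "\<Xi> \<subseteq> \<Lambda>2" and adm: "adm X \<Xi> c K"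
      show "fin_synth (X \<times> \<Xi>) c (\<lambda>z. \<phi> (fst z) * \<psi> (snd z)) \<in> ?H \<and>
        ?N (fin_synth (X \<times> \<Xi>) c (\<lambda>z. \<phi> (fst z) * \<psi> (snd z))) \<le> C * (A * P) * K"
        by (rule C(2)) (use a adm in \<open>auto simp: adm_def\<close>)
    qed
    then show ?thesis using C(1) by blast
  qed
  obtain B where B: "B \<ge> 0"
    "\<And>c K D n. (\<And>x \<xi>. x \<in> \<Lambda>1 \<Longrightarrow> \<xi> \<in> \<Lambda>2 \<Longrightarrow> norm (c (x, \<xi>)) \<le> D * (1 + norm x) ^ n) \<Longrightarrow> K \<ge> 0 \<Longrightarrow>
      (\<And>k. adm (lattice_ball \<Lambda>1 k) (lattice_ball \<Lambda>2 k) c K) \<Longrightarrow>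
      (\<And>e. e > 0 \<Longrightarrow> \<exists>J. \<forall>j\<ge>J. \<forall>k\<ge>j. adm (lattice_ball \<Lambda>1 k) (lattice_ball \<Lambda>2 k) (\<lambda>\<mu>. if \<mu> \<in> lattice_ball \<Lambda>1 j \<times> lattice_ball \<Lambda>2 j then 0 else c \<mu>) e) \<Longrightarrow>
      \<exists>u\<in>tempered. \<exists>h. approximates ?H ?N h u \<and> (\<forall>k. ?N (h k) \<le> B * K) \<and> represents_dist (synth (\<Lambda>1 \<times> \<Lambda>2) chi c) u"
    apply (rule synthesis_in_completion[OF lattice1 lattice2 p1 chi_test N r1])
    subgoal premises prems by (rule prems(1)[OF prems(2) prems(3)])
    done
  \<comment> \<open>The supremum in \<open>c0w\<close> is a supremum of reals and needs boundedness:
    outside a ball the rows are at most 1, and the ball contains finitely many lattice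
    points.\<close>
  have c0_bdd: "bdd_above ((\<lambda>x. nrm (l2 \<Lambda>2) (curry c x) * w x) ` \<Lambda>1)"
    and c0_tail: "\<And>e. e > 0 \<Longrightarrow> \<exists>X0. finite X0 \<and> X0 \<subseteq> \<Lambda>1 \<and> (\<forall>x\<in>\<Lambda>1 - X0. nrm (l2 \<Lambda>2) (curry c x) * w x \<le> e)"
    if cY: "c \<in> elems ?Y" for c
  proof -
    let ?g = "\<lambda>x. nrm (l2 \<Lambda>2) (curry c x) * w x"
    have lim: "(?g \<longlongrightarrow> 0) ?A" using cY by (simp add: c0w_def)
    show tail: "\<exists>X0. finite X0 \<and> X0 \<subseteq> \<Lambda>1 \<and> (\<forall>x\<in>\<Lambda>1 - X0. ?g x \<le> e)" if "e > 0" for e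
    proof -
      have "\<forall>\<^sub>F x in ?A. ?g x < e" by (rule order_tendstoD(2)[OF lim that])
      then obtain b where b: "\<And>x. b \<le> norm x \<Longrightarrow> x \<in> \<Lambda>1 \<Longrightarrow> ?g x < e"
        unfolding eventually_inf_principal eventually_at_infinity by blast
      have "?g x \<le> e" if "x \<in> \<Lambda>1 - (\<Lambda>1 \<inter> cball 0 b)" for x
        by (rule less_imp_le[OF b]) (use that in auto)
      then show ?thesis using lattice_finite_cball[OF lattice1, of 0 b] by (intro exI[of _ "\<Lambda>1 \<inter> cball 0 b"]) blast
    qed
    from tail[of 1] obtain X0 where X0: "finite X0" "\<And>x. x \<in> \<Lambda>1 - X0 \<Longrightarrow> ?g x \<le> 1" by auto
    obtain M where M: "\<And>x. x \<in> X0 \<Longrightarrow> ?g x \<le> M" using bdd_above_finite[of "?g ` X0"] X0(1) by (auto simp: bdd_above_def)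
    show "bdd_above (?g ` \<Lambda>1)"
    proof (rule bdd_aboveI2)
      fix x assume "x \<in> \<Lambda>1"
      then show "?g x \<le> max 1 M" using X0(2)[of x] M[of x] by (cases "x \<in> X0") auto
    qed
  qed
  have "?X \<approx>\<^sub>t\<^sub>o\<^sub>p ?Y"
  proof (rule eq_topI)
    show "C / norm \<kappa> > 0" using C(1) \<kappa> by simp
  next
    fix c assume "c \<in> elems ?X"
    then obtain u where c: "c \<in> extensional (\<Lambda>1 \<times> \<Lambda>2)" and u: "u \<in> elems ?F" "represents_dist (synth (\<Lambda>1 \<times> \<Lambda>2) chi c) u"
      by (auto simp: discrete_space_def)
    have nX: "nrm ?X c = nrm ?F u" by (rule discrete_space_nrm[OF k0 u])
    have lim: "(\<lambda>k. row_norm w \<Xi> (W.coef (h k)) x) \<longlonglongrightarrow> row_norm w \<Xi> (\<lambda>\<mu>. \<kappa> * c \<mu>) x"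
      if "approximates ?H ?N h u" "x \<in> \<Lambda>1" "\<Xi> \<subseteq> \<Lambda>2" for h x \<Xi>
      by (intro row_norm_tendsto coef[OF u(2) that(1)]) (use that in auto)
    have le: "row_norm w \<Xi> c x \<le> C / norm \<kappa> * nrm ?F u" if X: "x \<in> \<Lambda>1" "finite \<Xi>" "\<Xi> \<subseteq> \<Lambda>2" for x \<Xi>
    proof -
      have "norm \<kappa> / C * row_norm w \<Xi> c x \<le> nrm ?F u"
      proof (rule completion_norm_ge[OF N u(1)])
        fix h L assume h: "approximates ?H ?N h u" and L: "(\<lambda>k. ?N (h k)) \<longlonglongrightarrow> L"
        have "row_norm w \<Xi> (\<lambda>\<mu>. \<kappa> * c \<mu>) x \<le> C * L"
        proof (rule LIMSEQ_le[OF lim[OF h X(1,3)]])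
          show "(\<lambda>k. C * ?N (h k)) \<longlonglongrightarrow> C * L" by (intro tendsto_intros L)
          show "\<exists>M. \<forall>k\<ge>M. row_norm w \<Xi> (W.coef (h k)) x \<le> C * ?N (h k)"
            using C(2)[OF _ X] h by (auto simp: approximates_def)
        qed
        then have "norm \<kappa> * row_norm w \<Xi> c x \<le> C * L" by (simp add: row_norm_scale)
        then show "norm \<kappa> / C * row_norm w \<Xi> c x \<le> L" using C(1) by (simp add: field_simps)
      qed
      then show ?thesis using C(1) \<kappa> by (simp add: field_simps)
    qed
    have nn: "0 \<le> C / norm \<kappa> * nrm ?F u" using order_trans[OF row_norm_nonneg le[OF \<Lambda>0(1), of "{}"]] by simp
    have van: "\<forall>\<^sub>F x in ?A. \<forall>\<Xi>. finite \<Xi> \<longrightarrow> \<Xi> \<subseteq> \<Lambda>2 \<longrightarrow> row_norm w \<Xi> c x \<le> e" if e: "e > 0" for e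
    proof -
      obtain h where h: "approximates ?H ?N h u" using u(1) by (auto simp: completion_def)
      have hH: "h k \<in> ?H" for k using h by (simp add: approximates_def)
      \<comment> \<open>Half of the budget goes to the distance of later approximants from
        \<open>h M\<close>, half to the rows of \<open>h M\<close> itself, which vanish at infinity.
        The coefficients converge to \<kappa> c, hence the factor.\<close>
      define e1 where "e1 = norm \<kappa> * e / 2"
      have e1: "e1 > 0" using e \<kappa> by (simp add: e1_def)
      have "e1 / C > 0" using e1 C(1) by simp
      then obtain M where M: "\<And>j k. j \<ge> M \<Longrightarrow> k \<ge> M \<Longrightarrow> ?N (\<lambda>z. h j z - h k z) < e1 / C"
        using h unfolding approximates_def by blast
      obtain G where G: "(G \<longlongrightarrow> 0) ?A" "\<And>x \<Xi>. x \<in> \<Lambda>1 \<Longrightarrow> finite \<Xi> \<Longrightarrow> \<Xi> \<subseteq> \<Lambda>2 \<Longrightarrow> row_norm w \<Xi> (W.coef (h M)) x \<le> G x"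
        by (rule W.coef_row_vanishes[OF hH[of M]]) (rule that)
      have bound: "row_norm w \<Xi> (\<lambda>\<mu>. \<kappa> * c \<mu>) x \<le> e1 + G x" if X: "x \<in> \<Lambda>1" "finite \<Xi>" "\<Xi> \<subseteq> \<Lambda>2" for x \<Xi>
      proof (rule LIMSEQ_le_const2[OF lim[OF h X(1,3)]], intro exI[of _ M] allI impI)
        fix k assume k: "M \<le> k"
        have d: "(\<lambda>z. h k z - h M z) \<in> ?H" by (rule tensor_seminormD(6)[OF N hH hH])
        have "row_norm w \<Xi> (W.coef (h k)) x = row_norm w \<Xi> (\<lambda>\<mu>. W.coef (\<lambda>z. h k z - h M z) \<mu> + W.coef (h M) \<mu>) x"
          by (simp add: W.coef_diff[OF hH hH])
        also have "\<dots> \<le> row_norm w \<Xi> (W.coef (\<lambda>z. h k z - h M z)) x + row_norm w \<Xi> (W.coef (h M)) x"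
          by (rule row_norm_triangle) (rule less_imp_le[OF w_pos])
        also have "\<dots> \<le> C * ?N (\<lambda>z. h k z - h M z) + G x" by (intro add_mono C(2)[OF d X] G(2) X)
        also have "C * ?N (\<lambda>z. h k z - h M z) \<le> C * (e1 / C)"
          using M[OF k order_refl] C(1) by (intro mult_left_mono) auto
        finally show "row_norm w \<Xi> (W.coef (h k)) x \<le> e1 + G x" using C(1) by simp
      qed
      have "\<forall>\<^sub>F x in ?A. G x < e1" by (rule order_tendstoD(2)[OF G(1) e1])
      moreover have "\<forall>\<^sub>F x in ?A. x \<in> \<Lambda>1" by (simp add: eventually_inf_principal)
      ultimately show ?thesis
      proof eventually_elim
        case (elim x)
        show ?case
        proof (intro allI impI)
          fix \<Xi> assume "finite \<Xi>" "\<Xi> \<subseteq> \<Lambda>2"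
          from bound[OF elim(2) this] have "norm \<kappa> * row_norm w \<Xi> c x \<le> e1 + G x" by (simp add: row_norm_scale)
          also have "\<dots> \<le> norm \<kappa> * e" using elim(1) by (simp add: e1_def)
          finally show "row_norm w \<Xi> c x \<le> e" using \<kappa> by simp
        qed
      qed
    qed
    from c0wI[OF w_pos c nn \<Lambda>0(2) le van] show "c \<in> elems ?Y \<and> nrm ?Y c \<le> C / norm \<kappa> * nrm ?X c" by (simp add: nX)
  next
    fix c assume cY: "c \<in> elems ?Y"
    let ?g = "\<lambda>x. nrm (l2 \<Lambda>2) (curry c x) * w x"
    have c: "c \<in> extensional (\<Lambda>1 \<times> \<Lambda>2)" and row: "\<And>x. x \<in> \<Lambda>1 \<Longrightarrow> curry c x \<in> elems (l2 \<Lambda>2)"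
      using cY by (auto simp: c0w_def)
    have g0: "?g x \<ge> 0" for x using w_pos[of x] by (intro mult_nonneg_nonneg l2_nrm_nonneg) auto
    define K where "K = nrm ?Y c"
    have gK: "?g x \<le> K" if "x \<in> \<Lambda>1" for x
      unfolding K_def c0w_def nspace.simps by (rule cSUP_upper[OF that c0_bdd[OF cY]])
    have K0: "K \<ge> 0" using order_trans[OF g0 gK[OF \<Lambda>0(1)]] .
    have rg: "row_norm w \<Xi> c x \<le> ?g x" if "x \<in> \<Lambda>1" "finite \<Xi>" "\<Xi> \<subseteq> \<Lambda>2" for x \<Xi>
      by (rule row_norm_le_l2[OF less_imp_le[OF w_pos] row]) (use that in auto)
    obtain C0 n where growth: "\<forall>c K. (\<forall>x\<in>\<Lambda>1. curry c x \<in> elems (l2 \<Lambda>2) \<and> nrm (l2 \<Lambda>2) (curry c x) * w x \<le> K) \<longrightarrow>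
    (\<forall>x\<in>\<Lambda>1. \<forall>\<xi>\<in>\<Lambda>2. norm (c (x, \<xi>)) \<le> (K * C0) * (1 + norm x) ^ n)"
      by (rule coefficient_growth)
    have lattice_ball: "finite (lattice_ball \<Lambda>1 k)" "lattice_ball \<Lambda>1 k \<subseteq> \<Lambda>1" "finite (lattice_ball \<Lambda>2 k)" "lattice_ball \<Lambda>2 k \<subseteq> \<Lambda>2" for k
      by (intro lattice_ball_finite lattice1 lattice2 lattice_ball_subset)+
    have "\<exists>u\<in>tempered. \<exists>h. approximates ?H ?N h u \<and> (\<forall>k. ?N (h k) \<le> B * K) \<and> represents_dist (synth (\<Lambda>1 \<times> \<Lambda>2) chi c) u"
    proof (rule B(2)[OF _ K0])
      show "norm (c (x, \<xi>)) \<le> (K * C0) * (1 + norm x) ^ n" if "x \<in> \<Lambda>1" "\<xi> \<in> \<Lambda>2" for x \<xi>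
        using growth[rule_format, of c K x \<xi>] row gK that by auto
      show "adm (lattice_ball \<Lambda>1 k) (lattice_ball \<Lambda>2 k) c K" for k
        unfolding adm_def
      proof (intro conjI K0 ballI)
        fix x assume "x \<in> lattice_ball \<Lambda>1 k"
        then have "x \<in> \<Lambda>1" using lattice_ball(2) by blast
        then show "row_norm w (lattice_ball \<Lambda>2 k) c x \<le> K" using order_trans[OF rg gK] lattice_ball(3,4) by blast
      qed
      fix e :: real assume e: "e > 0"
      \<comment> \<open>With a supremum norm each row may use all of e, so no share per row of
        \<open>X0\<close> is needed.\<close>
      from c0_tail[OF cY this] obtain X0 where X0: "finite X0" "X0 \<subseteq> \<Lambda>1" "\<And>x. x \<in> \<Lambda>1 - X0 \<Longrightarrow> ?g x \<le> e" by blast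
      obtain J1 where J1: "\<And>j x \<Xi>. j \<ge> J1 \<Longrightarrow> x \<in> X0 \<Longrightarrow> finite \<Xi> \<Longrightarrow> \<Xi> \<subseteq> \<Lambda>2 \<Longrightarrow> row_norm w (\<Xi> - lattice_ball \<Lambda>2 j) c x \<le> e"
        by (rule row_tail[OF _ X0(1) e, of c]) (use X0(2) row in blast, rule that)
      obtain J2 where J2: "\<And>j. j \<ge> J2 \<Longrightarrow> X0 \<subseteq> lattice_ball \<Lambda>1 j" by (rule finite_subset_lattice_ball[OF X0(1,2)]) (rule that)
      have "adm (lattice_ball \<Lambda>1 k) (lattice_ball \<Lambda>2 k) (\<lambda>\<mu>. if \<mu> \<in> lattice_ball \<Lambda>1 j \<times> lattice_ball \<Lambda>2 j then 0 else c \<mu>) e"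
        if j: "j \<ge> max J1 J2" and jk: "k \<ge> j" for j k
        unfolding adm_def
      proof (intro conjI less_imp_le[OF e] ballI)
        let ?m = "\<lambda>\<mu>. if \<mu> \<in> lattice_ball \<Lambda>1 j \<times> lattice_ball \<Lambda>2 j then 0 else c \<mu>"
        fix x assume x: "x \<in> lattice_ball \<Lambda>1 k"
        show "row_norm w (lattice_ball \<Lambda>2 k) ?m x \<le> e"
        proof (cases "x \<in> X0")
          case True
          then have "x \<in> lattice_ball \<Lambda>1 j" using J2[of j] j by auto
          then have "row_norm w (lattice_ball \<Lambda>2 k) ?m x = row_norm w (lattice_ball \<Lambda>2 k - lattice_ball \<Lambda>2 j) c x"
            by (simp only: row_norm_mask[OF lattice_ball(3)] if_True)
          then show ?thesis using J1[OF _ True lattice_ball(3,4)] j by simp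
        next
          case False
          have "x \<in> \<Lambda>1" using x lattice_ball(2) by blast
          have "row_norm w (lattice_ball \<Lambda>2 k) ?m x \<le> ?g x"
            unfolding row_norm_mask[OF lattice_ball(3)]
            using rg[OF \<open>x \<in> \<Lambda>1\<close> lattice_ball(3,4), of k] rg[OF \<open>x \<in> \<Lambda>1\<close>, of "lattice_ball \<Lambda>2 k - lattice_ball \<Lambda>2 j"] lattice_ball(3,4)[of k] by auto
          then show ?thesis using X0(3)[of x] False \<open>x \<in> \<Lambda>1\<close> by auto
        qed
      qed
      then show "\<exists>J. \<forall>j\<ge>J. \<forall>k\<ge>j. adm (lattice_ball \<Lambda>1 k) (lattice_ball \<Lambda>2 k) (\<lambda>\<mu>. if \<mu> \<in> lattice_ball \<Lambda>1 j \<times> lattice_ball \<Lambda>2 j then 0 else c \<mu>) e" by blast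
    qed
    then obtain u h where u: "u \<in> tempered" "approximates ?H ?N h u" "\<And>k. ?N (h k) \<le> B * K"
      "represents_dist (synth (\<Lambda>1 \<times> \<Lambda>2) chi c) u" by blast
    have uF: "u \<in> elems ?F" using u by (auto simp: completion_def)
    have "nrm ?X c \<le> B * K"
      unfolding discrete_space_nrm[OF k0 uF u(4)] by (rule completion_norm_le[OF N u(2,3)])
    then show "c \<in> elems ?X \<and> nrm ?X c \<le> B * nrm ?Y c"
      using c uF u(4) by (auto simp: discrete_space_def K_def)
  next
    fix c assume cY: "c \<in> elems ?Y"
    \<comment> \<open>A supremum is nonnegative as soon as one member is; the row at the lattice
      point 0 is always present.\<close>
    have "0 \<le> nrm (l2 \<Lambda>2) (curry c 0) * w 0" using w_pos[of 0] by (intro mult_nonneg_nonneg l2_nrm_nonneg) auto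
    also have "\<dots> \<le> nrm ?Y c" unfolding c0w_def nspace.simps by (rule cSUP_upper[OF \<Lambda>0(1) c0_bdd[OF cY]])
    finally show "nrm ?Y c \<ge> 0" .
  qed
  then show ?thesis by (simp add: inj_tensor_def)
qed

end

theorem corollary5p31:
  fixes \<Lambda>1 \<Lambda>2 :: "(real ^ 'n) set"
    and w :: "real ^ 'n \<Rightarrow> real"
    and U :: "((real ^ 'n) \<times> (real ^ 'n)) set"
    and chi :: "(real ^ 'n) \<times> (real ^ 'n) \<Rightarrow> complex"
    and p :: real
  assumes "is_lattice \<Lambda>1" and "is_lattice \<Lambda>2"
    and "poly_bounded_weight w"
    and "open U" and "bounded U" and "0 \<in> U"
    and "disjoint_family_on (\<lambda>\<mu>. (+) \<mu> ` U) (\<Lambda>1 \<times> \<Lambda>2)"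
    and "chi \<in> test_functions U" and "chi \<noteq> (\<lambda>_. 0)"
  shows "(1 \<le> p \<and> p \<le> 2 \<longrightarrow>
            discrete_space (Lp p w \<otimes>\<^sub>\<pi> L2) chi (\<Lambda>1 \<times> \<Lambda>2) \<approx>\<^sub>t\<^sub>o\<^sub>p l1w w \<Lambda>1 \<Lambda>2 (l2 \<Lambda>2)) \<and>
         (2 \<le> p \<longrightarrow>
            discrete_space (Lp p w \<otimes>\<^sub>\<epsilon> L2) chi (\<Lambda>1 \<times> \<Lambda>2) \<approx>\<^sub>t\<^sub>o\<^sub>p c0w w \<Lambda>1 \<Lambda>2 (l2 \<Lambda>2))"
proof -
  have G: "gabor_discrete \<Lambda>1 \<Lambda>2 w p U chi" if "1 \<le> p"
    by unfold_locales (use assms that in auto)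
  show ?thesis
    using gabor_discrete.proj_discrete_space[OF G] gabor_discrete.inj_discrete_space[OF G] by auto
qed

end
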